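(* In the setting and notation of the context, the algebra $\mathfrak A$ is given as a quiver with relations $kQ/I$, where $Q$ is the quiver with $|Z(H):Z|$ vertices labelled $[\phi]$, corresponding to the idempotents $e_\phi\in kZ(H)$ lying over $\chi$, and directed edges $$[\phi]\xrightarrow{\ i\ }[\phi\psi_i]$$ corresponding to the element $\mathsf w_{i,\phi}=g_{i,\phi}w_ie_\phi=e_{\phi\psi_i}g_{i,\phi}w_i=e_{\phi\psi_i}g_{i,\phi}w_ie_\phi$, for those $i$ such that the element $w_i$ of $\mathrm{Jen}_*(P)$ has degree one. The relations are those that follow from the structure constant relations \begin{align*} \mathsf w_{j,\phi\psi_i}\mathsf w_{i,\phi}-q_{i,j,\phi}\mathsf w_{i,\phi\psi_j}\mathsf w_{j,\phi}&=\sum_kc_{i,j,k}\,q'_{i,j,k,\phi}\mathsf w_{k,\phi},\\ \mathsf w_{i,\phi\psi_i^{p-1}}\cdots\mathsf w_{i,\phi\psi_i}\mathsf w_{i,\phi}&=\sum_kd_{i,k}\,q''_{i,k,\phi}\mathsf w_{k,\phi}, \end{align*} where for each $k$ such that $w_k$ is in degree at least $2$, any $\mathsf w_{k,\zeta}$ appearing is replaced by an element of $kQ$ corresponding to an expression for $\mathsf w_{k,\zeta}$ in terms of the $\mathsf w_{i,\phi}$ such that $w_i$ has degree one (such expressions exist). There is a PBW style basis $\mathcal B'$ for $\mathfrak A$, consisting of the $e_\phi$ and the composable monomials in the $\mathsf w_{i,\phi}$ in which the indices $i$ are in order and each index $i$ is repeated at most $p-1$ times, giving $\dim(kQ/I)=\dim(\mathfrak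 A)=|Z(H):Z|\cdot|P|$.
   Context: Setup. $p$ is a prime, $k$ an algebraically closed field of characteristic $p$; in groups $[g,h]=ghg^{-1}h^{-1}$, in associative algebras $[a,b]=ab-ba$. $P$ is a finite $p$-group, $L$ an abelian $p'$-subgroup of $\mathrm{Aut}(P)$, and $\alpha\in H^2(L,k^\times)$, represented by a $2$-cocycle of the same order. Associated to $\alpha$ is a central extension $1\to Z\to H\to L\to1$ of finite $p'$-groups and a faithful character $\chi\colon Z\to k^\times$ with $Z=[H,H]$ and $\alpha(x,y)=\chi(\hat x\hat y\,\widehat{xy}^{\,-1})$ for some choice of inverse images $\hat x\in H$ of $x\in L$. $H$ acts on $P$ via $H\to L$; $e=\frac1{|Z|}\sum_{z\in Z}\chi(z^{-1})z$. Characters. $\mathrm{Irr}(Z(H)|\chi)$ is the set of homomorphisms $\phi\colon Z(H)\to k^\times$ extending $\chi$, and $e_\phi=\frac1{|Z(H)|}\sum_{h\in Z(H)}\phi(h^{-1})h$. Fix $\phi_0\in \mathrm{Irr}(Z(H)|\chi)$ and for each $\phi$ a $\xi_\phi\in\mathrm{Hom}(H/Z,k^\times)$ (inflated to $H$) restricting to $\phi\phi_0^{-1}$ on $Z(H)$, with $\xi_{\phi_0}=1$. For $\psi\in\mathrm{Hom}(H/Z,k^\times)$ write $\phi\psi$ for $\phi\cdot\psi|_{Z(H)}$. The map $\rho\colon H\to\mathrm{Hom}(H,k^\times)$, $\rho(g)(h)=\chi([h,g])$, has kernel $Z(H)$ and image $\mathrm{Hom}(H/Z(H),k^\times)$. For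 each $\psi,\phi$ choose $g_{\psi,\phi}\in H$ with $\rho(g_{\psi,\phi})=\xi_{\phi\psi}\xi_\phi^{-1}\psi^{-1}$. Jennings Lie algebra. $F_r(P)=\{g\in P\mid g-1\in J^r(kP)\}$ and $\mathrm{Jen}_*(P)=\bigoplus_{r\ge1}k\otimes_{\mathbb F_p}F_r(P)/F_{r+1}(P)$, a $p$-restricted Lie algebra with bracket induced by commutators and $p$-map by $p$-th powers in $P$; $H$ acts on it and on its restricted universal enveloping algebra $\mathcal U\mathrm{Jen}_*(P)$. Choose a basis $w_1,\dots,w_n$ ($p^n=|P|$) of $\mathrm{Jen}_*(P)$ of homogeneous $H$-eigenvectors with $\deg w_i\le\deg w_j$ for $i\le j$, ${}^gw_i=\psi_i(g)w_i$ with $\psi_i\in\mathrm{Hom}(H/Z,k^\times)$, and write $[w_i,w_j]=\sum_kc_{i,j,k}w_k$, $w_i^{[p]}=\sum_kd_{i,k}w_k$. Put $g_{i,\phi}=g_{\psi_i,\phi}$ and $\mathsf w_{i,\phi}=g_{i,\phi}w_ie_\phi$. $\mathfrak A$ is the subalgebra of $(\mathcal U\mathrm{Jen}_*(P)\rtimes H)e$ generated by all the $e_\phi$ and $\mathsf w_{i,\phi}$; it is generated by the $e_\phi$ and those $\mathsf w_{i,\phi}$ with $\deg w_i=1$. Scalars. Elements of $Z(H)$ are defined by $g_{j,\phi\psi_i}g_{i,\phi}=g_{i,\phi\psi_j}g_{j,\phi}z_{i,j,\phi}$; if $c_{i,j,k}\ne0$, $g_{j,\phi\psi_i}g_{i,\phi}=g_{k,\phi}z'_{i,j,k,\phi}$;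 if $d_{i,k}\neq0$, $g_{i,\phi\psi_i^{p-1}}\cdots g_{i,\phi\psi_i}g_{i,\phi}=g_{k,\phi}z''_{i,k,\phi}$. Then $q_{i,j,\phi}=\psi_i(g_{j,\phi}z_{i,j,\phi})\psi_j(g_{i,\phi}^{-1}z_{i,j,\phi})\phi(z_{i,j,\phi})$, $q'_{i,j,k,\phi}=\psi_j(g_{i,\phi})^{-1}\psi_k(z'_{i,j,k,\phi})\phi(z'_{i,j,k,\phi})$, $q''_{i,k,\phi}=\big(\prod_{a=0}^{p-2}\psi_i(g_{i,\phi\psi_i^a})^{-(p-1-a)}\big)\psi_k(z''_{i,k,\phi})\phi(z''_{i,k,\phi})$. Terms with $c_{i,j,k}=0$ or $d_{i,k}=0$ are omitted. The relations are for all $i,j$ and all $\phi\in\mathrm{Irr}(Z(H)|\chi)$. Products of arrows are read right to left.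
   Formalization: In the first relation the right side is taken as −Σ_k c_{i,j,k} q′_{i,j,k,φ} w_{k,φ}: the printed plus sign is false for odd p when the bracket is nonzero. The expression for w_{k,ζ} is a combination of paths from [ζ] to [ζψ_k]. *)

theory Defs
  imports
    "HOL-Algebra.Bij"
    "HOL-Algebra.Generated_Groups"
    "HOL-Algebra.Ideal_Product"
    "HOL-Algebra.Multiplicative_Group"
    "HOL-Algebra.QuotRing"
    "HOL-Algebra.Subrings"
    "HOL-Library.Poly_Mapping"
    "Jordan_Normal_Form.VS_Connect"
    "Graph_Theory.Arc_Walk"
begin

text \<open>
  The ground field is a type \<open>'k\<close>, viewed as a structure through \<open>class_ring\<close>; its multiplicative group is \<open>units_of class_ring\<close>.  Vector spaces
  and (associative, unital) \<open>'k\<close>-algebras are records of type \<open>('k, 'a) module\<close>; for a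
  bare vector space the fields \<open>mult\<close> and \<open>one\<close> carry no information.  Formal
  linear combinations are finitely supported functions.
\<close>

section \<open>Vector spaces and algebras\<close>

definition scale :: "'k::semiring_0 \<Rightarrow> ('b \<Rightarrow>\<^sub>0 'k) \<Rightarrow> ('b \<Rightarrow>\<^sub>0 'k)" where
  "scale c f = Poly_Mapping.map ((*) c) f"

text \<open>The linear map of free vector spaces induced by a map of basis elements.\<close>

definition push :: "('a \<Rightarrow> 'b) \<Rightarrow> ('a \<Rightarrow>\<^sub>0 'k) \<Rightarrow> ('b \<Rightarrow>\<^sub>0 'k::comm_monoid_add)" where
  "push h f = (\<Sum>x\<in>Poly_Mapping.keys f. Poly_Mapping.single (h x) (Poly_Mapping.lookup f x))"

definition free_space :: "'b set \<Rightarrow> ('k::field, 'b \<Rightarrow>\<^sub>0 'k) module" where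
  "free_space B = \<lparr>carrier = {f. Poly_Mapping.keys f \<subseteq> B}, mult = undefined, one = undefined,
     zero = 0, add = (+), smult = scale\<rparr>"

text \<open>The algebra with basis \<open>B\<close>, product of basis elements \<open>m\<close>, and unit \<open>u\<close>.\<close>

definition basis_algebra ::
    "'b set \<Rightarrow> ('b \<Rightarrow> 'b \<Rightarrow> 'b \<Rightarrow>\<^sub>0 'k) \<Rightarrow> ('b \<Rightarrow>\<^sub>0 'k) \<Rightarrow> ('k::field, 'b \<Rightarrow>\<^sub>0 'k) module" where
  "basis_algebra B m u = \<lparr>carrier = {f. Poly_Mapping.keys f \<subseteq> B},
     mult = (\<lambda>f g. \<Sum>x\<in>Poly_Mapping.keys f. \<Sum>y\<in>Poly_Mapping.keys g.
               scale (Poly_Mapping.lookup f x * Poly_Mapping.lookup g y) (m x y)),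
     one = u, zero = 0, add = (+), smult = scale\<rparr>"

definition group_algebra :: "'g monoid \<Rightarrow> ('k::field, 'g \<Rightarrow>\<^sub>0 'k) module" where
  "group_algebra G = basis_algebra (carrier G)
     (\<lambda>x y. Poly_Mapping.single (x \<otimes>\<^bsub>G\<^esub> y) 1) (Poly_Mapping.single \<one>\<^bsub>G\<^esub> 1)"

definition free_algebra :: "'x set \<Rightarrow> ('k::field, 'x list \<Rightarrow>\<^sub>0 'k) module" where
  "free_algebra X = basis_algebra (lists X)
     (\<lambda>u v. Poly_Mapping.single (u @ v) 1) (Poly_Mapping.single [] 1)"

text \<open>
  Quotient of an algebra by a two-sided ideal, or of a vector space by a subspace: this is
  \<^const>\<open>FactRing\<close> together with its scalar multiplication.
\<close>

definition quot_alg :: "('k, 'a) module \<Rightarrow> 'a set \<Rightarrow> ('k, 'a set) module" where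
  "quot_alg A I = \<lparr>carrier = carrier (A Quot I), mult = mult (A Quot I), one = one (A Quot I),
     zero = zero (A Quot I), add = add (A Quot I),
     smult = (\<lambda>c X. \<Union>x\<in>X. I +>\<^bsub>A\<^esub> (c \<odot>\<^bsub>A\<^esub> x))\<rparr>"

definition direct_sum :: "'i set \<Rightarrow> ('i \<Rightarrow> ('k, 'a) module) \<Rightarrow> ('k, 'i \<Rightarrow> 'a) module" where
  "direct_sum I M = \<lparr>
     carrier = {v \<in> (\<Pi>\<^sub>E i\<in>I. carrier (M i)). finite {i \<in> I. v i \<noteq> \<zero>\<^bsub>M i\<^esub>}},
     mult = undefined, one = undefined,
     zero = (\<lambda>i\<in>I. \<zero>\<^bsub>M i\<^esub>), add = (\<lambda>u v. \<lambda>i\<in>I. u i \<oplus>\<^bsub>M i\<^esub> v i),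
     smult = (\<lambda>c v. \<lambda>i\<in>I. c \<odot>\<^bsub>M i\<^esub> v i)\<rparr>"

definition subalgebra_generated :: "('k, 'a) module \<Rightarrow> 'a set \<Rightarrow> ('k, 'a) module" where
  "subalgebra_generated A S =
     A\<lparr>carrier := \<Inter>{B. subring B A \<and> (\<forall>c. \<forall>b\<in>B. c \<odot>\<^bsub>A\<^esub> b \<in> B) \<and> S \<subseteq> B}\<rparr>"

text \<open>The algebra \<open>A e\<close> for a central idempotent \<open>e\<close>; its unit is \<open>e\<close>.\<close>

definition corner :: "('k, 'a) module \<Rightarrow> 'a \<Rightarrow> ('k, 'a) module" where
  "corner A e = A\<lparr>carrier := {a \<otimes>\<^bsub>A\<^esub> e | a. a \<in> carrier A}, one := e\<rparr>"

definition alg_hom :: "('k::field, 'a) module \<Rightarrow> ('k, 'b) module \<Rightarrow> ('a \<Rightarrow> 'b) set" where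
  "alg_hom A B = Ring.ring_hom A B \<inter> module_hom class_ring A B"

definition alg_iso :: "('k::field, 'a) module \<Rightarrow> ('k, 'b) module \<Rightarrow> ('a \<Rightarrow> 'b) set" where
  "alg_iso A B = ring_iso A B \<inter> module_hom class_ring A B"

text \<open>
  The skew group algebra (smash product) of a finite group \<open>G\<close> acting on \<open>A\<close>.  The function
  \<open>f\<close> stands for the sum of the \<open>f x \<cdot> x\<close>, and
  \<open>(a \<cdot> y) (b \<cdot> z) = (a (act y b)) \<cdot> (y z)\<close>.
\<close>

definition skew_group_algebra ::
    "('k, 'a) module \<Rightarrow> 'g monoid \<Rightarrow> ('g \<Rightarrow> 'a \<Rightarrow> 'a) \<Rightarrow> ('k, 'g \<Rightarrow> 'a) module" where
  "skew_group_algebra A G act = \<lparr>carrier = carrier G \<rightarrow>\<^sub>E carrier A,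
     mult = (\<lambda>f h. \<lambda>x\<in>carrier G. \<Oplus>\<^bsub>A\<^esub>y\<in>carrier G. f y \<otimes>\<^bsub>A\<^esub> act y (h (inv\<^bsub>G\<^esub> y \<otimes>\<^bsub>G\<^esub> x))),
     one = (\<lambda>x\<in>carrier G. if x = \<one>\<^bsub>G\<^esub> then \<one>\<^bsub>A\<^esub> else \<zero>\<^bsub>A\<^esub>),
     zero = (\<lambda>x\<in>carrier G. \<zero>\<^bsub>A\<^esub>),
     add = (\<lambda>f h. \<lambda>x\<in>carrier G. f x \<oplus>\<^bsub>A\<^esub> h x),
     smult = (\<lambda>c f. \<lambda>x\<in>carrier G. c \<odot>\<^bsub>A\<^esub> f x)\<rparr>"

definition skew_elt :: "('k, 'a) module \<Rightarrow> 'g monoid \<Rightarrow> 'a \<Rightarrow> 'g \<Rightarrow> 'g \<Rightarrow> 'a" where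
  "skew_elt A G a g = (\<lambda>x\<in>carrier G. if x = g then a else \<zero>\<^bsub>A\<^esub>)"

section \<open>Path algebras\<close>

text \<open>
  A quiver is a \<^typ>\<open>('v, 'e) pre_digraph\<close>.  A path is a pair of its starting vertex and the list
  of its arrows in the order in which they are traversed.  Products are read right to left:
  \<open>p * q\<close> is \<open>q\<close> followed by \<open>p\<close>.
\<close>

definition quiver_paths :: "('v, 'e) pre_digraph \<Rightarrow> 'v \<Rightarrow> 'v \<Rightarrow> ('v \<times> 'e list) set" where
  "quiver_paths Q u v = {(u, p) | p. pre_digraph.awalk Q u p v}"

definition path_mult ::
    "('v, 'e) pre_digraph \<Rightarrow> 'v \<times> 'e list \<Rightarrow> 'v \<times> 'e list \<Rightarrow> ('v \<times> 'e list) \<Rightarrow>\<^sub>0 'k::field" where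
  "path_mult Q p q = (if last (pre_digraph.awalk_verts Q (fst q) (snd q)) = fst p
     then Poly_Mapping.single (fst q, snd q @ snd p) 1 else 0)"

definition path_vertex :: "'v \<Rightarrow> ('v \<times> 'e list) \<Rightarrow>\<^sub>0 'k::field" where
  "path_vertex u = Poly_Mapping.single (u, []) 1"

definition path_arrow :: "('v, 'e) pre_digraph \<Rightarrow> 'e \<Rightarrow> ('v \<times> 'e list) \<Rightarrow>\<^sub>0 'k::field" where
  "path_arrow Q a = Poly_Mapping.single (tail Q a, [a]) 1"

definition path_algebra ::
    "('v, 'e) pre_digraph \<Rightarrow> ('k::field, ('v \<times> 'e list) \<Rightarrow>\<^sub>0 'k) module" where
  "path_algebra Q = basis_algebra (\<Union>u\<in>verts Q. \<Union>v\<in>verts Q. quiver_paths Q u v)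
     (path_mult Q) (\<Sum>u\<in>verts Q. path_vertex u)"

section \<open>The Jennings filtration and the underlying space of the Jennings Lie algebra\<close>

definition maximal_left_ideal :: "'a set \<Rightarrow> ('k, 'a) module \<Rightarrow> bool" where
  "maximal_left_ideal M A \<longleftrightarrow>
     (let left_ideal = (\<lambda>N. additive_subgroup N A \<and> (\<forall>a\<in>carrier A. \<forall>x\<in>N. a \<otimes>\<^bsub>A\<^esub> x \<in> N))
      in left_ideal M \<and> M \<noteq> carrier A \<and>
         (\<forall>N. left_ideal N \<longrightarrow> M \<subseteq> N \<longrightarrow> N = M \<or> N = carrier A))"

definition jacobson_radical :: "('k, 'a) module \<Rightarrow> 'a set" where
  "jacobson_radical A = carrier A \<inter> \<Inter>{M. maximal_left_ideal M A}"

fun ideal_power :: "('k, 'a) module \<Rightarrow> 'a set \<Rightarrow> nat \<Rightarrow> 'a set" where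
  "ideal_power A J 0 = carrier A"
| "ideal_power A J (Suc r) = ideal_prod A (ideal_power A J r) J"

definition jennings_filtration :: "'k::field itself \<Rightarrow> 'p monoid \<Rightarrow> nat \<Rightarrow> 'p set" where
  "jennings_filtration K P r = {g \<in> carrier P.
     Poly_Mapping.single g (1::'k) - Poly_Mapping.single \<one>\<^bsub>P\<^esub> 1
       \<in> ideal_power (group_algebra P) (jacobson_radical (group_algebra P)) r}"

text \<open>
  \<open>k \<otimes>\<^bsub>\<int>\<^esub> A\<close> for an abelian group \<open>A\<close>, written multiplicatively: the element
  \<open>c \<otimes> a\<close> is the class of \<open>Poly_Mapping.single a c\<close>.  If \<open>A\<close> is an elementary abelian \<open>p\<close>-group
  and \<open>k\<close> has characteristic \<open>p\<close>, this is the tensor product over the field with \<open>p\<close> elements.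
\<close>

definition tensor_relations :: "'a monoid \<Rightarrow> ('a \<Rightarrow>\<^sub>0 'k::field) set" where
  "tensor_relations A = LinearCombinations.module.span class_ring (free_space (carrier A))
     {Poly_Mapping.single (a \<otimes>\<^bsub>A\<^esub> b) 1 - Poly_Mapping.single a 1 - Poly_Mapping.single b 1
      | a b. a \<in> carrier A \<and> b \<in> carrier A}"

definition extend_scalars :: "'a monoid \<Rightarrow> ('k::field, ('a \<Rightarrow>\<^sub>0 'k) set) module" where
  "extend_scalars A = quot_alg (free_space (carrier A)) (tensor_relations A)"

definition jennings_factor :: "'k::field itself \<Rightarrow> 'p monoid \<Rightarrow> nat \<Rightarrow> 'p set monoid" where
  "jennings_factor K P r =
     (P\<lparr>carrier := jennings_filtration K P r\<rparr>) Mod (jennings_filtration K P (Suc r))"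

type_synonym ('k, 'p) jen = "nat \<Rightarrow> ('p set \<Rightarrow>\<^sub>0 'k) set"

definition jennings_space :: "'p monoid \<Rightarrow> ('k::field, ('k, 'p) jen) module" where
  "jennings_space P = direct_sum {1..} (\<lambda>r. extend_scalars (jennings_factor TYPE('k) P r))"

text \<open>For \<open>a\<close> in the \<open>r\<close>-th term of the filtration, the element \<open>1 \<otimes> a\<close> in degree \<open>r\<close>.\<close>

definition jennings_elt :: "'p monoid \<Rightarrow> nat \<Rightarrow> 'p \<Rightarrow> ('k::field, 'p) jen" where
  "jennings_elt P r a = (\<lambda>s\<in>{1..}.
     let G = jennings_factor TYPE('k) P s in
     if s = r
     then tensor_relations G +>\<^bsub>free_space (carrier G)\<^esub>
            Poly_Mapping.single (jennings_filtration TYPE('k) P (Suc r) #>\<^bsub>P\<^esub> a) 1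
     else \<zero>\<^bsub>extend_scalars G\<^esub>)"

definition jennings_component :: "'p monoid \<Rightarrow> nat \<Rightarrow> ('k::field, 'p) jen set" where
  "jennings_component P r = {v \<in> carrier (jennings_space P).
     \<forall>s\<ge>1. s \<noteq> r \<longrightarrow> v s = \<zero>\<^bsub>extend_scalars (jennings_factor TYPE('k) P s)\<^esub>}"

text \<open>
  The action of an automorphism \<open>\<sigma>\<close> of \<open>P\<close>.  An element of degree \<open>r\<close> is a coset of formal
  linear combinations of cosets; \<open>\<sigma>\<close> is applied elementwise.
\<close>

definition jennings_act ::
    "('p \<Rightarrow> 'p) \<Rightarrow> ('k::field, 'p) jen \<Rightarrow> ('k, 'p) jen" where
  "jennings_act \<sigma> v = (\<lambda>r\<in>{1..}. push (image \<sigma>) ` v r)"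

section \<open>Restricted Lie algebras and their enveloping algebras\<close>

text \<open>
  \<open>jacobson_coeff V br p i x y\<close> is Jacobson's \<open>s\<^sub>i (x, y)\<close>, where
  \<open>i \<cdot> s\<^sub>i (x, y)\<close> is the coefficient of \<open>t\<close> to the power \<open>i - 1\<close> in \<open>ad (t x + y)\<close> to the power
  \<open>p - 1\<close> applied to \<open>x\<close>; the coefficient is expanded as a sum over words of length \<open>p - 1\<close>
  in \<open>ad x\<close> (\<^const>\<open>True\<close>) and \<open>ad y\<close> (\<^const>\<open>False\<close>).
\<close>

definition jacobson_coeff ::
    "('k::field, 'v) module \<Rightarrow> ('v \<Rightarrow> 'v \<Rightarrow> 'v) \<Rightarrow> nat \<Rightarrow> nat \<Rightarrow> 'v \<Rightarrow> 'v \<Rightarrow> 'v" where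
  "jacobson_coeff V br p i x y = inverse (of_nat i) \<odot>\<^bsub>V\<^esub>
     (\<Oplus>\<^bsub>V\<^esub>bs\<in>{bs. length bs = p - 1 \<and> count_list bs True = i - 1}.
        foldr (\<lambda>b. br (if b then x else y)) bs x)"

locale restricted_lie_algebra = vectorspace "class_ring :: 'k ring" V
  for V :: "('k::field, 'v) module" (structure) +
  fixes br :: "'v \<Rightarrow> 'v \<Rightarrow> 'v" and pm :: "'v \<Rightarrow> 'v" and p :: nat
  assumes br_closed: "\<lbrakk>x \<in> carrier V; y \<in> carrier V\<rbrakk> \<Longrightarrow> br x y \<in> carrier V"
    and br_add_left: "\<lbrakk>x \<in> carrier V; y \<in> carrier V; z \<in> carrier V\<rbrakk> \<Longrightarrow>
      br (x \<oplus>\<^bsub>V\<^esub> y) z = br x z \<oplus>\<^bsub>V\<^esub> br y z"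
    and br_add_right: "\<lbrakk>x \<in> carrier V; y \<in> carrier V; z \<in> carrier V\<rbrakk> \<Longrightarrow>
      br x (y \<oplus>\<^bsub>V\<^esub> z) = br x y \<oplus>\<^bsub>V\<^esub> br x z"
    and br_smult_left: "\<lbrakk>x \<in> carrier V; y \<in> carrier V\<rbrakk> \<Longrightarrow>
      br (c \<odot>\<^bsub>V\<^esub> x) y = c \<odot>\<^bsub>V\<^esub> br x y"
    and br_smult_right: "\<lbrakk>x \<in> carrier V; y \<in> carrier V\<rbrakk> \<Longrightarrow>
      br x (c \<odot>\<^bsub>V\<^esub> y) = c \<odot>\<^bsub>V\<^esub> br x y"
    and br_self: "x \<in> carrier V \<Longrightarrow> br x x = \<zero>\<^bsub>V\<^esub>"
    and jacobi: "\<lbrakk>x \<in> carrier V; y \<in> carrier V; z \<in> carrier V\<rbrakk> \<Longrightarrow>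
      br x (br y z) \<oplus>\<^bsub>V\<^esub> br y (br z x) \<oplus>\<^bsub>V\<^esub> br z (br x y) = \<zero>\<^bsub>V\<^esub>"
    and pm_closed: "x \<in> carrier V \<Longrightarrow> pm x \<in> carrier V"
    and pm_smult: "x \<in> carrier V \<Longrightarrow> pm (c \<odot>\<^bsub>V\<^esub> x) = (c ^ p) \<odot>\<^bsub>V\<^esub> pm x"
    and pm_ad: "\<lbrakk>x \<in> carrier V; y \<in> carrier V\<rbrakk> \<Longrightarrow> br (pm x) y = (br x ^^ p) y"
    and pm_add: "\<lbrakk>x \<in> carrier V; y \<in> carrier V\<rbrakk> \<Longrightarrow>
      pm (x \<oplus>\<^bsub>V\<^esub> y) = pm x \<oplus>\<^bsub>V\<^esub> pm y \<oplus>\<^bsub>V\<^esub> (\<Oplus>\<^bsub>V\<^esub>i\<in>{1..<p}. jacobson_coeff V br p i x y)"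

text \<open>
  The restricted enveloping algebra is the tensor algebra modulo
  \<open>x y - y x = [x, y]\<close> and \<open>x\<^sup>p = pm x\<close>; the first two families of relations pass from
  the free algebra on the set \<^term>\<open>carrier V\<close> to the tensor algebra of \<open>V\<close>.
\<close>

definition enveloping_ideal ::
    "('k::field, 'v) module \<Rightarrow> ('v \<Rightarrow> 'v \<Rightarrow> 'v) \<Rightarrow> ('v \<Rightarrow> 'v) \<Rightarrow> nat \<Rightarrow> ('v list \<Rightarrow>\<^sub>0 'k) set" where
  "enveloping_ideal V br pm p = Idl\<^bsub>free_algebra (carrier V)\<^esub>
     ({Poly_Mapping.single [x \<oplus>\<^bsub>V\<^esub> y] 1 - Poly_Mapping.single [x] 1 - Poly_Mapping.single [y] 1
        | x y. x \<in> carrier V \<and> y \<in> carrier V}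
    \<union> {Poly_Mapping.single [c \<odot>\<^bsub>V\<^esub> x] 1 - Poly_Mapping.single [x] c | c x. x \<in> carrier V}
    \<union> {Poly_Mapping.single [x, y] 1 - Poly_Mapping.single [y, x] 1
          - Poly_Mapping.single [br x y] 1 | x y. x \<in> carrier V \<and> y \<in> carrier V}
    \<union> {Poly_Mapping.single (replicate p x) 1 - Poly_Mapping.single [pm x] 1
        | x. x \<in> carrier V})"

definition enveloping_algebra ::
    "('k::field, 'v) module \<Rightarrow> ('v \<Rightarrow> 'v \<Rightarrow> 'v) \<Rightarrow> ('v \<Rightarrow> 'v) \<Rightarrow> nat
      \<Rightarrow> ('k, ('v list \<Rightarrow>\<^sub>0 'k) set) module" where
  "enveloping_algebra V br pm p =
     quot_alg (free_algebra (carrier V)) (enveloping_ideal V br pm p)"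

definition enveloping_elt ::
    "('k::field, 'v) module \<Rightarrow> ('v \<Rightarrow> 'v \<Rightarrow> 'v) \<Rightarrow> ('v \<Rightarrow> 'v) \<Rightarrow> nat
      \<Rightarrow> 'v \<Rightarrow> ('v list \<Rightarrow>\<^sub>0 'k) set" where
  "enveloping_elt V br pm p x =
     enveloping_ideal V br pm p +>\<^bsub>free_algebra (carrier V)\<^esub> Poly_Mapping.single [x] 1"

text \<open>
  The automorphism of the enveloping algebra induced by an automorphism \<open>\<tau>\<close> of the restricted
  Lie algebra.
\<close>

definition enveloping_act ::
    "('v \<Rightarrow> 'v) \<Rightarrow> ('v list \<Rightarrow>\<^sub>0 'k::field) set \<Rightarrow> ('v list \<Rightarrow>\<^sub>0 'k) set" where
  "enveloping_act \<tau> X = push (map \<tau>) ` X"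

section \<open>Groups, characters and cocycles\<close>

definition group_center :: "('g, 'r) monoid_scheme \<Rightarrow> 'g set" where
  "group_center G = {z \<in> carrier G. \<forall>g\<in>carrier G. z \<otimes>\<^bsub>G\<^esub> g = g \<otimes>\<^bsub>G\<^esub> z}"

definition commutator :: "('g, 'r) monoid_scheme \<Rightarrow> 'g \<Rightarrow> 'g \<Rightarrow> 'g" where
  "commutator G g h = g \<otimes>\<^bsub>G\<^esub> h \<otimes>\<^bsub>G\<^esub> inv\<^bsub>G\<^esub> g \<otimes>\<^bsub>G\<^esub> inv\<^bsub>G\<^esub> h"

text \<open>
  Two-cocycles and two-coboundaries of \<open>G\<close> with values in the multiplicative group of \<open>k\<close> with
  trivial action.
\<close>

definition cocycle_group :: "'g monoid \<Rightarrow> ('g \<times> 'g \<Rightarrow> 'k::field) monoid" where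
  "cocycle_group G = \<lparr>
     carrier = {a \<in> carrier G \<times> carrier G \<rightarrow>\<^sub>E UNIV - {0}.
       \<forall>x\<in>carrier G. \<forall>y\<in>carrier G. \<forall>z\<in>carrier G.
         a (x, y) * a (x \<otimes>\<^bsub>G\<^esub> y, z) = a (x, y \<otimes>\<^bsub>G\<^esub> z) * a (y, z)},
     mult = (\<lambda>a b. \<lambda>v\<in>carrier G \<times> carrier G. a v * b v),
     one = (\<lambda>v\<in>carrier G \<times> carrier G. 1)\<rparr>"

definition coboundaries :: "'g monoid \<Rightarrow> ('g \<times> 'g \<Rightarrow> 'k::field) set" where
  "coboundaries G = {\<lambda>v\<in>carrier G \<times> carrier G.
       b (fst v) * b (snd v) * inverse (b (fst v \<otimes>\<^bsub>G\<^esub> snd v))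
     | b. b \<in> carrier G \<rightarrow> UNIV - {0}}"

definition cohomology_group :: "'g monoid \<Rightarrow> ('g \<times> 'g \<Rightarrow> 'k::field) set monoid" where
  "cohomology_group G = cocycle_group G Mod coboundaries G"

section \<open>The setting\<close>

text \<open>
  \<open>chr\<close> is the characteristic \<open>p\<close>; \<open>grpP\<close>, \<open>autL\<close>, \<open>cocyc\<close>, \<open>grpH\<close>, \<open>subZ\<close>, \<open>chi\<close>, \<open>proj\<close> are
  \<open>P\<close>, \<open>L\<close>, the cocycle representing \<open>\<alpha>\<close>, \<open>H\<close>, \<open>Z\<close>, \<open>\<chi>\<close> and the map from \<open>H\<close> to \<open>L\<close>; \<open>lbr\<close> and
  \<open>lpm\<close> are the bracket and the \<open>p\<close>-map of the Jennings Lie algebra; \<open>rk\<close>, \<open>wb\<close>, \<open>degw\<close>, \<open>psi\<close> are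
  \<open>n\<close>, the \<open>w\<^sub>i\<close>, their degrees and their characters \<open>\<psi>\<^sub>i\<close>, for \<open>1 \<le> i \<le> n\<close>; \<open>cc\<close>
  and \<open>dd\<close> are the structure constants; \<open>phi0\<close>, \<open>xi\<close>, \<open>gsel\<close> are \<open>\<phi>\<^sub>0\<close>, the \<open>\<xi>\<^bsub>\<phi>\<^esub>\<close> and the
  \<open>g\<^bsub>\<psi>,\<phi>\<^esub>\<close> (first argument \<open>\<psi>\<close>).
\<close>

record (overloaded) ('k, 'p, 'h) jennings_data =
  chr :: nat
  grpP :: "'p monoid"
  autL :: "('p \<Rightarrow> 'p) set"
  cocyc :: "('p \<Rightarrow> 'p) \<times> ('p \<Rightarrow> 'p) \<Rightarrow> 'k"
  grpH :: "'h monoid"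
  subZ :: "'h set"
  chi :: "'h \<Rightarrow> 'k"
  proj :: "'h \<Rightarrow> 'p \<Rightarrow> 'p"
  lbr :: "('k, 'p) jen \<Rightarrow> ('k, 'p) jen \<Rightarrow> ('k, 'p) jen"
  lpm :: "('k, 'p) jen \<Rightarrow> ('k, 'p) jen"
  rk :: nat
  wb :: "nat \<Rightarrow> ('k, 'p) jen"
  degw :: "nat \<Rightarrow> nat"
  psi :: "nat \<Rightarrow> 'h \<Rightarrow> 'k"
  cc :: "nat \<Rightarrow> nat \<Rightarrow> nat \<Rightarrow> 'k"
  dd :: "nat \<Rightarrow> nat \<Rightarrow> 'k"
  phi0 :: "'h \<Rightarrow> 'k"
  xi :: "('h \<Rightarrow> 'k) \<Rightarrow> 'h \<Rightarrow> 'k"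
  gsel :: "('h \<Rightarrow> 'k) \<Rightarrow> ('h \<Rightarrow> 'k) \<Rightarrow> 'h"

definition centerH :: "('k, 'p, 'h) jennings_data \<Rightarrow> 'h set" where
  "centerH S = group_center (grpH S)"

text \<open>
  Characters are extensional functions, so that equality is equality of characters.
  Characters of \<open>H/Z\<close> are represented by their inflations to \<open>H\<close>.
\<close>

definition Irr_over :: "('k::field, 'p, 'h) jennings_data \<Rightarrow> ('h \<Rightarrow> 'k) set" where
  "Irr_over S = {\<phi> \<in> hom ((grpH S)\<lparr>carrier := centerH S\<rparr>) (units_of class_ring)
       \<inter> extensional (centerH S). \<forall>z\<in>subZ S. \<phi> z = chi S z}"

definition chars_HZ :: "('k::field, 'p, 'h) jennings_data \<Rightarrow> ('h \<Rightarrow> 'k) set" where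
  "chars_HZ S = {\<psi> \<in> hom (grpH S) (units_of class_ring) \<inter> extensional (carrier (grpH S)).
       \<forall>z\<in>subZ S. \<psi> z = 1}"

definition twist ::
    "('k::field, 'p, 'h) jennings_data \<Rightarrow> ('h \<Rightarrow> 'k) \<Rightarrow> ('h \<Rightarrow> 'k) \<Rightarrow> 'h \<Rightarrow> 'k" where
  "twist S \<phi> \<psi> = (\<lambda>z\<in>centerH S. \<phi> z * \<psi> z)"

definition rho :: "('k::field, 'p, 'h) jennings_data \<Rightarrow> 'h \<Rightarrow> 'h \<Rightarrow> 'k" where
  "rho S g h = chi S (commutator (grpH S) h g)"

locale jennings_setting =
  fixes S :: "('k::alg_closed_field, 'p, 'h) jennings_data"
  assumes prime_chr: "prime (chr S)"
    and char_k: "CHAR('k) = chr S"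
    and group_P: "group (grpP S)"
    and finite_P: "finite (carrier (grpP S))"
    and order_P: "Coset.order (grpP S) = chr S ^ rk S"
    and subgroup_L: "subgroup (autL S) (AutoGroup (grpP S))"
    and abelian_L: "comm_group ((AutoGroup (grpP S))\<lparr>carrier := autL S\<rparr>)"
    and order_L: "\<not> chr S dvd card (autL S)"
    and cocycle: "cocyc S \<in> carrier (cocycle_group ((AutoGroup (grpP S))\<lparr>carrier := autL S\<rparr>))"
    and cocycle_order:
      "group.ord (cocycle_group ((AutoGroup (grpP S))\<lparr>carrier := autL S\<rparr>)) (cocyc S) =
       group.ord (cohomology_group ((AutoGroup (grpP S))\<lparr>carrier := autL S\<rparr>))
         (coboundaries ((AutoGroup (grpP S))\<lparr>carrier := autL S\<rparr>)
           #>\<^bsub>cocycle_group ((AutoGroup (grpP S))\<lparr>carrier := autL S\<rparr>)\<^esub> cocyc S)"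
    and group_H: "group (grpH S)"
    and finite_H: "finite (carrier (grpH S))"
    and order_H: "\<not> chr S dvd Coset.order (grpH S)"
    and proj_hom: "proj S \<in> hom (grpH S) ((AutoGroup (grpP S))\<lparr>carrier := autL S\<rparr>)"
    and proj_surj: "proj S ` carrier (grpH S) = autL S"
    and proj_kernel:
      "subZ S = kernel (grpH S) ((AutoGroup (grpP S))\<lparr>carrier := autL S\<rparr>) (proj S)"
    and Z_central: "subZ S \<subseteq> centerH S"
    and Z_derived: "subZ S = derived (grpH S) (carrier (grpH S))"
    and chi_hom: "chi S \<in> hom ((grpH S)\<lparr>carrier := subZ S\<rparr>) (units_of class_ring)"
    and chi_faithful: "inj_on (chi S) (subZ S)"
    and cocycle_chi: "\<exists>s \<in> autL S \<rightarrow> carrier (grpH S).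
      (\<forall>x\<in>autL S. proj S (s x) = x) \<and>
      (\<forall>x\<in>autL S. \<forall>y\<in>autL S. cocyc S (x, y) =
         chi S (s x \<otimes>\<^bsub>grpH S\<^esub> s y \<otimes>\<^bsub>grpH S\<^esub> inv\<^bsub>grpH S\<^esub> s (x \<otimes>\<^bsub>AutoGroup (grpP S)\<^esub> y)))"
    and lie: "restricted_lie_algebra (jennings_space (grpP S)) (lbr S) (lpm S) (chr S)"
    and lie_bracket: "\<And>r s a b. \<lbrakk>1 \<le> r; 1 \<le> s;
        a \<in> jennings_filtration TYPE('k) (grpP S) r; b \<in> jennings_filtration TYPE('k) (grpP S) s\<rbrakk>
      \<Longrightarrow> lbr S (jennings_elt (grpP S) r a) (jennings_elt (grpP S) s b) =
          jennings_elt (grpP S) (r + s) (commutator (grpP S) a b)"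
    and lie_pmap: "\<And>r a. \<lbrakk>1 \<le> r; a \<in> jennings_filtration TYPE('k) (grpP S) r\<rbrakk>
      \<Longrightarrow> lpm S (jennings_elt (grpP S) r a) =
          jennings_elt (grpP S) (chr S * r) (a [^]\<^bsub>grpP S\<^esub> chr S)"
    and wb_basis: "vectorspace.basis class_ring (jennings_space (grpP S)) (wb S ` {1..rk S})"
    and wb_inj: "inj_on (wb S) {1..rk S}"
    and wb_homogeneous: "\<And>i. i \<in> {1..rk S} \<Longrightarrow>
      1 \<le> degw S i \<and> wb S i \<in> jennings_component (grpP S) (degw S i)"
    and degw_mono: "\<And>i j. \<lbrakk>i \<in> {1..rk S}; j \<in> {1..rk S}; i \<le> j\<rbrakk> \<Longrightarrow> degw S i \<le> degw S j"
    and psi_char: "\<And>i. i \<in> {1..rk S} \<Longrightarrow> psi S i \<in> chars_HZ S"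
    and wb_eigen: "\<And>i g. \<lbrakk>i \<in> {1..rk S}; g \<in> carrier (grpH S)\<rbrakk> \<Longrightarrow>
      jennings_act (proj S g) (wb S i) = psi S i g \<odot>\<^bsub>jennings_space (grpP S)\<^esub> wb S i"
    and struct_c: "\<And>i j. \<lbrakk>i \<in> {1..rk S}; j \<in> {1..rk S}\<rbrakk> \<Longrightarrow>
      lbr S (wb S i) (wb S j) = (\<Oplus>\<^bsub>jennings_space (grpP S)\<^esub>k\<in>{1..rk S}.
        cc S i j k \<odot>\<^bsub>jennings_space (grpP S)\<^esub> wb S k)"
    and struct_d: "\<And>i. i \<in> {1..rk S} \<Longrightarrow>
      lpm S (wb S i) = (\<Oplus>\<^bsub>jennings_space (grpP S)\<^esub>k\<in>{1..rk S}.
        dd S i k \<odot>\<^bsub>jennings_space (grpP S)\<^esub> wb S k)"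
    and phi0_Irr: "phi0 S \<in> Irr_over S"
    and xi_char: "\<And>\<phi>. \<phi> \<in> Irr_over S \<Longrightarrow> xi S \<phi> \<in> chars_HZ S"
    and xi_restrict: "\<And>\<phi> z. \<lbrakk>\<phi> \<in> Irr_over S; z \<in> centerH S\<rbrakk> \<Longrightarrow>
      xi S \<phi> z = \<phi> z * inverse (phi0 S z)"
    and xi_phi0: "\<And>h. h \<in> carrier (grpH S) \<Longrightarrow> xi S (phi0 S) h = 1"
    and gsel_closed: "\<And>\<psi> \<phi>. \<lbrakk>\<psi> \<in> chars_HZ S; \<phi> \<in> Irr_over S\<rbrakk> \<Longrightarrow> gsel S \<psi> \<phi> \<in> carrier (grpH S)"
    and gsel_rho: "\<And>\<psi> \<phi> h. \<lbrakk>\<psi> \<in> chars_HZ S; \<phi> \<in> Irr_over S; h \<in> carrier (grpH S)\<rbrakk> \<Longrightarrow>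
      rho S (gsel S \<psi> \<phi>) h = xi S (twist S \<phi> \<psi>) h * inverse (xi S \<phi> h) * inverse (\<psi> h)"

section \<open>The algebra generated by the idempotents and the weight elements\<close>

definition env :: "('k::field, 'p, 'h) jennings_data
    \<Rightarrow> ('k, (('k, 'p) jen list \<Rightarrow>\<^sub>0 'k) set) module" where
  "env S = enveloping_algebra (jennings_space (grpP S)) (lbr S) (lpm S) (chr S)"

type_synonym ('k, 'p, 'h) smash = "'h \<Rightarrow> (('k, 'p) jen list \<Rightarrow>\<^sub>0 'k) set"

definition smash :: "('k::field, 'p, 'h) jennings_data \<Rightarrow> ('k, ('k, 'p, 'h) smash) module" where
  "smash S = skew_group_algebra (env S) (grpH S)
     (\<lambda>h. enveloping_act (jennings_act (proj S h)))"

definition smash_grp :: "('k::field, 'p, 'h) jennings_data \<Rightarrow> 'h \<Rightarrow> ('k, 'p, 'h) smash" where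
  "smash_grp S h = skew_elt (env S) (grpH S) \<one>\<^bsub>env S\<^esub> h"

definition smash_w :: "('k::field, 'p, 'h) jennings_data \<Rightarrow> nat \<Rightarrow> ('k, 'p, 'h) smash" where
  "smash_w S i = skew_elt (env S) (grpH S)
     (enveloping_elt (jennings_space (grpP S)) (lbr S) (lpm S) (chr S) (wb S i)) \<one>\<^bsub>grpH S\<^esub>"

definition char_idem ::
    "('k::field, 'p, 'h) jennings_data \<Rightarrow> 'h set \<Rightarrow> ('h \<Rightarrow> 'k) \<Rightarrow> ('k, 'p, 'h) smash" where
  "char_idem S C \<theta> = (\<Oplus>\<^bsub>smash S\<^esub>h\<in>C.
     (\<theta> (inv\<^bsub>grpH S\<^esub> h) / of_nat (card C)) \<odot>\<^bsub>smash S\<^esub> smash_grp S h)"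

definition e_chi :: "('k::field, 'p, 'h) jennings_data \<Rightarrow> ('k, 'p, 'h) smash" where
  "e_chi S = char_idem S (subZ S) (chi S)"

definition e_phi :: "('k::field, 'p, 'h) jennings_data \<Rightarrow> ('h \<Rightarrow> 'k) \<Rightarrow> ('k, 'p, 'h) smash" where
  "e_phi S \<phi> = char_idem S (centerH S) \<phi>"

definition gi :: "('k::field, 'p, 'h) jennings_data \<Rightarrow> nat \<Rightarrow> ('h \<Rightarrow> 'k) \<Rightarrow> 'h" where
  "gi S i \<phi> = gsel S (psi S i) \<phi>"

definition w_elt ::
    "('k::field, 'p, 'h) jennings_data \<Rightarrow> nat \<Rightarrow> ('h \<Rightarrow> 'k) \<Rightarrow> ('k, 'p, 'h) smash" where
  "w_elt S i \<phi> = smash_grp S (gi S i \<phi>) \<otimes>\<^bsub>smash S\<^esub> smash_w S i \<otimes>\<^bsub>smash S\<^esub> e_phi S \<phi>"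

definition alg_A :: "('k::field, 'p, 'h) jennings_data \<Rightarrow> ('k, ('k, 'p, 'h) smash) module" where
  "alg_A S = subalgebra_generated (corner (smash S) (e_chi S))
     (e_phi S ` Irr_over S \<union> {w_elt S i \<phi> | i \<phi>. i \<in> {1..rk S} \<and> \<phi> \<in> Irr_over S})"

section \<open>The scalars\<close>

text \<open>\<open>twists S i a \<phi>\<close> is \<open>\<phi> \<psi>\<^sub>i\<^sup>a\<close>, and
  \<open>g_power S i m \<phi>\<close> is the product of the \<open>g\<close> with indices \<open>(i, \<phi> \<psi>\<^sub>i\<^sup>a)\<close>, where \<open>a\<close> decreases from
  \<open>m - 1\<close> on the left to \<open>0\<close> on the right.\<close>

definition twists ::
    "('k::field, 'p, 'h) jennings_data \<Rightarrow> nat \<Rightarrow> nat \<Rightarrow> ('h \<Rightarrow> 'k) \<Rightarrow> 'h \<Rightarrow> 'k" where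
  "twists S i a \<phi> = ((\<lambda>\<theta>. twist S \<theta> (psi S i)) ^^ a) \<phi>"

fun g_power :: "('k::field, 'p, 'h) jennings_data \<Rightarrow> nat \<Rightarrow> nat \<Rightarrow> ('h \<Rightarrow> 'k) \<Rightarrow> 'h" where
  "g_power S i 0 \<phi> = \<one>\<^bsub>grpH S\<^esub>"
| "g_power S i (Suc m) \<phi> = gi S i (twists S i m \<phi>) \<otimes>\<^bsub>grpH S\<^esub> g_power S i m \<phi>"

definition z1 :: "('k::field, 'p, 'h) jennings_data \<Rightarrow> nat \<Rightarrow> nat \<Rightarrow> ('h \<Rightarrow> 'k) \<Rightarrow> 'h" where
  "z1 S i j \<phi> = inv\<^bsub>grpH S\<^esub> (gi S i (twist S \<phi> (psi S j)) \<otimes>\<^bsub>grpH S\<^esub> gi S j \<phi>)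
     \<otimes>\<^bsub>grpH S\<^esub> (gi S j (twist S \<phi> (psi S i)) \<otimes>\<^bsub>grpH S\<^esub> gi S i \<phi>)"

definition z2 :: "('k::field, 'p, 'h) jennings_data \<Rightarrow> nat \<Rightarrow> nat \<Rightarrow> nat \<Rightarrow> ('h \<Rightarrow> 'k) \<Rightarrow> 'h" where
  "z2 S i j k \<phi> = inv\<^bsub>grpH S\<^esub> (gi S k \<phi>)
     \<otimes>\<^bsub>grpH S\<^esub> (gi S j (twist S \<phi> (psi S i)) \<otimes>\<^bsub>grpH S\<^esub> gi S i \<phi>)"

definition z3 :: "('k::field, 'p, 'h) jennings_data \<Rightarrow> nat \<Rightarrow> nat \<Rightarrow> ('h \<Rightarrow> 'k) \<Rightarrow> 'h" where
  "z3 S i k \<phi> = inv\<^bsub>grpH S\<^esub> (gi S k \<phi>) \<otimes>\<^bsub>grpH S\<^esub> g_power S i (chr S) \<phi>"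

definition q1 :: "('k::field, 'p, 'h) jennings_data \<Rightarrow> nat \<Rightarrow> nat \<Rightarrow> ('h \<Rightarrow> 'k) \<Rightarrow> 'k" where
  "q1 S i j \<phi> = psi S i (gi S j \<phi> \<otimes>\<^bsub>grpH S\<^esub> z1 S i j \<phi>)
     * psi S j (inv\<^bsub>grpH S\<^esub> (gi S i \<phi>) \<otimes>\<^bsub>grpH S\<^esub> z1 S i j \<phi>) * \<phi> (z1 S i j \<phi>)"

definition q2 :: "('k::field, 'p, 'h) jennings_data \<Rightarrow> nat \<Rightarrow> nat \<Rightarrow> nat \<Rightarrow> ('h \<Rightarrow> 'k) \<Rightarrow> 'k" where
  "q2 S i j k \<phi> = inverse (psi S j (gi S i \<phi>)) * psi S k (z2 S i j k \<phi>) * \<phi> (z2 S i j k \<phi>)"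

definition q3 :: "('k::field, 'p, 'h) jennings_data \<Rightarrow> nat \<Rightarrow> nat \<Rightarrow> ('h \<Rightarrow> 'k) \<Rightarrow> 'k" where
  "q3 S i k \<phi> =
     (\<Prod>a<chr S - 1. inverse (psi S i (gi S i (twists S i a \<phi>)) ^ (chr S - 1 - a)))
     * psi S k (z3 S i k \<phi>) * \<phi> (z3 S i k \<phi>)"

section \<open>The quiver and the relations\<close>

text \<open>The arrow \<open>(i, \<phi>)\<close> is the one labelled \<open>i\<close> that starts at \<open>\<phi>\<close>.\<close>

definition quiver ::
    "('k::field, 'p, 'h) jennings_data \<Rightarrow> ('h \<Rightarrow> 'k, nat \<times> ('h \<Rightarrow> 'k)) pre_digraph" where
  "quiver S = \<lparr>verts = Irr_over S,
     arcs = {(i, \<phi>). i \<in> {1..rk S} \<and> degw S i = 1 \<and> \<phi> \<in> Irr_over S},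
     tail = snd, head = (\<lambda>(i, \<phi>). twist S \<phi> (psi S i))\<rparr>"

type_synonym ('k, 'h) kQ = "(('h \<Rightarrow> 'k) \<times> (nat \<times> ('h \<Rightarrow> 'k)) list) \<Rightarrow>\<^sub>0 'k"

text \<open>
  The composable product starting at \<open>\<phi>\<close> with indices \<open>is\<close> in the order of application,
  i.e. \<open>is\<close> is the written product read from right to left.  \<open>E\<close> gives the idempotents and \<open>W\<close>
  the factors.
\<close>

fun composable ::
    "('k::field, 'p, 'h) jennings_data \<Rightarrow> ('k, 'a) module \<Rightarrow> (('h \<Rightarrow> 'k) \<Rightarrow> 'a)
      \<Rightarrow> (nat \<Rightarrow> ('h \<Rightarrow> 'k) \<Rightarrow> 'a) \<Rightarrow> nat list \<Rightarrow> ('h \<Rightarrow> 'k) \<Rightarrow> 'a" where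
  "composable S A E W [] \<phi> = E \<phi>"
| "composable S A E W (i # is) \<phi> = composable S A E W is (twist S \<phi> (psi S i)) \<otimes>\<^bsub>A\<^esub> W i \<phi>"

text \<open>
  The element of the path algebra put for the symbol \<open>\<w>\<^bsub>i,\<phi>\<^esub>\<close>: the arrow if \<open>w\<^sub>i\<close> has degree
  one, and the chosen expression \<open>X i \<phi>\<close> otherwise.
\<close>

definition w_sub :: "('k::field, 'p, 'h) jennings_data \<Rightarrow> (nat \<Rightarrow> ('h \<Rightarrow> 'k) \<Rightarrow> ('k, 'h) kQ)
    \<Rightarrow> nat \<Rightarrow> ('h \<Rightarrow> 'k) \<Rightarrow> ('k, 'h) kQ" where
  "w_sub S X i \<phi> = (if degw S i = 1 then path_arrow (quiver S) (i, \<phi>) else X i \<phi>)"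

text \<open>
  The sign in front of the sum in \<open>relation1\<close> is forced by
  \<open>[w\<^sub>i, w\<^sub>j] = \<Sum>\<^sub>k c\<^bsub>i,j,k\<^esub> w\<^sub>k\<close>: the left-hand side
  \<open>\<w>\<^bsub>j,\<phi>\<psi>\<^sub>i\<^esub> \<w>\<^bsub>i,\<phi>\<^esub> - q\<^bsub>i,j,\<phi>\<^esub> \<w>\<^bsub>i,\<phi>\<psi>\<^sub>j\<^esub> \<w>\<^bsub>j,\<phi>\<^esub>\<close> is a multiple of
  \<open>g\<^bsub>j,\<phi>\<psi>\<^sub>i\<^esub> g\<^bsub>i,\<phi>\<^esub> [w\<^sub>j, w\<^sub>i] e\<^bsub>\<phi>\<^esub>\<close>, so its coefficients are \<open>c\<^bsub>j,i,k\<^esub> = - c\<^bsub>i,j,k\<^esub>\<close>.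
  For instance, if \<open>H\<close> is trivial, it is the plain commutator \<open>[w\<^sub>j, w\<^sub>i]\<close>.  With the
  opposite sign the relations fail in the algebra whenever \<open>p\<close> is odd and the bracket is nonzero.
\<close>

definition relation1 :: "('k::field, 'p, 'h) jennings_data
    \<Rightarrow> (nat \<Rightarrow> ('h \<Rightarrow> 'k) \<Rightarrow> ('k, 'h) kQ) \<Rightarrow> nat \<Rightarrow> nat \<Rightarrow> ('h \<Rightarrow> 'k) \<Rightarrow> ('k, 'h) kQ" where
  "relation1 S X i j \<phi> = (let W = w_sub S X; kQ = path_algebra (quiver S) in
     W j (twist S \<phi> (psi S i)) \<otimes>\<^bsub>kQ\<^esub> W i \<phi>
     - scale (q1 S i j \<phi>) (W i (twist S \<phi> (psi S j)) \<otimes>\<^bsub>kQ\<^esub> W j \<phi>)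
     - (\<Sum>k\<in>{k\<in>{1..rk S}. cc S i j k \<noteq> 0}. scale (- cc S i j k * q2 S i j k \<phi>) (W k \<phi>)))"

definition relation2 :: "('k::field, 'p, 'h) jennings_data
    \<Rightarrow> (nat \<Rightarrow> ('h \<Rightarrow> 'k) \<Rightarrow> ('k, 'h) kQ) \<Rightarrow> nat \<Rightarrow> ('h \<Rightarrow> 'k) \<Rightarrow> ('k, 'h) kQ" where
  "relation2 S X i \<phi> = (let W = w_sub S X; kQ = path_algebra (quiver S) in
     composable S kQ path_vertex W (replicate (chr S) i) \<phi>
     - (\<Sum>k\<in>{k\<in>{1..rk S}. dd S i k \<noteq> 0}. scale (dd S i k * q3 S i k \<phi>) (W k \<phi>)))"

definition relation_ideal :: "('k::field, 'p, 'h) jennings_data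
    \<Rightarrow> (nat \<Rightarrow> ('h \<Rightarrow> 'k) \<Rightarrow> ('k, 'h) kQ) \<Rightarrow> ('k, 'h) kQ set" where
  "relation_ideal S X = Idl\<^bsub>path_algebra (quiver S)\<^esub>
     ({relation1 S X i j \<phi> | i j \<phi>. i \<in> {1..rk S} \<and> j \<in> {1..rk S} \<and> \<phi> \<in> Irr_over S}
    \<union> {relation2 S X i \<phi> | i \<phi>. i \<in> {1..rk S} \<and> \<phi> \<in> Irr_over S})"

text \<open>\<open>X\<close> chooses expressions, with respect to the correspondence \<open>\<Phi>\<close> from the path
  algebra; an expression for \<open>\<w>\<^bsub>k,\<zeta>\<^esub>\<close> is a combination of paths from \<open>\<zeta>\<close> to \<open>\<zeta> \<psi>\<^sub>k\<close>.\<close>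

definition is_expression :: "('k::field, 'p, 'h) jennings_data
    \<Rightarrow> (('k, 'h) kQ \<Rightarrow> ('k, 'p, 'h) smash) \<Rightarrow> nat \<Rightarrow> ('h \<Rightarrow> 'k) \<Rightarrow> ('k, 'h) kQ \<Rightarrow> bool" where
  "is_expression S \<Phi> k \<zeta> x \<longleftrightarrow>
     Poly_Mapping.keys x \<subseteq> quiver_paths (quiver S) \<zeta> (twist S \<zeta> (psi S k)) \<and> \<Phi> x = w_elt S k \<zeta>"

definition PBW_index :: "('k::field, 'p, 'h) jennings_data \<Rightarrow> (nat list \<times> ('h \<Rightarrow> 'k)) set" where
  "PBW_index S = {(is, \<phi>). set is \<subseteq> {1..rk S} \<and> sorted (rev is)
     \<and> (\<forall>i. count_list is i \<le> chr S - 1) \<and> \<phi> \<in> Irr_over S}"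

definition PBW_monomial ::
    "('k::field, 'p, 'h) jennings_data \<Rightarrow> nat list \<times> ('h \<Rightarrow> 'k) \<Rightarrow> ('k, 'p, 'h) smash" where
  "PBW_monomial S = (\<lambda>(is, \<phi>). composable S (alg_A S) (e_phi S) (w_elt S) is \<phi>)"

end

theory Submission
  imports Defs "HOL-Algebra.Group_Action"
begin

text \<open>
A Poincare-Birkhoff-Witt theorem comes for free from \<open>|P| = p\<^sup>n\<close>. The ordered words in the \<open>w\<^sub>i\<close> span
the restricted enveloping algebra \<open>U\<close>. On the other hand \<open>U\<close> acts on \<open>kP\<close> through the associated graded
algebra, transported to \<open>kP\<close> along a splitting of the radical filtration, and evaluation at the class
of \<open>1\<close> maps the words in degree one onto a spanning set of \<open>kP\<close>. Hence the \<open>p\<^sup>n\<close> ordered words are independent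
and \<open>U\<close> is generated in degree one.

In the smash product a composable product of elements \<open>w\<close> is a nonzero multiple of \<open>g u e\<close> with \<open>g\<close> in \<open>H\<close>, \<open>u\<close> a word
and \<open>e\<close> one of the idempotents. Two such \<open>g\<close> with the same \<open>\<rho>(g)\<close> differ by an element of \<open>Z(H)\<close>, which \<open>e\<close> turns
into a scalar; this gives the relations. They rewrite every path into ordered words, and these stay
independent since their coefficients at the elements of \<open>H\<close> are multiples of ordered words of \<open>U\<close>.
\<close>

\<comment> \<open>Since \<open>|P|\<close> is also the dimension of \<open>kP\<close>, evaluation at
  the class of \<open>1\<close> is bijective. Its injectivity is what turns the surjection from the
  degree-one words into generation of \<open>U\<close> in degree one. For \<open>U\<close> to act at
  all, the \<open>p\<close>-map must become the \<open>p\<close>-th power of operators. On group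
  elements this is the Frobenius identity for \<open>g - 1\<close>, but the \<open>p\<close>-map is
  not additive: its defect is given by Jacobson's formula, which is therefore proved for arbitrary
  rings with \<open>p = 0\<close>. The splitting is finite because the augmentation ideal is
  nilpotent. This is shown over the prime field, where orbits of the group can be counted. An
  expression for \<open>w_k\<close> by paths may use only words with the character of
  \<open>w_k\<close>; averaging over \<open>H\<close>, whose order is invertible in
  \<open>k\<close>, selects them. That the relations suffice needs no study of the kernel: one
  indexed family spans \<open>kQ/I\<close> and is carried to an independent family, so no element
  outside \<open>I\<close> can be killed.\<close>
syntax (input) "_index" :: "logic \<Rightarrow> index" ("(\<^sub>_)" [1000] 1000)

abbreviation single where "single \<equiv> Poly_Mapping.single"
abbreviation keys where "keys \<equiv> Poly_Mapping.keys"
abbreviation lookup where "lookup \<equiv> Poly_Mapping.lookup"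

section \<open>Linear algebra over a field\<close>

locale k_space = vectorspace "class_ring :: 'k ring" V
 for V :: "('k::field, 'v) module" (structure)
begin

lemma sm_closed [simp, intro]: "x : carrier V ==> c \<odot> x : carrier V"
 using smult_closed[of c x] by simp

lemma sm_add_r: "x : carrier V ==> y : carrier V ==> c \<odot> (x \<oplus> y) = c \<odot> x \<oplus> c \<odot> y"
 using smult_r_distr[of c x y] by simp

lemma sm_add_l: "x : carrier V ==> (c + d) \<odot> x = c \<odot> x \<oplus> d \<odot> x"
 using smult_l_distr[of c d x] by simp

lemma sm_sm: "x : carrier V ==> c \<odot> (d \<odot> x) = (c * d) \<odot> x"
 using smult_assoc1[of c d x] by simp

lemma sm_one [simp]: "x : carrier V ==> 1 \<odot> x = x"
 using smult_one[of x] by simp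

lemma sm_zero [simp]: "x : carrier V ==> 0 \<odot> x = \<zero>"
 using lmult_0[of x] by simp

lemma sm_zero_r [simp]: "c \<odot> \<zero> = \<zero>"
 using rmult_0[of c] by simp

lemma sm_minus: "x : carrier V ==> (- c) \<odot> x = \<ominus> (c \<odot> x)"
 using smult_l_minus[of c x] by (simp add: class_ring_simps)

lemma sm_neg: "x : carrier V ==> (- 1) \<odot> x = \<ominus> x"
 using sm_minus[of x 1] by simp

lemma sm_eq_zero: "x : carrier V ==> c \<odot> x = \<zero> ==> c = 0 \<or> x = \<zero>"
 by (metis field_class.field_inverse sm_one sm_sm sm_zero_r)

lemma sm_finsum:
 "f : I \<rightarrow> carrier V ==> c \<odot> (\<Oplus>i\<in>I. f i) = (\<Oplus>i\<in>I. c \<odot> f i)"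
proof (induction I rule: infinite_finite_induct)
 case (insert i I)
 then show ?case by (simp add: Pi_def sm_add_r)
qed auto

lemma finsum_sm_left:
 "x : carrier V ==> (\<Oplus>i\<in>I. f i \<odot> x) = (\<Sum>i\<in>I. f i) \<odot> x"
proof (induction I rule: infinite_finite_induct)
 case (insert i I)
 then show ?case by (simp add: Pi_def sm_add_l)
qed auto

lemma finsum_single:
 assumes "finite I" "i : I" "\<And>j. j : I ==> j ~= i ==> f j = \<zero>" "f i : carrier V"
 shows "(\<Oplus>j\<in>I. f j) = f i"
proof -
 have "(\<Oplus>j\<in>I. f j) = f i \<oplus> (\<Oplus>j\<in>I - {i}. f j)"
  using assms by (subst insert_Diff[OF assms(2), symmetric], subst finsum_insert) (auto simp: Pi_def)
 also have "(\<Oplus>j\<in>I - {i}. f j) = (\<Oplus>j\<in>I - {i}. \<zero>)"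
  using assms by (intro finsum_cong') auto
 finally show ?thesis using assms(4) by simp
qed

lemma finsum_swap:
 assumes "finite I" "finite J" "\<And>i j. i : I ==> j : J ==> f i j : carrier V"
 shows "(\<Oplus>i\<in>I. \<Oplus>j\<in>J. f i j) = (\<Oplus>j\<in>J. \<Oplus>i\<in>I. f i j)"
 using assms(1,3)
proof (induction I rule: finite_induct)
 case (insert i I)
 have "(\<Oplus>j\<in>J. \<Oplus>i\<in>insert i I. f i j) = (\<Oplus>j\<in>J. f i j \<oplus> (\<Oplus>i\<in>I. f i j))"
  using insert by (intro finsum_cong') (auto simp: Pi_def)
 also have "\<dots> = (\<Oplus>j\<in>J. f i j) \<oplus> (\<Oplus>j\<in>J. \<Oplus>i\<in>I. f i j)"
  using insert by (intro finsum_addf) (auto simp: Pi_def)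
 finally show ?case using insert by (simp add: Pi_def)
qed simp

lemma minus_eq_zero_iff: "x : carrier V ==> y : carrier V ==> x \<ominus> y = \<zero> \<longleftrightarrow> x = y"
 by (metis a_minus_def a_inv_closed add.inv_comm minus_equality minus_minus r_neg)

definition subsp :: "'v set => bool" where
 "subsp W \<longleftrightarrow> W <= carrier V \<and> \<zero> : W \<and> (\<forall>x\<in>W. \<forall>y\<in>W. x \<oplus> y : W) \<and> (\<forall>c. \<forall>x\<in>W. c \<odot> x : W)"

text \<open>One scaled generator is added at a time, which gives an induction with a single step.
  \<open>span_eq_spn\<close> identifies the result with the library's \<open>span\<close>.\<close>

inductive_set spn :: "'v set => 'v set" for S where
 zero: "\<zero> : spn S"
| step: "x : S ==> y : spn S ==> c \<odot> x \<oplus> y : spn S"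

lemma subsp_spn: 
 assumes "S <= carrier V"
 shows "subsp (spn S)"
proof -
 have 1: "x : carrier V" if "x : spn S" for x
  using that assms by induction auto
 have 2: "x \<oplus> y : spn S" if "x : spn S" "y : spn S" for x y
  using that
 proof induction
  case (step x u c)
  then have "(c \<odot> x \<oplus> u) \<oplus> y = c \<odot> x \<oplus> (u \<oplus> y)"
   using 1 assms by (intro a_assoc) auto
  then show ?case using step spn.step[of x S "u \<oplus> y" c] by simp
 qed (use 1 in auto)
 have 3: "c \<odot> x : spn S" if "x : spn S" for c x
  using that
 proof induction
  case (step x u d)
  have "c \<odot> (d \<odot> x \<oplus> u) = (c * d) \<odot> x \<oplus> c \<odot> u"
   using step 1 assms by (subst sm_add_r) (auto simp: sm_sm)
  then show ?case using step spn.step[of x S "c \<odot> u" "c * d"] by simp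
 qed (auto intro: spn.zero)
 show ?thesis using 1 2 3 spn.zero unfolding subsp_def by auto
qed

lemma subspD:
 assumes "subsp W"
 shows "W <= carrier V" "\<zero> : W" "x : W ==> y : W ==> x \<oplus> y : W" "x : W ==> c \<odot> x : W"
 using assms by (auto simp: subsp_def)

lemma subsp_minus: "subsp W ==> x : W ==> y : W ==> x \<ominus> y : W"
 by (metis a_minus_def sm_neg subspD(1,3,4) subsetD)

lemma subsp_finsum: "subsp W ==> (\<And>i. i : I ==> f i : W) ==> (\<Oplus>i\<in>I. f i) : W"
proof (induction I rule: infinite_finite_induct)
 case (insert i I)
 then show ?case using subspD[OF insert.prems(1)] by (subst finsum_insert) (auto simp: Pi_def)
qed (auto dest: subspD)

lemma spn_superset: "S <= carrier V ==> x : S ==> x : spn S"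
 using spn.step[of x S \<zero> 1] spn.zero by auto

lemma spn_least: "subsp W ==> S <= W ==> spn S <= W"
proof
 fix x assume *: "subsp W" "S <= W" and "x : spn S"
 from this(3) show "x : W" by induction (use * subspD[OF *(1)] in auto)
qed

lemma spn_carrier: "S <= carrier V ==> spn S <= carrier V"
 using subsp_spn subspD(1) by blast

text \<open>The coefficients belong to indices and not to vectors, so the family may repeat a
  vector.\<close>

lemma spn_family:
 assumes I: "finite I" and b: "\<And>i. i : I ==> b i : carrier V" and x: "x : spn (b ` I)"
 shows "\<exists>a. x = (\<Oplus>i\<in>I. a i \<odot> b i)"
 using x
proof induction
 case zero
 have "\<zero> = (\<Oplus>i\<in>I. 0 \<odot> b i)" using b by (simp add: finsum_zero cong: finsum_cong')
 then show ?case by (intro exI[of _ "\<lambda>_. 0"])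
next
 case (step y u c)
 then obtain j a where j: "j : I" "y = b j" and a: "u = (\<Oplus>i\<in>I. a i \<odot> b i)" by auto
 have "(\<Oplus>i\<in>I. (a i + (if i = j then c else 0)) \<odot> b i)
   = (\<Oplus>i\<in>I. a i \<odot> b i \<oplus> (if i = j then c else 0) \<odot> b i)"
  using b by (intro finsum_cong') (auto simp: sm_add_l)
 also have "\<dots> = u \<oplus> (\<Oplus>i\<in>I. (if i = j then c else 0) \<odot> b i)"
  using b a by (subst finsum_addf) auto
 also have "(\<Oplus>i\<in>I. (if i = j then c else 0) \<odot> b i) = c \<odot> y"
  using b j I by (subst finsum_single[of I j]) auto
 also have "u \<oplus> c \<odot> y = c \<odot> y \<oplus> u"
  using a b j by (intro a_comm) auto
 finally show ?case by metis
qed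

lemma submodule_subsp: "subsp W ==> submodule class_ring W V"
 unfolding submodule_def using module_axioms by (auto simp: subsp_def)

lemma span_subset_subsp: "subsp W ==> S <= W ==> span S <= W"
 using span_is_subset submodule_subsp by blast

lemma subsp_span: "S <= carrier V ==> subsp (span S)"
 using span_is_submodule[of S] unfolding submodule_def subsp_def by simp

lemma span_eq_spn:
 assumes "S <= carrier V"
 shows "span S = spn S"
proof
 show "span S <= spn S"
  using subsp_spn spn_superset assms by (intro span_subset_subsp) auto
 show "spn S <= span S"
  using subsp_span in_own_span assms by (intro spn_least) auto
qed

text \<open>Independence is required of the family and not of its image. This already excludes
  repetitions: if \<open>b i = b j\<close>, the coefficients 1 and -1 give a forbidden
  relation.\<close>

lemma indep_family_basis:
 assumes I: "finite I" and b: "\<And>i. i : I ==> b i : carrier V"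
  and spanning: "carrier V <= spn (b ` I)"
  and indep: "\<And>a. (\<Oplus>i\<in>I. a i \<odot> b i) = \<zero> ==> \<forall>i\<in>I. a i = 0"
 shows "inj_on b I" "basis (b ` I)" "dim = card I"
proof -
 show inj: "inj_on b I"
 proof (rule inj_onI, rule ccontr)
  fix i j assume ij: "i : I" "j : I" "b i = b j" "i ~= j"
  let ?a = "\<lambda>k. if k = i then 1 else if k = j then - 1 else (0::'k)"
  have "(\<Oplus>k\<in>I. ?a k \<odot> b k) = (\<Oplus>k\<in>insert i (insert j (I - {i, j})). ?a k \<odot> b k)"
   using ij by (intro arg_cong2[where f = "finsum V"]) auto
  also have "\<dots> = b i \<oplus> ((-1) \<odot> b j \<oplus> (\<Oplus>k\<in>I - {i, j}. ?a k \<odot> b k))"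
   using ij b I by (subst finsum_insert, auto simp: Pi_def)+
  also have "(\<Oplus>k\<in>I - {i, j}. ?a k \<odot> b k) = (\<Oplus>k\<in>I - {i, j}. \<zero>)"
   using ij b by (intro finsum_cong') auto
  also have "b i \<oplus> ((-1) \<odot> b j \<oplus> (\<Oplus>k\<in>I - {i, j}. \<zero>)) = \<zero>"
   using ij b by (simp add: sm_neg r_neg)
  finally have "\<forall>k\<in>I. ?a k = 0" by (rule indep[of ?a])
  then show False using ij by force
 qed
 have "lin_indpt (b ` I)"
 proof (rule finite_lin_indpt2)
  fix a assume "lincomb a (b ` I) = \<zero>"
  then have "(\<Oplus>i\<in>I. a (b i) \<odot> b i) = \<zero>"
   using inj b unfolding lincomb_def by (subst (asm) finsum_reindex) auto
  then have "\<forall>i\<in>I. a (b i) = 0" by (rule indep)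
  then show "\<forall>v\<in>b ` I. a v = \<zero>\<^sub>class_ring" by auto
 qed (use I b in auto)
 moreover have "b ` I <= carrier V" using b by auto
 moreover have "span (b ` I) = carrier V"
  using spanning span_eq_spn[of "b ` I"] spn_carrier[of "b ` I"] b by auto
 ultimately show "basis (b ` I)" unfolding basis_def by auto
 with dim_basis[of "b ` I"] I inj show "dim = card I" by (simp add: card_image)
qed

lemma basis_family:
 assumes I: "finite I" and inj: "inj_on b I" and basis: "basis (b ` I)"
 shows "\<And>i. i : I ==> b i : carrier V" "carrier V <= spn (b ` I)"
  "\<And>a. (\<Oplus>i\<in>I. a i \<odot> b i) = \<zero> ==> \<forall>i\<in>I. a i = 0"
proof -
 show b: "\<And>i. i : I ==> b i : carrier V" using basis unfolding basis_def by auto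
 then show "carrier V <= spn (b ` I)"
  using basis span_eq_spn[of "b ` I"] unfolding basis_def by auto
 fix a assume a: "(\<Oplus>i\<in>I. a i \<odot> b i) = \<zero>"
 show "\<forall>i\<in>I. a i = 0"
 proof (rule ccontr)
  assume "\<not> ?thesis"
  then obtain i where i: "i : I" "a i ~= 0" by auto
  let ?a = "\<lambda>v. a (the_inv_into I b v)"
  have "lincomb ?a (b ` I) = (\<Oplus>i\<in>I. ?a (b i) \<odot> b i)"
   unfolding lincomb_def using b inj by (subst finsum_reindex) auto
  also have "\<dots> = (\<Oplus>i\<in>I. a i \<odot> b i)"
   using b inj by (intro finsum_cong') (auto simp: the_inv_into_f_f)
  finally have "lin_dep (b ` I)"
   using lin_dep_crit[of "b ` I" "b ` I" ?a "b i"] i a I inj by (auto simp: the_inv_into_f_f)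
  then show False using basis unfolding basis_def by auto
 qed
qed

end

text \<open>The condition on \<open>0 \<odot> x\<close> stands in for the existence of negatives: it
  makes \<open>(-1) \<odot> x\<close> an additive inverse of \<open>x\<close>.\<close>

lemma k_spaceI:
 fixes V :: "('k::field, 'v) module" (structure)
 assumes "\<zero> : carrier V" "\<And>x y. x : carrier V ==> y : carrier V ==> x \<oplus> y : carrier V"
  "\<And>c x. x : carrier V ==> c \<odot> x : carrier V"
  "\<And>x y. x : carrier V ==> y : carrier V ==> x \<oplus> y = y \<oplus> x"
  "\<And>x y z. x : carrier V ==> y : carrier V ==> z : carrier V ==> (x \<oplus> y) \<oplus> z = x \<oplus> (y \<oplus> z)"
  "\<And>x. x : carrier V ==> x \<oplus> \<zero> = x"
  "\<And>c d x. x : carrier V ==> (c * d) \<odot> x = c \<odot> (d \<odot> x)"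
  "\<And>x. x : carrier V ==> 1 \<odot> x = x"
  "\<And>c d x. x : carrier V ==> (c + d) \<odot> x = c \<odot> x \<oplus> d \<odot> x"
  "\<And>c x y. x : carrier V ==> y : carrier V ==> c \<odot> (x \<oplus> y) = c \<odot> x \<oplus> c \<odot> y"
  "\<And>x. x : carrier V ==> 0 \<odot> x = \<zero>"
 shows "k_space V"
proof -
 have "\<exists>y\<in>carrier V. x \<oplus> y = \<zero>" if "x : carrier V" for x
 proof
  show "x \<oplus> (-1) \<odot> x = \<zero>" using assms(8)[of x] assms(9)[of x 1 "-1"] assms(11) that by simp
 qed (use assms that in auto)
 then have "vectorspace class_ring V"
  using assms(1-10) by (intro vs_criteria class_field) auto
 then show ?thesis by (rule k_space.intro)
qed

lemma module_homI:
 assumes "\<And>x. x : carrier V ==> f x : carrier W"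
  "\<And>x y. x : carrier V ==> y : carrier V ==> f (x \<oplus>\<^sub>V y) = f x \<oplus>\<^sub>W f y"
  "\<And>c x. x : carrier V ==> f (c \<odot>\<^sub>V x) = c \<odot>\<^sub>W f x"
 shows "f : module_hom class_ring V W"
 using assms by (auto simp: module_hom_def)

locale k_linear = V: k_space V + W: k_space W
 for V :: "('k::field, 'v) module" and W :: "('k, 'w) module" +
 fixes f
 assumes hom: "f : module_hom class_ring V W"
begin

lemma f_closed [simp, intro]: "x : carrier V ==> f x : carrier W"
 using module_hom_closed[OF hom] by auto

lemma f_add: "x : carrier V ==> y : carrier V ==> f (x \<oplus>\<^sub>V y) = f x \<oplus>\<^sub>W f y"
 using module_hom_add[OF hom] .

lemma f_sm: "x : carrier V ==> f (c \<odot>\<^sub>V x) = c \<odot>\<^sub>W f x"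
 using module_hom_smult[OF hom, of c x] by simp

lemma f_zero [simp]: "f \<zero>\<^sub>V = \<zero>\<^sub>W"
 using f_sm[of "\<zero>\<^sub>V" 0] by simp

lemma f_neg: "x : carrier V ==> f (\<ominus>\<^sub>V x) = \<ominus>\<^sub>W f x"
 using f_sm[of x "-1"] by (simp add: V.sm_neg W.sm_neg)

lemma f_minus: "x : carrier V ==> y : carrier V ==> f (x \<ominus>\<^sub>V y) = f x \<ominus>\<^sub>W f y"
 by (simp add: a_minus_def f_add f_neg)

lemma f_finsum: "(\<And>i. i : I ==> g i : carrier V) ==> f (\<Oplus>\<^sub>V i\<in>I. g i) = (\<Oplus>\<^sub>W i\<in>I. f (g i))"
proof (induction I rule: infinite_finite_induct)
 case (insert i I)
 then show ?case by (simp add: Pi_def f_add)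
qed auto

lemma f_lincomb: "(\<And>i. i : I ==> b i : carrier V) ==>
  f (\<Oplus>\<^sub>V i\<in>I. a i \<odot>\<^sub>V b i) = (\<Oplus>\<^sub>W i\<in>I. a i \<odot>\<^sub>W f (b i))"
 by (subst f_finsum) (auto intro!: W.finsum_cong' simp: f_sm)

lemma subsp_vimage: "W.subsp U ==> V.subsp {x : carrier V. f x : U}"
 unfolding V.subsp_def W.subsp_def by (auto simp: f_add f_sm)

end

section \<open>Algebras\<close>

locale k_algebra = k_space A + ring A for A :: "('k::field, 'a) module" (structure) +
 assumes sm_mult_l: "x : carrier A ==> y : carrier A ==> (c \<odot> x) \<otimes> y = c \<odot> (x \<otimes> y)"
  and sm_mult_r: "x : carrier A ==> y : carrier A ==> x \<otimes> (c \<odot> y) = c \<odot> (x \<otimes> y)"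

lemma k_algebraI:
 fixes A :: "('k::field, 'a) module" (structure)
 assumes V: "k_space A"
  and one: "\<one> : carrier A" and m: "\<And>x y. x : carrier A ==> y : carrier A ==> x \<otimes> y : carrier A"
  and assoc: "\<And>x y z. x : carrier A ==> y : carrier A ==> z : carrier A ==>
   (x \<otimes> y) \<otimes> z = x \<otimes> (y \<otimes> z)"
  and unit: "\<And>x. x : carrier A ==> \<one> \<otimes> x = x" "\<And>x. x : carrier A ==> x \<otimes> \<one> = x"
  and distr: "\<And>x y z. x : carrier A ==> y : carrier A ==> z : carrier A ==>
   (x \<oplus> y) \<otimes> z = x \<otimes> z \<oplus> y \<otimes> z"
   "\<And>x y z. x : carrier A ==> y : carrier A ==> z : carrier A ==>
   z \<otimes> (x \<oplus> y) = z \<otimes> x \<oplus> z \<otimes> y"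
  and sm: "\<And>c x y. x : carrier A ==> y : carrier A ==> (c \<odot> x) \<otimes> y = c \<odot> (x \<otimes> y)"
   "\<And>c x y. x : carrier A ==> y : carrier A ==> x \<otimes> (c \<odot> y) = c \<odot> (x \<otimes> y)"
 shows "k_algebra A"
proof -
 interpret V: k_space A by (rule V)
 have "ring A"
  using assms by (intro ringI V.abelian_group_axioms Group.monoidI) auto
 with V sm show ?thesis by (intro k_algebra.intro k_algebra_axioms.intro)
qed

context k_algebra
begin

text \<open>Ideals of the underlying ring absorb scalars because \<open>c \<odot> x\<close> is the
  product of \<open>c \<odot> \<one>\<close> and \<open>x\<close>.\<close>

lemma ideal_subsp: 
 assumes "ideal I A"
 shows "subsp I"
proof -
 interpret I: ideal I A by (rule assms)
 have "c \<odot> x : I" if "x : I" for c x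
 proof -
  have "c \<odot> x = (c \<odot> \<one>) \<otimes> x" using that I.a_subset by (subst sm_mult_l) auto
  then show ?thesis using that I.I_l_closed by auto
 qed
 then show ?thesis using I.a_subset I.zero_closed I.a_closed unfolding subsp_def by auto
qed

end

locale k_alg_hom = A: k_algebra A + B: k_algebra B
 for A :: "('k::field, 'a) module" and B :: "('k, 'b) module" +
 fixes f
 assumes alg_hom: "f : alg_hom A B"

sublocale k_alg_hom \<subseteq> k_linear A B f
 using alg_hom by unfold_locales (auto simp: alg_hom_def)

context k_alg_hom
begin

lemma f_mult: "x : carrier A ==> y : carrier A ==> f (x \<otimes>\<^sub>A y) = f x \<otimes>\<^sub>B f y"
 using alg_hom by (auto simp: alg_hom_def Ring.ring_hom_def)

lemma f_one [simp]: "f \<one>\<^sub>A = \<one>\<^sub>B"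
 using alg_hom by (auto simp: alg_hom_def Ring.ring_hom_def)


lemma ideal_kernel: "ideal {x : carrier A. f x = \<zero>\<^sub>B} A"
proof (rule Ideal.idealI)
 show "ring A" by (rule A.ring_axioms)
 show "subgroup {x : carrier A. f x = \<zero>\<^sub>B} (add_monoid A)"
  by (rule subgroup.intro) (auto simp: f_add f_neg a_inv_def[symmetric])
qed (auto simp: f_mult)

end

lemma alg_homI:
 assumes "\<And>x. x : carrier A ==> f x : carrier B"
  "\<And>x y. x : carrier A ==> y : carrier A ==> f (x \<otimes>\<^sub>A y) = f x \<otimes>\<^sub>B f y"
  "\<And>x y. x : carrier A ==> y : carrier A ==> f (x \<oplus>\<^sub>A y) = f x \<oplus>\<^sub>B f y"
  "\<And>c x. x : carrier A ==> f (c \<odot>\<^sub>A x) = c \<odot>\<^sub>B f x"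
  "f \<one>\<^sub>A = \<one>\<^sub>B"
 shows "f : alg_hom A B"
 using assms by (auto simp: alg_hom_def Ring.ring_hom_def module_hom_def)

section \<open>Formal linear combinations and quotients\<close>

lemma lookup_scale [simp]: "lookup (scale c f) x = c * lookup f x"
 unfolding scale_def by (simp add: Poly_Mapping.map.rep_eq when_def)

interpretation fs: vector_space "scale :: 'k::field => ('b \<Rightarrow>\<^sub>0 'k) => _"
 by unfold_locales (auto intro!: poly_mapping_eqI simp: lookup_add algebra_simps)

lemma keys_scale: "keys (scale c f) <= keys f"
 by (auto simp: in_keys_iff)

lemma scale_single: "scale c (single x d) = single x (c * d)"
 by (intro poly_mapping_eqI) (auto simp: lookup_single when_def)

lemma single_scale_one: "single x c = scale c (single x (1::'k::field))"
 by (simp add: scale_single)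

lemma sum_singles: "(\<Sum>x\<in>keys f. single x (lookup f x)) = f"
 by (intro poly_mapping_eqI)
  (auto simp: lookup_sum lookup_single when_def in_keys_iff sum.delta)

lemma keys_add_subset: "keys f <= B ==> keys g <= B ==> keys (f + g) <= B"
 using Poly_Mapping.keys_add[of f g] by blast

lemma keys_minus_subset:
 fixes f g :: "'b \<Rightarrow>\<^sub>0 'k::ab_group_add"
 shows "keys f <= B ==> keys g <= B ==> keys (f - g) <= B"
 by (auto simp: in_keys_iff lookup_minus subset_iff) (metis diff_self)

lemma keys_scale_subset: "keys f <= B ==> keys (scale c f) <= B"
 using keys_scale[of c f] by blast

lemma keys_sum_subset:
 "(\<And>i. i : I ==> keys (f i) <= B) ==> keys (\<Sum>i\<in>I. f i) <= B"
 by (induction I rule: infinite_finite_induct) (auto intro!: keys_add_subset simp: subset_iff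
   dest!: subsetD[OF Poly_Mapping.keys_add])

text \<open>The combination is built up from its monomials, and all partial sums keep their support
  in \<open>B\<close>. In the sum case both supports are therefore known to lie in
  \<open>B\<close>.\<close>

lemma poly_mapping_induct_on [consumes 1, case_names zero single add]:
 fixes f :: "'b \<Rightarrow>\<^sub>0 'k::comm_monoid_add"
 assumes "keys f <= B" "P 0" "\<And>x c. x : B ==> P (single x c)"
  "\<And>f g. keys f <= B ==> keys g <= B ==> P f ==> P g ==> P (f + g)"
 shows "P f"
proof -
 have "P (\<Sum>x\<in>S. single x (lookup f x)) \<and>
   keys (\<Sum>x\<in>S. single x (lookup f x)) <= B"
  if "finite S" "S <= B" for S
  using that
 proof induction
  case (insert x S)
  then show ?case using assms(3)[of x "lookup f x"]
   by (auto intro!: assms(4) dest!: subsetD[OF Poly_Mapping.keys_add] split: if_splits)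
 qed (use assms in auto)
 from this[of "keys f"] assms(1) show ?thesis by (simp add: sum_singles)
qed

context k_space
begin

definition lext :: "('b => 'v) => ('b \<Rightarrow>\<^sub>0 'k) => 'v" where
 "lext h f = (\<Oplus>x\<in>keys f. lookup f x \<odot> h x)"

lemma lext_superset:
 assumes "finite S" "keys f <= S" "\<And>x. x : S ==> h x : carrier V"
 shows "lext h f = (\<Oplus>x\<in>S. lookup f x \<odot> h x)"
 unfolding lext_def using assms
 by (intro add.finprod_mono_neutral_cong_left) (auto simp: in_keys_iff)

lemma lext_closed: "keys f <= B ==> (\<And>x. x : B ==> h x : carrier V) ==> lext h f : carrier V"
 unfolding lext_def by (auto intro!: finsum_closed)

lemma lext_zero [simp]: "lext h 0 = \<zero>"
 by (simp add: lext_def)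

lemma lext_single [simp]: "h x : carrier V ==> lext h (single x c) = c \<odot> h x"
 using lext_superset[of "{x}" "single x c" h] by (auto simp: Pi_def)

lemma lext_add:
 assumes "keys f <= B" "keys g <= B" "\<And>x. x : B ==> h x : carrier V"
 shows "lext h (f + g) = lext h f \<oplus> lext h g"
proof -
 let ?S = "keys f \<union> keys g"
 have S: "?S <= B" "finite ?S" using assms by auto
 have h: "h x : carrier V" if "x : ?S" for x using S assms that by auto
 have "lext h (f + g) = (\<Oplus>x\<in>?S. lookup (f + g) x \<odot> h x)"
  using S h Poly_Mapping.keys_add[of f g] by (intro lext_superset) auto
 also have "\<dots> = (\<Oplus>x\<in>?S. lookup f x \<odot> h x \<oplus> lookup g x \<odot> h x)"
  using h by (intro finsum_cong') (auto simp: lookup_add sm_add_l Pi_def)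
 also have "\<dots> = lext h f \<oplus> lext h g"
  using S h lext_superset[of ?S f h] lext_superset[of ?S g h] by (subst finsum_addf) (auto simp: Pi_def)
 finally show ?thesis .
qed

lemma lext_scale:
 assumes "keys f <= B" "\<And>x. x : B ==> h x : carrier V"
 shows "lext h (scale c f) = c \<odot> lext h f"
proof -
 have "lext h (scale c f) = (\<Oplus>x\<in>keys f. c \<odot> (lookup f x \<odot> h x))"
  using assms keys_scale[of c f]
  by (subst lext_superset[of "keys f"]) (auto simp: sm_sm intro!: finsum_cong')
 also have "\<dots> = c \<odot> lext h f"
  using assms unfolding lext_def by (subst sm_finsum) auto
 finally show ?thesis .
qed

end

lemma free_space_simps [simp]:
 "carrier (free_space B) = {f. keys f <= B}" "zero (free_space B) = 0"
 "add (free_space B) = (+)" "smult (free_space B) = scale"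
 by (simp_all add: free_space_def)

lemma k_space_free_space: "k_space (free_space B :: ('k::field, 'b \<Rightarrow>\<^sub>0 'k) module)"
 by (rule k_spaceI) (auto intro!: keys_add_subset keys_scale_subset simp: fs.scale_left_distrib
   fs.scale_right_distrib add.commute add.assoc dest!: subsetD[OF Poly_Mapping.keys_add] subsetD[OF keys_scale])

lemma (in k_space) lext_hom:
 "(\<And>x. x : B ==> h x : carrier V) ==> lext h : module_hom class_ring (free_space B) V"
 by (rule module_homI) (auto intro: lext_closed lext_add lext_scale)

subsection \<open>Algebras given by a basis\<close>

text \<open>The product of \<open>basis_algebra\<close> as a bare function. It is bilinear on all
  finitely supported functions, so most calculations need no carrier conditions.\<close>

definition bmul :: "('b => 'b => 'b \<Rightarrow>\<^sub>0 'k::field) => ('b \<Rightarrow>\<^sub>0 'k) => ('b \<Rightarrow>\<^sub>0 'k) => ('b \<Rightarrow>\<^sub>0 'k)" where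
 "bmul m f g = (\<Sum>x\<in>keys f. \<Sum>y\<in>keys g.
   scale (lookup f x * lookup g y) (m x y))"

lemma basis_algebra_simps [simp]:
 "carrier (basis_algebra B m u) = {f. keys f <= B}" "zero (basis_algebra B m u) = 0"
 "add (basis_algebra B m u) = (+)" "smult (basis_algebra B m u) = scale"
 "mult (basis_algebra B m u) = bmul m" "one (basis_algebra B m u) = u"
 by (simp_all add: basis_algebra_def bmul_def fun_eq_iff)

lemma bmul_superset:
 assumes "finite S" "keys f <= S" "finite T" "keys g <= T"
 shows "bmul m f g = (\<Sum>x\<in>S. \<Sum>y\<in>T. scale (lookup f x * lookup g y) (m x y))"
proof -
 have "bmul m f g = (\<Sum>x\<in>keys f. \<Sum>y\<in>T. scale (lookup f x * lookup g y) (m x y))"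
  unfolding bmul_def using assms by (intro sum.cong sum.mono_neutral_left) (auto simp: in_keys_iff)
 also have "\<dots> = (\<Sum>x\<in>S. \<Sum>y\<in>T. scale (lookup f x * lookup g y) (m x y))"
  using assms by (intro sum.mono_neutral_left) (auto simp: in_keys_iff)
 finally show ?thesis .
qed

lemma bmul_add_left: "bmul m (f + f') g = bmul m f g + bmul m f' g"
proof -
 let ?S = "keys f \<union> keys f'" and ?T = "keys g"
 have *: "finite ?S" "finite ?T" "keys f <= ?S" "keys f' <= ?S"
  "keys (f + f') <= ?S" by (auto dest!: subsetD[OF Poly_Mapping.keys_add])
 show ?thesis
  unfolding bmul_superset[OF *(1,3,2) subset_refl] bmul_superset[OF *(1,4,2) subset_refl]
   bmul_superset[OF *(1,5,2) subset_refl]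
  by (simp add: lookup_add ring_distribs fs.scale_left_distrib sum.distrib)
qed

lemma bmul_add_right: "bmul m f (g + g') = bmul m f g + bmul m f g'"
proof -
 let ?S = "keys g \<union> keys g'" and ?T = "keys f"
 have *: "finite ?S" "finite ?T" "keys g <= ?S" "keys g' <= ?S"
  "keys (g + g') <= ?S" by (auto dest!: subsetD[OF Poly_Mapping.keys_add])
 show ?thesis
  unfolding bmul_superset[OF *(2) subset_refl *(1,3)] bmul_superset[OF *(2) subset_refl *(1,4)]
   bmul_superset[OF *(2) subset_refl *(1,5)]
  by (simp add: lookup_add ring_distribs fs.scale_left_distrib sum.distrib)
qed

lemma bmul_scale_left: "bmul m (scale c f) g = scale c (bmul m f g)"
 unfolding bmul_superset[OF finite_keys keys_scale finite_keys subset_refl]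
 by (simp add: bmul_def fs.scale_sum_right mult.assoc)

lemma bmul_scale_right: "bmul m f (scale c g) = scale c (bmul m f g)"
 unfolding bmul_superset[OF finite_keys subset_refl finite_keys keys_scale]
 by (simp add: bmul_def fs.scale_sum_right mult_ac)

lemma bmul_zero [simp]: "bmul m 0 g = 0" "bmul m f 0 = 0"
 by (simp_all add: bmul_def)

lemma bmul_single: "bmul m (single x c) (single y d) = scale (c * d) (m x y)"
 using bmul_superset[of "{x}" "single x c" "{y}" "single y d" m] by simp

lemma bmul_minus_left: "bmul m (f - f') g = bmul m f g - bmul m f' g"
 using bmul_add_left[of m "f - f'" f' g] by (simp add: algebra_simps)

lemma bmul_minus_right: "bmul m f (g - g') = bmul m f g - bmul m f g'"
 using bmul_add_right[of m f "g - g'" g'] by (simp add: algebra_simps)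

lemma bmul_sum_left: "bmul m (\<Sum>i\<in>I. f i) g = (\<Sum>i\<in>I. bmul m (f i) g)"
 by (induction I rule: infinite_finite_induct) (auto simp: bmul_add_left)

lemma bmul_sum_right: "bmul m g (\<Sum>i\<in>I. f i) = (\<Sum>i\<in>I. bmul m g (f i))"
 by (induction I rule: infinite_finite_induct) (auto simp: bmul_add_right)

text \<open>A product of basis elements may be any combination of them, for instance zero for paths
  that do not compose. By bilinearity of \<open>bmul\<close> the algebra laws need testing on basis
  elements only.\<close>

locale algebra_basis =
 fixes B :: "'b set" and m :: "'b => 'b => 'b \<Rightarrow>\<^sub>0 'k::field" and u :: "'b \<Rightarrow>\<^sub>0 'k"
 assumes keys_m: "x : B ==> y : B ==> keys (m x y) <= B"
  and keys_u: "keys u <= B"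
  and assoc: "x : B ==> y : B ==> z : B ==>
   bmul m (m x y) (single z 1) = bmul m (single x 1) (m y z)"
  and unit_left: "x : B ==> bmul m u (single x 1) = single x 1"
  and unit_right: "x : B ==> bmul m (single x 1) u = single x 1"
begin

lemma bmul_keys: "keys f <= B ==> keys g <= B ==> keys (bmul m f g) <= B"
 unfolding bmul_def by (intro keys_sum_subset keys_scale_subset keys_m) auto

lemma bmul_assoc:
 assumes "keys f <= B" "keys g <= B" "keys h <= B"
 shows "bmul m (bmul m f g) h = bmul m f (bmul m g h)"
proof -
 have singles: "bmul m (bmul m (single x a) (single y b)) (single z c)
   = bmul m (single x a) (bmul m (single y b) (single z c))"
  if "x : B" "y : B" "z : B" for x y z a b c
 proof -
  have "bmul m (scale (a * b) (m x y)) (scale c (single z 1)) =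
    bmul m (scale a (single x 1)) (scale (b * c) (m y z))"
   unfolding bmul_scale_left bmul_scale_right assoc[OF that] by (simp add: mult_ac)
  then show ?thesis by (simp add: bmul_single scale_single)
 qed
 show ?thesis
  using assms(1)
 proof (induction f rule: poly_mapping_induct_on)
  case (single x a)
  show ?case using assms(2)
  proof (induction g rule: poly_mapping_induct_on)
   case (single y b)
   show ?case using assms(3)
    by (induction h rule: poly_mapping_induct_on)
     (use single \<open>x : B\<close> singles in \<open>auto simp: bmul_add_right\<close>)
  qed (auto simp: bmul_add_left bmul_add_right)
 qed (auto simp: bmul_add_left)
qed

lemma bmul_unit_left: "keys f <= B ==> bmul m u f = f"
proof (induction f rule: poly_mapping_induct_on)
 case (single x c)
 then show ?case using unit_left[of x] by (subst (1 2) single_scale_one) (simp add: bmul_scale_right)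
qed (auto simp: bmul_add_right)

lemma bmul_unit_right: "keys f <= B ==> bmul m f u = f"
proof (induction f rule: poly_mapping_induct_on)
 case (single x c)
 then show ?case using unit_right[of x] by (subst (1 2) single_scale_one) (simp add: bmul_scale_left)
qed (auto simp: bmul_add_left)

lemma k_algebra: "k_algebra (basis_algebra B m u)"
proof (rule k_algebraI)
 show "k_space (basis_algebra B m u)"
  by (rule k_spaceI) (auto intro!: keys_add_subset keys_scale_subset simp: fs.scale_left_distrib
   fs.scale_right_distrib add.commute add.assoc dest!: subsetD[OF Poly_Mapping.keys_add] subsetD[OF keys_scale])
qed (use keys_u bmul_keys in \<open>auto simp: bmul_assoc bmul_unit_left bmul_unit_right bmul_add_left
  bmul_add_right bmul_scale_left bmul_scale_right\<close>)

lemma lext_alg_hom: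
 assumes "k_algebra A" and h: "\<And>x. x : B ==> h x : carrier A"
  and mult: "\<And>x y. x : B ==> y : B ==> k_space.lext A h (m x y) = h x \<otimes>\<^sub>A h y"
  and one: "k_space.lext A h u = \<one>\<^sub>A"
 shows "k_space.lext A h : alg_hom (basis_algebra B m u) A"
proof -
 interpret A: k_algebra A by fact
 note cl = A.lext_closed[OF _ h] and ad = A.lext_add[OF _ _ h] and sc = A.lext_scale[OF _ h]
 have "A.lext h (bmul m f g) = A.lext h f \<otimes>\<^sub>A A.lext h g"
  if f: "keys f <= B" and g: "keys g <= B" for f g
  using f
 proof (induction f rule: poly_mapping_induct_on)
  case (single x c)
  show ?case using g
  proof (induction g rule: poly_mapping_induct_on)
   case (single y d)
   then show ?case using \<open>x : B\<close> h mult
    by (simp add: bmul_single sc[OF keys_m] A.sm_mult_l A.sm_mult_r A.sm_sm mult.commute)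
  next
   case (add g g')
   have ks: "keys (single x c) <= B" using single by simp
   show ?case using single add ad[OF bmul_keys[OF ks add.hyps(1)] bmul_keys[OF ks add.hyps(2)]]
    by (simp add: bmul_add_right ad cl A.r_distr h)
  qed (use single h in auto)
 next
  case (add f f')
  then show ?case using g ad[OF bmul_keys[OF add.hyps(1) g] bmul_keys[OF add.hyps(2) g]]
   by (simp add: bmul_add_left ad cl A.l_distr)
 qed (use cl[OF g] in auto)
 then show ?thesis
  by (intro alg_homI) (auto simp: cl ad sc one)
qed

end

subsection \<open>Quotients\<close>

lemma quot_alg_simps:
 "carrier (quot_alg A I) = (\<lambda>x. I +>\<^sub>A x) ` carrier A" "zero (quot_alg A I) = I"
 "add (quot_alg A I) = set_add A" "mult (quot_alg A I) = rcoset_mult A I"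
 "one (quot_alg A I) = I +>\<^sub>A \<one>\<^sub>A"
 "smult (quot_alg A I) c X = (\<Union>x\<in>X. I +>\<^sub>A (c \<odot>\<^sub>A x))"
 by (auto simp: quot_alg_def FactRing_def A_RCOSETS_def')

context k_space
begin

lemma subsp_abelian_subgroup:
 assumes "subsp I"
 shows "abelian_subgroup I V"
proof (rule abelian_subgroupI3)
 show "additive_subgroup I V"
  using assms sm_neg unfolding additive_subgroup_def
  by (intro subgroup.intro) (auto simp: subsp_def a_inv_def[symmetric], metis subsetD)
qed (rule abelian_group_axioms)

lemma
 assumes I: "subsp I"
 shows quot_add: "x : carrier V ==> y : carrier V ==>
   (I +> x) \<oplus>\<^sub>(quot_alg V I) (I +> y) = I +> (x \<oplus> y)"
  and quot_smult: "x : carrier V ==> c \<odot>\<^sub>(quot_alg V I) (I +> x) = I +> (c \<odot> x)"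
  and quot_eq_iff: "x : carrier V ==> y : carrier V ==> I +> x = I +> y \<longleftrightarrow> x \<ominus> y : I"
  and quot_zero: "I +> \<zero> = \<zero>\<^sub>(quot_alg V I)"
  and quot_mem_iff: "x : carrier V ==> y : I +> x \<longleftrightarrow> y : carrier V \<and> y \<ominus> x : I"
  and quot_space: "k_space (quot_alg V I)"
  and quot_hom: "(\<lambda>x. I +> x) : module_hom class_ring V (quot_alg V I)"
proof -
 interpret I: abelian_subgroup I V by (rule subsp_abelian_subgroup[OF I])
 show add: "(I +> x) \<oplus>\<^sub>(quot_alg V I) (I +> y) = I +> (x \<oplus> y)"
  if "x : carrier V" "y : carrier V" for x y
  using that by (simp add: quot_alg_simps I.a_rcos_sum)
 have mem: "y : I +> x \<longleftrightarrow> y : carrier V \<and> y \<ominus> x : I" if "x : carrier V" for x y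
 proof
  assume "y : I +> x"
  then obtain i where i: "i : I" "y = i \<oplus> x" by (auto simp: a_r_coset_def')
  then have "i : carrier V" using I.a_subset by auto
  with i that show "y : carrier V \<and> y \<ominus> x : I" by (simp add: a_minus_def a_assoc r_neg)
 next
  assume y: "y : carrier V \<and> y \<ominus> x : I"
  then have "y = (y \<ominus> x) \<oplus> x" using that by (simp add: a_minus_def a_assoc l_neg)
  with y show "y : I +> x" by (auto simp: a_r_coset_def')
 qed
 then show "x : carrier V ==> y : I +> x \<longleftrightarrow> y : carrier V \<and> y \<ominus> x : I" for x y .
 show eq: "I +> x = I +> y \<longleftrightarrow> x \<ominus> y : I" if "x : carrier V" "y : carrier V" for x y
 proof
  assume "I +> x = I +> y"
  then show "x \<ominus> y : I" using I.a_rcos_self[OF that(1)] mem[OF that(2)] by auto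
 next
  assume xy: "x \<ominus> y : I"
  have "z \<ominus> x : I \<longleftrightarrow> z \<ominus> y : I" if z: "z : carrier V" for z
  proof
   assume "z \<ominus> x : I"
   then have "(z \<ominus> x) \<oplus> (x \<ominus> y) : I" using xy subspD(3)[OF I] by auto
   also have "(z \<ominus> x) \<oplus> (x \<ominus> y) = z \<ominus> y"
    using z that \<open>x : carrier V\<close> \<open>y : carrier V\<close> 
    by (simp add: a_minus_def a_assoc) (simp add: r_neg1)
   finally show "z \<ominus> y : I" .
  next
   assume "z \<ominus> y : I"
   then have "(z \<ominus> y) \<ominus> (x \<ominus> y) : I" using xy subsp_minus[OF I] by auto
   also have "(z \<ominus> y) \<ominus> (x \<ominus> y) = z \<ominus> x"
    using z that \<open>x : carrier V\<close> \<open>y : carrier V\<close>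
    by (simp add: a_minus_def a_assoc minus_add a_comm[of "\<ominus> x"]) (simp add: r_neg1)
   finally show "z \<ominus> x : I" .
  qed
  then show "I +> x = I +> y" using mem that by blast
 qed
 show sm: "c \<odot>\<^sub>(quot_alg V I) (I +> x) = I +> (c \<odot> x)" if x: "x : carrier V" for c x
 proof -
  have "I +> (c \<odot> y) = I +> (c \<odot> x)" if "y : I +> x" for y
  proof -
   have y: "y : carrier V" "y \<ominus> x : I" using mem x that by auto
   then have "c \<odot> (y \<ominus> x) : I" using subspD(4)[OF I] by auto
   also have "c \<odot> (y \<ominus> x) = c \<odot> y \<ominus> c \<odot> x"
    using x y by (simp add: a_minus_def sm_add_r flip: sm_neg) (simp add: sm_sm mult.commute)
   finally show ?thesis using eq x y by auto
  qed
  moreover have "x : I +> x" using x by (rule I.a_rcos_self)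
  ultimately show ?thesis unfolding quot_alg_simps by blast
 qed
 show zero: "I +> \<zero> = \<zero>\<^sub>(quot_alg V I)"
  using subspD(1)[OF I] mem[of \<zero>] by (auto simp: quot_alg_simps a_minus_def)
 note car = quot_alg_simps(1)
 show "k_space (quot_alg V I)"
  by (rule k_spaceI)
   (auto simp: car add sm a_ac sm_sm sm_add_l sm_add_r simp flip: zero intro!: imageI)
 show "(\<lambda>x. I +> x) : module_hom class_ring V (quot_alg V I)"
  by (rule module_homI) (auto simp: car add sm)
qed

end

context k_algebra
begin

lemma
 assumes I: "ideal I A"
 shows quot_mult: "x : carrier A ==> y : carrier A ==>
   (I +> x) \<otimes>\<^sub>(quot_alg A I) (I +> y) = I +> (x \<otimes> y)"
  and quot_algebra: "k_algebra (quot_alg A I)"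
  and quot_alg_hom: "(\<lambda>x. I +> x) : alg_hom A (quot_alg A I)"
proof -
 interpret I: ideal I A by fact
 have s: "subsp I" using ideal_subsp[OF I] .
 note add = quot_add[OF s] and sm = quot_smult[OF s] and zero = quot_zero[OF s]
 show mult: "(I +> x) \<otimes>\<^sub>(quot_alg A I) (I +> y) = I +> (x \<otimes> y)"
  if "x : carrier A" "y : carrier A" for x y
  using that by (simp add: quot_alg_simps I.rcoset_mult_add)
 note car = quot_alg_simps(1) and one = quot_alg_simps(5)[of A I]
 show "k_algebra (quot_alg A I)"
  by (rule k_algebraI[OF quot_space[OF s]])
   (auto simp: car add sm mult one m_assoc l_distr r_distr sm_mult_l sm_mult_r intro!: imageI)
 show "(\<lambda>x. I +> x) : alg_hom A (quot_alg A I)"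
  by (rule alg_homI) (auto simp: car add sm mult one)
qed

end

section \<open>Sorting words\<close>

text \<open>The sum of the letters multiplied by their positions, counted from 0. Exchanging the
  letters of an ascent \<open>i < j\<close> lowers it by \<open>j - i\<close>, which makes sorting
  terminate.\<close>

fun position_weight :: "nat list => nat" where
 "position_weight [] = 0"
| "position_weight (x # xs) = sum_list xs + position_weight xs"

lemma position_weight_append:
 "position_weight (u @ v) = position_weight u + length u * sum_list v + position_weight v"
 by (induction u) auto

lemma position_weight_swap:
 "i < j ==> position_weight (u @ j # i # v) < position_weight (u @ i # j # v)"
 by (simp add: position_weight_append algebra_simps)

lemma ascent_if_not_decreasing:
 fixes w :: "nat list"
 assumes "\<not> sorted (rev w)"
 shows "\<exists>u i j v. w = u @ i # j # v \<and> i < j"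
 using assms
proof (induction w)
 case (Cons x w)
 show ?case
 proof (cases "sorted (rev w)")
  case False
  then show ?thesis using Cons by (metis append_Cons)
 next
  case True
  then obtain y v where w: "w = y # v" using Cons.prems by (cases w) auto
  have "x < y"
   using True Cons.prems unfolding w by (auto simp: sorted_append dest: le_trans)
  then show ?thesis unfolding w by (metis append_Nil)
 qed
qed simp

text \<open>Equal letters of a weakly decreasing word are adjacent. A letter occurring at least
  \<open>p\<close> times therefore gives a factor \<open>replicate p i\<close>, to which the
  \<open>p\<close>-th power relation applies.\<close>

lemma decreasing_split:
 fixes w :: "nat list"
 assumes "sorted (rev w)"
 shows "w = filter (\<lambda>x. i < x) w @ replicate (count_list w i) i @ filter (\<lambda>x. x < i) w"
 using assms
proof (induction w)
 case (Cons x w)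
 then have IH: "w = filter (\<lambda>x. i < x) w @ replicate (count_list w i) i @ filter (\<lambda>x. x < i) w"
  and le: "\<forall>y\<in>set w. y \<le> x" by (auto simp: sorted_append)
 consider "i < x" | "x = i" | "x < i" by linarith
 then show ?case
 proof cases
  case 1
  then show ?thesis using IH by simp
 next
  case 2
  then have "filter (\<lambda>x. i < x) w = []" using le by (auto simp: filter_empty_conv)
  then show ?thesis using 2 IH by simp
 next
  case 3
  then have "filter (\<lambda>x. i < x) w = []" "i \<notin> set w" using le by (auto simp: filter_empty_conv)
  then show ?thesis using 3 IH by (simp add: count_list_0_iff)
 qed
qed simp

text \<open>
 A rewriting step either moves towards decreasing order or shortens the word, which is why the
 ordered words with bounded multiplicities suffice.
\<close>

lemma ordered_word_induct:
 fixes P :: "nat list => bool"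
 assumes w: "set w <= I" and p: "2 \<le> p"
  and ordered: "\<And>w. set w <= I ==> sorted (rev w) ==> (\<forall>i. count_list w i \<le> p - 1) ==> P w"
  and swap: "\<And>u i j v. set (u @ i # j # v) <= I ==> i < j ==> P (u @ j # i # v) ==>
   (\<And>k. k : I ==> P (u @ k # v)) ==> P (u @ i # j # v)"
  and pow: "\<And>u i v. set (u @ i # v) <= I ==>
   (\<And>k. k : I ==> P (u @ k # v)) ==> P (u @ replicate p i @ v)"
 shows "P w"
 using w
proof (induction w rule: wf_induct_rule[OF wf_measures[of "[length, position_weight]"]])
 case (1 w)
 have IH: "P v" if "set v <= I"
  "length v < length w \<or> length v = length w \<and> position_weight v < position_weight w" for v
  using that "1.IH"[of v] by auto
 show ?case
 proof (cases "sorted (rev w)")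
  case False
  then obtain u i j v where ij: "w = u @ i # j # v" "i < j"
   using ascent_if_not_decreasing by blast
  show ?thesis
   unfolding ij(1)
  proof (rule swap)
   show "P (u @ j # i # v)"
    using ij position_weight_swap[of i j u v] "1.prems" by (intro IH) auto
   show "P (u @ k # v)" if "k : I" for k
    using ij that "1.prems" by (intro IH) auto
  qed (use ij "1.prems" in auto)
 next
  case True
  show ?thesis
  proof (cases "\<forall>i. count_list w i \<le> p - 1")
   case True
   then show ?thesis using ordered \<open>sorted (rev w)\<close> "1.prems" by auto
  next
   case False
   then obtain i where i: "p \<le> count_list w i" by (metis Suc_leI leI p Suc_pred' less_le_trans zero_less_numeral not_less_eq_eq)
   define u v where "u = filter (\<lambda>x. i < x) w"
    and "v = replicate (count_list w i - p) i @ filter (\<lambda>x. x < i) w"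
   have *: "w = u @ replicate p i @ v"
    using decreasing_split[OF True, of i] i unfolding u_def v_def
    by (metis append.assoc le_add_diff_inverse replicate_add)
   have iw: "i : set w" 
    using i p count_notin by fastforce
   have uv: "set u <= I" "set v <= I" "i : I"
    using "1.prems" iw unfolding u_def v_def by (auto split: if_splits)
   show ?thesis
    unfolding *
   proof (rule pow)
    show "P (u @ k # v)" if "k : I" for k
     using that uv p arg_cong[OF *, of length] by (intro IH) auto
   qed (use uv in auto)
  qed
 qed
qed

definition ordered_words :: "nat => nat => nat list set" where
 "ordered_words n p = {w. set w <= {1..n} \<and> sorted (rev w) \<and> (\<forall>i. count_list w i \<le> p - 1)}"

text \<open>A weakly decreasing word is determined by its multiplicities, and these may be any
  numbers below \<open>p\<close>.\<close>

lemma bij_ordered_words: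
 assumes "1 \<le> p"
 shows "bij_betw (\<lambda>w. \<lambda>i\<in>{1..n}. count_list w i) (ordered_words n p) ({1..n} \<rightarrow>\<^sub>E {..<p})"
proof (rule bij_betw_imageI)
 show "inj_on (\<lambda>w. \<lambda>i\<in>{1..n}. count_list w i) (ordered_words n p)"
 proof (rule inj_onI)
  fix v w assume v: "v : ordered_words n p" and w: "w : ordered_words n p"
   and eq: "(\<lambda>i\<in>{1..n}. count_list v i) = (\<lambda>i\<in>{1..n}. count_list w i)"
  have "count_list v i = count_list w i" for i
  proof (cases "i : {1..n}")
   case True
   then show ?thesis using fun_cong[OF eq, of i] by simp
  next
   case False
   then have "i \<notin> set v" "i \<notin> set w" using v w unfolding ordered_words_def by auto
   then show ?thesis by (simp add: count_notin)
  qed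
  then have "mset (rev v) = mset (rev w)" by (intro multiset_eqI) (simp add: count_mset)
  then have "rev v = rev w"
   using v w unfolding ordered_words_def by (metis (mono_tags, lifting) mem_Collect_eq properties_for_sort)
  then show "v = w" by simp
 qed
 have "\<exists>w\<in>ordered_words n p. f = (\<lambda>i\<in>{1..n}. count_list w i)" if f: "f : {1..n} \<rightarrow>\<^sub>E {..<p}" for f
 proof
  \<comment> \<open>The multiset with the prescribed multiplicities; listing it in decreasing order
    gives the preimage.\<close>
  define M where "M = (\<Sum>i\<in>{1..n}. replicate_mset (f i) i)"
  have M: "count M i = (if i : {1..n} then f i else 0)" for i
   unfolding M_def by (simp add: count_sum cong: if_cong)
  define w where "w = rev (sorted_list_of_multiset M)"
  have c: "count_list w i = count M i" for i
   unfolding w_def by (metis count_mset mset_rev mset_sorted_list_of_multiset)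
  have c': "count_list (sorted_list_of_multiset M) i = count M i" for i
   by (metis count_mset mset_sorted_list_of_multiset)
  have "set_mset M <= {1..n}" using M by (auto simp flip: count_greater_zero_iff split: if_splits)
  then show "w : ordered_words n p"
   using f assms unfolding ordered_words_def
   by (auto simp: w_def sorted_sorted_list_of_multiset c' M PiE_iff Suc_leI
     intro!: le_diff_conv2[THEN iffD2] simp flip: Suc_le_eq)
  show "f = (\<lambda>i\<in>{1..n}. count_list w i)"
   using f by (auto simp: c M fun_eq_iff PiE_iff extensional_def)
 qed
 moreover have "(\<lambda>i\<in>{1..n}. count_list w i) : {1..n} \<rightarrow>\<^sub>E {..<p}" if "w : ordered_words n p" for w
 proof -
  have "count_list w i < p" for i
  proof -
   have "count_list w i \<le> p - 1" using that by (simp add: ordered_words_def)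
   then show ?thesis using assms by linarith
  qed
  then show ?thesis by auto
 qed
 ultimately show "(\<lambda>w. \<lambda>i\<in>{1..n}. count_list w i) ` ordered_words n p = {1..n} \<rightarrow>\<^sub>E {..<p}"
  by blast
qed

lemma
 assumes "1 \<le> p"
 shows finite_ordered_words: "finite (ordered_words n p)"
  and card_ordered_words: "card (ordered_words n p) = p ^ n"
 using bij_betw_finite[OF bij_ordered_words[OF assms, of n]] bij_betw_same_card[OF bij_ordered_words[OF assms, of n]]
 by (auto simp: card_PiE intro!: finite_PiE)

section \<open>Jacobson's formula\<close>

text \<open>\<open>word_sum x y n c\<close> is the sum of the words of length \<open>n\<close> in \<open>x\<close> and \<open>y\<close> with \<open>c\<close> letters \<open>x\<close>,
 and \<open>marked_sum x y j m c\<close> is the sum of the words \<open>u x v\<close> with \<open>u\<close>, \<open>v\<close> of lengths \<open>j\<close>, \<open>m\<close>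
 containing \<open>c\<close> letters \<open>x\<close> in total.\<close>

fun word_sum :: "'a::ring_1 => 'a => nat => nat => 'a" where
 "word_sum x y 0 0 = 1"
| "word_sum x y 0 (Suc c) = 0"
| "word_sum x y (Suc n) 0 = y * word_sum x y n 0"
| "word_sum x y (Suc n) (Suc c) = x * word_sum x y n c + y * word_sum x y n (Suc c)"

definition marked_sum :: "'a::ring_1 => 'a => nat => nat => nat => 'a" where
 "marked_sum x y j m c = (\<Sum>a\<le>c. word_sum x y j a * x * word_sum x y m (c - a))"

text \<open>The defining recursion splits off the first letter. Commutators also multiply on the
  right, so the same sums must be split at the last letter.\<close>

lemma word_sum_right:
 "word_sum x y (Suc n) 0 = word_sum x y n 0 * y"
 "word_sum x y (Suc n) (Suc c) = word_sum x y n c * x + word_sum x y n (Suc c) * y"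
proof -
 show 1: "word_sum x y (Suc n) 0 = word_sum x y n 0 * y" for n
 proof (induction n)
  case (Suc n)
  have "word_sum x y (Suc (Suc n)) 0 = y * (word_sum x y n 0 * y)"
   by (simp only: Suc.IH[symmetric] word_sum.simps(3)[of x y "Suc n"])
  then show ?case by (simp add: mult.assoc)
 qed simp
 show "word_sum x y (Suc n) (Suc c) = word_sum x y n c * x + word_sum x y n (Suc c) * y"
 proof (induction n arbitrary: c)
  case 0
  then show ?case by (cases c) auto
 next
  case (Suc n)
  show ?case
  proof (cases c)
   case 0
   have "word_sum x y (Suc (Suc n)) (Suc 0) = x * (word_sum x y n 0 * y)
     + y * (word_sum x y n 0 * x + word_sum x y n (Suc 0) * y)"
    by (simp only: 1 Suc.IH word_sum.simps(4)[of x y "Suc n"])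
   also have "\<dots> = word_sum x y (Suc n) 0 * x + word_sum x y (Suc n) (Suc 0) * y"
    by (simp add: algebra_simps)
   finally show ?thesis unfolding 0 .
  next
   case (Suc d)
   have "word_sum x y (Suc (Suc n)) (Suc (Suc d)) = x * (word_sum x y n d * x + word_sum x y n (Suc d) * y)
     + y * (word_sum x y n (Suc d) * x + word_sum x y n (Suc (Suc d)) * y)"
    by (simp only: \<open>\<And>c. word_sum x y (Suc n) (Suc c) = _\<close> word_sum.simps(4)[of x y "Suc n"])
   also have "\<dots> = word_sum x y (Suc n) (Suc d) * x + word_sum x y (Suc n) (Suc (Suc d)) * y"
    by (simp add: algebra_simps)
   finally show ?thesis unfolding Suc .
  qed
 qed
qed

lemma word_sum_large: "n < c ==> word_sum x y n c = 0"
proof (induction n arbitrary: c)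
 case 0
 then show ?case by (cases c) auto
next
 case (Suc n)
 then show ?case by (cases c) auto
qed

lemma word_sum_all: "word_sum x y n n = x ^ n"
 by (induction n) (auto simp: word_sum_large)

lemma word_sum_none: "word_sum x y n 0 = y ^ n"
 by (induction n) auto

lemma power_add_word_sum: "(x + y) ^ n = (\<Sum>c\<le>n. word_sum x y n c)"
proof (induction n)
 case (Suc n)
 have "(\<Sum>c\<le>Suc n. word_sum x y (Suc n) c)
   = y * word_sum x y n 0 + (\<Sum>c\<le>n. x * word_sum x y n c + y * word_sum x y n (Suc c))"
  by (subst sum.atMost_Suc_shift) simp
 also have "\<dots> = x * (\<Sum>c\<le>n. word_sum x y n c)
   + y * (word_sum x y n 0 + (\<Sum>c\<le>n. word_sum x y n (Suc c)))"
  by (simp add: sum.distrib sum_distrib_left algebra_simps)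
 also have "word_sum x y n 0 + (\<Sum>c\<le>n. word_sum x y n (Suc c)) = (\<Sum>c\<le>n. word_sum x y n c)"
  by (subst sum.atMost_Suc_shift[symmetric]) (simp add: word_sum_large)
 finally show ?case using Suc by (simp add: algebra_simps)
qed simp

text \<open>A letter put in front of a marked word lengthens the part before the mark and leaves the
  rest alone.\<close>

lemma marked_sum_left:
 "y * marked_sum x y j m 0 = marked_sum x y (Suc j) m 0"
 "x * marked_sum x y j m c + y * marked_sum x y j m (Suc c) = marked_sum x y (Suc j) m (Suc c)"
proof -
 show "y * marked_sum x y j m 0 = marked_sum x y (Suc j) m 0"
  by (simp add: marked_sum_def mult.assoc)
 show "x * marked_sum x y j m c + y * marked_sum x y j m (Suc c) = marked_sum x y (Suc j) m (Suc c)"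
  unfolding marked_sum_def sum.atMost_Suc_shift
  by (simp add: sum.distrib sum_distrib_left algebra_simps)
qed

lemma marked_sum_right:
 "marked_sum x y j m 0 * y = marked_sum x y j (Suc m) 0"
 "marked_sum x y j m c * x + marked_sum x y j m (Suc c) * y = marked_sum x y j (Suc m) (Suc c)"
proof -
 show "marked_sum x y j m 0 * y = marked_sum x y j (Suc m) 0"
  using word_sum_right(1)[of x y m] by (simp add: marked_sum_def mult.assoc)
 have "marked_sum x y j (Suc m) (Suc c) =
  (\<Sum>a\<le>c. word_sum x y j a * x * word_sum x y (Suc m) (Suc (c - a))) + word_sum x y j (Suc c) * x * word_sum x y (Suc m) 0"
  by (simp add: marked_sum_def Suc_diff_le del: word_sum.simps)
 also have "\<dots> = (\<Sum>a\<le>c. word_sum x y j a * x * (word_sum x y m (c - a) * x + word_sum x y m (Suc c - a) * y))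
   + word_sum x y j (Suc c) * x * (word_sum x y m 0 * y)"
  by (simp add: word_sum_right Suc_diff_le del: word_sum.simps)
 also have "\<dots> = marked_sum x y j m c * x + marked_sum x y j m (Suc c) * y"
  by (simp add: marked_sum_def sum.distrib sum_distrib_right algebra_simps)
 finally show "marked_sum x y j m c * x + marked_sum x y j m (Suc c) * y = marked_sum x y j (Suc m) (Suc c)" ..
qed

lemma marked_sum_0: "marked_sum x y 0 m c = x * word_sum x y m c"
proof -
 have "marked_sum x y 0 m c = (\<Sum>a\<le>c. if a = 0 then x * word_sum x y m c else 0)"
  unfolding marked_sum_def
 proof (rule sum.cong)
  show "word_sum x y 0 a * x * word_sum x y m (c - a) = (if a = 0 then x * word_sum x y m c else 0)" for a
   by (cases a) auto
 qed simp
 then show ?thesis by simp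
qed

text \<open>A word with \<open>Suc c\<close> letters \<open>x\<close> can be marked in
  \<open>Suc c\<close> ways. Equivalently, this compares coefficients in the derivative of
  \<open>(t x + y) ^ n\<close> with respect to \<open>t\<close>.\<close>

lemma word_sum_derivation:
 "of_nat (Suc c) * word_sum x y n (Suc c) = (\<Sum>j<n. marked_sum x y j (n - 1 - j) c)"
proof (induction n arbitrary: c)
 case (Suc n)
 have "(\<Sum>j<Suc n. marked_sum x y j (Suc n - 1 - j) c) =
   x * word_sum x y n c + (\<Sum>j<n. marked_sum x y (Suc j) (n - 1 - j) c)"
  by (subst sum.lessThan_Suc_shift) (simp add: marked_sum_0)
 also have "(\<Sum>j<n. marked_sum x y (Suc j) (n - 1 - j) c)
   = x * (of_nat c * word_sum x y n c) + y * (of_nat (Suc c) * word_sum x y n (Suc c))"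
 proof (cases c)
  case 0
  show ?thesis
   unfolding Suc.IH 0 by (simp add: sum_distrib_left marked_sum_left)
 next
  case (Suc d)
  show ?thesis
   unfolding Suc.IH Suc by (simp add: sum_distrib_left marked_sum_left(2)[symmetric] sum.distrib)
 qed
 also have "x * word_sum x y n c + \<dots> = of_nat (Suc c) * word_sum x y (Suc n) (Suc c)"
  by (simp add: algebra_simps mult_of_nat_commute)
 finally show ?case ..
qed simp

text \<open>The coefficient of \<open>t ^ c\<close> in the \<open>m\<close>-th power of
  \<open>ad (t x + y)\<close> applied to \<open>x\<close>. For \<open>m = p - 1\<close> and
  \<open>c = i - 1\<close> it is the sum in \<open>jacobson_coeff\<close>, with the bracket taken to
  be the ring commutator.\<close>

definition ad_sum :: "'a::ring_1 => 'a => nat => nat => 'a" where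
 "ad_sum x y m c = (\<Sum>bs\<in>{bs. length bs = m \<and> count_list bs True = c}.
   foldr (\<lambda>b v. (if b then x else y) * v - v * (if b then x else y)) bs x)"

lemma finite_bool_lists: "finite {bs :: bool list. length bs = m \<and> P bs}"
 by (rule finite_subset[OF _ finite_lists_length_eq[of "UNIV :: bool set" m]]) auto

lemma ad_sum_rec:
 "ad_sum x y 0 c = (if c = 0 then x else 0)"
 "ad_sum x y (Suc m) 0 = y * ad_sum x y m 0 - ad_sum x y m 0 * y"
 "ad_sum x y (Suc m) (Suc c) = (x * ad_sum x y m c - ad_sum x y m c * x)
   + (y * ad_sum x y m (Suc c) - ad_sum x y m (Suc c) * y)"
proof -
 let ?L = "\<lambda>m c. {bs. length bs = m \<and> count_list bs True = c}"
 have "?L 0 c = (if c = 0 then {[]} else {})" by auto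
 then show "ad_sum x y 0 c = (if c = 0 then x else 0)" unfolding ad_sum_def by (simp cong: conj_cong)
 have "?L (Suc m) 0 = Cons False ` ?L m 0"
 proof (intro equalityI subsetI)
  fix bs assume "bs : ?L (Suc m) 0"
  then show "bs : Cons False ` ?L m 0" by (cases bs) (auto split: if_splits)
 qed auto
 then show "ad_sum x y (Suc m) 0 = y * ad_sum x y m 0 - ad_sum x y m 0 * y"
  unfolding ad_sum_def by (simp add: sum.reindex sum_subtractf sum_distrib_left sum_distrib_right)
 have "?L (Suc m) (Suc c) = Cons True ` ?L m c \<union> Cons False ` ?L m (Suc c)"
 proof (intro equalityI subsetI)
  fix bs assume "bs : ?L (Suc m) (Suc c)"
  then show "bs : Cons True ` ?L m c \<union> Cons False ` ?L m (Suc c)" by (cases bs) (auto split: if_splits)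
 qed auto
 moreover have "Cons True ` ?L m c \<inter> Cons False ` ?L m (Suc c) = {}" by auto
 ultimately show "ad_sum x y (Suc m) (Suc c) = (x * ad_sum x y m c - ad_sum x y m c * x)
   + (y * ad_sum x y m (Suc c) - ad_sum x y m (Suc c) * y)"
  unfolding ad_sum_def
  by (simp add: sum.union_disjoint finite_bool_lists sum.reindex sum_subtractf sum_distrib_left sum_distrib_right)
qed

text \<open>\<open>ad\<close> is left minus right multiplication. These commute, so its
  \<open>m\<close>-th power expands binomially, with \<open>j\<close> factors on the left of the
  marked \<open>x\<close> and \<open>m - j\<close> signed factors on its right.\<close>

lemma ad_sum_marked_sum:
 "ad_sum x y m c = (\<Sum>j\<le>m. (- 1) ^ (m - j) * of_nat (m choose j) * marked_sum x y j (m - j) c)"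
proof (induction m arbitrary: c)
 case 0
 show ?case by (cases c) (auto simp: ad_sum_rec marked_sum_0)
next
 case (Suc m)
 let ?s = "\<lambda>m j. (- 1) ^ (m - j) * of_nat (m choose j) :: 'a"
 have s: "z * (?s m j * v) = ?s m j * (z * v)" for z j and v :: 'a
  by (simp add: mult.assoc[symmetric] mult_of_nat_commute[symmetric])
   (simp add: mult.assoc mult_of_nat_commute minus_one_power_iff)
 have s': "(?s m j * v) * z = ?s m j * (v * z)" for z j and v :: 'a
  by (simp add: mult.assoc)
 have 1: "ad_sum x y (Suc m) c = (\<Sum>j\<le>m. ?s m j * marked_sum x y (Suc j) (m - j) c)
   - (\<Sum>j\<le>m. ?s m j * marked_sum x y j (Suc (m - j)) c)"
 proof (cases c)
  case 0
  show ?thesis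
   unfolding 0 ad_sum_rec Suc.IH marked_sum_left[symmetric] marked_sum_right[symmetric]
   by (simp add: sum_distrib_left sum_distrib_right s s')
 next
  case (Suc d)
  show ?thesis
   unfolding Suc ad_sum_rec \<open>\<And>c. ad_sum x y m c = _\<close> marked_sum_left[symmetric] marked_sum_right[symmetric]
   by (simp add: sum_distrib_left sum_distrib_right s s' sum.distrib distrib_left)
 qed
 have 2: "(\<Sum>j\<le>m. ?s m j * marked_sum x y (Suc j) (m - j) c)
   = (\<Sum>j\<le>Suc m. (if j = 0 then 0 else ?s m (j - 1)) * marked_sum x y j (Suc m - j) c)"
  by (subst sum.atMost_Suc_shift) simp
 have 3: "(\<Sum>j\<le>m. ?s m j * marked_sum x y j (Suc (m - j)) c)
   = (\<Sum>j\<le>Suc m. (if j = Suc m then 0 else ?s m j) * marked_sum x y j (Suc m - j) c)"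
  by (auto intro!: sum.cong simp: Suc_diff_le)
 \<comment> \<open>Pascal's rule with signs. The index \<open>j\<close> was shifted in the left
   products only, hence the two boundary cases.\<close>
 have "(if j = 0 then 0 else ?s m (j - 1)) - (if j = Suc m then 0 else ?s m j) = ?s (Suc m) j"
  if "j \<le> Suc m" for j
 proof (cases j)
  case (Suc i)
  show ?thesis
  proof (cases "i = m")
   case False
   then have "m - i = Suc (m - Suc i)" using that Suc by auto
   then show ?thesis using Suc False by (simp add: algebra_simps)
  qed (use Suc in \<open>simp add: binomial_eq_0\<close>)
 qed simp
 then show ?case
  unfolding 1 2 3 sum_subtractf[symmetric] left_diff_distrib[symmetric] by (intro sum.cong) auto
qed

text \<open>Two neighbouring entries of row \<open>p - 1\<close> of Pascal's triangle add up to a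
  binomial coefficient divisible by \<open>p\<close>, so they are opposite modulo \<open>p\<close>.
  The induction runs downwards from \<open>j = p - 1\<close>, where the value is 1.\<close>

lemma signed_choose_char:
 assumes p: "prime p" "of_nat p = (0::'a::ring_1)" and j: "j < p"
 shows "(- 1) ^ (p - 1 - j) * of_nat ((p - 1) choose j) = (1::'a)"
proof -
 have "j \<le> p - 1" using j by simp
 then show ?thesis
 proof (induction j rule: inc_induct)
  case (step j)
  have "p choose Suc j = ((p - 1) choose j) + ((p - 1) choose Suc j)"
   using step p prime_gt_0_nat[of p] by (cases p) auto
  moreover have "p dvd (p choose Suc j)"
   using step p by (intro dvd_choose_prime) auto
  then have "of_nat (p choose Suc j) = (0::'a)" using p(2) by (auto simp: dvd_def)
  ultimately have "of_nat ((p - 1) choose j) = - (of_nat ((p - 1) choose Suc j) :: 'a)"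
   by (metis add_eq_0_iff2 of_nat_add)
  moreover have "p - 1 - j = Suc (p - 1 - Suc j)" using step by auto
  ultimately show ?case using step.IH by simp
 qed simp
qed

text \<open>For \<open>m = p - 1\<close> every signed binomial coefficient in
  \<open>ad_sum_marked_sum\<close> becomes 1. The iterated commutators then add up to all marked
  words, which \<open>word_sum_derivation\<close> counts.\<close>

theorem jacobson_formula:
 fixes x y :: "'a::ring_1"
 assumes p: "prime p" "of_nat p = (0::'a)"
 shows "(x + y) ^ p = x ^ p + y ^ p + (\<Sum>i\<in>{1..<p}. word_sum x y p i)"
  and "i : {1..<p} ==> of_nat i * word_sum x y p i = ad_sum x y (p - 1) (i - 1)"
proof -
 have p0: "0 < p" using p(1) prime_gt_0_nat by blast
 have "{..p} = insert 0 (insert p {1..<p})" using p0 by auto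
 then show "(x + y) ^ p = x ^ p + y ^ p + (\<Sum>i\<in>{1..<p}. word_sum x y p i)"
  using p0 by (simp add: power_add_word_sum word_sum_all word_sum_none algebra_simps)
 assume i: "i : {1..<p}"
 have "ad_sum x y (p - 1) (i - 1) = (\<Sum>j<p. marked_sum x y j (p - 1 - j) (i - 1))"
  unfolding ad_sum_marked_sum using p0 signed_choose_char[OF p] by (intro sum.cong) auto
 also have "\<dots> = of_nat i * word_sum x y p i"
  using word_sum_derivation[of "i - 1" x y p] i by simp
 finally show "of_nat i * word_sum x y p i = ad_sum x y (p - 1) (i - 1)" ..
qed

section \<open>Skew group algebras\<close>

locale skew_algebra = A: k_algebra A + G: group G
 for A :: "('k::field, 'a) module" and G :: "'g monoid" +
 fixes act :: "'g => 'a => 'a"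
 assumes fin: "finite (carrier G)"
  and act_hom: "g : carrier G ==> act g : alg_hom A A"
  and act_mult: "g : carrier G ==> h : carrier G ==> a : carrier A ==> act (g \<otimes>\<^sub>G h) a = act g (act h a)"
  and act_one: "a : carrier A ==> act \<one>\<^sub>G a = a"
begin

abbreviation R where "R \<equiv> skew_group_algebra A G act"

lemma skew_simps:
 "carrier R = carrier G \<rightarrow>\<^sub>E carrier A"
 "f \<otimes>\<^sub>R h = (\<lambda>x\<in>carrier G. \<Oplus>\<^sub>A y\<in>carrier G. f y \<otimes>\<^sub>A act y (h (inv\<^bsub>G\<^esub> y \<otimes>\<^sub>G x)))"
 "\<one>\<^sub>R = (\<lambda>x\<in>carrier G. if x = \<one>\<^sub>G then \<one>\<^sub>A else \<zero>\<^sub>A)"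
 "\<zero>\<^sub>R = (\<lambda>x\<in>carrier G. \<zero>\<^sub>A)"
 "f \<oplus>\<^sub>R h = (\<lambda>x\<in>carrier G. f x \<oplus>\<^sub>A h x)"
 "c \<odot>\<^sub>R f = (\<lambda>x\<in>carrier G. c \<odot>\<^sub>A f x)"
 by (simp_all add: skew_group_algebra_def)

lemma act_linear: "g : carrier G ==> k_alg_hom A A (act g)"
 using act_hom by (intro k_alg_hom.intro k_alg_hom_axioms.intro A.k_algebra_axioms)

lemma act_lin: "g : carrier G ==> k_linear A A (act g)"
 using act_hom by unfold_locales (auto simp: alg_hom_def)

lemma act_closed [simp]: "g : carrier G ==> a : carrier A ==> act g a : carrier A"
 using k_linear.f_closed[OF act_lin] .

lemma act_zero [simp]: "g : carrier G ==> act g \<zero>\<^sub>A = \<zero>\<^sub>A"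
 using act_lin k_linear.f_zero by metis

lemma act_unit [simp]: "g : carrier G ==> act g \<one>\<^sub>A = \<one>\<^sub>A"
 using act_linear k_alg_hom.f_one by metis

lemma act_prod: "g : carrier G ==> a : carrier A ==> b : carrier A ==>
  act g (a \<otimes>\<^sub>A b) = act g a \<otimes>\<^sub>A act g b"
 using act_linear k_alg_hom.f_mult by metis

lemma act_add: "g : carrier G ==> a : carrier A ==> b : carrier A ==>
  act g (a \<oplus>\<^sub>A b) = act g a \<oplus>\<^sub>A act g b"
 using act_lin k_linear.f_add by metis

lemma act_sm: "g : carrier G ==> a : carrier A ==> act g (c \<odot>\<^sub>A a) = c \<odot>\<^sub>A act g a"
 using act_lin k_linear.f_sm by metis

lemma act_finsum: "g : carrier G ==> (\<And>i. i : I ==> f i : carrier A) ==>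
  act g (\<Oplus>\<^sub>A i\<in>I. f i) = (\<Oplus>\<^sub>A i\<in>I. act g (f i))"
 using k_linear.f_finsum[OF act_lin, of g I f] by simp

lemma finsum_shift:
 assumes "z : carrier G" "\<And>y. y : carrier G ==> F y : carrier A"
 shows "(\<Oplus>\<^sub>A y\<in>carrier G. F y) = (\<Oplus>\<^sub>A w\<in>carrier G. F (z \<otimes>\<^sub>G w))"
proof -
 have "(\<lambda>w. z \<otimes>\<^sub>G w) ` carrier G = carrier G"
  using assms by (simp add: G.surj_const_mult)
 moreover have "inj_on (\<lambda>w. z \<otimes>\<^sub>G w) (carrier G)"
  using assms by (simp add: G.inj_on_cmult)
 ultimately show ?thesis
  using A.finsum_reindex[of F "\<lambda>w. z \<otimes>\<^sub>G w" "carrier G"] assms by auto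
qed

lemma apply_closed [simp]: "f : carrier R ==> x : carrier G ==> f x : carrier A"
 by (auto simp: skew_simps)

lemma R_eqI: "f : carrier R ==> h : carrier R ==> (\<And>x. x : carrier G ==> f x = h x) ==> f = h"
 by (auto simp: skew_simps intro: PiE_ext)

lemma space_R: "k_space R"
 by (rule k_spaceI)
  (auto simp: skew_simps fun_eq_iff A.a_ac A.sm_sm A.sm_add_l A.sm_add_r PiE_iff extensional_def)

lemma mult_closed: "f : carrier R ==> h : carrier R ==> f \<otimes>\<^sub>R h : carrier R"
 by (auto simp: skew_simps PiE_iff intro!: A.finsum_closed)

text \<open>Both sides become double sums over \<open>y\<close> and \<open>z\<close>. Exchanging the
  sums and substituting the product of \<open>z\<close> and \<open>w\<close> for \<open>y\<close>
  matches them.\<close>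

lemma mult_assoc:
 assumes f: "f : carrier R" and h: "h : carrier R" and l: "l : carrier R"
 shows "(f \<otimes>\<^sub>R h) \<otimes>\<^sub>R l = f \<otimes>\<^sub>R (h \<otimes>\<^sub>R l)"
proof (rule R_eqI)
 fix x assume x: "x : carrier G"
 note [simp] = apply_closed[OF f] apply_closed[OF h] apply_closed[OF l]
 let ?F = "\<lambda>z y. f z \<otimes>\<^sub>A (act z (h (inv\<^bsub>G\<^esub> z \<otimes>\<^sub>G y)) \<otimes>\<^sub>A act y (l (inv\<^bsub>G\<^esub> y \<otimes>\<^sub>G x)))"
 have "((f \<otimes>\<^sub>R h) \<otimes>\<^sub>R l) x = (\<Oplus>\<^sub>A y\<in>carrier G. \<Oplus>\<^sub>A z\<in>carrier G. ?F z y)"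
  using x fin by (simp add: skew_simps(2), intro A.finsum_cong') 
   (auto simp: A.finsum_ldistr A.m_assoc Pi_def intro!: A.finsum_cong' A.finsum_closed)
 also have "\<dots> = (\<Oplus>\<^sub>A z\<in>carrier G. \<Oplus>\<^sub>A y\<in>carrier G. ?F z y)"
  using x fin by (intro A.finsum_swap) auto
 also have "\<dots> = (\<Oplus>\<^sub>A z\<in>carrier G. \<Oplus>\<^sub>A w\<in>carrier G. ?F z (z \<otimes>\<^sub>G w))"
  using x by (intro A.finsum_cong' finsum_shift) (auto intro!: A.finsum_closed)
 also have "\<dots> = (f \<otimes>\<^sub>R (h \<otimes>\<^sub>R l)) x"
 proof -
  have "(\<Oplus>\<^sub>A w\<in>carrier G. ?F z (z \<otimes>\<^sub>G w))
    = f z \<otimes>\<^sub>A act z (\<Oplus>\<^sub>A w\<in>carrier G. h w \<otimes>\<^sub>A act w (l (inv\<^bsub>G\<^esub> w \<otimes>\<^sub>G (inv\<^bsub>G\<^esub> z \<otimes>\<^sub>G x))))"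
   if z: "z : carrier G" for z
  proof -
   have "f z \<otimes>\<^sub>A act z (\<Oplus>\<^sub>A w\<in>carrier G. h w \<otimes>\<^sub>A act w (l (inv\<^bsub>G\<^esub> w \<otimes>\<^sub>G (inv\<^bsub>G\<^esub> z \<otimes>\<^sub>G x))))
    = (\<Oplus>\<^sub>A w\<in>carrier G. f z \<otimes>\<^sub>A act z (h w \<otimes>\<^sub>A act w (l (inv\<^bsub>G\<^esub> w \<otimes>\<^sub>G (inv\<^bsub>G\<^esub> z \<otimes>\<^sub>G x)))))"
    using x z fin by (subst act_finsum) (auto intro!: A.finsum_rdistr simp: Pi_def)
   also have "\<dots> = (\<Oplus>\<^sub>A w\<in>carrier G. ?F z (z \<otimes>\<^sub>G w))"
   proof (intro A.finsum_cong')
    fix w assume w: "w : carrier G"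
    have 1: "inv\<^bsub>G\<^esub> w \<otimes>\<^sub>G (inv\<^bsub>G\<^esub> z \<otimes>\<^sub>G x) = inv\<^bsub>G\<^esub> (z \<otimes>\<^sub>G w) \<otimes>\<^sub>G x"
     "inv\<^bsub>G\<^esub> z \<otimes>\<^sub>G (z \<otimes>\<^sub>G w) = w"
     using x z w by (auto simp: G.inv_mult_group G.m_assoc) (simp flip: G.m_assoc)
    show "f z \<otimes>\<^sub>A act z (h w \<otimes>\<^sub>A act w (l (inv\<^bsub>G\<^esub> w \<otimes>\<^sub>G (inv\<^bsub>G\<^esub> z \<otimes>\<^sub>G x)))) = ?F z (z \<otimes>\<^sub>G w)"
     unfolding 1 using x z w by (simp add: act_prod act_mult)
   qed (use x z in auto)
   finally show ?thesis ..
  qed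
  then show ?thesis
   using x by (simp add: skew_simps(2)) (intro A.finsum_cong', auto intro!: A.finsum_closed)
 qed
 finally show "((f \<otimes>\<^sub>R h) \<otimes>\<^sub>R l) x = (f \<otimes>\<^sub>R (h \<otimes>\<^sub>R l)) x" .
qed (use assms in \<open>auto intro!: mult_closed\<close>)

lemma algebra_R: "k_algebra R"
proof (rule k_algebraI[OF space_R])
 show one: "\<one>\<^sub>R : carrier R" by (auto simp: skew_simps)
 interpret R: k_space R by (rule space_R)
 fix f assume f: "f : carrier R"
 note [simp] = apply_closed[OF f]
 show "\<one>\<^sub>R \<otimes>\<^sub>R f = f"
 proof (rule R_eqI)
  fix x assume x: "x : carrier G"
  have "(\<one>\<^sub>R \<otimes>\<^sub>R f) x
    = (\<Oplus>\<^sub>A y\<in>carrier G. (if y = \<one>\<^sub>G then \<one>\<^sub>A else \<zero>\<^sub>A) \<otimes>\<^sub>A act y (f (inv\<^bsub>G\<^esub> y \<otimes>\<^sub>G x)))"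
   using x by (simp add: skew_simps(2,3)) (intro A.finsum_cong', auto)
  also have "\<dots> = f x"
   using x fin by (subst A.finsum_single[of _ "\<one>\<^sub>G"]) (auto simp: act_one)
  finally show "(\<one>\<^sub>R \<otimes>\<^sub>R f) x = f x" .
 qed (use f one mult_closed in auto)
 show "f \<otimes>\<^sub>R \<one>\<^sub>R = f"
 proof (rule R_eqI)
  fix x assume x: "x : carrier G"
  have *: "inv\<^bsub>G\<^esub> y \<otimes>\<^sub>G x = \<one>\<^sub>G \<longleftrightarrow> y = x" if "y : carrier G" for y
   using x that by (metis G.inv_closed G.inv_solve_left' G.one_closed G.r_one G.l_inv)
  have "(f \<otimes>\<^sub>R \<one>\<^sub>R) x
    = (\<Oplus>\<^sub>A y\<in>carrier G. f y \<otimes>\<^sub>A act y (if y = x then \<one>\<^sub>A else \<zero>\<^sub>A))"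
   using x by (simp add: skew_simps(2,3)) (intro A.finsum_cong', auto simp: *)
  also have "\<dots> = f x"
   using x fin by (subst A.finsum_single[of _ x]) auto
  finally show "(f \<otimes>\<^sub>R \<one>\<^sub>R) x = f x" .
 qed (use f one mult_closed in auto)
 fix h assume h: "h : carrier R"
 note [simp] = apply_closed[OF h]
 show "f \<otimes>\<^sub>R h : carrier R" using f h by (rule mult_closed)
 {
  fix c :: 'k
  show "c \<odot>\<^sub>R f \<otimes>\<^sub>R h = c \<odot>\<^sub>R (f \<otimes>\<^sub>R h)"
  proof (rule R_eqI)
   fix x assume x: "x : carrier G"
   show "(c \<odot>\<^sub>R f \<otimes>\<^sub>R h) x = (c \<odot>\<^sub>R (f \<otimes>\<^sub>R h)) x"
    using x by (simp add: skew_simps(2,6), subst A.sm_finsum)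
     (auto intro!: A.finsum_cong' simp: A.sm_mult_l)
  qed (use f h in \<open>auto intro!: mult_closed\<close>)
  show "f \<otimes>\<^sub>R (c \<odot>\<^sub>R h) = c \<odot>\<^sub>R (f \<otimes>\<^sub>R h)"
  proof (rule R_eqI)
   fix x assume x: "x : carrier G"
   show "(f \<otimes>\<^sub>R (c \<odot>\<^sub>R h)) x = (c \<odot>\<^sub>R (f \<otimes>\<^sub>R h)) x"
    using x by (simp add: skew_simps(2,6), subst A.sm_finsum)
     (auto intro!: A.finsum_cong' simp: A.sm_mult_r act_sm)
  qed (use f h in \<open>auto intro!: mult_closed\<close>)
 }
 fix l assume l: "l : carrier R"
 note [simp] = apply_closed[OF l]
 show "(f \<otimes>\<^sub>R h) \<otimes>\<^sub>R l = f \<otimes>\<^sub>R (h \<otimes>\<^sub>R l)" using f h l by (rule mult_assoc)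
 show "(f \<oplus>\<^sub>R h) \<otimes>\<^sub>R l = f \<otimes>\<^sub>R l \<oplus>\<^sub>R h \<otimes>\<^sub>R l"
 proof (rule R_eqI)
  fix x assume x: "x : carrier G"
  show "((f \<oplus>\<^sub>R h) \<otimes>\<^sub>R l) x = (f \<otimes>\<^sub>R l \<oplus>\<^sub>R h \<otimes>\<^sub>R l) x"
  proof -
   have "((f \<oplus>\<^sub>R h) \<otimes>\<^sub>R l) x = (\<Oplus>\<^sub>A y\<in>carrier G. f y \<otimes>\<^sub>A act y (l (inv\<^bsub>G\<^esub> y \<otimes>\<^sub>G x))
     \<oplus>\<^sub>A h y \<otimes>\<^sub>A act y (l (inv\<^bsub>G\<^esub> y \<otimes>\<^sub>G x)))"
    using x by (simp add: skew_simps(2,5) del: A.finsum_addf A.add.finprod_multf) (intro A.finsum_cong', auto simp: A.l_distr)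
   also have "\<dots> = (f \<otimes>\<^sub>R l \<oplus>\<^sub>R h \<otimes>\<^sub>R l) x"
    using x by (subst A.finsum_addf) (auto simp: skew_simps(2,5))
   finally show ?thesis .
  qed
 qed (use f h l in \<open>auto intro!: mult_closed\<close>)
 show "l \<otimes>\<^sub>R (f \<oplus>\<^sub>R h) = l \<otimes>\<^sub>R f \<oplus>\<^sub>R l \<otimes>\<^sub>R h"
 proof (rule R_eqI)
  fix x assume x: "x : carrier G"
  show "(l \<otimes>\<^sub>R (f \<oplus>\<^sub>R h)) x = (l \<otimes>\<^sub>R f \<oplus>\<^sub>R l \<otimes>\<^sub>R h) x"
  proof -
   have "(l \<otimes>\<^sub>R (f \<oplus>\<^sub>R h)) x = (\<Oplus>\<^sub>A y\<in>carrier G. l y \<otimes>\<^sub>A act y (f (inv\<^bsub>G\<^esub> y \<otimes>\<^sub>G x))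
     \<oplus>\<^sub>A l y \<otimes>\<^sub>A act y (h (inv\<^bsub>G\<^esub> y \<otimes>\<^sub>G x)))"
    using x by (simp add: skew_simps(2,5) del: A.finsum_addf A.add.finprod_multf)
     (intro A.finsum_cong', auto simp: A.r_distr act_add)
   also have "\<dots> = (l \<otimes>\<^sub>R f \<oplus>\<^sub>R l \<otimes>\<^sub>R h) x"
    using x by (subst A.finsum_addf) (auto simp: skew_simps(2,5))
   finally show ?thesis .
  qed
 qed (use f h l in \<open>auto intro!: mult_closed\<close>)
qed

sublocale R: k_algebra R by (rule algebra_R)

abbreviation elt where "elt \<equiv> skew_elt A G"

lemma elt_closed [simp]: "a : carrier A ==> elt a g : carrier R"
 by (auto simp: skew_elt_def skew_simps(1))

lemma elt_mult:
 assumes "a : carrier A" "b : carrier A" "g : carrier G" "h : carrier G"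
 shows "elt a g \<otimes>\<^sub>R elt b h = elt (a \<otimes>\<^sub>A act g b) (g \<otimes>\<^sub>G h)"
proof (rule R_eqI)
 fix x assume x: "x : carrier G"
 have *: "inv\<^bsub>G\<^esub> g \<otimes>\<^sub>G x = h \<longleftrightarrow> x = g \<otimes>\<^sub>G h"
  using x assms G.inv_solve_left'[of h g x] by auto
 have "(elt a g \<otimes>\<^sub>R elt b h) x = (\<Oplus>\<^sub>A y\<in>carrier G. (if y = g then a else \<zero>\<^sub>A) \<otimes>\<^bsub>A\<^esub>
   act y (if inv\<^bsub>G\<^esub> y \<otimes>\<^sub>G x = h then b else \<zero>\<^sub>A))"
  using x assms by (simp add: skew_simps(2) skew_elt_def) (intro A.finsum_cong', auto)
 also have "\<dots> = elt (a \<otimes>\<^sub>A act g b) (g \<otimes>\<^sub>G h) x"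
  using x assms fin by (subst A.finsum_single[of _ g]) (auto simp: * skew_elt_def)
 finally show "(elt a g \<otimes>\<^sub>R elt b h) x = elt (a \<otimes>\<^sub>A act g b) (g \<otimes>\<^sub>G h) x" .
qed (use assms in auto)

lemma elt_add: "a : carrier A ==> b : carrier A ==> elt (a \<oplus>\<^sub>A b) g = elt a g \<oplus>\<^sub>R elt b g"
 by (auto simp: skew_elt_def skew_simps fun_eq_iff)

lemma elt_sm: "a : carrier A ==> elt (c \<odot>\<^sub>A a) g = c \<odot>\<^sub>R elt a g"
 by (auto simp: skew_elt_def skew_simps fun_eq_iff)

lemma elt_one: "elt \<one>\<^sub>A \<one>\<^sub>G = \<one>\<^sub>R"
 by (auto simp: skew_elt_def skew_simps fun_eq_iff)

lemma elt_hom: "(\<lambda>a. elt a \<one>\<^sub>G) : alg_hom A R"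
 by (rule alg_homI) (auto simp: elt_add elt_sm elt_one elt_mult act_one)

lemma finsum_apply: "(\<And>i. i : I ==> F i : carrier R) ==> x : carrier G ==>
  (\<Oplus>\<^sub>R i\<in>I. F i) x = (\<Oplus>\<^sub>A i\<in>I. F i x)"
proof (induction I rule: infinite_finite_induct)
 case (insert i I)
 then have "(\<Oplus>\<^sub>R i\<in>I. F i) : carrier R" by (intro R.finsum_closed) auto
 then show ?case using insert by (subst R.finsum_insert) (auto simp: Pi_def skew_simps(5))
qed (auto simp: skew_simps(4))

end

section \<open>The group algebra of a finite p-group\<close>

text \<open>Orbit lengths divide \<open>p ^ n\<close>, so they are 1 or divisible by
  \<open>p\<close>. The orbits of length 1 are the fixed points, and the sum of all lengths is
  \<open>card E\<close>.\<close>

lemma (in group) p_group_fixed_points: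
 assumes p: "prime p" "Coset.order G = p ^ n" and E: "finite E" "p dvd card E"
  and closed: "\<And>g x. g : carrier G ==> x : E ==> a g x : E"
  and one: "\<And>x. x : E ==> a \<one> x = x"
  and mult: "\<And>g h x. g : carrier G ==> h : carrier G ==> x : E ==> a (g \<otimes> h) x = a g (a h x)"
 shows "p dvd card {x : E. \<forall>g\<in>carrier G. a g x = x}"
proof -
 define \<phi> where "\<phi> g = restrict (a g) E" for g
 have inv: "a g (a (inv g) x) = x" "a (inv g) (a g x) = x" if "g : carrier G" "x : E" for g x
  using that mult[of g "inv g" x] mult[of "inv g" g x] one by auto
 have bij: "\<phi> g : Bij E" if g: "g : carrier G" for g
  unfolding Bij_def \<phi>_def using g closed inv
  by (auto intro!: bij_betw_byWitness[where f' = "a (inv g)"])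
 have "\<phi> : hom G (BijGroup E)"
  using bij closed mult
  by (auto simp: hom_def BijGroup_def \<phi>_def compose_def fun_eq_iff)
 then have "group_hom G (BijGroup E) \<phi>"
  by (intro group_hom.intro group_hom_axioms.intro group_axioms group_BijGroup)
 then interpret act: group_action G E \<phi> by (rule group_action.intro)
 let ?O = "orbits G E \<phi>" and ?Fix = "{x : E. \<forall>g\<in>carrier G. a g x = x}"
 have finO: "finite ?O" unfolding orbits_def using E by simp
 have sum: "card E = (\<Sum>orb\<in>?O. card orb)"
  using act.disjoint_sum[OF E(1), of "\<lambda>_. 1::nat"] by simp
 have "card orb = 1 \<or> p dvd card orb" if orb: "orb : ?O" for orb
 proof -
  obtain x where "x : E" "orb = orbit G \<phi> x" using orb unfolding orbits_def by blast
  then have "card orb dvd p ^ n"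
   using act.orbit_stabilizer_theorem[of x] p(2) by (metis dvd_triv_left)
  then obtain k where "card orb = p ^ k" using p(1) divides_primepow_nat by blast
  then show ?thesis by (cases k) auto
 qed
 then have "p dvd (\<Sum>orb\<in>?O - {orb. card orb = 1}. card orb)"
  by (intro dvd_sum) auto
 moreover have "(\<Sum>orb\<in>?O. card orb) = (\<Sum>orb\<in>?O \<inter> {orb. card orb = 1}. card orb)
   + (\<Sum>orb\<in>?O - {orb. card orb = 1}. card orb)"
  using finO by (subst sum.Int_Diff[of _ _ "{orb. card orb = 1}"]) auto
 ultimately have "p dvd (\<Sum>orb\<in>?O \<inter> {orb. card orb = 1}. card orb)"
  using E(2) unfolding sum by (simp add: dvd_add_left_iff)
 also have "(\<Sum>orb\<in>?O \<inter> {orb. card orb = 1}. card orb) = card (?O \<inter> {orb. card orb = 1})"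
  by simp
 also have "?O \<inter> {orb. card orb = 1} = (\<lambda>x. {x}) ` ?Fix"
 proof (intro equalityI subsetI)
  fix orb assume orb: "orb : ?O \<inter> {orb. card orb = 1}"
  then obtain x where x: "x : E" "orb = orbit G \<phi> x" unfolding orbits_def by blast
  then have "x : orb" using act.orbit_refl by auto
  with orb have orbx: "orb = {x}" by (auto simp: card_1_singleton_iff)
  have "a g x = x" if "g : carrier G" for g
   using that x orbx unfolding orbit_def \<phi>_def by auto
  with x orbx show "orb : (\<lambda>x. {x}) ` ?Fix" by auto
 next
  fix orb assume "orb : (\<lambda>x. {x}) ` ?Fix"
  then obtain x where x: "x : ?Fix" "orb = {x}" by auto
  then have "orbit G \<phi> x = {x}" unfolding orbit_def \<phi>_def by (auto intro!: exI[of _ "\<one>"])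
  with x show "orb : ?O \<inter> {orb. card orb = 1}" unfolding orbits_def by auto
 qed
 also have "card \<dots> = card ?Fix" by (rule card_image) auto
 finally show ?thesis .
qed

locale p_group_algebra = group G for G :: "'p monoid" (structure) +
 fixes K :: "'k::field itself" and p n :: nat
 assumes prime: "prime p" and char: "CHAR('k) = p"
  and finite_G: "finite (carrier G)" and order_G: "Coset.order G = p ^ n"
begin

abbreviation A :: "('k, 'p \<Rightarrow>\<^sub>0 'k) module" where "A \<equiv> group_algebra G"

definition gmul :: "('p \<Rightarrow>\<^sub>0 'k) => ('p \<Rightarrow>\<^sub>0 'k) => ('p \<Rightarrow>\<^sub>0 'k)" (infixl \<open>\<star>\<close> 70) where
 "gmul = bmul (\<lambda>x y. single (x \<otimes> y) 1)"

definition ge :: "'p => ('p \<Rightarrow>\<^sub>0 'k)" where "ge x = single x 1"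

definition del :: "'p => ('p \<Rightarrow>\<^sub>0 'k)" where "del x = ge x - ge \<one>"

definition kG :: "('p \<Rightarrow>\<^sub>0 'k) set" where "kG = {f. keys f <= carrier G}"

lemma ge_mult: "ge x \<star> ge y = ge (x \<otimes> y)"
 by (simp add: gmul_def ge_def bmul_single)

sublocale basis: algebra_basis "carrier G" "\<lambda>x y. single (x \<otimes> y) (1::'k)" "single \<one> 1"
proof
 show "bmul (\<lambda>x y. single (x \<otimes> y) (1::'k)) (single (x \<otimes> y) 1) (single z 1)
  = bmul (\<lambda>x y. single (x \<otimes> y) (1::'k)) (single x 1) (single (y \<otimes> z) 1)"
  if "x : carrier G" "y : carrier G" "z : carrier G" for x y z
  using that by (simp add: bmul_single m_assoc)
qed (auto simp: bmul_single)

lemma A_simps: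
 "carrier A = kG" "f \<otimes>\<^sub>A h = f \<star> h" "\<one>\<^sub>A = ge \<one>" "\<zero>\<^sub>A = 0" "f \<oplus>\<^sub>A h = f + h" "c \<odot>\<^sub>A f = scale c f"
 by (auto simp: group_algebra_def gmul_def kG_def ge_def)

lemma algebra_A: "k_algebra A"
 unfolding group_algebra_def by (rule basis.k_algebra)

lemma gmul_assoc: "f : kG ==> g : kG ==> h : kG ==> (f \<star> g) \<star> h = f \<star> (g \<star> h)"
 unfolding gmul_def kG_def by (rule basis.bmul_assoc) auto

lemma gmul_closed: "f : kG ==> g : kG ==> f \<star> g : kG"
 unfolding gmul_def kG_def using basis.bmul_keys by auto

lemma gmul_one: "f : kG ==> ge \<one> \<star> f = f" "f : kG ==> f \<star> ge \<one> = f"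
 unfolding gmul_def kG_def ge_def using basis.bmul_unit_left basis.bmul_unit_right by auto

lemmas gmul_linear = bmul_add_left[of "\<lambda>x y. single (x \<otimes> y) (1::'k)", folded gmul_def]
 bmul_add_right[of "\<lambda>x y. single (x \<otimes> y) (1::'k)", folded gmul_def]
 bmul_minus_left[of "\<lambda>x y. single (x \<otimes> y) (1::'k)", folded gmul_def]
 bmul_minus_right[of "\<lambda>x y. single (x \<otimes> y) (1::'k)", folded gmul_def]
 bmul_scale_left[of "\<lambda>x y. single (x \<otimes> y) (1::'k)", folded gmul_def]
 bmul_scale_right[of "\<lambda>x y. single (x \<otimes> y) (1::'k)", folded gmul_def]

lemma gmul_zero [simp]: "f \<star> 0 = 0" "0 \<star> f = 0"
 by (simp_all add: gmul_def)

lemma subspace_kG: "fs.subspace kG"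
 unfolding kG_def by (rule fs.subspaceI) (auto dest!: subsetD[OF Poly_Mapping.keys_add] subsetD[OF keys_scale])

lemma ge_closed [simp]: "x : carrier G ==> ge x : kG"
 by (simp add: ge_def kG_def)

lemma del_closed [simp]: "x : carrier G ==> del x : kG"
 unfolding del_def by (intro fs.subspace_diff[OF subspace_kG]) auto

lemma ge_eq_del: "ge x = del x + ge \<one>"
 by (simp add: del_def)

lemma kG_span: "kG = fs.span (ge ` carrier G)"
proof
 show "kG <= fs.span (ge ` carrier G)"
 proof
  fix f assume "f : kG"
  then have "keys f <= carrier G" by (simp add: kG_def)
  then show "f : fs.span (ge ` carrier G)"
  proof (induction f rule: poly_mapping_induct_on)
   case (single x c)
   then show ?case unfolding single_scale_one[of x c] ge_def[symmetric] by (intro fs.span_scale fs.span_base) auto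
  qed (auto intro: fs.span_add fs.span_zero)
 qed
 show "fs.span (ge ` carrier G) <= kG"
  using subspace_kG by (intro fs.span_minimal) auto
qed

lemma gmul_span:
 assumes "\<And>x y. x : X ==> y : Y ==> x \<star> y : W" "fs.subspace W" "f : fs.span X" "g : fs.span Y"
 shows "f \<star> g : W"
proof -
 have 1: "x \<star> g : W" if x: "x : X" for x
  using assms(4)
 proof (induction g rule: fs.span_induct)
  case base
  then show ?case
   using assms(2) by (auto simp: fs.subspace_def gmul_linear)
 qed (use x assms(1) in auto)
 show ?thesis
  using assms(3)
 proof (induction f rule: fs.span_induct)
  case base
  then show ?case
   using assms(2) by (auto simp: fs.subspace_def gmul_linear)
 qed (use 1 in auto)
qed

subsection \<open>Nilpotency of the augmentation ideal\<close>

text \<open>Counting fixed points requires a finite module, while \<open>'k\<close> may be infinite.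
  Over this finite subring the group ring \<open>kF\<close> is finite and still contains 1 and all
  translates of its elements.\<close>

definition prime_field :: "'k set" where "prime_field = range of_nat"

lemma of_nat_mod_char: "of_nat (m mod p) = (of_nat m :: 'k)"
proof -
 have "of_nat m = (of_nat (p * (m div p) + m mod p) :: 'k)" by simp
 also have "\<dots> = of_nat (m mod p)" using char by (simp only: of_nat_add of_nat_mult) (metis add_0 mult_zero_left of_nat_CHAR)
 finally show ?thesis ..
qed

lemma of_nat_inj: "inj_on (of_nat :: nat => 'k) {..<p}"
proof (rule linorder_inj_onI')
 fix m l assume *: "m : {..<p}" "l : {..<p}" "m < l"
 show "of_nat m ~= (of_nat l :: 'k)"
 proof
  assume "of_nat m = (of_nat l :: 'k)"
  then have "of_nat (l - m) = (0 :: 'k)" using * by (simp add: of_nat_diff)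
  then have "p dvd l - m" using char by (simp add: of_nat_eq_0_iff_char_dvd)
  then show False using * by (auto dest: dvd_imp_le)
 qed
qed

lemma prime_field_eq: "prime_field = of_nat ` {..<p}"
proof -
 have "m mod p < p" for m using prime prime_gt_0_nat by auto
 then have "(of_nat m :: 'k) : of_nat ` {..<p}" for m
  using of_nat_mod_char[of m] by (metis imageI lessThan_iff)
 then show ?thesis unfolding prime_field_def by auto
qed

lemma card_prime_field: "card prime_field = p" "finite prime_field"
 unfolding prime_field_eq using of_nat_inj by (simp_all add: card_image)

lemma prime_field_closed: "a : prime_field ==> b : prime_field ==> a + b : prime_field"
  "a : prime_field ==> - a : prime_field" "0 : prime_field" "1 : prime_field"
proof -
 show "a : prime_field ==> b : prime_field ==> a + b : prime_field"
  unfolding prime_field_def by (auto simp flip: of_nat_add)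
 show "0 : prime_field" "1 : prime_field"
  unfolding prime_field_def using rangeI[of of_nat 0] rangeI[of of_nat 1] by auto
 assume "a : prime_field"
 then obtain m where m: "a = of_nat m" unfolding prime_field_def by auto
 have "- a = of_nat ((p - 1) * m)"
  using prime_gt_0_nat[OF prime] of_nat_CHAR[where 'a = 'k] m char by (simp add: of_nat_diff)
 then show "- a : prime_field" unfolding prime_field_def by blast
qed

definition kF :: "('p \<Rightarrow>\<^sub>0 'k) set" where "kF = {f : kG. \<forall>x. lookup f x : prime_field}"

lemma kF_kG: "f : kF ==> f : kG"
 by (simp add: kF_def)

lemma kF_add: "f : kF ==> g : kF ==> f + g : kF"
 unfolding kF_def using fs.subspace_add[OF subspace_kG] by (auto simp: lookup_add intro: prime_field_closed)

lemma kF_neg: "f : kF ==> - f : kF"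
 unfolding kF_def using fs.subspace_neg[OF subspace_kG] by (auto intro: prime_field_closed)

lemma kF_zero: "0 : kF" unfolding kF_def using fs.subspace_0[OF subspace_kG] by (auto intro: prime_field_closed)

lemma bij_kF: "bij_betw (\<lambda>f. restrict (lookup f) (carrier G)) kF (carrier G \<rightarrow>\<^sub>E prime_field)"
proof (rule bij_betw_imageI)
 show "inj_on (\<lambda>f. restrict (lookup f) (carrier G)) kF"
 proof (rule inj_onI, rule poly_mapping_eqI)
  fix f g x assume *: "f : kF" "g : kF"
   "restrict (lookup f) (carrier G) = restrict (lookup g) (carrier G)"
  show "lookup f x = lookup g x"
  proof (cases "x : carrier G")
   case True
   then show ?thesis using fun_cong[OF *(3), of x] by simp
  next
   case False
   then have "x \<notin> keys f" "x \<notin> keys g" using * by (auto simp: kF_def kG_def)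
   then show ?thesis by (simp add: in_keys_iff)
  qed
 qed
 have "\<exists>f\<in>kF. c = restrict (lookup f) (carrier G)" if c: "c : carrier G \<rightarrow>\<^sub>E prime_field" for c
 proof -
  let ?f = "\<Sum>x\<in>carrier G. single x (c x)"
  have l: "lookup ?f x = (if x : carrier G then c x else 0)" for x
   using finite_G by (simp add: lookup_sum lookup_single when_def)
  have "?f : kF"
   using c unfolding kF_def kG_def by (auto simp: l in_keys_iff prime_field_closed split: if_splits)
  moreover have "c = restrict (lookup ?f) (carrier G)"
   using c by (auto simp: l fun_eq_iff restrict_def PiE_iff extensional_def)
  ultimately show ?thesis by blast
 qed
 then show "(\<lambda>f. restrict (lookup f) (carrier G)) ` kF = carrier G \<rightarrow>\<^sub>E prime_field"
  by (auto simp: kF_def)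
qed

lemma card_kF: "card kF = p ^ card (carrier G)" "finite kF"
 using bij_betw_same_card[OF bij_kF] bij_betw_finite[OF bij_kF] card_prime_field finite_G
 by (auto simp: card_PiE intro!: finite_PiE)

lemma lookup_ge_mult:
 assumes "g : carrier G" "f : kG"
 shows "lookup (ge g \<star> f) x = (if x : carrier G then lookup f (inv g \<otimes> x) else 0)"
proof -
 have "keys f <= carrier G" using assms by (simp add: kG_def)
 then show ?thesis
 proof (induction f rule: poly_mapping_induct_on)
  case (single y c)
  have "x : carrier G ==> g \<otimes> y = x \<longleftrightarrow> y = inv g \<otimes> x"
   using single assms inv_solve_left[of y g x] by auto
  then show ?case using single assms
   by (auto simp: ge_def gmul_def bmul_single scale_single lookup_single when_def)
 qed (auto simp: gmul_linear lookup_add)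
qed

lemma kF_translate: "g : carrier G ==> f : kF ==> ge g \<star> f : kF"
 unfolding kF_def by (auto simp: lookup_ge_mult gmul_closed prime_field_closed)

text \<open>The p-group acts on the nontrivial quotient \<open>kF / B\<close>, a set of cardinality a power of \<open>p\<close>, so
 besides \<open>B\<close> itself there is another fixed coset.\<close>

lemma fixed_vector_mod:
 assumes B: "B <= kF" "0 : B" "\<And>x y. x : B ==> y : B ==> x + y : B" "\<And>x. x : B ==> - x : B"
  and stable: "\<And>g x. g : carrier G ==> x : B ==> ge g \<star> x : B" and ne: "B ~= kF"
 shows "\<exists>v\<in>kF - B. \<forall>g\<in>carrier G. del g \<star> v : B"
proof -
 \<comment> \<open>The additive group in multiplicative dress, so that the coset notation and
   Lagrange's theorem apply to it.\<close>
 let ?F = "\<lparr>carrier = kF, mult = (+), one = 0\<rparr> :: ('p \<Rightarrow>\<^sub>0 'k) monoid"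
 have grp: "group ?F"
 proof (rule groupI)
  show "\<exists>y\<in>carrier ?F. y \<otimes>\<^sub>?F x = \<one>\<^sub>?F" if "x : carrier ?F" for x
   using that kF_neg by (intro bexI[of _ "- x"]) auto
 qed (auto simp: kF_zero kF_add add.assoc)
 interpret F: group ?F by (rule grp)
 have inv: "inv\<^bsub>?F\<^esub> x = - x" if "x : kF" for x
  using that kF_neg by (intro F.inv_equality) auto
 have sub: "subgroup B ?F"
  using B inv by (intro subgroup.intro) (auto simp: subset_iff)
 have co: "B #>\<^sub>?F v = (\<lambda>b. b + v) ` B" for v
  by (auto simp: r_coset_def)
 have co_mem: "x : B #>\<^sub>?F v \<longleftrightarrow> x - v : B" for x v
  unfolding co by (metis (no_types, lifting) add_diff_cancel diff_add_cancel image_iff)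
 have co_eq: "B #>\<^sub>?F v = B #>\<^sub>?F w \<longleftrightarrow> v - w : B" for v w
 proof
  assume "B #>\<^sub>?F v = B #>\<^sub>?F w"
  then show "v - w : B" using co_mem[of v v] co_mem[of v w] B(2) by auto
 next
  assume *: "v - w : B"
  have "x - v : B \<longleftrightarrow> x - w : B" for x
   using B(3)[of "x - v" "v - w"] B(3)[of "x - w" "- (v - w)"] B(4)[of "v - w"] * by auto
  then show "B #>\<^sub>?F v = B #>\<^sub>?F w" using co_mem by blast
 qed
 let ?E = "rcosets\<^bsub>?F\<^esub> B"
 have E: "?E = (\<lambda>v. B #>\<^sub>?F v) ` kF" by (auto simp: RCOSETS_def)
 have finE: "finite ?E" unfolding E using card_kF by simp
 have lag: "card ?E * card B = p ^ card (carrier G)"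
  using F.lagrange[OF sub] card_kF by (simp add: Coset.order_def)
 then have "card ?E dvd p ^ card (carrier G)" by (metis dvd_triv_left)
 then obtain m where m: "card ?E = p ^ m" using prime divides_primepow_nat by blast
 have "card B < card kF" using B(1) ne card_kF by (intro psubset_card_mono) auto
 then have "m ~= 0" using m lag card_kF by (cases m) auto
 then have pE: "p dvd card ?E" using m by simp
 define a where "a g C = (\<lambda>x. ge g \<star> x) ` C" for g C
 have a: "a g (B #>\<^sub>?F v) = B #>\<^sub>?F (ge g \<star> v)" if g: "g : carrier G" for g v
 proof -
  have "(\<lambda>b. ge g \<star> b) ` B = B"
  proof
   show "B <= (\<lambda>b. ge g \<star> b) ` B"
   proof
    fix b assume b: "b : B"
    then have bk: "b : kG" using B(1) by (auto simp: kF_def)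
    have "b = ge g \<star> (ge (inv g) \<star> b)"
     using g bk by (simp add: gmul_assoc[symmetric] ge_mult gmul_one)
    then show "b : (\<lambda>b. ge g \<star> b) ` B" using stable[of "inv g" b] b g by auto
   qed
  qed (use stable g in auto)
  then have "(\<lambda>b. b + ge g \<star> v) ` ((\<lambda>b. ge g \<star> b) ` B) = (\<lambda>b. b + ge g \<star> v) ` B" by simp
  then show ?thesis unfolding a_def co by (simp add: image_image gmul_linear)
 qed
 let ?Fix = "{x : ?E. \<forall>g\<in>carrier G. a g x = x}"
 have "p dvd card ?Fix"
 proof (rule p_group_fixed_points[OF prime order_G finE pE])
  show "a g x : ?E" if "g : carrier G" "x : ?E" for g x
   using that kF_translate by (auto simp: E a)
  show "a \<one> x = x" if x: "x : ?E" for x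
  proof -
   obtain v where "v : kF" "x = B #>\<^sub>?F v" using x by (auto simp: E)
   then show ?thesis by (simp add: a kF_kG gmul_one)
  qed
  show "a (g \<otimes> h) x = a g (a h x)" if gh: "g : carrier G" "h : carrier G" and x: "x : ?E" for g h x
  proof -
   obtain v where "v : kF" "x = B #>\<^sub>?F v" using x by (auto simp: E)
   then show ?thesis using gh by (simp add: a kF_kG gmul_assoc[symmetric] ge_mult)
  qed
 qed
 moreover have B0: "B #>\<^sub>?F 0 : ?Fix" using kF_zero by (auto simp: E a)
 ultimately obtain C where C: "C : ?Fix" "C ~= B #>\<^sub>?F 0"
 proof (cases "\<exists>C\<in>?Fix. C ~= B #>\<^sub>?F 0")
  case False
  then have "?Fix = {B #>\<^sub>?F 0}" using B0 by blast
  then have "card ?Fix = 1" by simp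
  then show ?thesis using \<open>p dvd card ?Fix\<close> prime by auto
 qed auto
 then obtain v where v: "v : kF" "C = B #>\<^sub>?F v" by (auto simp: E)
 have "v \<notin> B" using C(2) v co_eq[of v 0] by auto
 moreover have "del g \<star> v : B" if g: "g : carrier G" for g
 proof -
  have "B #>\<^sub>?F (ge g \<star> v) = B #>\<^sub>?F v" using C(1) v a[OF g] g by auto
  then have "ge g \<star> v - v : B" using co_eq by blast
  then show ?thesis using v by (simp add: del_def gmul_linear kF_def gmul_one)
 qed
 ultimately show ?thesis using v by blast
qed

primrec dprod :: "'p list => ('p \<Rightarrow>\<^sub>0 'k)" where
 "dprod [] = ge \<one>"
| "dprod (g # gs) = del g \<star> dprod gs"

abbreviation DP where "DP r \<equiv> dprod ` {gs. set gs <= carrier G \<and> length gs = r}"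

lemma dprod_closed [simp]: "set gs <= carrier G ==> dprod gs : kG"
 by (induction gs) (auto intro: gmul_closed)

lemma dprod_append: "set gs <= carrier G ==> set hs <= carrier G ==> dprod (gs @ hs) = dprod gs \<star> dprod hs"
 by (induction gs) (auto simp: gmul_one gmul_assoc)

text \<open>The ascending socle series of \<open>kF\<close>: each \<open>g - 1\<close> moves a term
  into the preceding one.\<close>

primrec socle :: "nat => ('p \<Rightarrow>\<^sub>0 'k) set" where
 "socle 0 = {0}"
| "socle (Suc i) = {v : kF. \<forall>g\<in>carrier G. del g \<star> v : socle i}"

lemma socle_props:
 "socle i <= kF \<and> 0 : socle i \<and> (\<forall>x\<in>socle i. \<forall>y\<in>socle i. x + y : socle i) \<and>
  (\<forall>x\<in>socle i. - x : socle i) \<and> socle i <= socle (Suc i)"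
proof (induction i)
 case (Suc i)
 have neg: "f \<star> (- x) = - (f \<star> x)" for f x
  using gmul_linear(4)[of f 0 x] by simp
 show ?case using Suc by (auto simp: gmul_linear kF_add kF_neg kF_zero neg)
qed (auto simp: kF_zero)

lemma socle_subset: "socle i <= kF" and socle_mono: "socle i <= socle (Suc i)"
 using socle_props[of i] by auto

lemma finite_socle: "finite (socle i)"
 using socle_subset card_kF(2) by (rule finite_subset)

lemma socle_stable: 
 assumes "g : carrier G" "v : socle i"
 shows "ge g \<star> v : socle i"
proof (cases i)
 case (Suc j)
 have v: "v : kF" using assms socle_props by blast
 have "del g \<star> v : socle i" using assms socle_props[of j] unfolding Suc by auto
 then have "del g \<star> v + v : socle i" using assms socle_props by blast
 also have "del g \<star> v + v = ge g \<star> v"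
  using v by (simp add: del_def gmul_linear kF_def gmul_one)
 finally show ?thesis .
qed (use assms in auto)

text \<open>A proper term of the series is strictly enlarged by a fixed vector modulo it, and this
  cannot continue in the finite set \<open>kF\<close>.\<close>

lemma socle_eventually: "\<exists>N. socle N = kF"
proof (rule ccontr)
 assume "\<not> ?thesis"
 then have ne: "socle i ~= kF" for i by auto
 have "i < card (socle i)" for i
 proof (induction i)
  case (Suc i)
  obtain v where "v : kF - socle i" "\<forall>g\<in>carrier G. del g \<star> v : socle i"
   using fixed_vector_mod[OF socle_subset, of i] socle_props[of i] socle_stable[of _ _ i] ne[of i]
   by (metis (no_types, lifting))
  then have "v : socle (Suc i)" "v \<notin> socle i" by simp_all
  then have "socle i \<subset> socle (Suc i)" using socle_mono[of i] by blast
  then have "card (socle i) < card (socle (Suc i))" by (rule psubset_card_mono[OF finite_socle])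
  then show ?case using Suc by linarith
 qed simp
 moreover have "card (socle i) \<le> card kF" for i
  by (rule card_mono[OF card_kF(2) socle_subset])
 ultimately show False by (meson not_less)
qed

text \<open>The element 1 lies in the last term \<open>socle N = kF\<close> of the series, and each
  factor \<open>g - 1\<close> descends by one term. After \<open>N\<close> factors only
  \<open>socle 0 = {0}\<close> is left.\<close>

lemma nilpotent: "\<exists>N\<ge>1. \<forall>gs. set gs <= carrier G \<longrightarrow> length gs = N \<longrightarrow> dprod gs = 0"
proof -
 obtain N where N: "socle N = kF" using socle_eventually by blast
 have "dprod gs : socle (N - length gs)" if "set gs <= carrier G" "length gs \<le> N" for gs
  using that
 proof (induction gs)
  case Nil
  have "ge \<one> : kF"
   unfolding kF_def by (auto simp: ge_def lookup_single when_def prime_field_closed kG_def)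
  then show ?case using N by simp
 next
  case (Cons g gs)
  then have "dprod gs : socle (Suc (N - length (g # gs)))"
   by (simp add: Suc_diff_Suc)
  then show ?case using Cons.prems by auto
 qed
 then have *: "dprod gs = 0" if "set gs <= carrier G" "length gs = N" for gs
  using that by fastforce
 show ?thesis
 proof (intro exI conjI allI impI)
  \<comment> \<open>One factor more than the series requires, so that the length claimed is at least
    1.\<close>
  fix gs assume gs: "set gs <= carrier G" "length gs = Suc N"
  then show "dprod gs = 0" using * by (cases gs) auto
 qed simp
qed

end

section \<open>Linear endomorphisms\<close>

text \<open>Endomorphisms are made a type so that they form an instance of \<open>ring_1\<close>.
  The formulas on powers of sums are stated for that class.\<close>

typedef (overloaded) ('b, 'k) endo =
 "{f :: ('b \<Rightarrow>\<^sub>0 'k::field) => ('b \<Rightarrow>\<^sub>0 'k). Vector_Spaces.linear scale scale f}"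
 morphisms app Endo
 using fs.linear_id by auto

setup_lifting type_definition_endo

instantiation endo :: (type, field) ring_1
begin

lift_definition zero_endo :: "('a, 'b) endo" is "\<lambda>_. 0"
 by (simp add: Vector_Spaces.linear_iff fs.vector_space_axioms)
lift_definition one_endo :: "('a, 'b) endo" is "\<lambda>v. v"
 by (simp add: Vector_Spaces.linear_iff fs.vector_space_axioms)
lift_definition plus_endo :: "('a, 'b) endo => ('a, 'b) endo => ('a, 'b) endo" is "\<lambda>f g v. f v + g v"
 by (auto simp: Vector_Spaces.linear_iff fs.scale_right_distrib)
lift_definition minus_endo :: "('a, 'b) endo => ('a, 'b) endo => ('a, 'b) endo" is "\<lambda>f g v. f v - g v"
 by (auto simp: Vector_Spaces.linear_iff fs.scale_right_diff_distrib)
lift_definition uminus_endo :: "('a, 'b) endo => ('a, 'b) endo" is "\<lambda>f v. - f v"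
 by (auto simp: Vector_Spaces.linear_iff)
lift_definition times_endo :: "('a, 'b) endo => ('a, 'b) endo => ('a, 'b) endo" is "\<lambda>f g v. f (g v)"
 by (auto simp: Vector_Spaces.linear_iff)

instance
proof
 show "(0 :: ('a, 'b) endo) ~= 1"
 proof
  assume "(0 :: ('a, 'b) endo) = 1"
  then have "app (0 :: ('a, 'b) endo) (single undefined 1) = app 1 (single undefined 1)" by simp
  then have "single undefined 1 = (0 :: 'a \<Rightarrow>\<^sub>0 'b)"
   by (simp add: zero_endo.rep_eq one_endo.rep_eq)
  then show False by (metis lookup_single_eq lookup_zero zero_neq_one)
 qed
qed (transfer; auto simp: fun_eq_iff Vector_Spaces.linear_iff)+

end

lift_definition smult_endo :: "'k::field => ('b, 'k) endo => ('b, 'k) endo" is "\<lambda>c f v. scale c (f v)"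
 by (auto simp: Vector_Spaces.linear_iff fs.scale_right_distrib mult.commute)

definition endo_algebra :: "('k::field, ('b, 'k) endo) module" where
 "endo_algebra = \<lparr>carrier = UNIV, monoid.mult = (*), one = 1, zero = 0, add = (+), smult = smult_endo\<rparr>"

lemma endo_algebra_simps [simp]:
 "carrier endo_algebra = UNIV" "f \<otimes>\<^sub>endo_algebra g = f * g" "\<one>\<^sub>endo_algebra = 1"
 "\<zero>\<^sub>endo_algebra = 0" "f \<oplus>\<^sub>endo_algebra g = f + g" "c \<odot>\<^sub>endo_algebra f = smult_endo c f"
 by (simp_all add: endo_algebra_def)

lemma smult_endo_laws:
 "smult_endo c (smult_endo d f) = smult_endo (c * d) f" "smult_endo 1 f = f" "smult_endo 0 f = 0"
 "smult_endo (c + d) f = smult_endo c f + smult_endo d f"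
 "smult_endo c (f + g) = smult_endo c f + smult_endo c g"
 "smult_endo c f * g = smult_endo c (f * g)" "f * smult_endo c g = smult_endo c (f * g)"
 by (transfer; auto simp: fun_eq_iff fs.scale_left_distrib fs.scale_right_distrib Vector_Spaces.linear_iff)+

lemma endo_algebra: "k_algebra (endo_algebra :: ('k::field, ('b, 'k) endo) module)"
 by (intro k_algebraI k_spaceI) (auto simp: smult_endo_laws algebra_simps)

lemma endo_pow: "f [^]\<^sub>endo_algebra (m::nat) = f ^ m"
 by (induction m) (auto simp: power_commutes)

lemma smult_endo_of_nat: "smult_endo (of_nat m) f = of_nat m * f"
 by (induction m) (auto simp: smult_endo_laws ring_distribs)

lemma app_linear: "Vector_Spaces.linear scale scale (app f)"
 using app by auto

section \<open>The Jennings filtration\<close>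

context p_group_algebra
begin

text \<open>The \<open>r\<close>-th power of the augmentation ideal. The case \<open>r = 0\<close>
  is separate because the only product of no factors is 1, whose span is too small.\<close>

definition JS :: "nat => ('p \<Rightarrow>\<^sub>0 'k) set" where
 "JS r = (if r = 0 then kG else fs.span (DP r))"

lemma subspace_JS: "fs.subspace (JS r)"
 unfolding JS_def using subspace_kG by auto

lemma JS_kG: "JS r <= kG"
proof (cases "r = 0")
 case False
 have "fs.span (DP r) <= kG"
  using dprod_closed by (intro fs.span_minimal[OF _ subspace_kG]) auto
 with False show ?thesis by (simp add: JS_def)
qed (simp add: JS_def)

lemma JS_carrier: "a : JS r ==> a : kG" using JS_kG by auto

lemma JS_add: "a : JS r ==> b : JS r ==> a + b : JS r"
 and JS_diff: "a : JS r ==> b : JS r ==> a - b : JS r"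
 and JS_scale: "a : JS r ==> scale c a : JS r"
 and JS_zero: "0 : JS r"
 using fs.subspace_add[OF subspace_JS] fs.subspace_diff[OF subspace_JS] 
  fs.subspace_scale[OF subspace_JS] fs.subspace_0[OF subspace_JS] by auto

lemma dprod_JS: "set gs <= carrier G ==> dprod gs : JS (length gs)"
 unfolding JS_def by (auto intro!: fs.span_base)

lemma del_JS: "g : carrier G ==> del g : JS 1"
 using dprod_JS[of "[g]"] by (simp add: gmul_one)

lemma ge_del: "x : carrier G ==> g : carrier G ==> ge x \<star> del g = del (x \<otimes> g) - del x"
 "x : carrier G ==> g : carrier G ==> del g \<star> ge x = del (g \<otimes> x) - del x"
 by (simp_all add: del_def gmul_linear ge_mult)

text \<open>It suffices to multiply the first factor by a group element, and
  \<open>u (g - 1) = (u g - 1) - (u - 1)\<close> is again a combination of such factors.\<close>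

lemma JS_left:
 assumes f: "f : kG" and a: "a : JS s"
 shows "f \<star> a : JS s"
proof (cases "s = 0")
 case True
 then show ?thesis using assms gmul_closed by (simp add: JS_def)
next
 case False
 show ?thesis
 proof (rule gmul_span[OF _ subspace_JS])
  show "f : fs.span (ge ` carrier G)" using f kG_span by simp
  show "a : fs.span (DP s)" using a False by (simp add: JS_def)
  fix x y assume "x : ge ` carrier G" "y : DP s"
  then obtain u ks where u: "u : carrier G" "x = ge u" and ks: "set ks <= carrier G" 
   "length ks = s" "y = dprod ks"
   by blast
  then obtain g gs where "ks = g # gs" using False by (cases ks) auto
  then have gs: "set (g # gs) <= carrier G" "length (g # gs) = s" "y = dprod (g # gs)" using ks by auto
  have "x \<star> y = (ge u \<star> del g) \<star> dprod gs" using u gs by (simp add: gmul_assoc)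
  also have "\<dots> = dprod ((u \<otimes> g) # gs) - dprod (u # gs)" using u gs by (simp add: ge_del gmul_linear)
  also have "\<dots> : JS s" using u gs dprod_JS[of "(u \<otimes> g) # gs"] dprod_JS[of "u # gs"] by (auto intro: JS_diff)
  finally show "x \<star> y : JS s" .
 qed
qed

lemma JS_right:
 assumes f: "f : kG" and a: "a : JS s"
 shows "a \<star> f : JS s"
proof (cases "s = 0")
 case True
 then show ?thesis using assms gmul_closed by (simp add: JS_def)
next
 case False
 show ?thesis
 proof (rule gmul_span[OF _ subspace_JS])
  show "f : fs.span (ge ` carrier G)" using f kG_span by simp
  show "a : fs.span (DP s)" using a False by (simp add: JS_def)
  fix x y assume "y : ge ` carrier G" "x : DP s"
  then obtain u gs where u: "u : carrier G" "y = ge u" and gs: "set gs <= carrier G" 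
   "length gs = s" "x = dprod gs" by auto
  then obtain hs h where h: "gs = hs @ [h]" using False by (metis length_0_conv rev_exhaust)
  have "x \<star> y = dprod hs \<star> (del h \<star> ge u)" using u gs h by (simp add: dprod_append gmul_assoc gmul_one)
  also have "\<dots> = dprod (hs @ [h \<otimes> u]) - dprod (hs @ [u])"
   using u gs h by (simp add: ge_del gmul_linear dprod_append gmul_one)
  also have "\<dots> : JS s" using u gs h dprod_JS[of "hs @ [h \<otimes> u]"] dprod_JS[of "hs @ [u]"]
   by (auto intro: JS_diff)
  finally show "x \<star> y : JS s" .
 qed
qed

lemma JS_mult:
 assumes a: "a : JS r" and b: "b : JS s"
 shows "a \<star> b : JS (r + s)"
proof (cases "r = 0 \<or> s = 0")
 case True
 then show ?thesis using assms JS_left[of a b s] JS_right[of b a r] JS_carrier by auto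
next
 case False
 show ?thesis
 proof (rule gmul_span[OF _ subspace_JS])
  show "a : fs.span (DP r)" using a False by (simp add: JS_def)
  show "b : fs.span (DP s)" using b False by (simp add: JS_def)
  fix x y assume "x : DP r"
   "y : DP s"
  then obtain gs hs where "set gs <= carrier G" "length gs = r" "x = dprod gs"
   "set hs <= carrier G" "length hs = s" "y = dprod hs" by auto
  then show "x \<star> y : JS (r + s)" using dprod_JS[of "gs @ hs"] by (simp add: dprod_append)
 qed
qed

lemma JS_Suc: "JS (Suc r) <= JS r"
proof -
 have "dprod gs : JS r" if "set gs <= carrier G" "length gs = Suc r" for gs
  using that dprod_JS by (cases gs) (auto intro!: JS_left)
 then have "fs.span (DP (Suc r)) <= JS r"
  by (intro fs.span_minimal[OF _ subspace_JS]) auto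
 then show ?thesis by (simp add: JS_def)
qed

lemma JS_mono: "r \<le> s ==> JS s <= JS r"
 by (induction s rule: dec_induct) (use JS_Suc in auto)

text \<open>An exponent at which the powers of the augmentation ideal have vanished. It truncates
  all sums over degrees from here on.\<close>

definition N :: nat where "N = (SOME N. N \<ge> 1 \<and> JS N = {0})"

lemma JS_vanishes: "N \<ge> 1 \<and> JS N = {0}"
proof -
 obtain M where M: "M \<ge> 1" "\<And>gs. set gs <= carrier G ==> length gs = M ==> dprod gs = 0"
  using nilpotent by blast
 then have "DP M <= {0}" by auto
 then have "fs.span (DP M) <= {0}"
  by (rule fs.span_minimal[OF _ fs.subspace_single_0])
 then have "JS M <= {0}" using M(1) by (simp add: JS_def)
 then have "M \<ge> 1 \<and> JS M = {0}" using M JS_zero by auto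
 then show ?thesis unfolding N_def by (rule someI)
qed

lemma JS_large: "N \<le> r ==> a : JS r ==> a = 0"
 using JS_mono JS_vanishes by blast

subsection \<open>The radical\<close>

text \<open>The augmentation map. By \<open>eps_JS\<close> and \<open>kG_decompose\<close> its
  kernel on \<open>kG\<close> is \<open>JS 1\<close>.\<close>

definition eps :: "('p \<Rightarrow>\<^sub>0 'k) => 'k" where "eps f = (\<Sum>x\<in>carrier G. lookup f x)"

lemma eps_linear: "eps (f + g) = eps f + eps g" "eps (f - g) = eps f - eps g" "eps (scale c f) = c * eps f"
 by (simp_all add: eps_def lookup_add lookup_minus sum.distrib sum_subtractf sum_distrib_left)

lemma eps_ge: "x : carrier G ==> eps (ge x) = 1"
 using finite_G by (simp add: eps_def ge_def lookup_single when_def)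

lemma JS_1: "JS 1 = fs.span (del ` carrier G)"
proof -
 have "DP 1 = del ` carrier G"
 proof (intro equalityI subsetI)
  fix a assume "a : DP 1"
  then obtain gs where gs: "set gs <= carrier G" "length gs = 1" "a = dprod gs" by blast
  then obtain g where "gs = [g]" by (cases gs) auto
  with gs have "g : carrier G" "a = del g" by (auto simp: gmul_one)
  then show "a : del ` carrier G" by simp
 next
  fix a assume "a : del ` carrier G"
  then obtain g where "g : carrier G" "a = del g" by blast
  then show "a : DP 1"
   by (intro image_eqI[of _ _ "[g]"]) (simp_all add: gmul_one)
 qed
 then show ?thesis by (simp add: JS_def)
qed

lemma eps_JS: "a : JS 1 ==> eps a = 0"
 unfolding JS_1
proof (induction a rule: fs.span_induct)
 case base
 show ?case by (auto simp: fs.subspace_def eps_linear) (simp add: eps_def)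
qed (auto simp: del_def eps_linear eps_ge)

lemma kG_decompose: "f : kG ==> f - scale (eps f) (ge \<one>) : JS 1"
 unfolding kG_span
proof (induction f rule: fs.span_induct)
 case base
 show ?case
 proof (rule fs.subspaceI)
  fix f g assume "f : {f. f - scale (eps f) (ge \<one>) : JS 1}" "g : {f. f - scale (eps f) (ge \<one>) : JS 1}"
  then show "f + g : {f. f - scale (eps f) (ge \<one>) : JS 1}"
   using JS_add[of "f - scale (eps f) (ge \<one>)" 1 "g - scale (eps g) (ge \<one>)"]
   by (simp add: eps_linear fs.scale_left_distrib algebra_simps)
 next
  fix c f assume "f : {f. f - scale (eps f) (ge \<one>) : JS 1}"
  then show "scale c f : {f. f - scale (eps f) (ge \<one>) : JS 1}"
   using JS_scale[of "f - scale (eps f) (ge \<one>)" 1 c]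
   by (simp add: eps_linear fs.scale_right_diff_distrib)
 qed (simp add: eps_def JS_zero)
qed (auto simp: eps_ge simp flip: del_def intro: del_JS[unfolded One_nat_def])

definition left_ideal :: "('p \<Rightarrow>\<^sub>0 'k) set => bool" where
 "left_ideal M \<longleftrightarrow> additive_subgroup M A \<and> (\<forall>a\<in>carrier A. \<forall>x\<in>M. a \<otimes>\<^sub>A x : M)"

lemma left_ideal_iff:
 "left_ideal M \<longleftrightarrow> fs.subspace M \<and> M <= kG \<and> (\<forall>a\<in>kG. \<forall>x\<in>M. a \<star> x : M)"
proof
 interpret A: k_algebra A by (rule algebra_A)
 assume L: "left_ideal M"
 then interpret M: additive_subgroup M A by (simp add: left_ideal_def)
 have sub: "M <= kG" using M.a_subset by (simp add: A_simps)
 have l: "a \<star> x : M" if "a : kG" "x : M" for a x using L that by (simp add: left_ideal_def A_simps)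
 have "fs.subspace M"
 proof (rule fs.subspaceI)
  fix c x assume "x : M"
  then have "scale c (ge \<one>) \<star> x : M" using fs.subspace_scale[OF subspace_kG] by (intro l) auto
  then show "scale c x : M" using sub \<open>x : M\<close> by (auto simp: gmul_linear gmul_one subset_iff)
 qed (use M.a_closed M.zero_closed in \<open>auto simp: A_simps\<close>)
 then show "fs.subspace M \<and> M <= kG \<and> (\<forall>a\<in>kG. \<forall>x\<in>M. a \<star> x : M)" using sub l by auto
next
 interpret A: k_algebra A by (rule algebra_A)
 assume L: "fs.subspace M \<and> M <= kG \<and> (\<forall>a\<in>kG. \<forall>x\<in>M. a \<star> x : M)"
 have "A.subsp M"
  using L unfolding A.subsp_def by (auto simp: A_simps fs.subspace_def)
 then have "additive_subgroup M A" using A.subsp_abelian_subgroup abelian_subgroup_def by blast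
 then show "left_ideal M" using L by (simp add: left_ideal_def A_simps)
qed

lemma maximal_left_ideal_iff: "maximal_left_ideal M A \<longleftrightarrow> left_ideal M \<and> M ~= kG \<and>
  (\<forall>M'. left_ideal M' \<longrightarrow> M <= M' \<longrightarrow> M' = M \<or> M' = kG)"
 unfolding maximal_left_ideal_def Let_def left_ideal_def by (simp add: A_simps)

lemma left_ideal_one: "left_ideal M ==> ge \<one> : M ==> M = kG"
 unfolding left_ideal_iff using gmul_one by (metis subsetI subset_antisym)

lemma left_ideal_JS: "left_ideal (JS r)"
 unfolding left_ideal_iff using subspace_JS JS_kG JS_left by auto

text \<open>An element of a larger left ideal outside \<open>JS 1\<close> differs from a nonzero
  multiple of 1 by an element of \<open>JS 1\<close>, so that ideal contains 1.\<close>

lemma maximal_JS: "maximal_left_ideal (JS 1) A"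
 unfolding maximal_left_ideal_iff
proof (intro conjI allI impI)
 show "JS 1 ~= kG" using eps_JS[of "ge \<one>"] eps_ge[of "\<one>"] ge_closed[of "\<one>"] by force
 fix M assume M: "left_ideal M" "JS 1 <= M"
 note Ms = M(1)[unfolded left_ideal_iff]
 show "M = JS 1 \<or> M = kG"
 proof (cases "M = JS 1")
  case False
  then obtain x where x: "x : M" "x \<notin> JS 1" using M by auto
  then have xk: "x : kG" using Ms by auto
  then have d: "x - scale (eps x) (ge \<one>) : JS 1" by (rule kG_decompose)
  then have "eps x ~= 0" using x by auto
  have "x - (x - scale (eps x) (ge \<one>)) : M" using Ms by (intro fs.subspace_diff[OF _ x(1) subsetD[OF M(2) d]]) auto
  then have "scale (eps x) (ge \<one>) : M" by simp
  then have "scale (inverse (eps x)) (scale (eps x) (ge \<one>)) : M"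
   by (rule fs.subspace_scale[OF conjunct1[OF Ms]])
  then have "ge \<one> : M" using \<open>eps x ~= 0\<close> by simp
  then show ?thesis using left_ideal_one M by auto
 qed simp
qed (rule left_ideal_JS)

text \<open>The sum of \<open>M\<close> and \<open>JS 1\<close> is a left ideal. If it were
  everything, 1 would be congruent modulo \<open>M\<close> to elements of \<open>JS i\<close> for
  every \<open>i\<close>, and these vanish for \<open>i = N\<close>.\<close>

lemma JS_in_maximal:
 assumes "maximal_left_ideal M A"
 shows "JS 1 <= M"
proof -
 note M = assms[unfolded maximal_left_ideal_iff]
 note Ms = conjunct1[OF M, unfolded left_ideal_iff]
 let ?S = "{x + y |x y. x : M \<and> y : JS 1}"
 have S: "left_ideal ?S"
  unfolding left_ideal_iff
 proof (intro conjI ballI)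
  show "fs.subspace ?S" using Ms subspace_JS by (intro fs.subspace_sums) auto
  show "?S <= kG" using Ms JS_kG fs.subspace_add[OF subspace_kG] by (auto simp: subset_iff)
  fix a x assume "a : kG" "x : ?S"
  then obtain y z where yz: "x = y + z" "y : M" "z : JS 1" by auto
  then have "a \<star> x = a \<star> y + a \<star> z" "a \<star> y : M" "a \<star> z : JS 1" 
   using \<open>a : kG\<close> Ms JS_left by (auto simp: gmul_linear)
  then show "a \<star> x : ?S" by blast
 qed
 have MS: "M <= ?S" using JS_zero by force
 show ?thesis
 proof (cases "?S = kG")
  case False
  then have "?S = M" using M S MS by blast
  moreover have "0 : M" using Ms fs.subspace_0 by auto
  ultimately show ?thesis by force
 next
  case True
  then obtain m a where ma: "ge \<one> = m + a" "m : M" "a : JS 1" using ge_closed[of "\<one>"] by blast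
  have ak: "a : kG" using ma JS_carrier by auto
  \<comment> \<open>With \<open>1 = m + a\<close>, membership of \<open>1 - b\<close> in
    \<open>M\<close> gives that of \<open>m + a (1 - b) = 1 - a b\<close>, and \<open>a b\<close>
    lies one power deeper than \<open>b\<close>.\<close>
  have "\<exists>b\<in>JS i. ge \<one> - b : M" for i
  proof (induction i)
   case 0
   show ?case using Ms fs.subspace_0 by (intro bexI[of _ "ge \<one>"]) (auto simp: JS_def)
  next
   case (Suc i)
   then obtain b where b: "b : JS i" "ge \<one> - b : M" by auto
   have bk: "b : kG" using b JS_carrier by auto
   have "m + a \<star> (ge \<one> - b) : M" using Ms ma b ak fs.subspace_add by blast
   also have "m + a \<star> (ge \<one> - b) = ge \<one> - a \<star> b"
   proof -
    have "a \<star> (ge \<one> - b) = a - a \<star> b" using ak by (simp add: gmul_linear gmul_one)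
    then show ?thesis unfolding ma(1) by simp
   qed
   finally show ?case using JS_mult[OF ma(3) b(1)] by auto
  qed
  then obtain b where "b : JS N" "ge \<one> - b : M" by blast
  then have "ge \<one> : M" using JS_vanishes by auto
  then have False using left_ideal_one M by auto
  then show ?thesis ..
 qed
qed

lemma radical_eq: "jacobson_radical A = JS 1"
 unfolding jacobson_radical_def using maximal_JS JS_in_maximal JS_kG by (auto simp: A_simps)

lemma ideal_power_eq: "ideal_power A (jacobson_radical A) r = JS r"
proof (induction r)
 case 0
 show ?case by (simp add: JS_def A_simps)
next
 case (Suc r)
 have sub: "fs.subspace (ideal_prod A (JS r) (JS 1))"
 proof (rule fs.subspaceI)
  show "0 : ideal_prod A (JS r) (JS 1)"
   using ideal_prod.prod[of 0 "JS r" 0 "JS 1" A] JS_zero by (simp add: A_simps)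
  show "x + y : ideal_prod A (JS r) (JS 1)"
   if "x : ideal_prod A (JS r) (JS 1)" "y : ideal_prod A (JS r) (JS 1)" for x y
   using ideal_prod.sum[OF that] by (simp add: A_simps)
  show "scale c x : ideal_prod A (JS r) (JS 1)" if "x : ideal_prod A (JS r) (JS 1)" for c x
   using that
  proof induction
   case (prod i j)
   then show ?case
    using ideal_prod.prod[of "scale c i" "JS r" j "JS 1" A] JS_scale by (simp add: A_simps gmul_linear)
  next
   case (sum x y)
   then show ?case
    using ideal_prod.sum[of "scale c x" A "JS r" "JS 1" "scale c y"]
    by (simp add: A_simps fs.scale_right_distrib)
  qed
 qed
 have "ideal_prod A (JS r) (JS 1) = JS (Suc r)"
 proof (intro equalityI subsetI)
  fix x assume "x : ideal_prod A (JS r) (JS 1)"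
  then show "x : JS (Suc r)"
  proof induction
   case (prod i j)
   then show ?case using JS_mult[of i r j 1] by (simp add: A_simps)
  qed (simp add: A_simps JS_add)
 next
  fix x assume "x : JS (Suc r)"
  then have "x : fs.span (DP (Suc r))" by (simp add: JS_def)
  moreover have "DP (Suc r) <= ideal_prod A (JS r) (JS 1)"
  proof clarify
   fix gs assume gs: "set gs <= carrier G" "length gs = Suc r"
   then obtain hs h where h: "gs = hs @ [h]" by (metis length_0_conv nat.distinct(1) rev_exhaust)
   then have "dprod gs = dprod hs \<star> del h" using gs by (simp add: dprod_append gmul_one)
   moreover have "dprod hs : JS r" "del h : JS 1" using dprod_JS[of hs] del_JS gs h by auto
   ultimately show "dprod gs : ideal_prod A (JS r) (JS 1)"
    using ideal_prod.prod[of "dprod hs" "JS r" "del h" "JS 1" A] by (simp add: A_simps)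
  qed
  ultimately show "x : ideal_prod A (JS r) (JS 1)" using fs.span_minimal[OF _ sub] by blast
 qed
 then show ?case using Suc by (simp add: radical_eq)
qed

lemma jennings_filtration_eq: "jennings_filtration TYPE('k) G r = {g : carrier G. del g : JS r}"
 unfolding jennings_filtration_def ideal_power_eq del_def ge_def ..

subsection \<open>A splitting of the radical filtration\<close>

text \<open>\<open>prj r\<close> is a projection onto \<open>JS r\<close>; the recursion makes these projections nested, so that
 the \<open>cmp r\<close> are orthogonal idempotents.\<close>

definition sel :: "nat => ('p \<Rightarrow>\<^sub>0 'k) => ('p \<Rightarrow>\<^sub>0 'k)" where
 "sel r = (SOME s. range s <= JS r \<and> Vector_Spaces.linear scale scale s \<and> (\<forall>v\<in>JS r. s v = v))"

primrec prj :: "nat => ('p \<Rightarrow>\<^sub>0 'k) => ('p \<Rightarrow>\<^sub>0 'k)" where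
 "prj 0 = sel 0"
| "prj (Suc r) = (\<lambda>v. sel (Suc r) (prj r v))"

definition cmp :: "nat => ('p \<Rightarrow>\<^sub>0 'k) => ('p \<Rightarrow>\<^sub>0 'k)" where "cmp r v = prj r v - prj (Suc r) v"

lemma sel_props: "range (sel r) <= JS r \<and> Vector_Spaces.linear scale scale (sel r) \<and> (\<forall>v\<in>JS r. sel r v = v)"
proof -
 interpret fp: vector_space_pair "scale :: 'k => ('p \<Rightarrow>\<^sub>0 'k) => _" "scale :: 'k => ('p \<Rightarrow>\<^sub>0 'k) => _"
  by unfold_locales
 have "\<exists>s. range s <= JS r \<and> Vector_Spaces.linear scale scale s \<and> (\<forall>v\<in>JS r. s v = v)"
  using fp.linear_exists_left_inverse_on[OF fs.linear_id subspace_JS[of r]] by simp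
 then show ?thesis unfolding sel_def by (rule someI_ex)
qed

lemma prj_linear: "Vector_Spaces.linear scale scale (prj r)"
proof (induction r)
 case (Suc r)
 then show ?case using sel_props[of "Suc r"] by (simp add: Vector_Spaces.linear_iff)
qed (simp add: sel_props)

lemma prj_lin: "prj r (v + w) = prj r v + prj r w" "prj r (v - w) = prj r v - prj r w"
 "prj r (scale c v) = scale c (prj r v)" "prj r 0 = 0"
proof -
 show 1: "prj r (v + w) = prj r v + prj r w" "prj r (scale c v) = scale c (prj r v)" for v w c
  using prj_linear[of r] by (simp_all add: Vector_Spaces.linear_iff)
 show "prj r 0 = 0" using 1(2)[of 0 0] by simp
 show "prj r (v - w) = prj r v - prj r w" using 1(1)[of "v - w" w] by simp
qed

lemma prj_JS: "prj r v : JS r"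
 using sel_props[of r] by (cases r) auto

lemma prj_fix: "v : JS r ==> prj r v = v"
proof (induction r)
 case (Suc r)
 then show ?case using JS_Suc[of r] sel_props[of "Suc r"] by auto
qed (use sel_props[of 0] in auto)

lemma prj_prj: "d \<le> e ==> prj d (prj e v) = prj e v" "d \<le> e ==> prj e (prj d v) = prj e v"
proof -
 show "d \<le> e ==> prj d (prj e v) = prj e v" using prj_JS[of e v] JS_mono prj_fix by blast
 show "d \<le> e ==> prj e (prj d v) = prj e v"
 proof (induction e rule: dec_induct)
  case base
  then show ?case using prj_JS prj_fix by blast
 qed simp
qed

lemma cmp_lin: "cmp r (v + w) = cmp r v + cmp r w" "cmp r (v - w) = cmp r v - cmp r w"
 "cmp r (scale c v) = scale c (cmp r v)" "cmp r 0 = 0"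
 by (simp_all add: cmp_def prj_lin fs.scale_right_diff_distrib del: prj.simps)

lemma cmp_sum: "cmp r (\<Sum>i\<in>I. f i) = (\<Sum>i\<in>I. cmp r (f i))"
 by (induction I rule: infinite_finite_induct) (auto simp: cmp_lin)

lemma cmp_JS: "cmp r v : JS r"
 unfolding cmp_def using prj_JS[of r v] prj_JS[of "Suc r" v] JS_Suc by (blast intro: JS_diff)

lemma cmp_kills: "v : JS (Suc r) ==> cmp r v = 0"
 unfolding cmp_def using prj_fix[of v r] prj_fix[of v "Suc r"] JS_Suc[of r] by auto

lemma cmp_rest: "v : JS r ==> v - cmp r v : JS (Suc r)"
 unfolding cmp_def using prj_JS[of "Suc r" v] by (simp add: prj_fix del: prj.simps)

lemma cmp_large: "N \<le> r ==> cmp r v = 0"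
 using JS_large cmp_JS by blast

lemma cmp_cmp: "cmp d (cmp e v) = (if d = e then cmp e v else 0)"
proof -
 have "prj d (cmp e v) = (if d \<le> e then cmp e v else 0)" for d
 proof (cases "d \<le> e")
  case True
  then show ?thesis by (simp add: cmp_def prj_lin prj_prj del: prj.simps)
 next
  case False
  then show ?thesis using prj_prj(2)[of e d v] prj_prj(2)[of "Suc e" d v]
   by (simp add: cmp_def prj_lin del: prj.simps)
 qed
 then show ?thesis unfolding cmp_def[of d] by (auto simp del: prj.simps)
qed

text \<open>The sum telescopes; \<open>prj 0\<close> fixes \<open>kG\<close> and
  \<open>prj N\<close> has image zero.\<close>

lemma sum_cmp: "v : kG ==> (\<Sum>d<N. cmp d v) = v"
proof -
 assume v: "v : kG"
 have "(\<Sum>d<M. cmp d v) = prj 0 v - prj M v" for M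
  by (induction M) (auto simp: cmp_def simp del: prj.simps)
 moreover have "prj N v = 0" using prj_JS[of N v] JS_vanishes by auto
 moreover have "prj 0 v = v" using v by (intro prj_fix) (simp add: JS_def)
 ultimately show ?thesis by simp
qed

text \<open>The action of the class of \<open>a : JS r\<close> in \<open>JS r / JS (r + 1)\<close> on the associated graded algebra, transported
 to \<open>kG\<close> along the splitting.\<close>

definition gract :: "nat => ('p \<Rightarrow>\<^sub>0 'k) => ('p \<Rightarrow>\<^sub>0 'k) => ('p \<Rightarrow>\<^sub>0 'k)" where
 "gract r a v = (\<Sum>d<N. cmp (d + r) (a \<star> cmp d v))"

lemma gract_linear: "Vector_Spaces.linear scale scale (gract r a)"
 unfolding Vector_Spaces.linear_iff
 by (auto simp: fs.vector_space_axioms gract_def cmp_lin gmul_linear sum.distrib fs.scale_sum_right)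

lemma gract_add: "gract r (a + b) v = gract r a v + gract r b v"
 and gract_scale: "gract r (scale c a) v = scale c (gract r a v)"
 and gract_diff: "gract r (a - b) v = gract r a v - gract r b v"
 by (auto simp: gract_def cmp_lin gmul_linear sum.distrib sum_subtractf fs.scale_sum_right)

text \<open>Hence \<open>gract r a\<close> depends only on the class of \<open>a\<close> modulo
  \<open>JS (Suc r)\<close>.\<close>

lemma gract_kills: "a : JS (Suc r) ==> gract r a v = 0"
 unfolding gract_def using JS_mult[OF _ cmp_JS, of a "Suc r" _ v]
 by (intro sum.neutral ballI cmp_kills) (simp add: add.commute)

text \<open>Applying \<open>b\<close> to degree \<open>e\<close> gives an element of
  \<open>JS (e + s)\<close>. Replacing it by its leading component changes the product with
  \<open>a\<close> by an element of the next power, which the final component map kills.\<close>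

lemma gract_mult:
 assumes a: "a : JS r" and b: "b : JS s"
 shows "gract r a (gract s b v) = gract (r + s) (a \<star> b) v"
proof -
 have "gract r a (gract s b v)
   = (\<Sum>d<N. \<Sum>e<N. if d = e + s then cmp (d + r) (a \<star> cmp d (b \<star> cmp e v)) else 0)"
  unfolding gract_def cmp_sum cmp_cmp
  by (intro sum.cong refl) (auto simp: gmul_def bmul_sum_right cmp_sum cmp_lin intro!: sum.cong)
 also have "\<dots> = (\<Sum>e<N. \<Sum>d<N. if d = e + s then cmp (d + r) (a \<star> cmp d (b \<star> cmp e v)) else 0)"
  by (rule sum.swap)
 \<comment> \<open>If \<open>e + s\<close> is at least \<open>N\<close>, the inner sum has no term
   with \<open>d = e + s\<close>; the corresponding component is zero by \<open>cmp_large\<close>,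
   so both sides agree.\<close>
 also have "\<dots> = (\<Sum>e<N. cmp (e + s + r) (a \<star> cmp (e + s) (b \<star> cmp e v)))"
  by (intro sum.cong refl) (auto simp: cmp_large cmp_lin)
 also have "\<dots> = gract (r + s) (a \<star> b) v"
  unfolding gract_def
 proof (intro sum.cong refl)
  fix e
  let ?y = "b \<star> cmp e v"
  have y: "?y : JS (e + s)" using JS_mult[OF b cmp_JS[of e v]] by (simp add: add.commute)
  have "a \<star> (?y - cmp (e + s) ?y) : JS (Suc (e + s + r))"
   using JS_mult[OF a cmp_rest[OF y]] by (simp add: add_ac)
  then have "cmp (e + s + r) (a \<star> ?y - a \<star> cmp (e + s) ?y) = 0"
   by (intro cmp_kills) (simp add: gmul_linear)
  then have "cmp (e + s + r) (a \<star> cmp (e + s) ?y) = cmp (e + s + r) (a \<star> ?y)" by (simp add: cmp_lin)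
  also have "a \<star> ?y = (a \<star> b) \<star> cmp e v"
   using a b cmp_JS[of e v] JS_carrier by (simp add: gmul_assoc)
  finally show "cmp (e + s + r) (a \<star> cmp (e + s) ?y) = cmp (e + (r + s)) ((a \<star> b) \<star> cmp e v)"
   by (simp add: add_ac)
 qed
 finally show ?thesis .
qed

lift_definition gr :: "nat => ('p \<Rightarrow>\<^sub>0 'k) => ('p, 'k) endo" is gract
 by (rule gract_linear)

end

section \<open>Extension of scalars and direct sums\<close>

lemma push_superset:
 assumes "finite S" "keys f <= S"
 shows "push h f = (\<Sum>x\<in>S. single (h x) (lookup f x))"
 unfolding push_def using assms by (intro sum.mono_neutral_left) (auto simp: in_keys_iff)

lemma push_add: "push h (f + g) = push h f + push h g"
proof -
 let ?S = "keys f \<union> keys g"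
 have "keys (f + g) <= ?S" by (rule Poly_Mapping.keys_add)
 then show ?thesis
  by (simp add: push_superset[of ?S] lookup_add single_add sum.distrib)
qed

lemma push_single [simp]: "push h (single x c) = single (h x) c"
 using push_superset[of "{x}" "single x c" h] by simp

lemma push_zero [simp]: "push h 0 = 0"
 by (simp add: push_def)

lemma push_scale: "push h (scale c f) = scale c (push h (f :: 'b \<Rightarrow>\<^sub>0 'k::field))"
 using push_superset[of "keys f" "scale c f" h] keys_scale[of c f]
 by (simp add: push_def[of h f] scale_single fs.scale_sum_right)

lemma push_minus: "push h (f - g) = push h f - push h (g :: 'b \<Rightarrow>\<^sub>0 'k::ab_group_add)"
 using push_add[of h "f - g" g] by (simp add: algebra_simps)

lemma keys_push: "keys f <= B ==> h ` B <= C ==> keys (push h f) <= C"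
 by (induction f rule: poly_mapping_induct_on) (auto simp: push_add dest!: subsetD[OF Poly_Mapping.keys_add])

lemma push_push: "push h (push g f) = push (\<lambda>x. h (g x)) f"
 by (induction f rule: poly_mapping_induct_on[OF subset_refl]) (auto simp: push_add)

lemma push_cong_id: "keys f <= B ==> (\<And>x. x : B ==> h x = x) ==> push h f = f"
 by (induction f rule: poly_mapping_induct_on) (auto simp: push_add)

lemma push_hom: "h ` B <= C ==> push h : module_hom class_ring (free_space B) (free_space C)"
 by (rule module_homI) (auto simp: push_add push_scale dest: keys_push)

context k_space
begin

text \<open>Actions are defined by elementwise images. These are full cosets only if
  \<open>T\<close> maps \<open>I\<close> onto itself, which is why the later lemmas on actions ask
  for an inverse map.\<close>

lemma image_coset:
 assumes I: "subsp I" and T: "T : module_hom class_ring V V" and TI: "T ` I = I" and x: "x : carrier V"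
 shows "T ` (I +> x) = I +> T x"
proof -
 have "T ` (I +> x) = (\<lambda>i. T i \<oplus> T x) ` I"
  using x subspD(1)[OF I] module_hom_add[OF T] by (auto simp: a_r_coset_def' image_iff subset_iff)
 also have "\<dots> = (\<lambda>i. i \<oplus> T x) ` (T ` I)" by (simp add: image_image)
 also have "\<dots> = I +> T x" unfolding TI by (auto simp: a_r_coset_def')
 finally show ?thesis .
qed

end

lemma free_space_minus [simp]: "x \<ominus>\<^sub>(free_space B) y = x - y"
 if "keys x <= B" "keys y <= B" for x y :: "'b \<Rightarrow>\<^sub>0 'k::field"
proof -
 interpret k_space "free_space B :: ('k, 'b \<Rightarrow>\<^sub>0 'k) module" by (rule k_space_free_space)
 have "x \<ominus>\<^sub>(free_space B) y = x + scale (- 1) y"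
  using that sm_neg[of y] by (simp add: a_minus_def)
 then show ?thesis by simp
qed

locale scalar_extension =
 fixes A :: "'a monoid" and K :: "'k::field itself"
 assumes closed: "a : carrier A ==> b : carrier A ==> a \<otimes>\<^sub>A b : carrier A"
begin

abbreviation FS :: "('k, 'a \<Rightarrow>\<^sub>0 'k) module" where "FS \<equiv> free_space (carrier A)"
abbreviation rels :: "('a \<Rightarrow>\<^sub>0 'k) set" where "rels \<equiv> tensor_relations A"
abbreviation E :: "('k, ('a \<Rightarrow>\<^sub>0 'k) set) module" where "E \<equiv> extend_scalars A"

definition rel_gens :: "('a \<Rightarrow>\<^sub>0 'k) set" where
 "rel_gens = {single (a \<otimes>\<^sub>A b) 1 - single a 1 - single b 1
   | a b. a : carrier A \<and> b : carrier A}"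

sublocale FS: k_space FS by (rule k_space_free_space)

lemma rel_gens_carrier: "rel_gens <= carrier FS"
proof
 fix r assume "r : rel_gens"
 then obtain a b where ab: "a : carrier A" "b : carrier A"
  "r = single (a \<otimes>\<^sub>A b) 1 - single a 1 - single b 1"
  unfolding rel_gens_def by auto
 have "keys r <= carrier A"
  unfolding ab(3) using ab(1,2) closed by (intro keys_minus_subset) auto
 then show "r : carrier FS" by simp
qed

lemma rels_eq: "rels = FS.spn rel_gens"
 unfolding tensor_relations_def rel_gens_def[symmetric] by (rule FS.span_eq_spn[OF rel_gens_carrier])

lemma subsp_rels: "FS.subsp rels"
 unfolding rels_eq by (rule FS.subsp_spn[OF rel_gens_carrier])

sublocale E: k_space E
 unfolding extend_scalars_def by (rule FS.quot_space[OF subsp_rels])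

definition tens :: "'a => 'k => ('a \<Rightarrow>\<^sub>0 'k) set" where
 "tens a c = rels +>\<^sub>FS single a c"

lemma E_carrier: "carrier E = (\<lambda>x. rels +>\<^sub>FS x) ` {x. keys x <= carrier A}"
 by (simp add: extend_scalars_def quot_alg_simps)

lemma E_add: "keys x <= carrier A ==> keys y <= carrier A ==>
  (rels +>\<^sub>FS x) \<oplus>\<^sub>E (rels +>\<^sub>FS y) = rels +>\<^sub>FS (x + y)"
 using FS.quot_add[OF subsp_rels, of x y] by (simp add: extend_scalars_def)

lemma E_smult: "keys x <= carrier A ==> c \<odot>\<^sub>E (rels +>\<^sub>FS x) = rels +>\<^sub>FS scale c x"
 using FS.quot_smult[OF subsp_rels, of x c] by (simp add: extend_scalars_def)

lemma E_zero: "\<zero>\<^sub>E = rels +>\<^sub>FS 0"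
 using FS.quot_zero[OF subsp_rels] by (simp add: extend_scalars_def)

lemma tens_smult: "a : carrier A ==> tens a c = c \<odot>\<^sub>E tens a 1"
 unfolding tens_def by (subst E_smult) (auto simp: scale_single)

lemma tens_closed: "a : carrier A ==> tens a c : carrier E"
 unfolding tens_def E_carrier by (intro imageI) auto

lemma E_induct [consumes 1, case_names zero tens add]:
 assumes "X : carrier E" "P \<zero>\<^sub>E" "\<And>a c. a : carrier A ==> P (c \<odot>\<^sub>E tens a 1)"
  "\<And>X Y. X : carrier E ==> Y : carrier E ==> P X ==> P Y ==> P (X \<oplus>\<^sub>E Y)"
 shows "P X"
proof -
 obtain x where x: "keys x <= carrier A" "X = rels +>\<^sub>FS x" using assms(1) by (auto simp: E_carrier)
 from x(1) have "P (rels +>\<^sub>FS x)"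
 proof (induction x rule: poly_mapping_induct_on)
  case (single a c)
  then show ?case using assms(3)[of a c] tens_smult[of a c] by (simp add: tens_def)
 next
  case (add x y)
  then have "P ((rels +>\<^sub>FS x) \<oplus>\<^sub>E (rels +>\<^sub>FS y))"
   by (intro assms(4)) (auto simp: E_carrier)
  then show ?case using add by (simp add: E_add)
 qed (use assms(2) E_zero in auto)
 then show ?thesis using x by simp
qed

context
 fixes W :: "('k, 'w) module" and h :: "'a => 'w"
 assumes W: "k_space W" and h: "\<And>a. a : carrier A ==> h a : carrier W"
  and h_mult: "\<And>a b. a : carrier A ==> b : carrier A ==> h (a \<otimes>\<^sub>A b) = h a \<oplus>\<^sub>W h b"
begin

text \<open>The linear map out of the extension of scalars that its universal property attaches to
  \<open>h\<close>. It is evaluated at an arbitrary representative, and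
  \<open>lift_fun_coset\<close> shows that the choice does not matter.\<close>

definition lift_fun :: "('a \<Rightarrow>\<^sub>0 'k) set => 'w" where
 "lift_fun X = k_space.lext W h (SOME x. x : X)"

lemma lift_fun_coset:
 assumes x: "keys x <= carrier A"
 shows "lift_fun (rels +>\<^sub>FS x) = k_space.lext W h x"
proof -
 interpret W: k_space W by (rule W)
 interpret L: k_linear FS W "W.lext h"
  by unfold_locales (intro W.lext_hom h)
 have "FS.subsp {x : carrier FS. W.lext h x : {\<zero>\<^sub>W}}"
  by (intro L.subsp_vimage) (auto simp: W.subsp_def)
 moreover have "rel_gens <= {x : carrier FS. W.lext h x : {\<zero>\<^sub>W}}"
 proof
  fix r assume r: "r : rel_gens"
  then obtain a b where ab: "a : carrier A" "b : carrier A"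
   "r = single (a \<otimes>\<^sub>A b) 1 - single a 1 - single b 1"
   unfolding rel_gens_def by auto
  have k: "keys (single (a \<otimes>\<^sub>A b) (1::'k) - single a 1) <= carrier A"
   using ab closed by (intro keys_minus_subset) auto
  have "W.lext h r = (h (a \<otimes>\<^sub>A b) \<ominus>\<^sub>W h a) \<ominus>\<^sub>W h b"
   using L.f_minus[of "single (a \<otimes>\<^sub>A b) 1 - single a 1" "single b 1"]
    L.f_minus[of "single (a \<otimes>\<^sub>A b) 1" "single a 1"] k ab closed h
   by simp
  also have "\<dots> = \<zero>\<^sub>W"
   using ab h by (simp add: h_mult a_minus_def W.a_assoc W.a_comm[of "h b"] W.r_neg)
  finally show "r : {x : carrier FS. W.lext h x : {\<zero>\<^sub>W}}" using r rel_gens_carrier by auto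
 qed
 ultimately have ker: "rels <= {x : carrier FS. W.lext h x : {\<zero>\<^sub>W}}"
  unfolding rels_eq by (rule FS.spn_least)
 define y where "y = (SOME y. y : rels +>\<^sub>FS x)"
 have "x : rels +>\<^sub>FS x" using x FS.quot_mem_iff[OF subsp_rels, of x x] FS.subspD(2)[OF subsp_rels] by simp
 then have "y : rels +>\<^sub>FS x" unfolding y_def by (rule someI)
 then have y: "keys y <= carrier A" "y - x : rels"
  using x FS.quot_mem_iff[OF subsp_rels, of x y] by auto
 then have "W.lext h (y - x) = \<zero>\<^sub>W" using ker by auto
 then have "W.lext h y \<ominus>\<^sub>W W.lext h x = \<zero>\<^sub>W" using L.f_minus[of y x] x y by simp
 then show ?thesis using x y W.minus_eq_zero_iff by (auto simp: lift_fun_def y_def)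
qed

lemma lift_fun_hom: "lift_fun : module_hom class_ring E W"
proof -
 interpret W: k_space W by (rule W)
 show ?thesis
  by (rule module_homI) (auto simp: E_carrier E_add E_smult lift_fun_coset keys_scale_subset 
    keys_add_subset W.lext_add[OF _ _ h] W.lext_scale[OF _ h] W.lext_closed[OF _ h])
qed

lemma lift_fun_tens: "a : carrier A ==> lift_fun (tens a 1) = h a"
proof -
 interpret W: k_space W by (rule W)
 show "a : carrier A ==> lift_fun (tens a 1) = h a"
  using h unfolding tens_def by (subst lift_fun_coset) auto
qed

end

text \<open>A multiplicative map sends relations to relations. Applying this to the right inverse
  \<open>h'\<close> as well gives the equality of \<open>rels\<close> with its image that
  \<open>image_coset\<close> requires.\<close>

lemma push_coset:
 assumes h: "\<And>a. a : carrier A ==> h a : carrier A" "\<And>a. a : carrier A ==> h' a : carrier A"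
  and inv: "\<And>a. a : carrier A ==> h (h' a) = a" 
  and mult: "\<And>a b. a : carrier A ==> b : carrier A ==> h (a \<otimes>\<^sub>A b) = h a \<otimes>\<^sub>A h b"
   "\<And>a b. a : carrier A ==> b : carrier A ==> h' (a \<otimes>\<^sub>A b) = h' a \<otimes>\<^sub>A h' b"
  and x: "keys x <= carrier A"
 shows "push h ` (rels +>\<^sub>FS x) = rels +>\<^sub>FS push h x"
proof -
 have sub: "push h ` rels <= rels" 
  if h: "\<And>a. a : carrier A ==> h a : carrier A"
   and mult: "\<And>a b. a : carrier A ==> b : carrier A ==> h (a \<otimes>\<^sub>A b) = h a \<otimes>\<^sub>A h b" for h
 proof -
  interpret L: k_linear FS FS "push h"
   using push_hom[of h "carrier A" "carrier A"] h by unfold_locales auto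
  have "FS.subsp {x : carrier FS. push h x : rels}" by (rule L.subsp_vimage[OF subsp_rels])
  moreover have "rel_gens <= {x : carrier FS. push h x : rels}"
  proof
   fix r assume r: "r : rel_gens"
   then obtain a b where ab: "a : carrier A" "b : carrier A"
    "r = single (a \<otimes>\<^sub>A b) 1 - single a 1 - single b 1"
    unfolding rel_gens_def by auto
   then have "push h r = single (h a \<otimes>\<^sub>A h b) 1 - single (h a) 1 - single (h b) 1"
    using mult by (simp add: push_minus)
   then have "push h r : rel_gens" unfolding rel_gens_def using ab h by blast
   then have "push h r : rels" unfolding rels_eq by (rule FS.spn_superset[OF rel_gens_carrier])
   then show "r : {x : carrier FS. push h x : rels}" using r rel_gens_carrier by auto
  qed
  ultimately have "FS.spn rel_gens <= {x : carrier FS. push h x : rels}" by (rule FS.spn_least)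
  then show ?thesis unfolding rels_eq by auto
 qed
 have "rels <= push h ` rels"
 proof
  fix r assume r: "r : rels"
  then have "push h' r : rels" using sub[of h'] h mult by auto
  moreover have "push h (push h' r) = r"
   using r FS.subspD(1)[OF subsp_rels] unfolding push_push by (intro push_cong_id[of _ "carrier A"]) (auto simp: inv)
  ultimately show "r : push h ` rels" by (metis imageI)
 qed
 with sub[of h] h mult have "push h ` rels = rels" by blast
 then show ?thesis
  using FS.image_coset[OF subsp_rels, of "push h" x] push_hom[of h "carrier A" "carrier A"] h x by auto
qed

end

lemma direct_sum_simps:
 "carrier (direct_sum I M) = {v : (\<Pi>\<^sub>E i\<in>I. carrier (M i)). finite {i : I. v i ~= \<zero>\<^sub>(M i)}}"
 "\<zero>\<^sub>(direct_sum I M) = (\<lambda>i\<in>I. \<zero>\<^sub>(M i))"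
 "u \<oplus>\<^sub>(direct_sum I M) v = (\<lambda>i\<in>I. u i \<oplus>\<^sub>(M i) v i)"
 "c \<odot>\<^sub>(direct_sum I M) v = (\<lambda>i\<in>I. c \<odot>\<^sub>(M i) v i)"
 by (simp_all add: direct_sum_def)

locale k_direct_sum =
 fixes I :: "'i set" and M :: "'i => ('k::field, 'a) module"
 assumes spaces: "\<And>i. i : I ==> k_space (M i)"
begin

abbreviation D where "D \<equiv> direct_sum I M"

definition inj :: "'i => 'a => 'i => 'a" where
 "inj i x = (\<lambda>j\<in>I. if j = i then x else \<zero>\<^sub>(M j))"

lemma space_D: "k_space D"
proof (rule k_spaceI)
 note [simp] = direct_sum_simps
 have M: "k_space (M i)" if "i : I" for i using spaces that by auto
 have sp: "\<zero>\<^sub>(M i) : carrier (M i)" "x : carrier (M i) ==> y : carrier (M i) ==> x \<oplus>\<^sub>(M i) y : carrier (M i)"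
  "\<zero>\<^sub>(M i) \<oplus>\<^sub>(M i) \<zero>\<^sub>(M i) = \<zero>\<^sub>(M i)" "c \<odot>\<^sub>(M i) \<zero>\<^sub>(M i) = \<zero>\<^sub>(M i)"
  "x : carrier (M i) ==> y : carrier (M i) ==> x \<oplus>\<^sub>(M i) y = y \<oplus>\<^sub>(M i) x"
  "x : carrier (M i) ==> y : carrier (M i) ==> z : carrier (M i) ==> x \<oplus>\<^sub>(M i) y \<oplus>\<^sub>(M i) z = x \<oplus>\<^sub>(M i) (y \<oplus>\<^sub>(M i) z)"
  "x : carrier (M i) ==> c \<odot>\<^sub>(M i) x : carrier (M i)"
  "x : carrier (M i) ==> x \<oplus>\<^sub>(M i) \<zero>\<^sub>(M i) = x"
  "x : carrier (M i) ==> c \<odot>\<^sub>(M i) (d \<odot>\<^sub>(M i) x) = (c * d) \<odot>\<^sub>(M i) x"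
  "x : carrier (M i) ==> 1 \<odot>\<^sub>(M i) x = x" "x : carrier (M i) ==> 0 \<odot>\<^sub>(M i) x = \<zero>\<^sub>(M i)"
  "x : carrier (M i) ==> (c + d) \<odot>\<^sub>(M i) x = c \<odot>\<^sub>(M i) x \<oplus>\<^sub>(M i) d \<odot>\<^sub>(M i) x"
  "x : carrier (M i) ==> y : carrier (M i) ==> c \<odot>\<^sub>(M i) (x \<oplus>\<^sub>(M i) y) = c \<odot>\<^sub>(M i) x \<oplus>\<^sub>(M i) c \<odot>\<^sub>(M i) y"
  if "i : I" for i x y z c d
 proof -
  interpret k_space "M i" using M that .
  show "\<zero>\<^sub>(M i) : carrier (M i)" "x : carrier (M i) ==> y : carrier (M i) ==> x \<oplus>\<^sub>(M i) y : carrier (M i)"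
  "\<zero>\<^sub>(M i) \<oplus>\<^sub>(M i) \<zero>\<^sub>(M i) = \<zero>\<^sub>(M i)" "c \<odot>\<^sub>(M i) \<zero>\<^sub>(M i) = \<zero>\<^sub>(M i)"
  "x : carrier (M i) ==> y : carrier (M i) ==> z : carrier (M i) ==> x \<oplus>\<^sub>(M i) y \<oplus>\<^sub>(M i) z = x \<oplus>\<^sub>(M i) (y \<oplus>\<^sub>(M i) z)"
  "x : carrier (M i) ==> c \<odot>\<^sub>(M i) x : carrier (M i)"
  "x : carrier (M i) ==> x \<oplus>\<^sub>(M i) \<zero>\<^sub>(M i) = x"
  "x : carrier (M i) ==> c \<odot>\<^sub>(M i) (d \<odot>\<^sub>(M i) x) = (c * d) \<odot>\<^sub>(M i) x"
  "x : carrier (M i) ==> 1 \<odot>\<^sub>(M i) x = x" "x : carrier (M i) ==> 0 \<odot>\<^sub>(M i) x = \<zero>\<^sub>(M i)"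
  "x : carrier (M i) ==> (c + d) \<odot>\<^sub>(M i) x = c \<odot>\<^sub>(M i) x \<oplus>\<^sub>(M i) d \<odot>\<^sub>(M i) x"
  "x : carrier (M i) ==> y : carrier (M i) ==> c \<odot>\<^sub>(M i) (x \<oplus>\<^sub>(M i) y) = c \<odot>\<^sub>(M i) x \<oplus>\<^sub>(M i) c \<odot>\<^sub>(M i) y"
   by (auto simp: a_assoc sm_sm sm_add_l sm_add_r)
  show "x : carrier (M i) ==> y : carrier (M i) ==> x \<oplus>\<^sub>(M i) y = y \<oplus>\<^sub>(M i) x"
   by (rule a_comm)
 qed
 show "\<zero>\<^sub>D : carrier D" using sp(1) by auto
 fix u assume u: "u : carrier D"
 then have ui: "u i : carrier (M i)" if "i : I" for i using that by auto
 show "u \<oplus>\<^sub>D \<zero>\<^sub>D = u" "1 \<odot>\<^sub>D u = u" "0 \<odot>\<^sub>D u = \<zero>\<^sub>D"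
  using u ui by (auto simp: fun_eq_iff sp(8,10,11) PiE_iff extensional_def)
 show "c \<odot>\<^sub>D u : carrier D" for c
 proof -
  have "finite {i : I. c \<odot>\<^sub>(M i) u i ~= \<zero>\<^sub>(M i)}"
   using u by (auto intro: finite_subset[of _ "{i : I. u i ~= \<zero>\<^sub>(M i)}"] simp: sp(4))
  then show ?thesis using ui by (auto simp: sp(7) cong: conj_cong)
 qed
 show "(c * d) \<odot>\<^sub>D u = c \<odot>\<^sub>D (d \<odot>\<^sub>D u)" "(c + d) \<odot>\<^sub>D u = c \<odot>\<^sub>D u \<oplus>\<^sub>D d \<odot>\<^sub>D u" for c d
  using ui by (auto simp: fun_eq_iff sp(9,12))
 fix v assume v: "v : carrier D"
 then have vi: "v i : carrier (M i)" if "i : I" for i using that by auto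
 show "u \<oplus>\<^sub>D v : carrier D"
 proof -
  have fu: "finite {i : I. u i ~= \<zero>\<^sub>(M i)}" and fv: "finite {i : I. v i ~= \<zero>\<^sub>(M i)}"
   using u v by simp_all
  have "{i : I. u i \<oplus>\<^sub>(M i) v i ~= \<zero>\<^sub>(M i)} <= {i : I. u i ~= \<zero>\<^sub>(M i)} \<union> {i : I. v i ~= \<zero>\<^sub>(M i)}"
  proof
   fix i assume i: "i : {i : I. u i \<oplus>\<^sub>(M i) v i ~= \<zero>\<^sub>(M i)}"
   then show "i : {i : I. u i ~= \<zero>\<^sub>(M i)} \<union> {i : I. v i ~= \<zero>\<^sub>(M i)}"
    using sp(3)[of i] by (cases "u i = \<zero>\<^sub>(M i)"; cases "v i = \<zero>\<^sub>(M i)") simp_all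
  qed
  then have "finite {i : I. u i \<oplus>\<^sub>(M i) v i ~= \<zero>\<^sub>(M i)}"
   by (rule finite_subset[OF _ finite_UnI[OF fu fv]])
  then show ?thesis using ui vi sp(2) by (simp cong: conj_cong)
 qed
 show "u \<oplus>\<^sub>D v = v \<oplus>\<^sub>D u" using ui vi by (auto simp: fun_eq_iff sp(5))
 show "c \<odot>\<^sub>D (u \<oplus>\<^sub>D v) = c \<odot>\<^sub>D u \<oplus>\<^sub>D c \<odot>\<^sub>D v" for c
  using ui vi by (auto simp: fun_eq_iff sp(13))
 fix w assume w: "w : carrier D"
 then have wi: "w i : carrier (M i)" if "i : I" for i using that by auto
 show "(u \<oplus>\<^sub>D v) \<oplus>\<^sub>D w = u \<oplus>\<^sub>D (v \<oplus>\<^sub>D w)"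
  using ui vi wi by (auto simp: fun_eq_iff sp(6))
qed

sublocale D: k_space D by (rule space_D)

lemma inj_closed:
 assumes "i : I" "x : carrier (M i)"
 shows "inj i x : carrier D"
proof -
 have "\<zero>\<^sub>(M j) : carrier (M j)" if "j : I" for j
 proof -
  interpret k_space "M j" using spaces that .
  show ?thesis by simp
 qed
 moreover have "finite {j : I. inj i x j ~= \<zero>\<^sub>(M j)}"
  by (rule finite_subset[of _ "{i}"]) (auto simp: inj_def)
 ultimately show ?thesis using assms by (auto simp: direct_sum_simps inj_def)
qed

lemma inj_add: "i : I ==> inj i (x \<oplus>\<^sub>(M i) y) = inj i x \<oplus>\<^sub>D inj i y"
proof -
 assume i: "i : I"
 have "\<zero>\<^sub>(M j) \<oplus>\<^sub>(M j) \<zero>\<^sub>(M j) = \<zero>\<^sub>(M j)" if "j : I" for j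
 proof -
  interpret k_space "M j" using spaces that .
  show ?thesis by simp
 qed
 then show ?thesis by (auto simp: direct_sum_simps inj_def fun_eq_iff)
qed

lemma inj_smult: "i : I ==> inj i (c \<odot>\<^sub>(M i) x) = c \<odot>\<^sub>D inj i x"
proof -
 assume i: "i : I"
 have "c \<odot>\<^sub>(M j) \<zero>\<^sub>(M j) = \<zero>\<^sub>(M j)" if "j : I" for j
 proof -
  interpret k_space "M j" using spaces that .
  show ?thesis by simp
 qed
 then show ?thesis by (auto simp: direct_sum_simps inj_def fun_eq_iff)
qed

lemma inj_zero: "inj i \<zero>\<^sub>(M i) = \<zero>\<^sub>D"
 by (auto simp: direct_sum_simps inj_def fun_eq_iff)

lemma D_induct [consumes 1, case_names zero inj add]:
 assumes "v : carrier D" "P \<zero>\<^sub>D" "\<And>i x. i : I ==> x : carrier (M i) ==> P (inj i x)"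
  "\<And>u v. u : carrier D ==> v : carrier D ==> P u ==> P v ==> P (u \<oplus>\<^sub>D v)"
 shows "P v"
proof -
 have "P v" if "finite S" "v : carrier D" "{i : I. v i ~= \<zero>\<^sub>(M i)} = S" for S v
  using that
 proof (induction S arbitrary: v rule: finite_induct)
  case empty
  then have "v = \<zero>\<^sub>D" by (auto simp: direct_sum_simps fun_eq_iff PiE_iff extensional_def)
  then show ?case using assms(2) by simp
 next
  case (insert i S)
  have i: "i : I" using insert by auto
  let ?u = "v(i := \<zero>\<^sub>(M i))"
  interpret Mi: k_space "M i" using spaces i .
  have vj: "v j : carrier (M j)" if "j : I" for j using insert that by (auto simp: direct_sum_simps)
  have S: "{j : I. ?u j ~= \<zero>\<^sub>(M j)} = S" using insert i by auto
  then have uc: "?u : carrier D"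
   using insert.prems i insert.hyps by (auto simp: direct_sum_simps PiE_iff extensional_def)
  have "P ?u" using insert.IH[OF uc S] .
  moreover have "P (inj i (v i))" using assms(3) i vj by auto
  ultimately have "P (inj i (v i) \<oplus>\<^sub>D ?u)"
   using assms(4)[OF inj_closed[OF i vj[OF i]] uc] by auto
  also have "inj i (v i) \<oplus>\<^sub>D ?u = v"
  proof (rule ext)
   fix j
   show "(inj i (v i) \<oplus>\<^sub>D ?u) j = v j"
   proof (cases "j : I")
    case True
    interpret Mj: k_space "M j" using spaces True .
    show ?thesis using True vj[OF True] by (auto simp: direct_sum_simps inj_def)
   next
    case False
    then show ?thesis using insert.prems by (auto simp: direct_sum_simps PiE_iff extensional_def)
   qed
  qed
  finally show ?case .
 qed
 then show ?thesis using assms(1) by (auto simp: direct_sum_simps)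
qed

end

section \<open>The Jennings Lie algebra of a finite p-group\<close>

lemma endo_eqI: "(\<And>v. app f v = app g v) ==> f = g"
 by (metis app_inject ext)

lemma smult_endo_sum: "smult_endo c (\<Sum>i\<in>I. f i) = (\<Sum>i\<in>I. smult_endo c (f i))"
proof (induction I rule: infinite_finite_induct)
 have z: "smult_endo c 0 = 0" by (intro endo_eqI) (simp add: smult_endo.rep_eq zero_endo.rep_eq)
 show "smult_endo c (sum f {}) = (\<Sum>i\<in>{}. smult_endo c (f i))" using z by simp
 show "infinite A ==> smult_endo c (sum f A) = (\<Sum>i\<in>A. smult_endo c (f i))" for A using z by simp
qed (simp add: smult_endo_laws)

context p_group_algebra
begin

definition F :: "nat => 'p set" where "F = jennings_filtration TYPE('k) G"

lemma F_iff: "g : F r \<longleftrightarrow> g : carrier G \<and> del g : JS r"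
 by (simp add: F_def jennings_filtration_eq)

lemma F_closed: "g : F r ==> g : carrier G"
 by (simp add: F_iff)

lemma F_1: "F 1 = carrier G"
 using del_JS by (auto simp: F_iff)

lemma F_Suc: "F (Suc r) <= F r"
 by (auto simp: F_iff dest: subsetD[OF JS_Suc])

lemma del_mult: "x : carrier G ==> y : carrier G ==> del (x \<otimes> y) = del x + ge x \<star> del y"
 by (simp add: ge_del)

lemma del_inv: "x : carrier G ==> del (inv x) = - (ge (inv x) \<star> del x)"
 by (simp add: ge_del) (simp add: del_def)

lemma F_subgroup: "subgroup (F r) G"
proof
 show "x \<otimes> y : F r" if "x : F r" "y : F r" for x y
  using that by (auto simp: F_iff del_mult intro!: JS_add JS_left)
 show "inv x : F r" if "x : F r" for x
  using that by (simp add: F_iff del_inv JS_left fs.subspace_neg[OF subspace_JS])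
qed (auto simp: F_iff del_def JS_zero)

lemma F_conj: "x : carrier G ==> h : F r ==> x \<otimes> h \<otimes> inv x : F r"
proof -
 assume x: "x : carrier G" and h: "h : F r"
 have "(ge x \<star> del h) \<star> ge (inv x) = del (x \<otimes> h \<otimes> inv x)"
  using x F_closed[OF h] by (simp add: ge_del gmul_linear ge_mult) (simp add: del_def)
 moreover have "(ge x \<star> del h) \<star> ge (inv x) : JS r"
  using x h by (simp add: F_iff JS_left JS_right)
 ultimately show ?thesis using x F_closed[OF h] by (simp add: F_iff)
qed

lemma F_normal: "F (Suc r) \<lhd> (G\<lparr>carrier := F r\<rparr>)"
proof -
 interpret Fr: subgroup "F r" G by (rule F_subgroup)
 have sub: "subgroup (F (Suc r)) (G\<lparr>carrier := F r\<rparr>)"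
  using subgroup_incl[OF F_subgroup F_subgroup F_Suc] .
 show ?thesis
  unfolding group.normal_inv_iff[OF Fr.subgroup_is_group[OF group_axioms]]
 proof (intro conjI ballI sub)
  fix x h assume "x : carrier (G\<lparr>carrier := F r\<rparr>)" "h : F (Suc r)"
  then show "x \<otimes>\<^sub>(G\<lparr>carrier := F r\<rparr>) h \<otimes>\<^sub>(G\<lparr>carrier := F r\<rparr>) inv\<^bsub>G\<lparr>carrier := F r\<rparr>\<^esub> x : F (Suc r)"
   using F_conj[of x h "Suc r"] F_closed m_inv_consistent[OF F_subgroup, of x r] by simp
 qed
qed

definition Q :: "nat => 'p set monoid" where "Q = jennings_factor TYPE('k) G"

definition cl :: "nat => 'p => 'p set" where "cl r a = F (Suc r) #> a"

lemma Q_carrier: "carrier (Q r) = cl r ` F r"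
 by (auto simp: Q_def jennings_factor_def F_def[symmetric] FactGroup_def RCOSETS_def r_coset_def cl_def)

lemma Q_mult: "a : F r ==> b : F r ==> cl r a \<otimes>\<^sub>(Q r) cl r b = cl r (a \<otimes> b)"
 using normal.rcos_sum[OF F_normal, of a r b]
 by (simp add: Q_def jennings_factor_def F_def[symmetric] FactGroup_def cl_def r_coset_def set_mult_def)

lemma cl_mem: "a : F r ==> x : cl r a ==> x : F r \<and> (\<exists>h\<in>F (Suc r). x = h \<otimes> a)"
 using F_subgroup[of r] F_Suc[of r] by (auto simp: cl_def r_coset_def subgroup.m_closed subset_iff)

lemma cl_self: "a : carrier G ==> a : cl r a"
 using subgroup.one_closed[OF F_subgroup[of "Suc r"]] by (force simp: cl_def r_coset_def)

lemma F_mult: "a : F r ==> b : F r ==> a \<otimes> b : F r"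
 using subgroup.m_closed[OF F_subgroup] .

lemma scalar_extension_Q: "scalar_extension (Q r)"
 by unfold_locales (use F_mult in \<open>auto simp: Q_carrier Q_mult\<close>)

sublocale ext: scalar_extension "Q r" K for r by (rule scalar_extension_Q)

abbreviation Jen :: "('k, ('k, 'p) jen) module" where "Jen \<equiv> jennings_space G"

sublocale sum: k_direct_sum "{1..}" "\<lambda>r. extend_scalars (Q r) :: ('k, ('p set \<Rightarrow>\<^sub>0 'k) set) module"
 by (rule k_direct_sum.intro) (rule ext.E.k_space_axioms)

lemma Jen_def: "Jen = direct_sum {1..} (\<lambda>r. extend_scalars (Q r))"
 by (simp add: jennings_space_def Q_def)

lemma space_Jen: "k_space Jen"
 unfolding Jen_def by (rule sum.space_D)

abbreviation jelt :: "nat => 'p => ('k, 'p) jen" where "jelt \<equiv> jennings_elt G"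

lemma jelt_eq: "jelt r a = sum.inj r (ext.tens r (cl r a) 1)"
 unfolding jennings_elt_def sum.inj_def ext.tens_def cl_def Let_def
 by (rule ext) (simp add: restrict_def Q_def F_def del: One_nat_def)

lemma jelt_closed: "r \<ge> 1 ==> a : F r ==> jelt r a : carrier Jen"
 unfolding jelt_eq Jen_def by (intro sum.inj_closed ext.tens_closed) (auto simp: Q_carrier)

text \<open>The homogeneous elements \<open>1 \<otimes> a\<close> span the Jennings space.
  Multilinear identities are thereby reduced to group elements, where bracket and
  \<open>p\<close>-map are prescribed.\<close>

lemma jen_induct [consumes 1, case_names zero elt add]:
 assumes "v : carrier Jen" "P \<zero>\<^sub>Jen"
  "\<And>r a c. r \<ge> 1 ==> a : F r ==> P (c \<odot>\<^sub>Jen jelt r a)"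
  "\<And>u v. u : carrier Jen ==> v : carrier Jen ==> P u ==> P v ==> P (u \<oplus>\<^sub>Jen v)"
 shows "P v"
 using assms(1) unfolding Jen_def
proof (induction v rule: sum.D_induct)
 case zero
 then show ?case using assms(2) by (simp add: Jen_def)
next
 case (inj r X)
 have r: "r \<ge> 1" using inj by simp
 from inj(2) show ?case
 proof (induction X rule: ext.E_induct)
  case zero
  then show ?case using assms(2) by (simp add: Jen_def sum.inj_zero del: One_nat_def)
 next
  case (tens C c)
  then obtain a where "a : F r" "C = cl r a" by (auto simp: Q_carrier)
  then show ?case using assms(3)[OF r, of a c] r by (simp add: sum.inj_smult jelt_eq Jen_def del: One_nat_def)
 next
  case (add X Y)
  then show ?case using assms(4)[of "sum.inj r X" "sum.inj r Y"] r
   by (simp add: Jen_def sum.inj_add sum.inj_closed del: One_nat_def)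
 qed
next
 case (add u v)
 then show ?case using assms(4) by (simp add: Jen_def del: One_nat_def)
qed

subsection \<open>The map to the associated graded algebra\<close>

definition rep_gr :: "nat => 'p set => ('p, 'k) endo" where
 "rep_gr r C = gr r (del (SOME a. a : C))"

text \<open>Two representatives are related by \<open>b = h a\<close> with \<open>h\<close> in
  \<open>F (Suc r)\<close>. Then \<open>b - 1\<close> and \<open>a - 1\<close> differ by
  \<open>(h - 1) a\<close>, which lies in \<open>JS (Suc r)\<close> and acts by zero.\<close>

lemma rep_gr_cl: "r \<ge> 1 ==> a : F r ==> rep_gr r (cl r a) = gr r (del a)"
proof -
 assume r: "r \<ge> 1" and a: "a : F r"
 define b where "b = (SOME b. b : cl r a)"
 have "b : cl r a" unfolding b_def using cl_self[OF F_closed[OF a]] by (rule someI)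
 then obtain h where h: "h : F (Suc r)" "b = h \<otimes> a" using cl_mem[OF a] by blast
 have "del b = del h + ge h \<star> del a" using h a F_closed by (simp add: del_mult)
 also have "\<dots> = (del h + del h \<star> del a) + del a"
  using ge_eq_del[of h] h a F_closed by (simp add: gmul_linear gmul_one)
 finally have "del b = (del h + del h \<star> del a) + del a" .
 moreover have "del h + del h \<star> del a : JS (Suc r)"
  using h a F_closed by (simp add: JS_add JS_right F_iff)
 then have "gract r (del h + del h \<star> del a) v = 0" for v by (rule gract_kills)
 ultimately have "gr r (del b) = gr r (del a)"
  by (intro endo_eqI) (simp add: gr.rep_eq gract_add[of r _ "del a"])
 then show ?thesis by (simp add: rep_gr_def b_def)
qed

text \<open>\<open>a b - 1\<close> is the sum of \<open>a - 1\<close>, \<open>b - 1\<close> and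
  \<open>(a - 1) (b - 1)\<close>. The last term lies in \<open>JS (r + r)\<close>, hence in
  \<open>JS (Suc r)\<close> because \<open>r\<close> is positive.\<close>

lemma rep_gr_mult:
 assumes r: "r \<ge> 1" and C: "C : carrier (Q r)" "C' : carrier (Q r)"
 shows "rep_gr r (C \<otimes>\<^sub>(Q r) C') = rep_gr r C \<oplus>\<^sub>endo_algebra rep_gr r C'"
proof -
 obtain a b where ab: "a : F r" "C = cl r a" "b : F r" "C' = cl r b" using C by (auto simp: Q_carrier)
 have "del (a \<otimes> b) = del a + del b + del a \<star> del b"
  using ab F_closed ge_eq_del[of a] by (simp add: del_mult gmul_linear gmul_one)
 moreover have "del a \<star> del b : JS (Suc r)"
  using JS_mult[of "del a" r "del b" r] ab r JS_mono[of "Suc r" "r + r"] by (auto simp: F_iff)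
 ultimately have "gr r (del (a \<otimes> b)) = gr r (del a) + gr r (del b)"
  by (intro endo_eqI) (simp add: gr.rep_eq plus_endo.rep_eq gract_add gract_kills)
 then show ?thesis using ab r F_mult by (simp add: Q_mult rep_gr_cl)
qed

text \<open>Every homogeneous component acts by its own degree. Degrees from \<open>N\<close> on may
  be cut off, since there \<open>a - 1\<close> is already zero.\<close>

definition jmap :: "('k, 'p) jen => ('p, 'k) endo" where
 "jmap v = (\<Sum>r\<in>{1..<N}. ext.lift_fun endo_algebra (rep_gr r) (v r))"

lemma
 assumes "r \<ge> 1"
 shows lift_rep_gr_hom: "ext.lift_fun endo_algebra (rep_gr r) : module_hom class_ring (extend_scalars (Q r)) endo_algebra"
  and lift_rep_gr_tens: "C : carrier (Q r) ==> ext.lift_fun endo_algebra (rep_gr r) (ext.tens r C 1) = rep_gr r C"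
proof -
 interpret B: k_algebra "endo_algebra :: ('k, ('p, 'k) endo) module" by (rule endo_algebra)
 have B: "k_space (endo_algebra :: ('k, ('p, 'k) endo) module)" by unfold_locales
 show "ext.lift_fun endo_algebra (rep_gr r) : module_hom class_ring (extend_scalars (Q r)) endo_algebra"
  using assms by (intro ext.lift_fun_hom[OF B]) (auto simp: rep_gr_mult)
 show "C : carrier (Q r) ==> ext.lift_fun endo_algebra (rep_gr r) (ext.tens r C 1) = rep_gr r C"
  using assms by (intro ext.lift_fun_tens[OF B]) (auto simp: rep_gr_mult)
qed

lemma Jen_apply: "v : carrier Jen ==> r \<ge> 1 ==> v r : carrier (extend_scalars (Q r))"
 by (auto simp: Jen_def direct_sum_simps)

lemma jmap_hom: "jmap : module_hom class_ring Jen endo_algebra"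
proof (rule module_homI)
 fix u v assume uv: "u : carrier Jen" "v : carrier Jen"
 show "jmap (u \<oplus>\<^sub>Jen v) = jmap u \<oplus>\<^sub>endo_algebra jmap v"
  unfolding jmap_def endo_algebra_simps sum.distrib[symmetric]
 proof (intro sum.cong refl)
  fix r assume r: "r : {1..<N}"
  then have "(u \<oplus>\<^sub>Jen v) r = u r \<oplus>\<^sub>(extend_scalars (Q r)) v r" by (simp add: Jen_def direct_sum_simps)
  then show "ext.lift_fun endo_algebra (rep_gr r) ((u \<oplus>\<^sub>Jen v) r) =
    ext.lift_fun endo_algebra (rep_gr r) (u r) + ext.lift_fun endo_algebra (rep_gr r) (v r)"
   using module_hom_add[OF lift_rep_gr_hom[of r], of "u r" "v r"] r uv Jen_apply by simp
 qed
 fix c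
 show "jmap (c \<odot>\<^sub>Jen u) = c \<odot>\<^sub>endo_algebra jmap u"
 proof -
  have "jmap (c \<odot>\<^sub>Jen u) = (\<Sum>r\<in>{1..<N}. smult_endo c (ext.lift_fun endo_algebra (rep_gr r) (u r)))"
   unfolding jmap_def
  proof (intro sum.cong refl)
   fix r assume r: "r : {1..<N}"
   then have "(c \<odot>\<^sub>Jen u) r = c \<odot>\<^sub>(extend_scalars (Q r)) u r" by (simp add: Jen_def direct_sum_simps)
   then show "ext.lift_fun endo_algebra (rep_gr r) ((c \<odot>\<^sub>Jen u) r) =
     smult_endo c (ext.lift_fun endo_algebra (rep_gr r) (u r))"
    using module_hom_smult[OF lift_rep_gr_hom[of r], of c "u r"] r uv Jen_apply by simp
  qed
  also have "\<dots> = smult_endo c (jmap u)"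
   unfolding jmap_def by (simp add: smult_endo_sum)
  finally show ?thesis by simp
 qed
qed simp

lemma jmap_jelt:
 assumes r: "r \<ge> 1" and a: "a : F r"
 shows "jmap (jelt r a) = gr r (del a)"
proof -
 have "jmap (jelt r a) = (\<Sum>s\<in>{1..<N}. if s = r then gr r (del a) else 0)"
  unfolding jmap_def
 proof (intro sum.cong refl)
  fix s assume s: "s : {1..<N}"
  interpret E: k_space "extend_scalars (Q s) :: ('k, ('p set \<Rightarrow>\<^sub>0 'k) set) module" by unfold_locales
  have z: "ext.lift_fun endo_algebra (rep_gr s) \<zero>\<^sub>(extend_scalars (Q s)) = 0"
   using module_hom_smult[OF lift_rep_gr_hom[of s], of 0 "\<zero>\<^sub>(extend_scalars (Q s))"] s
   by (simp add: smult_endo_laws)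
  show "ext.lift_fun endo_algebra (rep_gr s) (jelt r a s) = (if s = r then gr r (del a) else 0)"
   using s a r z by (auto simp: jelt_eq sum.inj_def lift_rep_gr_tens Q_carrier rep_gr_cl simp del: One_nat_def)
 qed
 also have "\<dots> = gr r (del a)"
 proof (cases "r < N")
  case False
  then have "del a = 0" using a JS_large[of r "del a"] False by (simp add: F_iff)
  then have "gr r (del a) = 0" by (intro endo_eqI) (simp add: gr.rep_eq zero_endo.rep_eq gract_def cmp_lin)
  then show ?thesis by simp
 qed (use r in simp)
 finally show ?thesis .
qed

subsection \<open>The action of automorphisms\<close>

context
 fixes \<sigma> \<tau> :: "'p => 'p"
 assumes \<sigma>: "\<sigma> : hom G G" and \<tau>: "\<tau> : hom G G"
  and inv1: "\<And>x. x : carrier G ==> \<sigma> (\<tau> x) = x" and inv2: "\<And>x. x : carrier G ==> \<tau> (\<sigma> x) = x"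
begin

lemma push_ge: "push s (ge x) = ge (s x)" by (simp add: ge_def)

lemma push_gmul:
 assumes s: "s : hom G G"
 shows "f : kG ==> h : kG ==> push s (f \<star> h) = push s f \<star> push s h"
proof -
 assume "f : kG" "h : kG"
 then have f: "keys f <= carrier G" and h: "keys h <= carrier G" by (auto simp: kG_def)
 from f show "push s (f \<star> h) = push s f \<star> push s h"
 proof (induction f rule: poly_mapping_induct_on)
  case (single x c)
  from h show ?case
  proof (induction h rule: poly_mapping_induct_on)
   case (single y d)
   then show ?case using \<open>x : carrier G\<close> s
    by (simp add: gmul_def bmul_single push_scale hom_mult)
  qed (auto simp: gmul_linear push_add)
 qed (auto simp: gmul_linear push_add)
qed

text \<open>An endomorphism of the group sends \<open>g - 1\<close> to \<open>s g - 1\<close>, so it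
  respects products of \<open>r\<close> such factors.\<close>

lemma push_JS:
 assumes s: "s : hom G G" and a: "a : JS r"
 shows "push s a : JS r"
proof -
 have sc: "s x : carrier G" if "x : carrier G" for x using hom_in_carrier[OF s that] .
 have s1: "s \<one> = \<one>" using s hom_one[OF s group_axioms group_axioms] by simp
 have d: "push s (del x) = del (s x)" for x by (simp add: del_def push_minus push_ge s1)
 have dp: "push s (dprod gs) = dprod (map s gs)" if "set gs <= carrier G" for gs
  using that by (induction gs) (auto simp: push_ge s1 push_gmul[OF s] d)
 show ?thesis
 proof (cases "r = 0")
  case True
  then show ?thesis using a sc keys_push[of a "carrier G" s "carrier G"] by (auto simp: JS_def kG_def)
 next
  case False
  then have "a : fs.span (DP r)" using a by (simp add: JS_def)
  then show ?thesis
  proof (induction a rule: fs.span_induct)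
   case base
   show ?case using JS_add JS_scale JS_zero by (auto simp: fs.subspace_def push_add push_scale)
  next
   case (step a)
   then obtain gs where "set gs <= carrier G" "length gs = r" "a = dprod gs" by auto
   then show ?case using dprod_JS[of "map s gs"] sc by (auto simp: dp)
  qed
 qed
qed

lemma F_hom: "s : hom G G ==> a : F r ==> s a : F r"
proof -
 assume s: "s : hom G G" and a: "a : F r"
 have s1: "s \<one> = \<one>" using s hom_one[OF s group_axioms group_axioms] by simp
 have "push s (del a) = del (s a)" by (simp add: del_def push_minus push_ge s1)
 then show ?thesis using push_JS[OF s, of "del a" r] a hom_in_carrier[OF s, of a] by (simp add: F_iff)
qed

lemma image_cl:
 assumes a: "a : F r"
 shows "\<sigma> ` cl r a = cl r (\<sigma> a)"
proof -
 have "\<sigma> ` F (Suc r) = F (Suc r)"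
 proof
  show "F (Suc r) <= \<sigma> ` F (Suc r)"
  proof
   fix x assume x: "x : F (Suc r)"
   then have "\<tau> x : F (Suc r)" by (rule F_hom[OF \<tau>])
   then show "x : \<sigma> ` F (Suc r)" using inv1[OF F_closed[OF x]] by (metis imageI)
  qed
 qed (use F_hom[OF \<sigma>] in auto)
 then have "cl r (\<sigma> a) = (\<lambda>h. h \<otimes> \<sigma> a) ` (\<sigma> ` F (Suc r))" by (auto simp: cl_def r_coset_def)
 also have "\<dots> = \<sigma> ` cl r a"
  using a F_closed hom_mult[OF \<sigma>] by (auto simp: cl_def r_coset_def image_iff)
 finally show ?thesis ..
qed

end

lemma
 assumes \<sigma>: "\<sigma> : hom G G" and \<tau>: "\<tau> : hom G G"
  and inv1: "\<And>x. x : carrier G ==> \<sigma> (\<tau> x) = x" and inv2: "\<And>x. x : carrier G ==> \<tau> (\<sigma> x) = x"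
 shows act_coset: "keys x <= carrier (Q r) ==>
  push (image \<sigma>) ` (tensor_relations (Q r) +>\<^sub>(free_space (carrier (Q r))) (x :: 'p set \<Rightarrow>\<^sub>0 'k)) =
   tensor_relations (Q r) +>\<^sub>(free_space (carrier (Q r))) push (image \<sigma>) x"
  and act_hom: "jennings_act \<sigma> : module_hom class_ring Jen Jen"
  and act_jelt: "r \<ge> 1 ==> a : F r ==> jennings_act \<sigma> (jelt r a) = jelt r (\<sigma> a)"
proof -
 have s: "\<sigma> ` cl r a = cl r (\<sigma> a)" and t: "\<tau> ` cl r a = cl r (\<tau> a)"
  and sF: "\<sigma> a : F r" and tF: "\<tau> a : F r" if "a : F r" for a r
  using image_cl[of \<sigma> \<tau> a r] image_cl[of \<tau> \<sigma> a r] F_hom[of \<sigma> \<tau> \<sigma> a r] F_hom[of \<sigma> \<tau> \<tau> a r]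
   \<sigma> \<tau> inv1 inv2 that by auto
 show co: "push (image \<sigma>) ` (tensor_relations (Q r) +>\<^sub>(free_space (carrier (Q r))) (x :: 'p set \<Rightarrow>\<^sub>0 'k)) =
   tensor_relations (Q r) +>\<^sub>(free_space (carrier (Q r))) push (image \<sigma>) x"
  if x: "keys x <= carrier (Q r)" for x :: "'p set \<Rightarrow>\<^sub>0 'k" and r
 proof (rule ext.push_coset[where h' = "image \<tau>"])
  show "\<sigma> ` (C \<otimes>\<^sub>(Q r) C') = \<sigma> ` C \<otimes>\<^sub>(Q r) \<sigma> ` C'" if CC: "C : carrier (Q r)" "C' : carrier (Q r)" for C C'
  proof -
   obtain a b where ab: "a : F r" "C = cl r a" "b : F r" "C' = cl r b" using CC by (auto simp: Q_carrier)
   then show ?thesis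
    using s[OF F_mult[OF ab(1,3)]] hom_mult[OF \<sigma> F_closed[OF ab(1)] F_closed[OF ab(3)]] by (simp add: Q_mult s sF)
  qed
  show "\<tau> ` (C \<otimes>\<^sub>(Q r) C') = \<tau> ` C \<otimes>\<^sub>(Q r) \<tau> ` C'" if CC: "C : carrier (Q r)" "C' : carrier (Q r)" for C C'
  proof -
   obtain a b where ab: "a : F r" "C = cl r a" "b : F r" "C' = cl r b" using CC by (auto simp: Q_carrier)
   then show ?thesis
    using t[OF F_mult[OF ab(1,3)]] hom_mult[OF \<tau> F_closed[OF ab(1)] F_closed[OF ab(3)]] by (simp add: Q_mult t tF)
  qed
  show "\<sigma> ` (\<tau> ` C) = C" if C: "C : carrier (Q r)" for C
  proof -
   obtain a where a: "a : F r" "C = cl r a" using C by (auto simp: Q_carrier)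
   then show ?thesis using inv1[OF F_closed[OF a(1)]] by (simp add: s t tF)
  qed
 qed (use x sF tF in \<open>auto simp: Q_carrier s t\<close>)
 have push_closed: "keys (push (image \<sigma>) x) <= carrier (Q r)"
  if "keys x <= carrier (Q r)" for x :: "'p set \<Rightarrow>\<^sub>0 'k" and r
  by (rule keys_push[OF that]) (use sF in \<open>auto simp: Q_carrier s\<close>)
 let ?T = "\<lambda>X :: ('p set \<Rightarrow>\<^sub>0 'k) set. push (image \<sigma>) ` X"
 have T: "?T X : carrier (extend_scalars (Q r))"
  "X' : carrier (extend_scalars (Q r)) ==>
   ?T (X \<oplus>\<^sub>(extend_scalars (Q r)) X') = ?T X \<oplus>\<^sub>(extend_scalars (Q r)) ?T X'"
  "?T (c \<odot>\<^sub>(extend_scalars (Q r)) X) = c \<odot>\<^sub>(extend_scalars (Q r)) ?T X"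
  "?T \<zero>\<^sub>(extend_scalars (Q r)) = \<zero>\<^sub>(extend_scalars (Q r))"
  if X: "X : carrier (extend_scalars (Q r))" for X X' :: "('p set \<Rightarrow>\<^sub>0 'k) set" and r c
 proof -
  obtain x where x: "keys x <= carrier (Q r)"
   "X = tensor_relations (Q r) +>\<^sub>(free_space (carrier (Q r))) x"
   using X by (auto simp: ext.E_carrier)
  show "?T X : carrier (extend_scalars (Q r))"
   using x push_closed by (simp add: co ext.E_carrier)
  show "?T (c \<odot>\<^sub>(extend_scalars (Q r)) X) = c \<odot>\<^sub>(extend_scalars (Q r)) ?T X"
   using x push_closed by (simp add: co ext.E_smult push_scale keys_scale_subset)
  show "?T \<zero>\<^sub>(extend_scalars (Q r)) = \<zero>\<^sub>(extend_scalars (Q r))"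
   unfolding ext.E_zero using co[of 0 r] by simp
  show "?T (X \<oplus>\<^sub>(extend_scalars (Q r)) X') = ?T X \<oplus>\<^sub>(extend_scalars (Q r)) ?T X'"
   if X': "X' : carrier (extend_scalars (Q r))"
  proof -
   obtain y where y: "keys y <= carrier (Q r)"
    "X' = tensor_relations (Q r) +>\<^sub>(free_space (carrier (Q r))) y"
    using X' by (auto simp: ext.E_carrier)
   then show ?thesis using x push_closed by (simp add: co ext.E_add push_add keys_add_subset)
  qed
 qed
 show "jennings_act \<sigma> : module_hom class_ring Jen Jen"
 proof (rule module_homI)
  fix u assume u: "u : carrier Jen"
  have "finite {r : {1..}. ?T (u r) ~= \<zero>\<^sub>(extend_scalars (Q r))}"
  proof (rule finite_subset)
   show "finite {r : {1..}. u r ~= \<zero>\<^sub>(extend_scalars (Q r))}"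
    using u unfolding Jen_def direct_sum_simps by blast
   show "{r : {1..}. ?T (u r) ~= \<zero>\<^sub>(extend_scalars (Q r))} <= {r : {1..}. u r ~= \<zero>\<^sub>(extend_scalars (Q r))}"
    using T(4)[OF ext.E.zero_closed] by force
  qed
  then show "jennings_act \<sigma> u : carrier Jen"
   using T(1) Jen_apply[OF u]
   by (auto simp: Jen_def direct_sum_simps jennings_act_def cong: conj_cong)
  show "jennings_act \<sigma> (c \<odot>\<^sub>Jen u) = c \<odot>\<^sub>Jen jennings_act \<sigma> u" for c
   using T(3)[OF Jen_apply[OF u]]
   by (auto simp: Jen_def direct_sum_simps jennings_act_def fun_eq_iff)
  fix v assume v: "v : carrier Jen"
  show "jennings_act \<sigma> (u \<oplus>\<^sub>Jen v) = jennings_act \<sigma> u \<oplus>\<^sub>Jen jennings_act \<sigma> v"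
   using T(2)[OF Jen_apply[OF u] Jen_apply[OF v]]
   by (auto simp: Jen_def direct_sum_simps jennings_act_def fun_eq_iff)
 qed
 assume r: "r \<ge> 1" and a: "a : F r"
 have "?T (ext.tens r (cl r a) 1) = ext.tens r (cl r (\<sigma> a)) 1"
  unfolding ext.tens_def using a by (subst co) (auto simp: Q_carrier s)
 moreover have "?T \<zero>\<^sub>(extend_scalars (Q s)) = \<zero>\<^sub>(extend_scalars (Q s))" for s
  using T(4)[OF ext.E.zero_closed] .
 ultimately show "jennings_act \<sigma> (jelt r a) = jelt r (\<sigma> a)"
  unfolding jelt_eq sum.inj_def jennings_act_def by (intro ext) (simp add: restrict_def del: One_nat_def)
qed

end

section \<open>Restricted enveloping algebras\<close>

definition lprod :: "('a, 'b) monoid_scheme => 'a list => 'a" where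
 "lprod A xs = foldr (\<lambda>x y. x \<otimes>\<^sub>A y) xs \<one>\<^sub>A"

lemma lprod_simps [simp]: "lprod A [] = \<one>\<^sub>A" "lprod A (x # xs) = x \<otimes>\<^sub>A lprod A xs"
 by (simp_all add: lprod_def)

context k_algebra
begin

lemma lprod_closed [simp]: "set xs <= carrier A ==> lprod A xs : carrier A"
 by (induction xs) auto

lemma lprod_append: "set xs <= carrier A ==> set ys <= carrier A ==>
  lprod A (xs @ ys) = lprod A xs \<otimes> lprod A ys"
 by (induction xs) (auto simp: m_assoc)

lemma lprod_replicate: "x : carrier A ==> lprod A (replicate n x) = x [^] n"
proof (induction n)
 case (Suc n)
 then show ?case using nat_pow_Suc2[of x n] by (simp del: nat_pow_Suc)
qed simp

lemma subsp_mult_left: "subsp W ==> a : carrier A ==> subsp {u : carrier A. a \<otimes> u : W}"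
 unfolding subsp_def by (auto simp: r_distr sm_mult_r)

lemma subsp_mult_right: "subsp W ==> a : carrier A ==> subsp {u : carrier A. u \<otimes> a : W}"
 unfolding subsp_def by (auto simp: l_distr sm_mult_l)

end

lemma alg_hom_lprod:
 assumes "k_alg_hom A B f" "set xs <= carrier A"
 shows "f (lprod A xs) = lprod B (map f xs)"
proof -
 interpret k_alg_hom A B f by fact
 show ?thesis using assms(2) by (induction xs) (auto simp: f_mult)
qed

locale env_algebra = restricted_lie_algebra V br pm p
 for V :: "('k::field, 'v) module" (structure) and br pm p
begin

sublocale V: k_space V by (rule k_space.intro) (rule vectorspace_axioms)

abbreviation FA :: "('k, 'v list \<Rightarrow>\<^sub>0 'k) module" where "FA \<equiv> free_algebra (carrier V)"
abbreviation I :: "('v list \<Rightarrow>\<^sub>0 'k) set" where "I \<equiv> enveloping_ideal V br pm p"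
abbreviation U :: "('k, ('v list \<Rightarrow>\<^sub>0 'k) set) module" where "U \<equiv> enveloping_algebra V br pm p"
abbreviation inc where "inc \<equiv> enveloping_elt V br pm p"

abbreviation "word ws \<equiv> single ws (1 :: 'k)"

definition gens :: "('v list \<Rightarrow>\<^sub>0 'k) set" where
 "gens = {word [x \<oplus> y] - word [x] - word [y] | x y. x : carrier V \<and> y : carrier V}
  \<union> {word [c \<odot> x] - single [x] c | c x. x : carrier V}
  \<union> {word [x, y] - word [y, x] - word [br x y] | x y. x : carrier V \<and> y : carrier V}
  \<union> {word (replicate p x) - word [pm x] | x. x : carrier V}"

sublocale words: algebra_basis "lists (carrier V)" "\<lambda>u v. single (u @ v) (1::'k)" "single [] 1"
 by unfold_locales (auto simp: bmul_single)

sublocale FA: k_algebra FA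
 unfolding free_algebra_def by (rule words.k_algebra)

lemma FA_simps:
 "carrier FA = {f. keys f <= lists (carrier V)}" "\<zero>\<^sub>FA = 0" "f \<oplus>\<^sub>FA g = f + g"
 "c \<odot>\<^sub>FA f = scale c f" "f \<otimes>\<^sub>FA g = bmul (\<lambda>u v. single (u @ v) 1) f g" "\<one>\<^sub>FA = word []"
 by (simp_all add: free_algebra_def)

lemma FA_minus: "f : carrier FA ==> g : carrier FA ==> f \<ominus>\<^sub>FA g = f - g"
 using FA.sm_neg[of g] by (simp add: a_minus_def FA_simps)

lemma word_closed [simp]: "set ws <= carrier V ==> word ws : carrier FA"
 "set ws <= carrier V ==> single ws c : carrier FA"
 by (auto simp: FA_simps)

lemma diff_closed: "f : carrier FA ==> g : carrier FA ==> f - g : carrier FA"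
 by (simp add: FA_simps keys_minus_subset)

lemma gens_carrier: "gens <= carrier FA"
 unfolding gens_def by (auto intro!: diff_closed word_closed simp: br_closed pm_closed set_replicate_conv_if split: if_splits)

lemma I_eq: "I = Idl\<^bsub>FA\<^esub> gens"
 by (simp add: enveloping_ideal_def gens_def)

lemma ideal_I: "ideal I FA"
 unfolding I_eq by (rule FA.genideal_ideal[OF gens_carrier])

lemma gens_I: "gens <= I"
 unfolding I_eq by (rule FA.genideal_self[OF gens_carrier])

lemma subsp_I: "FA.subsp I" using FA.ideal_subsp[OF ideal_I] .

sublocale U: k_algebra U
 unfolding enveloping_algebra_def by (rule FA.quot_algebra[OF ideal_I])

definition cls where "cls x = I +>\<^sub>FA x"

sublocale cls: k_alg_hom FA U cls
 using FA.quot_alg_hom[OF ideal_I] by unfold_locales (simp add: enveloping_algebra_def cls_def[abs_def])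

lemma U_carrier: "carrier U = cls ` carrier FA"
 by (simp add: enveloping_algebra_def quot_alg_simps cls_def)

lemma cls_eq_iff: "x : carrier FA ==> y : carrier FA ==> cls x = cls y \<longleftrightarrow> x - y : I"
 using FA.quot_eq_iff[OF subsp_I] by (simp add: cls_def FA_minus)

lemma inc_eq: "inc x = cls (word [x])"
 by (simp add: enveloping_elt_def cls_def)

lemma inc_closed [simp]: "x : carrier V ==> inc x : carrier U"
 by (simp add: inc_eq)

lemma cls_word: "set ws <= carrier V ==> cls (word ws) = lprod U (map inc ws)"
proof (induction ws)
 case Nil
 then show ?case using cls.f_one by (simp add: FA_simps)
next
 case (Cons x ws)
 have "word (x # ws) = word [x] \<otimes>\<^sub>FA word ws" by (simp add: FA_simps bmul_single)
 then show ?case using Cons by (simp add: cls.f_mult inc_eq)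
qed

lemma cls_gens: "r : gens ==> cls r = \<zero>\<^sub>U"
 using gens_I gens_carrier cls_eq_iff[of r 0] cls.f_zero FA.zero_closed by (auto simp: FA_simps)

lemma cls_diff: "f : carrier FA ==> g : carrier FA ==> cls (f - g) = cls f \<ominus>\<^sub>U cls g"
 using cls.f_minus[of f g] by (simp add: FA_minus)

lemma inc_hom: "inc : module_hom class_ring V U"
proof (rule module_homI)
 fix x y c assume x: "x : carrier V"
 show "inc (c \<odot> x) = c \<odot>\<^sub>U inc x"
 proof -
  have "cls (word [c \<odot> x] - single [x] c) = \<zero>\<^sub>U"
   using x by (intro cls_gens) (auto simp: gens_def)
  then have "cls (word [c \<odot> x]) = cls (single [x] c)"
   using x cls_diff U.minus_eq_zero_iff by simp
  also have "single [x] c = c \<odot>\<^sub>FA word [x]" by (simp add: FA_simps scale_single)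
  finally show ?thesis using x by (simp add: inc_eq cls.f_sm)
 qed
 assume y: "y : carrier V"
 have "cls (word [x \<oplus> y] - word [x] - word [y]) = \<zero>\<^sub>U"
  using x y by (intro cls_gens) (auto simp: gens_def)
 then have "inc (x \<oplus> y) \<ominus>\<^sub>U inc x = inc y"
  using x y cls_diff diff_closed U.minus_eq_zero_iff by (simp add: inc_eq)
 then show "inc (x \<oplus> y) = inc x \<oplus>\<^sub>U inc y"
 proof -
  have "inc (x \<oplus> y) = (inc (x \<oplus> y) \<ominus>\<^sub>U inc x) \<oplus>\<^sub>U inc x"
   using x y by (simp add: a_minus_def U.a_assoc U.l_neg)
  then show ?thesis
   using x y \<open>inc (x \<oplus> y) \<ominus>\<^sub>U inc x = inc y\<close> by (simp add: U.a_comm)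
 qed
qed simp

sublocale inc: k_linear V U inc
 by unfold_locales (rule inc_hom)

lemma inc_br:
 assumes x: "x : carrier V" and y: "y : carrier V"
 shows "inc x \<otimes>\<^sub>U inc y \<ominus>\<^sub>U inc y \<otimes>\<^sub>U inc x = inc (br x y)"
proof -
 have "cls (word [x, y] - word [y, x] - word [br x y]) = \<zero>\<^sub>U"
  using x y by (intro cls_gens) (auto simp: gens_def)
 then show ?thesis
  using x y cls_diff diff_closed U.minus_eq_zero_iff cls_word[of "[x, y]"] cls_word[of "[y, x]"] br_closed
  by (simp add: inc_eq)
qed

lemma inc_pm: "x : carrier V ==> inc x [^]\<^sub>U p = inc (pm x)"
proof -
 assume x: "x : carrier V"
 have "cls (word (replicate p x) - word [pm x]) = \<zero>\<^sub>U"
  using x by (intro cls_gens) (auto simp: gens_def)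
 moreover have r: "set (replicate p x) <= carrier V" using x by auto
 ultimately have "cls (word (replicate p x)) = cls (word [pm x])"
  using x cls_diff U.minus_eq_zero_iff pm_closed by simp
 then show ?thesis using x r cls_word[OF r] U.lprod_replicate[of "inc x" p] by (simp add: inc_eq)
qed

lemma U_spanned:
 assumes W: "U.subsp W" and w: "\<And>ws. set ws <= carrier V ==> lprod U (map inc ws) : W"
 shows "carrier U <= W"
proof
 fix X assume "X : carrier U"
 then obtain x where x: "keys x <= lists (carrier V)" "X = cls x" by (auto simp: U_carrier FA_simps)
 from x(1) have "cls x : W"
 proof (induction x rule: poly_mapping_induct_on)
  case zero
  then show ?case using cls.f_zero U.subspD(2)[OF W] by (simp add: FA_simps)
 next
  case (single ws c)
  have "set ws <= carrier V" using single by auto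
  then have "cls (c \<odot>\<^sub>FA word ws) : W"
   using single w[of ws] cls_word[of ws] U.subspD(4)[OF W] by (subst cls.f_sm) auto
  then show ?case by (simp add: FA_simps scale_single)
 next
  case (add f g)
  then have "cls (f \<oplus>\<^sub>FA g) : W"
   using U.subspD(3)[OF W] by (subst cls.f_add) (auto simp: FA_simps)
  then show ?case by (simp add: FA_simps)
 qed
 then show "X : W" using x by simp
qed

text \<open>The universal property: the algebra map on words given by products of values of
  \<open>f\<close> kills the four families of generators, hence the ideal, and so descends to
  cosets.\<close>

lemma U_hom:
 assumes B: "k_algebra B" and f: "f : module_hom class_ring V B"
  and f_br: "\<And>x y. x : carrier V ==> y : carrier V ==>
   f (br x y) = f x \<otimes>\<^sub>B f y \<ominus>\<^sub>B f y \<otimes>\<^sub>B f x"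
  and f_pm: "\<And>x. x : carrier V ==> f (pm x) = f x [^]\<^sub>B p"
 shows "\<exists>F\<in>alg_hom U B. \<forall>v\<in>carrier V. F (inc v) = f v"
proof -
 interpret B: k_algebra B by (rule B)
 interpret f: k_linear V B f by unfold_locales (rule f)
 let ?h = "\<lambda>ws. lprod B (map f ws)"
 have h: "?h ws : carrier B" if "ws : lists (carrier V)" for ws
  using that by (intro B.lprod_closed) auto
 have "B.lext ?h : alg_hom FA B"
  unfolding free_algebra_def
 proof (rule words.lext_alg_hom[OF B h])
  fix u v assume uv: "u : lists (carrier V)" "v : lists (carrier V)"
  then have "u @ v : lists (carrier V)" by simp
  moreover have "set (map f u) <= carrier B" "set (map f v) <= carrier B" using uv by auto
  ultimately show "B.lext ?h (single (u @ v) 1) = ?h u \<otimes>\<^sub>B ?h v"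
   using uv h[of "u @ v"] by (subst B.lext_single) (auto simp: B.lprod_append)
 qed simp_all
 then interpret L: k_alg_hom FA B "B.lext ?h" by unfold_locales
 have L1: "B.lext ?h (word ws) = ?h ws" if "set ws <= carrier V" for ws
  using h[of ws] that by (auto simp: lists_eq_set)
 have sub: "B.lext ?h (a - b) = B.lext ?h a \<ominus>\<^sub>B B.lext ?h b" if "a : carrier FA" "b : carrier FA" for a b
  using that L.f_minus[of a b] by (simp add: FA_minus)
 have "gens <= {x : carrier FA. B.lext ?h x = \<zero>\<^sub>B}"
 proof
  fix r assume r: "r : gens"
  then have rc: "r : carrier FA" using gens_carrier by auto
  from r consider x y where "x : carrier V" "y : carrier V" "r = word [x \<oplus> y] - word [x] - word [y]"
   | c x where "x : carrier V" "r = word [c \<odot> x] - single [x] c"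
   | x y where "x : carrier V" "y : carrier V" "r = word [x, y] - word [y, x] - word [br x y]"
   | x where "x : carrier V" "r = word (replicate p x) - word [pm x]"
   unfolding gens_def by blast
  then have "B.lext ?h r = \<zero>\<^sub>B"
  proof cases
   case 1
   then have "B.lext ?h r = (f (x \<oplus> y) \<ominus>\<^sub>B f x) \<ominus>\<^sub>B f y"
    by (simp add: sub diff_closed L1)
   also have "\<dots> = \<zero>\<^sub>B"
    using 1 by (simp add: f.f_add a_minus_def B.a_assoc B.a_comm[of "f y"] B.r_neg)
   finally show ?thesis .
  next
   case 2
   have "B.lext ?h (single [x] c) = c \<odot>\<^sub>B f x"
    using 2 h[of "[x]"] by (subst B.lext_single) auto
   then show ?thesis
    using 2 by (simp add: sub L1 f.f_sm B.minus_eq_zero_iff)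
  next
   case 3
   then show ?thesis by (simp add: sub diff_closed L1 br_closed f_br B.minus_eq_zero_iff)
  next
   case 4
   then have "set (replicate p x) <= carrier V" by auto
   then show ?thesis using 4 by (simp add: sub L1 pm_closed f_pm B.minus_eq_zero_iff B.lprod_replicate)
  qed
  then show "r : {x : carrier FA. B.lext ?h x = \<zero>\<^sub>B}" using rc by simp
 qed
 then have ker: "I <= {x : carrier FA. B.lext ?h x = \<zero>\<^sub>B}"
  unfolding I_eq by (rule FA.genideal_minimal[OF L.ideal_kernel])
 define F where "F X = B.lext ?h (SOME x. x : X)" for X
 have F: "F (cls x) = B.lext ?h x" if x: "x : carrier FA" for x
 proof -
  define y where "y = (SOME y. y : cls x)"
  have m: "y : cls x \<longleftrightarrow> y : carrier FA \<and> y - x : I" for y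
   using FA.quot_mem_iff[OF subsp_I x, of y] x by (auto simp: cls_def FA_minus)
  have "x : cls x" using x FA.subspD(2)[OF subsp_I] unfolding m by (simp add: FA_simps)
  then have "y : cls x" unfolding y_def by (rule someI)
  then have y: "y : carrier FA" "y - x : I" unfolding m by auto
  then have "B.lext ?h (y - x) = \<zero>\<^sub>B" using ker by blast
  then have "B.lext ?h y \<ominus>\<^sub>B B.lext ?h x = \<zero>\<^sub>B" unfolding sub[OF y(1) x] .
  then have "B.lext ?h y = B.lext ?h x"
   using B.minus_eq_zero_iff[OF L.f_closed[OF y(1)] L.f_closed[OF x]] by blast
  then show ?thesis by (simp add: F_def y_def)
 qed
 have "F : alg_hom U B"
 proof (rule alg_homI)
  show "F \<one>\<^sub>U = \<one>\<^sub>B" using F[of "\<one>\<^sub>FA"] by simp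
 qed (auto simp: U_carrier F L.f_mult L.f_add L.f_sm simp flip: cls.f_mult cls.f_add cls.f_sm)
 moreover have "\<forall>v\<in>carrier V. F (inc v) = f v"
  using F L1[of "[_]"] by (auto simp: inc_eq)
 ultimately show ?thesis by blast
qed

lemma push_map_hom:
 assumes t: "\<And>v. v : carrier V ==> t v : carrier V"
 shows "push (map t) : alg_hom FA FA"
proof (rule alg_homI)
 show cl: "push (map t) x : carrier FA" if "x : carrier FA" for x
 proof -
  have "map t ` lists (carrier V) <= lists (carrier V)" using t by (auto simp: lists_eq_set subset_iff)
  then show ?thesis using that keys_push[of x "lists (carrier V)" "map t" "lists (carrier V)"] by (simp add: FA_simps)
 qed
 show "push (map t) (x \<otimes>\<^sub>FA y) = push (map t) x \<otimes>\<^sub>FA push (map t) y" for x y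
 proof (induction x rule: poly_mapping_induct_on[OF subset_refl])
  case (2 u c)
  show ?case
   by (induction y rule: poly_mapping_induct_on[OF subset_refl])
    (auto simp: FA_simps bmul_single bmul_add_right push_add push_scale)
 qed (auto simp: FA_simps bmul_add_left push_add)
qed (auto simp: FA_simps push_add push_scale)

text \<open>As for the Jennings space, the inverse \<open>s\<close> shows that the map on words
  carries the ideal onto itself, so that elementwise images of cosets are cosets.\<close>

lemma
 assumes t: "t : module_hom class_ring V V" and s: "s : module_hom class_ring V V"
  and inv: "\<And>v. v : carrier V ==> t (s v) = v"
  and br: "\<And>x y. x : carrier V ==> y : carrier V ==> t (br x y) = br (t x) (t y)"
   "\<And>x y. x : carrier V ==> y : carrier V ==> s (br x y) = br (s x) (s y)"
  and pm: "\<And>x. x : carrier V ==> t (pm x) = pm (t x)" "\<And>x. x : carrier V ==> s (pm x) = pm (s x)"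
 shows act_cls: "x : carrier FA ==> enveloping_act t (cls x) = cls (push (map t) x)"
  and env_act_hom: "enveloping_act t : alg_hom U U"
  and env_act_inc: "v : carrier V ==> enveloping_act t (inc v) = inc (t v)"
proof -
 have sub: "push (map t) ` I <= I"
  if t: "t : module_hom class_ring V V" 
   and br: "\<And>x y. x : carrier V ==> y : carrier V ==> t (br x y) = br (t x) (t y)"
   and pm: "\<And>x. x : carrier V ==> t (pm x) = pm (t x)" for t
 proof -
  interpret t: k_linear V V t by unfold_locales (rule t)
  interpret P: k_alg_hom FA FA "push (map t)" by unfold_locales (rule push_map_hom, simp)
  have "(\<lambda>x. cls (push (map t) x)) : alg_hom FA U"
   by (rule alg_homI) (auto simp: P.f_mult cls.f_mult P.f_add cls.f_add P.f_sm cls.f_sm)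
  then interpret C: k_alg_hom FA U "\<lambda>x. cls (push (map t) x)" by unfold_locales
  have "push (map t) r : gens" if "r : gens" for r
  proof -
   from that consider x y where "x : carrier V" "y : carrier V" "r = word [x \<oplus> y] - word [x] - word [y]"
   | c x where "x : carrier V" "r = word [c \<odot> x] - single [x] c"
   | x y where "x : carrier V" "y : carrier V" "r = word [x, y] - word [y, x] - word [br x y]"
   | x where "x : carrier V" "r = word (replicate p x) - word [pm x]"
   unfolding gens_def by blast
   then show ?thesis
   proof cases
    case 1
    then have "push (map t) r = word [t x \<oplus> t y] - word [t x] - word [t y]"
     by (simp add: push_minus t.f_add)
    then show ?thesis unfolding gens_def using 1 t.f_closed by blast
   next
    case 2
    then have "push (map t) r = word [c \<odot> t x] - single [t x] c"
     by (simp add: push_minus t.f_sm)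
    then show ?thesis unfolding gens_def using 2 t.f_closed by blast
   next
    case 3
    then have "push (map t) r = word [t x, t y] - word [t y, t x] - word [br (t x) (t y)]"
     by (simp add: push_minus br)
    then show ?thesis unfolding gens_def using 3 t.f_closed by blast
   next
    case 4
    then have "push (map t) r = word (replicate p (t x)) - word [pm (t x)]"
     by (simp add: push_minus pm)
    then show ?thesis unfolding gens_def using 4 t.f_closed by blast
   qed
  qed
  then have "gens <= {x : carrier FA. cls (push (map t) x) = \<zero>\<^sub>U}"
   using gens_carrier cls_gens by auto
  then have "I <= {x : carrier FA. cls (push (map t) x) = \<zero>\<^sub>U}"
   unfolding I_eq by (rule FA.genideal_minimal[OF C.ideal_kernel])
  moreover have "x : I" if "x : carrier FA" "cls x = \<zero>\<^sub>U" for x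
   using that cls_eq_iff[of x 0] cls.f_zero FA.zero_closed by (simp add: FA_simps)
  ultimately show ?thesis by auto
 qed
 interpret t: k_linear V V t by unfold_locales (rule t)
 interpret s: k_linear V V s by unfold_locales (rule s)
 interpret P: k_alg_hom FA FA "push (map t)" by unfold_locales (rule push_map_hom, simp)
 have "I <= push (map t) ` I"
 proof
  fix x assume x: "x : I"
  then have "x : carrier FA" using FA.subspD(1)[OF subsp_I] by auto
  then have "push (map t) (push (map s) x) = x"
   unfolding push_push FA_simps
   by (intro push_cong_id[of _ "lists (carrier V)"]) (auto simp: inv lists_eq_set subset_iff intro!: map_idI)
  moreover have "push (map s) x : I" using sub[OF s br(2) pm(2)] x by auto
  ultimately show "x : push (map t) ` I" by (metis imageI)
 qed
 with sub[OF t br(1) pm(1)] have TI: "push (map t) ` I = I" by auto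
 show act: "enveloping_act t (cls x) = cls (push (map t) x)" if x: "x : carrier FA" for x
  unfolding enveloping_act_def cls_def using P.hom TI x by (intro FA.image_coset[OF subsp_I]) auto
 show "enveloping_act t : alg_hom U U"
 proof (rule alg_homI)
  show "enveloping_act t \<one>\<^sub>U = \<one>\<^sub>U" using act[of "\<one>\<^sub>FA"] by simp
 qed (auto simp: U_carrier act P.f_mult P.f_add P.f_sm simp flip: cls.f_mult cls.f_add cls.f_sm)
 show "enveloping_act t (inc v) = inc (t v)" if "v : carrier V"
  unfolding inc_eq using that by (subst act) auto
qed

end

section \<open>The Poincare-Birkhoff-Witt basis\<close>

lemma word_sum_commute:
 fixes x y :: "'a::ring_1"
 assumes "x * y = y * x"
 shows "word_sum x y n c = of_nat (n choose c) * x ^ c * y ^ (n - c)"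
proof (induction n arbitrary: c)
 case 0
 then show ?case by (cases c) auto
next
 case (Suc n)
 have yx: "y * x ^ k = x ^ k * y" for k
  using assms by (induction k) (simp_all add: mult.assoc, metis mult.assoc)
 have pull: "z * (of_nat k * v) = of_nat k * (z * v)" for z v :: 'a and k
  by (metis mult.assoc mult_of_nat_commute)
 show ?case
 proof (cases c)
  case 0
  then show ?thesis using Suc.IH[of 0] by simp
 next
  case (Suc d)
  have "y * (of_nat (n choose Suc d) * x ^ Suc d * y ^ (n - Suc d))
    = of_nat (n choose Suc d) * (x ^ Suc d * (y * y ^ (n - Suc d)))"
   using yx[of "Suc d"] by (simp only: mult.assoc pull) (metis mult.assoc)
  also have "\<dots> = of_nat (n choose Suc d) * (x ^ Suc d * y ^ (n - d))"
  proof (cases "d < n")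
   case True
   then have "n - d = Suc (n - Suc d)" by simp
   then show ?thesis by simp
  qed (simp add: binomial_eq_0)
  finally have 1: "y * (of_nat (n choose Suc d) * x ^ Suc d * y ^ (n - Suc d))
   = of_nat (n choose Suc d) * (x ^ Suc d * y ^ (n - d))" .
  have 2: "x * (of_nat (n choose d) * x ^ d * y ^ (n - d)) = of_nat (n choose d) * (x ^ Suc d * y ^ (n - d))"
   by (simp only: mult.assoc pull power_Suc)
  show ?thesis
   unfolding Suc word_sum.simps Suc.IH 1 2 \<open>\<And>c. word_sum x y n c = _\<close>
   by (simp add: ring_distribs mult.assoc)
 qed
qed

text \<open>For commuting elements the intermediate word sums are multiples of binomial coefficients
  divisible by \<open>p\<close>.\<close>

lemma prime_power_add_commute:
 fixes x y :: "'a::ring_1"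
 assumes "prime p" "of_nat p = (0::'a)" "x * y = y * x"
 shows "(x + y) ^ p = x ^ p + y ^ p"
proof -
 have "word_sum x y p i = 0" if i: "i : {1..<p}" for i
 proof -
  have "p dvd (p choose i)" using assms(1) i by (intro dvd_choose_prime) auto
  then have "of_nat (p choose i) = (0::'a)" using assms(2) by (auto simp: dvd_def)
  then show ?thesis using word_sum_commute[OF assms(3), of p i] by simp
 qed
 then show ?thesis using jacobson_formula(1)[OF assms(1,2), of x y] by simp
qed

section \<open>Commutators, p-th powers and spanning sets in the associated graded algebra\<close>

context p_group_algebra
begin

lemma gr_mult: "a : JS r ==> b : JS s ==> gr r a * gr s b = gr (r + s) (a \<star> b)"
 by (intro endo_eqI) (simp add: times_endo.rep_eq gr.rep_eq gract_mult)

lemma gr_diff: "gr r (a - b) = gr r a - gr r b"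
 by (intro endo_eqI) (simp add: minus_endo.rep_eq gr.rep_eq gract_diff)

text \<open>With \<open>c\<close> the commutator, \<open>a b - b a = (c - 1) b a\<close>.
  Invertibility of \<open>b a\<close> puts \<open>c - 1\<close> into \<open>JS (r + s)\<close>, and
  replacing \<open>b a\<close> by 1 changes the product only in the next power.\<close>

lemma gr_commutator:
 assumes r: "r \<ge> 1" "s \<ge> 1" and a: "a : F r" and b: "b : F s"
 shows "commutator G a b : F (r + s)"
  and "gr r (del a) * gr s (del b) - gr s (del b) * gr r (del a) = gr (r + s) (del (commutator G a b))"
proof -
 let ?c = "commutator G a b" and ?d = "b \<otimes> a"
 have ab: "a : carrier G" "b : carrier G" using a b F_closed by auto
 have c: "?c : carrier G" using ab by (simp add: commutator_def)
 have cd: "?c \<otimes> ?d = a \<otimes> b" using ab by (simp add: commutator_def m_assoc) (simp flip: m_assoc)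
 have J: "del a \<star> del b - del b \<star> del a : JS (r + s)"
  using JS_mult[of "del a" r "del b" s] JS_mult[of "del b" s "del a" r] a b
  by (intro JS_diff) (auto simp: F_iff add.commute)
 have "del a \<star> del b - del b \<star> del a = ge (a \<otimes> b) - ge ?d"
  using ab by (simp add: del_def gmul_linear ge_mult)
 also have "\<dots> = del ?c \<star> ge ?d" using ab c cd by (simp add: del_def gmul_linear ge_mult)
 finally have eq: "del a \<star> del b - del b \<star> del a = del ?c \<star> ge ?d" .
 have "del ?c = (del ?c \<star> ge ?d) \<star> ge (inv ?d)"
  using ab c by (simp add: gmul_assoc ge_mult gmul_one)
 also have "\<dots> : JS (r + s)" using J ab unfolding eq[symmetric] by (intro JS_right) auto
 finally have cJ: "del ?c : JS (r + s)" .
 then show "?c : F (r + s)" using c by (simp add: F_iff)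
 have "del ?c \<star> ge ?d = del ?c + del ?c \<star> del ?d"
  using ge_eq_del[of ?d] c ab by (simp add: gmul_linear gmul_one)
 moreover have "del ?c \<star> del ?d : JS (Suc (r + s))"
  using JS_mult[OF cJ del_JS[of ?d]] ab by simp
 then have "gract (r + s) (del ?c \<star> del ?d) v = 0" for v by (rule gract_kills)
 ultimately have "gr (r + s) (del ?c \<star> ge ?d) = gr (r + s) (del ?c)"
  by (intro endo_eqI) (simp add: gr.rep_eq gract_add)
 moreover have "gr r (del a) * gr s (del b) - gr s (del b) * gr r (del a)
   = gr (r + s) (del a \<star> del b - del b \<star> del a)"
  using a b by (simp add: gr_mult F_iff gr_diff add.commute)
 ultimately show "gr r (del a) * gr s (del b) - gr s (del b) * gr r (del a) = gr (r + s) (del ?c)"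
  unfolding eq by simp
qed

text \<open>Left multiplications carry powers in the group algebra over to a ring of the type class,
  where \<open>prime_power_add_commute\<close> can be used; applying them to 1 leads back.\<close>

lift_definition left_mult :: "('p \<Rightarrow>\<^sub>0 'k) => ('p, 'k) endo" is "\<lambda>a v. a \<star> v"
 by (auto simp: Vector_Spaces.linear_iff gmul_linear fs.vector_space_axioms)

fun gpow :: "('p \<Rightarrow>\<^sub>0 'k) => nat => ('p \<Rightarrow>\<^sub>0 'k)" where
 "gpow a 0 = ge \<one>"
| "gpow a (Suc m) = a \<star> gpow a m"

lemma gpow_left_mult: "app (left_mult a ^ m) (ge \<one>) = gpow a m"
 by (induction m) (simp_all add: one_endo.rep_eq times_endo.rep_eq left_mult.rep_eq)

lemma endo_of_nat_p: "of_nat p = (0 :: ('p, 'k) endo)"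
proof -
 have "smult_endo (of_nat p) 1 = (of_nat p :: ('p, 'k) endo)" by (simp add: smult_endo_of_nat)
 then show ?thesis using char by (metis of_nat_CHAR smult_endo_laws(3))
qed

lemma neg_one_power_p: "(- 1) ^ p = (- 1 :: ('p, 'k) endo)"
proof (cases "p = 2")
 case True
 have "(1 :: ('p, 'k) endo) + 1 = 0" using endo_of_nat_p True by simp
 then show ?thesis using True by (metis add_eq_0_iff2 power2_minus power_one)
next
 case False
 then have "odd p" using prime primes_dvd_imp_eq two_is_prime_nat by blast
 then show ?thesis by simp
qed

text \<open>The Frobenius identity \<open>(a - 1) ^ p = a ^ p - 1\<close>, obtained from the
  commuting operators given by left multiplication by \<open>a\<close> and by -1.\<close>

lemma gpow_del: 
 assumes a: "a : carrier G"
 shows "gpow (del a) p = del (a [^] p)"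
proof -
 have ga: "gpow (ge a) m = ge (a [^] m)" for m
 proof (induction m)
  case (Suc m)
  then show ?case using a nat_pow_Suc2[of a m] by (simp add: ge_mult del: nat_pow_Suc)
 qed simp
 have L: "app (left_mult (del a)) v = app (left_mult (ge a) + (- 1)) v" if "v : kG" for v
  using that by (simp add: left_mult.rep_eq minus_endo.rep_eq one_endo.rep_eq del_def gmul_linear gmul_one)
 \<comment> \<open>The two operators are only known to agree on \<open>kG\<close>, so the induction
   must also record that the iterates of 1 stay there.\<close>
 have "app (left_mult (del a) ^ m) (ge \<one>) = app ((left_mult (ge a) + (- 1)) ^ m) (ge \<one>) \<and>
   app (left_mult (del a) ^ m) (ge \<one>) : kG" for m
 proof (induction m)
  case (Suc m)
  let ?v = "app (left_mult (del a) ^ m) (ge \<one>)"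
  have v: "?v : kG" using Suc by blast
  have "app (left_mult (del a) ^ Suc m) (ge \<one>) = app (left_mult (ge a) + (- 1)) ?v"
   using L[OF v] by (simp add: times_endo.rep_eq)
  also have "\<dots> = app ((left_mult (ge a) + (- 1)) ^ Suc m) (ge \<one>)"
   unfolding conjunct1[OF Suc] power_Suc times_endo.rep_eq ..
  finally have "app (left_mult (del a) ^ Suc m) (ge \<one>) = app ((left_mult (ge a) + (- 1)) ^ Suc m) (ge \<one>)" .
  moreover have "app (left_mult (del a) ^ Suc m) (ge \<one>) : kG"
   using v a by (simp add: times_endo.rep_eq left_mult.rep_eq gmul_closed)
  ultimately show ?case by blast
 qed (simp add: one_endo.rep_eq)
 then have "gpow (del a) p = app ((left_mult (ge a) + (- 1)) ^ p) (ge \<one>)" by (simp flip: gpow_left_mult)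
 also have "(left_mult (ge a) + (- 1)) ^ p = left_mult (ge a) ^ p + (- 1)"
  using prime_power_add_commute[OF prime endo_of_nat_p, of "left_mult (ge a)" "- 1"] neg_one_power_p by simp
 also have "app \<dots> (ge \<one>) = ge (a [^] p) - ge \<one>"
  using ga gpow_left_mult[of "ge a" p] by (simp add: minus_endo.rep_eq one_endo.rep_eq)
 finally show ?thesis by (simp add: del_def)
qed

lemma gpow_JS: "a : JS r ==> gpow a m : JS (m * r)"
proof (induction m)
 case 0
 then show ?case by (simp add: JS_def)
next
 case (Suc m)
 then show ?case using JS_mult[of a r "gpow a m" "m * r"] by simp
qed

lemma gr_power:
 assumes r: "a : JS r"
 shows "gr r a ^ Suc m = gr (Suc m * r) (gpow a (Suc m))"
proof (induction m)
 case 0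
 then show ?case using r JS_carrier by (simp add: gmul_one)
next
 case (Suc m)
 have "gr r a ^ Suc (Suc m) = gr r a * gr (Suc m * r) (gpow a (Suc m))" by (simp only: power_Suc[of _ "Suc m"] Suc)
 then show ?case using gr_mult[OF r gpow_JS[OF r, of "Suc m"]] by simp
qed

lemma gr_frobenius:
 assumes a: "a : F r"
 shows "gr r (del a) ^ p = gr (p * r) (del (a [^] p))" "a [^] p : F (p * r)"
proof -
 obtain m where m: "p = Suc m" using prime prime_gt_0_nat[of p] by (cases p) auto
 have d: "del a : JS r" "a : carrier G" using a by (auto simp: F_iff)
 show "gr r (del a) ^ p = gr (p * r) (del (a [^] p))"
  using gr_power[OF d(1), of m] gpow_del[OF d(2)] m by simp
 show "a [^] p : F (p * r)" using gpow_JS[OF d(1), of p] gpow_del[OF d(2)] d by (simp add: F_iff)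
qed

lemma gract_cmp:
 assumes a: "a : JS s" and y: "y : JS r"
 shows "gract s a (cmp r y) = cmp (s + r) (a \<star> y)"
proof -
 have "gract s a (cmp r y) = (\<Sum>d<N. if d = r then cmp (r + s) (a \<star> cmp r y) else 0)"
  unfolding gract_def cmp_cmp by (intro sum.cong) (auto simp: cmp_lin)
 also have "\<dots> = cmp (r + s) (a \<star> cmp r y)"
  using cmp_large[of r y] by (cases "r < N") (auto simp: cmp_lin)
 also have "\<dots> = cmp (r + s) (a \<star> y)"
 proof -
  have "a \<star> (y - cmp r y) : JS (Suc (r + s))"
   using JS_mult[OF a cmp_rest[OF y]] by (simp add: add.commute)
  then have "cmp (r + s) (a \<star> y - a \<star> cmp r y) = 0" by (intro cmp_kills) (simp add: gmul_linear)
  then show ?thesis by (simp add: cmp_lin)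
 qed
 finally show ?thesis by (simp add: add.commute)
qed

text \<open>Every vector is the sum of its components, and positive degrees are spanned by products
  of factors \<open>g - 1\<close>. In degree 0 a vector may be replaced by its augmentation times 1,
  the empty product.\<close>

lemma kG_eq_span_cmp:
 "kG <= fs.span {cmp (length gs) (dprod gs) |gs. set gs <= carrier G}" (is "_ <= fs.span ?S")
proof
 fix v assume v: "v : kG"
 have cmpS: "cmp r y : fs.span ?S" if "y : JS r" "r ~= 0" for r y
 proof -
  have "y : fs.span (DP r)" using that by (simp add: JS_def)
  then show ?thesis
  proof (induction y rule: fs.span_induct)
   case base
   show ?case by (auto simp: fs.subspace_def cmp_lin fs.span_zero fs.span_add fs.span_scale)
  next
   case (step y)
   then show ?case by (auto intro: fs.span_base)
  qed
 qed
 have "cmp r v : fs.span ?S" for r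
 proof (cases "r = 0")
  case False
  have "cmp r v = cmp r (cmp r v)" by (simp add: cmp_cmp)
  then show ?thesis using cmpS[OF cmp_JS[of r v] False] by simp
 next
  case True
  have "v - scale (eps v) (ge \<one>) : JS (Suc 0)" using kG_decompose[OF v] by simp
  then have "cmp 0 (v - scale (eps v) (ge \<one>)) = 0" by (rule cmp_kills)
  then have "cmp 0 v = scale (eps v) (cmp 0 (ge \<one>))" by (simp add: cmp_lin)
  moreover have "cmp 0 (ge \<one>) : ?S" by (auto intro!: exI[of _ "[]"])
  ultimately show ?thesis using True by (simp add: fs.span_base fs.span_scale)
 qed
 then have "(\<Sum>r<N. cmp r v) : fs.span ?S" by (intro fs.span_sum)
 then show "v : fs.span ?S" using sum_cmp[OF v] by simp
qed

lemma spanning_family_independent: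
 assumes W: "finite W" "card W = card (carrier G)" and e: "kG <= fs.span (e ` W)"
  and sum: "(\<Sum>w\<in>W. scale (c w) (e w)) = 0"
 shows "\<forall>w\<in>W. c w = 0"
proof (rule ccontr)
 assume "\<not> ?thesis"
 then obtain w where w: "w : W" "c w ~= 0" by auto
 have ind: "fs.independent (ge ` carrier G)"
 proof
  assume "fs.dependent (ge ` carrier G)"
  then obtain t u z where t: "finite t" "t <= ge ` carrier G" "(\<Sum>v\<in>t. scale (u v) v) = 0"
   and z: "z : t" "u z ~= 0" unfolding fs.dependent_explicit by blast
  then obtain x where x: "ge x : t" "u (ge x) ~= 0" by blast
  have "lookup (\<Sum>v\<in>t. scale (u v) v) x = (\<Sum>v\<in>t. if v = ge x then u (ge x) else 0)"
   unfolding lookup_sum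
  proof (intro sum.cong refl)
   fix v assume "v : t"
   then obtain y where "v = ge y" using t(2) by auto
   moreover have "ge y = ge x \<longleftrightarrow> y = x"
    unfolding ge_def by (metis lookup_single_eq lookup_single_not_eq zero_neq_one)
   ultimately show "lookup (scale (u v) v) x = (if v = ge x then u (ge x) else 0)"
    by (cases "y = x") (simp_all add: ge_def lookup_single_not_eq)
  qed
  then show False using t x by simp
 qed
 have inj: "inj_on ge (carrier G)" unfolding inj_on_def ge_def by (metis lookup_single_eq lookup_single_not_eq zero_neq_one)
 have "(\<Sum>v\<in>W. scale (c v) (e v)) = scale (c w) (e w) + (\<Sum>v\<in>W - {w}. scale (c v) (e v))"
  using W w by (simp add: sum.remove)
 then have "scale (c w) (e w) = - (\<Sum>v\<in>W - {w}. scale (c v) (e v))" using sum by (simp add: eq_neg_iff_add_eq_0)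
 then have "scale (inverse (c w)) (scale (c w) (e w)) = scale (inverse (c w)) (- (\<Sum>v\<in>W - {w}. scale (c v) (e v)))" by simp
 then have "e w = scale (inverse (c w)) (- (\<Sum>v\<in>W - {w}. scale (c v) (e v)))" using w by simp
 also have "\<dots> : fs.span (e ` (W - {w}))"
  by (intro fs.span_scale fs.span_neg fs.span_sum fs.span_base) auto
 finally have "e ` W <= fs.span (e ` (W - {w}))" by (auto intro: fs.span_base)
 then have "kG <= fs.span (e ` (W - {w}))" using e fs.span_minimal[OF _ fs.subspace_span] by blast
 then have "ge ` carrier G <= fs.span (e ` (W - {w}))" by auto
 then have "card (ge ` carrier G) \<le> card (e ` (W - {w}))"
  using fs.independent_span_bound[OF _ ind] W by auto
 also have "\<dots> \<le> card (W - {w})" using W by (intro card_image_le) auto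
 also have "\<dots> < card W" using W w by (intro psubset_card_mono) auto
 finally show False using W inj by (simp add: card_image)
qed

end

context env_algebra
begin

lemma br_zero [simp]: "y : carrier V ==> br \<zero> y = \<zero>" "y : carrier V ==> br y \<zero> = \<zero>"
 using br_smult_left[of \<zero> y 0] br_smult_right[of y \<zero> 0] br_closed by auto

lemma pm_zero: "0 < p ==> pm \<zero> = \<zero>"
 using pm_smult[of \<zero> 0] pm_closed[of \<zero>] by (simp add: power_0_left)

text \<open>The operation \<open>bb\<close> is left open so that the lemma serves both for the map
  into operators with their commutator and for automorphisms of the Lie algebra.\<close>

lemma jacobson_coeff_hom:
 assumes B: "k_space B" and f: "f : module_hom class_ring V B"
  and fb: "\<And>x y. x : carrier V ==> y : carrier V ==> f (br x y) = bb (f x) (f y)"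
  and x: "x : carrier V" and y: "y : carrier V"
 shows "f (jacobson_coeff V br p i x y) = jacobson_coeff B bb p i (f x) (f y)"
  and "jacobson_coeff V br p i x y : carrier V"
proof -
 interpret B: k_space B by (rule B)
 interpret f: k_linear V B f by unfold_locales (rule f)
 have cl: "foldr (\<lambda>b. br (if b then x else y)) bs x : carrier V" for bs
  using x y by (induction bs) (auto intro: br_closed)
 have fo: "f (foldr (\<lambda>b. br (if b then x else y)) bs x) = foldr (\<lambda>b. bb (if b then f x else f y)) bs (f x)" for bs
  using x y cl by (induction bs) (auto simp: fb)
 show "f (jacobson_coeff V br p i x y) = jacobson_coeff B bb p i (f x) (f y)"
  unfolding jacobson_coeff_def using cl by (simp add: f.f_sm f.f_finsum fo finsum_closed)
 show "jacobson_coeff V br p i x y : carrier V"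
  unfolding jacobson_coeff_def using cl by (simp add: finsum_closed)
qed

end

lemma endo_finsum: "finsum endo_algebra f I = sum f I" for f :: "'i => ('b, 'k::field) endo"
proof -
 interpret B: k_algebra "endo_algebra :: ('k::field, ('b, 'k) endo) module" by (rule endo_algebra)
 show ?thesis by (induction I rule: infinite_finite_induct) auto
qed

lemma endo_minus: "f \<ominus>\<^sub>endo_algebra g = f - g" for f g :: "('b, 'k::field) endo"
proof -
 interpret B: k_algebra "endo_algebra :: ('k::field, ('b, 'k) endo) module" by (rule endo_algebra)
 have "\<ominus>\<^sub>endo_algebra g = - g" by (rule B.minus_equality) auto
 then show ?thesis by (simp add: a_minus_def)
qed

section \<open>The action of the enveloping algebra on the group algebra\<close>

context jennings_setting
begin

abbreviation gH where "gH \<equiv> grpH S"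
abbreviation carH where "carH \<equiv> carrier gH"
abbreviation ivH where "ivH \<equiv> m_inv gH"

sublocale PG: p_group_algebra "grpP S" "TYPE('k)" "chr S" "rk S"
 using group_P prime_chr char_k finite_P order_P
 by (intro p_group_algebra.intro p_group_algebra_axioms.intro)

sublocale EN: env_algebra "jennings_space (grpP S)" "lbr S" "lpm S" "chr S"
 by (rule env_algebra.intro) (rule lie)

abbreviation rkS where "rkS \<equiv> {1..rk S}"
abbreviation Irr where "Irr \<equiv> Irr_over S"
abbreviation cenH where "cenH \<equiv> centerH S"
abbreviation tw where "tw \<equiv> twist S"
abbreviation ep where "ep \<equiv> e_phi S"
abbreviation we where "we \<equiv> w_elt S"
abbreviation PBWi where "PBWi \<equiv> PBW_index S"
abbreviation carU where "carU \<equiv> carrier EN.U"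

abbreviation Jn :: "('k, ('k, 'p) jen) module" where "Jn \<equiv> jennings_space (grpP S)"

lemma env_eq: "env S = EN.U" by (simp add: env_def)

abbreviation carJ where "carJ \<equiv> carrier Jn"

lemma bracket_jelt: "1 \<le> r ==> 1 \<le> s ==> a : PG.F r ==> b : PG.F s ==>
  lbr S (PG.jelt r a) (PG.jelt s b) = PG.jelt (r + s) (commutator (grpP S) a b)"
 using lie_bracket unfolding PG.F_def by blast

lemma pmap_jelt: "1 \<le> r ==> a : PG.F r ==>
  lpm S (PG.jelt r a) = PG.jelt (chr S * r) (a [^]\<^sub>(grpP S) chr S)"
 using lie_pmap unfolding PG.F_def by blast

lemma chr_pos: "0 < chr S" "1 \<le> chr S" "2 \<le> chr S"
 using prime_chr prime_gt_0_nat prime_ge_2_nat by (auto simp: Suc_leI)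

interpretation jm: k_linear Jn endo_algebra PG.jmap
proof -
 interpret B: k_algebra "endo_algebra :: ('k, ('p, 'k) endo) module" by (rule endo_algebra)
 show "k_linear Jn endo_algebra PG.jmap" by unfold_locales (rule PG.jmap_hom)
qed

text \<open>Bilinearity reduces the claim to elements \<open>1 \<otimes> a\<close> and
  \<open>1 \<otimes> b\<close>, where it is \<open>gr_commutator\<close>.\<close>

lemma jmap_br:
 assumes x: "x : carJ" and y: "y : carJ"
 shows "PG.jmap (lbr S x y) = PG.jmap x * PG.jmap y - PG.jmap y * PG.jmap x"
 using x
proof (induction x rule: PG.jen_induct)
 case zero
 then show ?case using y jm.f_zero by simp
next
 case (elt r a c)
 note ra = elt
 show ?case using y
 proof (induction y rule: PG.jen_induct)
  case zero
  then show ?case using ra PG.jelt_closed jm.f_zero by simp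
 next
  case (elt s b d)
  have "PG.jmap (lbr S (PG.jelt r a) (PG.jelt s b))
    = PG.jmap (PG.jelt r a) * PG.jmap (PG.jelt s b) - PG.jmap (PG.jelt s b) * PG.jmap (PG.jelt r a)"
   using ra elt PG.gr_commutator[of r s a b] by (simp add: bracket_jelt PG.jmap_jelt)
  then show ?case
   using ra elt PG.jelt_closed EN.br_closed
   by (simp add: EN.br_smult_left EN.br_smult_right jm.f_sm smult_endo_laws mult.commute[of d c])
    (metis diff_add_cancel eq_diff_eq smult_endo_laws(5))
 next
  case (add u v)
  then show ?case using ra PG.jelt_closed EN.br_closed
   by (simp add: EN.br_add_right jm.f_add algebra_simps)
 qed
next
 case (add u v)
 then show ?case using y EN.br_closed by (simp add: EN.br_add_left jm.f_add algebra_simps)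
qed

lemma smult_endo_power: "smult_endo c f ^ m = smult_endo (c ^ m) (f ^ m)"
 by (induction m) (simp_all add: smult_endo_laws mult.commute)

text \<open>The claim is not linear in \<open>x\<close>. For a sum, the axiom \<open>pm_add\<close>
  contributes Jacobson's terms, and \<open>jacobson_formula\<close> identifies their images with the
  mixed words in the \<open>p\<close>-th power of the sum of operators.\<close>

lemma jmap_pm:
 assumes x: "x : carJ"
 shows "PG.jmap (lpm S x) = PG.jmap x ^ chr S"
 using x
proof (induction x rule: PG.jen_induct)
 case zero
 then show ?case using jm.f_zero chr_pos by (simp add: EN.pm_zero power_0_left)
next
 case (elt r a c)
 have "PG.jmap (lpm S (PG.jelt r a)) = PG.jmap (PG.jelt r a) ^ chr S"
  using elt PG.gr_frobenius[of a r] chr_pos by (simp add: pmap_jelt PG.jmap_jelt)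
 then show ?case using elt PG.jelt_closed EN.pm_closed by (simp add: EN.pm_smult jm.f_sm smult_endo_power)
next
 case (add u v)
 have B: "k_space (endo_algebra :: ('k, ('p, 'k) endo) module)"
  by (rule k_algebra.axioms(1)[OF endo_algebra])
 have jc: "PG.jmap (jacobson_coeff Jn (lbr S) (chr S) i u v) = word_sum (PG.jmap u) (PG.jmap v) (chr S) i"
  "jacobson_coeff Jn (lbr S) (chr S) i u v : carJ" if i: "i : {1..<chr S}" for i
 proof -
  have "PG.jmap (jacobson_coeff Jn (lbr S) (chr S) i u v)
    = jacobson_coeff endo_algebra (\<lambda>f g. f * g - g * f) (chr S) i (PG.jmap u) (PG.jmap v)"
   using add jmap_br by (intro EN.jacobson_coeff_hom[OF B PG.jmap_hom]) auto
  also have "\<dots> = smult_endo (inverse (of_nat i)) (ad_sum (PG.jmap u) (PG.jmap v) (chr S - 1) (i - 1))"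
   by (simp add: jacobson_coeff_def endo_finsum ad_sum_def)
  also have "\<dots> = smult_endo (inverse (of_nat i)) (smult_endo (of_nat i) (word_sum (PG.jmap u) (PG.jmap v) (chr S) i))"
   using jacobson_formula(2)[OF prime_chr PG.endo_of_nat_p i, of "PG.jmap u" "PG.jmap v"]
   by (simp add: smult_endo_of_nat)
  also have "\<dots> = word_sum (PG.jmap u) (PG.jmap v) (chr S) i"
  proof -
   \<comment> \<open>Since \<open>i\<close> lies strictly between 0 and \<open>p\<close>, the
     division by \<open>i\<close> in \<open>jacobson_coeff\<close> can be undone.\<close>
   have "of_nat i ~= (0 :: 'k)" using i char_k by (auto simp: of_nat_eq_0_iff_char_dvd dest: dvd_imp_le)
   then show ?thesis by (simp add: smult_endo_laws)
  qed
  finally show "PG.jmap (jacobson_coeff Jn (lbr S) (chr S) i u v) = word_sum (PG.jmap u) (PG.jmap v) (chr S) i" .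
  show "jacobson_coeff Jn (lbr S) (chr S) i u v : carJ"
   using add jmap_br by (intro EN.jacobson_coeff_hom(2)[OF B PG.jmap_hom, where bb = "\<lambda>f g. f * g - g * f"]) auto
 qed
 have js: "PG.jmap (\<Oplus>\<^sub>Jn i\<in>{1..<chr S}. jacobson_coeff Jn (lbr S) (chr S) i u v)
   = (\<Sum>i\<in>{1..<chr S}. word_sum (PG.jmap u) (PG.jmap v) (chr S) i)"
  using jc by (subst jm.f_finsum) (auto simp: endo_finsum simp del: One_nat_def intro!: sum.cong)
 have jcl: "(\<Oplus>\<^sub>Jn i\<in>{1..<chr S}. jacobson_coeff Jn (lbr S) (chr S) i u v) : carJ"
  using jc(2) by (intro EN.finsum_closed) blast
 have "PG.jmap (lpm S (u \<oplus>\<^sub>Jn v)) = PG.jmap (lpm S u) + PG.jmap (lpm S v)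
   + (\<Sum>i\<in>{1..<chr S}. word_sum (PG.jmap u) (PG.jmap v) (chr S) i)"
  using add js jcl by (simp add: EN.pm_add EN.pm_closed jm.f_add del: One_nat_def)
 also have "\<dots> = PG.jmap (u \<oplus>\<^sub>Jn v) ^ chr S"
  using add jacobson_formula(1)[OF prime_chr PG.endo_of_nat_p] by (simp add: jm.f_add)
 finally show ?case .
qed

definition theta :: "(('k, 'p) jen list \<Rightarrow>\<^sub>0 'k) set => ('p, 'k) endo" where
 "theta = (SOME F. F : alg_hom EN.U endo_algebra \<and> (\<forall>v\<in>carJ. F (EN.inc v) = PG.jmap v))"

lemma theta: "theta : alg_hom EN.U endo_algebra" "v : carJ ==> theta (EN.inc v) = PG.jmap v"
proof -
 have "\<exists>F. F : alg_hom EN.U endo_algebra \<and> (\<forall>v\<in>carJ. F (EN.inc v) = PG.jmap v)"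
  using EN.U_hom[OF endo_algebra PG.jmap_hom] jmap_br jmap_pm by (auto simp: endo_minus endo_pow)
 then have "theta : alg_hom EN.U endo_algebra \<and> (\<forall>v\<in>carJ. theta (EN.inc v) = PG.jmap v)"
  unfolding theta_def by (rule someI_ex)
 then show "theta : alg_hom EN.U endo_algebra" "v : carJ ==> theta (EN.inc v) = PG.jmap v" by auto
qed

interpretation th: k_alg_hom EN.U endo_algebra theta
proof -
 interpret B: k_algebra "endo_algebra :: ('k, ('p, 'k) endo) module" by (rule endo_algebra)
 show "k_alg_hom EN.U endo_algebra theta" by unfold_locales (rule theta)
qed

text \<open>Evaluating the action at the class of \<open>1\<close> makes the enveloping algebra large enough.\<close>

definition ev :: "(('k, 'p) jen list \<Rightarrow>\<^sub>0 'k) set => ('p \<Rightarrow>\<^sub>0 'k)" where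
 "ev u = app (theta u) (PG.cmp 0 (PG.ge \<one>\<^sub>(grpP S)))"

lemma ev_lin: "u : carU ==> v : carU ==> ev (u \<oplus>\<^sub>EN.U v) = ev u + ev v"
 "u : carU ==> ev (c \<odot>\<^sub>EN.U u) = scale c (ev u)" "ev \<zero>\<^sub>EN.U = 0"
 using th.f_zero by (simp_all add: ev_def th.f_add th.f_sm plus_endo.rep_eq smult_endo.rep_eq zero_endo.rep_eq)

lemma ev_finsum: "(\<And>i. i : I ==> u i : carU) ==>
  ev (\<Oplus>\<^sub>EN.U i\<in>I. c i \<odot>\<^sub>EN.U u i) = (\<Sum>i\<in>I. scale (c i) (ev (u i)))"
proof (induction I rule: infinite_finite_induct)
 case (insert i I)
 then show ?case by (simp add: ev_lin Pi_def EN.U.finsum_closed)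
qed (simp_all add: ev_lin)

lemma ev_vimage: "fs.subspace W ==> EN.U.subsp {u : carU. ev u : W}"
 unfolding EN.U.subsp_def fs.subspace_def by (auto simp: ev_lin)

lemma ev_mult: "u : carU ==> v : carU ==> ev (u \<otimes>\<^sub>EN.U v) = app (theta u) (ev v)"
 by (simp add: ev_def th.f_mult times_endo.rep_eq)

text \<open>By \<open>gract_cmp\<close>, a letter coming from \<open>g\<close> carries the leading
  component of an element to that of its product with \<open>g - 1\<close>.\<close>

lemma ev_word_jelt:
 "set gs <= carrier (grpP S) ==>
  ev (lprod EN.U (map (\<lambda>g. EN.inc (PG.jelt 1 g)) gs)) = PG.cmp (length gs) (PG.dprod gs)"
proof (induction gs)
 case Nil
 then show ?case by (simp add: ev_def one_endo.rep_eq)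
next
 case (Cons g gs)
 have g: "g : PG.F 1" using Cons.prems by (simp add: PG.F_1[unfolded One_nat_def])
 then have j: "PG.jelt 1 g : carJ" using PG.jelt_closed by blast
 have "lprod EN.U (map (\<lambda>g. EN.inc (PG.jelt 1 g)) gs) : carU"
  using Cons.prems PG.jelt_closed[of 1] PG.F_1 by (intro EN.U.lprod_closed) auto
 then have "ev (lprod EN.U (map (\<lambda>g. EN.inc (PG.jelt 1 g)) (g # gs)))
   = app (PG.gr 1 (PG.del g)) (PG.cmp (length gs) (PG.dprod gs))"
  using j g Cons by (simp add: ev_mult theta PG.jmap_jelt)
 also have "\<dots> = PG.cmp (1 + length gs) (PG.dprod (g # gs))"
  using PG.gract_cmp[of "PG.del g" 1 "PG.dprod gs" "length gs"] PG.dprod_JS[of gs] PG.del_JS[of g] Cons.prems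
  by (simp add: PG.gr.rep_eq)
 finally show ?case by simp
qed

text \<open>Operators act on all finitely supported functions on the type, not only on those
  supported in \<open>P\<close>, so the values of \<open>ev\<close> have to be located.\<close>

lemma ev_kG: "u : carU ==> ev u : PG.kG"
proof -
 have m: "app (PG.jmap v) x : PG.kG" if "v : carJ" "x : PG.kG" for v x
  using that(1)
 proof (induction v rule: PG.jen_induct)
  case zero
  then show ?case using jm.f_zero fs.subspace_0[OF PG.subspace_kG] by (simp add: zero_endo.rep_eq)
 next
  case (elt r a c)
  have "PG.gract r (PG.del a) x : PG.kG"
   unfolding PG.gract_def by (intro fs.subspace_sum[OF PG.subspace_kG] PG.JS_carrier[OF PG.cmp_JS])
  then show ?case
   using elt PG.jelt_closed fs.subspace_scale[OF PG.subspace_kG]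
   by (simp add: jm.f_sm PG.jmap_jelt smult_endo.rep_eq PG.gr.rep_eq)
 next
  case (add u v)
  then show ?case using fs.subspace_add[OF PG.subspace_kG] by (simp add: jm.f_add plus_endo.rep_eq)
 qed
 have "ev (lprod EN.U (map EN.inc ws)) : PG.kG" if "set ws <= carJ" for ws
  using that
 proof (induction ws)
  case Nil
  then show ?case using PG.JS_carrier[OF PG.cmp_JS] by (simp add: ev_def one_endo.rep_eq)
 next
  case (Cons v ws)
  moreover have "lprod EN.U (map EN.inc ws) : carU"
   using Cons.prems by (intro EN.U.lprod_closed) auto
  ultimately show ?case by (simp add: ev_mult theta m)
 qed
 then have "carU <= {u : carU. ev u : PG.kG}"
  by (intro EN.U_spanned[OF ev_vimage[OF PG.subspace_kG]]) (auto simp: subset_iff intro!: EN.U.lprod_closed)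
 then show "u : carU ==> ev u : PG.kG" by auto
qed

section \<open>Words in the basis of eigenvectors and their straightening\<close>

abbreviation wi :: "nat => (('k, 'p) jen list \<Rightarrow>\<^sub>0 'k) set" where "wi i \<equiv> EN.inc (wb S i)"

text \<open>The list gives the indices in the order of application, as in \<open>composable\<close>;
  the written product therefore runs through the reversed list.\<close>

definition wword :: "nat list => (('k, 'p) jen list \<Rightarrow>\<^sub>0 'k) set" where
 "wword is = lprod EN.U (map wi (rev is))"

definition PBW :: "nat list set" where "PBW = ordered_words (rk S) (chr S)"

definition deg1 :: "nat set" where "deg1 = {i : rkS. degw S i = 1}"

lemma wb_family:
 "i : rkS ==> wb S i : carJ" "carJ <= EN.V.spn (wb S ` rkS)"
 "(\<Oplus>\<^sub>Jn i\<in>rkS. a i \<odot>\<^sub>Jn wb S i) = \<zero>\<^sub>Jn ==> \<forall>i\<in>rkS. a i = 0"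
 using EN.V.basis_family[OF _ wb_inj wb_basis] by blast+

lemma wi_closed [simp]: "i : rkS ==> wi i : carU"
 using wb_family(1) by simp

lemma wword_closed [simp]: "set is <= rkS ==> wword is : carU"
 unfolding wword_def by (intro EN.U.lprod_closed) (auto simp del: atLeastAtMost_iff)

lemma wword_append: "set is <= rkS ==> set js <= rkS ==>
  wword (is @ js) = wword js \<otimes>\<^sub>EN.U wword is"
 unfolding wword_def rev_append map_append
 by (rule EN.U.lprod_append) (auto simp del: atLeastAtMost_iff)

lemma wword_Nil [simp]: "wword [] = \<one>\<^sub>EN.U"
 by (simp add: wword_def)

lemma wword_single [simp]: "i : rkS ==> wword [i] = wi i"
 by (simp add: wword_def del: atLeastAtMost_iff)

lemma wi_commutator: "i : rkS ==> j : rkS ==>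
  wi i \<otimes>\<^sub>EN.U wi j \<ominus>\<^sub>EN.U wi j \<otimes>\<^sub>EN.U wi i = (\<Oplus>\<^sub>EN.U k\<in>rkS. cc S i j k \<odot>\<^sub>EN.U wi k)"
 using EN.inc_br[of "wb S i" "wb S j"] wb_family(1) EN.inc.f_lincomb[of "rkS" "wb S" "cc S i j"]
 by (simp add: struct_c del: One_nat_def)

lemma wi_power: "i : rkS ==>
  wi i [^]\<^sub>EN.U chr S = (\<Oplus>\<^sub>EN.U k\<in>rkS. dd S i k \<odot>\<^sub>EN.U wi k)"
 using EN.inc_pm[of "wb S i"] wb_family(1) EN.inc.f_lincomb[of "rkS" "wb S" "dd S i"]
 by (simp add: struct_d del: One_nat_def)

lemma subsp_words: "I <= rkS ==> EN.U.subsp (EN.U.spn (wword ` {is. set is <= I}))"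
 by (intro EN.U.subsp_spn) (auto intro!: wword_closed)

lemma inc_mult_span:
 assumes I: "I <= rkS" and v: "v : EN.V.spn (wb S ` I)" and u: "u : EN.U.spn (wword ` {is. set is <= I})"
 shows "EN.inc v \<otimes>\<^sub>EN.U u : EN.U.spn (wword ` {is. set is <= I})" (is "_ : ?W")
proof -
 note sub = subsp_words[OF I]
 have wbI: "wb S ` I <= carJ" using I wb_family(1) by blast
 have vJ: "v : carJ" using v EN.V.spn_carrier[OF wbI] by blast
 have wI: "wword ` {is. set is <= I} <= carU" using I by (auto intro!: wword_closed)
 have wW: "wword is : ?W" if "set is <= I" for "is"
  using that by (intro EN.U.spn_superset[OF wI]) auto
 have 1: "EN.inc v \<otimes>\<^sub>EN.U wword is : ?W" if "is": "set is <= I" for "is"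
 proof -
  let ?X = "{x : carU. x \<otimes>\<^sub>EN.U wword is : ?W}"
  have isn: "set is <= rkS" using "is" I by blast
  have "EN.V.subsp {v : carJ. EN.inc v : ?X}"
   using EN.U.subsp_mult_right[OF sub wword_closed[OF isn]] by (rule EN.inc.subsp_vimage)
  moreover have "wb S i : {v : carJ. EN.inc v : ?X}" if i: "i : I" for i
  proof -
   have i': "i : rkS" using i I by blast
   then show ?thesis
    using wW[of "is @ [i]"] wword_append[of "is" "[i]"] wb_family(1)[OF i'] i "is" isn by auto
  qed
  ultimately have "EN.V.spn (wb S ` I) <= {v : carJ. EN.inc v : ?X}"
   by (intro EN.V.spn_least) blast+
  then show ?thesis using v by blast
 qed
 have "EN.U.subsp {u : carU. EN.inc v \<otimes>\<^sub>EN.U u : ?W}"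
  using vJ by (intro EN.U.subsp_mult_left[OF sub]) simp
 then have "?W <= {u : carU. EN.inc v \<otimes>\<^sub>EN.U u : ?W}"
  using 1 wI by (intro EN.U.spn_least) auto
 then show ?thesis using u by auto
qed

text \<open>Used twice: with all indices for spanning by words in the basis, and with
  \<open>deg1\<close> for generation in degree one.\<close>

lemma lprod_inc_span:
 assumes I: "I <= rkS" and vs: "set vs <= EN.V.spn (wb S ` I)"
 shows "lprod EN.U (map EN.inc vs) : EN.U.spn (wword ` {is. set is <= I})"
 using vs
proof (induction vs)
 case Nil
 have "wword ` {is. set is <= I} <= carU" using I by (auto intro!: wword_closed)
 moreover have "wword [] : wword ` {is. set is <= I}" by (intro imageI) simp
 ultimately have "wword [] : EN.U.spn (wword ` {is. set is <= I})" by (rule EN.U.spn_superset)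
 then show ?case by simp
next
 case (Cons v vs)
 then show ?case using inc_mult_span[OF I, of v "lprod EN.U (map EN.inc vs)"] by simp
qed

lemma words_span_U:
 assumes W: "EN.U.subsp W" and w: "\<And>is. set is <= rkS ==> wword is : W"
 shows "carU <= W"
proof -
 have "carU <= EN.U.spn (wword ` {is. set is <= rkS})"
  using wb_family(2) lprod_inc_span[OF subset_refl] by (intro EN.U_spanned[OF subsp_words[OF subset_refl]]) blast
 also have "\<dots> <= W" using w by (intro EN.U.spn_least[OF W]) auto
 finally show ?thesis .
qed

text \<open>The straightening process. In the middle of a word an ascent is swapped at the cost of
  its commutator, and a \<open>p\<close>-th power is replaced by a combination of single
  letters.\<close>

lemma ordered_span_U: "carU <= EN.U.spn (wword ` PBW)"
proof (rule words_span_U)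
 let ?W = "EN.U.spn (wword ` PBW)"
 have PBW: "set is <= rkS" if "is : PBW" for "is"
  using that by (simp add: PBW_def ordered_words_def)
 show sub: "EN.U.subsp ?W" using PBW by (intro EN.U.subsp_spn) (auto simp del: atLeastAtMost_iff)
 fix "is" assume "is": "set is <= rkS"
 from "is" chr_pos(3) show "wword is : ?W"
 proof (rule ordered_word_induct)
  fix w assume "set w <= rkS" "sorted (rev w)" "\<forall>i. count_list w i \<le> chr S - 1"
  then have "w : PBW" by (simp add: PBW_def ordered_words_def)
  then show "wword w : ?W" using PBW by (intro EN.U.spn_superset) (auto simp del: atLeastAtMost_iff)
 next
  fix u i j v assume s: "set (u @ i # j # v) <= rkS" and *: "wword (u @ j # i # v) : ?W"
   "\<And>k. k : rkS ==> wword (u @ k # v) : ?W"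
  have uv: "set u <= rkS" "set v <= rkS" "i : rkS" "j : rkS"
   using s by auto
  have sp: "wword (u @ w @ v) = wword v \<otimes>\<^sub>EN.U wword w \<otimes>\<^sub>EN.U wword u" if "set w <= rkS" for w
   using that uv by (simp add: wword_append EN.U.m_assoc del: atLeastAtMost_iff)
  let ?c = "\<Oplus>\<^sub>EN.U k\<in>rkS. cc S j i k \<odot>\<^sub>EN.U wi k"
  \<comment> \<open>The elements that may stand between \<open>v\<close> and \<open>u\<close>
    without leaving the span. They form a subspace, so a relation between middle factors can be
    applied inside a word.\<close>
  let ?M = "{x : carU. wword v \<otimes>\<^sub>EN.U x : {y : carU. y \<otimes>\<^sub>EN.U wword u : ?W}}"
  have M: "EN.U.subsp ?M"
   using uv by (intro EN.U.subsp_mult_left EN.U.subsp_mult_right sub) auto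
  have Mw: "wword w : ?M \<longleftrightarrow> wword (u @ w @ v) : ?W" if "set w <= rkS" for w
   using that uv by (simp add: sp del: atLeastAtMost_iff)
  have "wi k : ?M" if "k : rkS" for k
   using Mw[of "[k]"] *(2)[OF that] that by (simp del: atLeastAtMost_iff)
  then have "?c : ?M" by (intro EN.U.subsp_finsum[OF M] EN.U.subspD(4)[OF M])
  moreover have "wword [j, i] : ?M" using Mw[of "[j, i]"] *(1) uv by simp
  moreover have "wword [i, j] = ?c \<oplus>\<^sub>EN.U wword [j, i]"
  proof -
   have w2: "wword [a, b] = wi b \<otimes>\<^sub>EN.U wi a" if "a : rkS" "b : rkS" for a b
    using that wword_append[of "[a]" "[b]"] by simp
   have "?c \<oplus>\<^sub>EN.U wi i \<otimes>\<^sub>EN.U wi j = wi j \<otimes>\<^sub>EN.U wi i"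
    unfolding wi_commutator[OF uv(4,3), symmetric] using uv
    by (simp add: a_minus_def EN.U.a_assoc EN.U.l_neg del: atLeastAtMost_iff)
   then show ?thesis using uv by (simp add: w2 del: atLeastAtMost_iff)
  qed
  ultimately have "wword [i, j] : ?M" using EN.U.subspD(3)[OF M] by simp
  then show "wword (u @ i # j # v) : ?W" using Mw[of "[i, j]"] uv by simp
 next
  fix u i v assume s: "set (u @ i # v) <= rkS" and *: "\<And>k. k : rkS ==> wword (u @ k # v) : ?W"
  have uv: "set u <= rkS" "set v <= rkS" "i : rkS"
   using s by auto
  have sp: "wword (u @ w @ v) = wword v \<otimes>\<^sub>EN.U wword w \<otimes>\<^sub>EN.U wword u" if "set w <= rkS" for w
   using that uv by (simp add: wword_append EN.U.m_assoc del: atLeastAtMost_iff)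
  let ?M = "{x : carU. wword v \<otimes>\<^sub>EN.U x : {y : carU. y \<otimes>\<^sub>EN.U wword u : ?W}}"
  have M: "EN.U.subsp ?M"
   using uv by (intro EN.U.subsp_mult_left EN.U.subsp_mult_right sub) auto
  have Mw: "wword w : ?M \<longleftrightarrow> wword (u @ w @ v) : ?W" if "set w <= rkS" for w
   using that uv by (simp add: sp del: atLeastAtMost_iff)
  have "wi k : ?M" if "k : rkS" for k
   using Mw[of "[k]"] *[OF that] that by (simp del: atLeastAtMost_iff)
  then have "wi i [^]\<^sub>EN.U chr S : ?M"
   unfolding wi_power[OF uv(3)] by (intro EN.U.subsp_finsum[OF M] EN.U.subspD(4)[OF M])
  moreover have "wword (replicate (chr S) i) = wi i [^]\<^sub>EN.U chr S"
   using EN.U.lprod_replicate[OF wi_closed[OF uv(3)]] by (simp add: wword_def)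
  moreover have "set (replicate (chr S) i) <= rkS" using uv by auto
  ultimately show "wword (u @ replicate (chr S) i @ v) : ?W"
   using Mw[of "replicate (chr S) i"] by simp
 qed
qed

end

section \<open>Independence of the ordered words and generation in degree one\<close>

context jennings_setting
begin

lemma PBW_subset: "w : PBW ==> set w <= rkS"
 by (simp add: PBW_def ordered_words_def)

lemma finite_PBW: "finite PBW" and card_PBW: "card PBW = Coset.order (grpP S)"
 unfolding PBW_def using finite_ordered_words[OF chr_pos(2)] card_ordered_words[OF chr_pos(2)] order_P by auto

lemma PBW_words: "wword ` PBW <= carU"
 using wword_closed PBW_subset by blast

lemma ev_PBW_spans: "PG.kG <= fs.span ((\<lambda>w. ev (wword w)) ` PBW)"
proof -
 let ?X = "fs.span ((\<lambda>w. ev (wword w)) ` PBW)"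
 have "EN.U.spn (wword ` PBW) <= {u : carU. ev u : ?X}"
  using PBW_words by (intro EN.U.spn_least ev_vimage) (auto intro: fs.span_base)
 then have U: "ev u : ?X" if "u : carU" for u using ordered_span_U that by blast
 have "PG.cmp (length gs) (PG.dprod gs) : ?X" if gs: "set gs <= carrier (grpP S)" for gs
 proof -
  have "lprod EN.U (map (\<lambda>g. EN.inc (PG.jelt 1 g)) gs) : carU"
   using gs PG.jelt_closed[of 1] PG.F_1 by (intro EN.U.lprod_closed) auto
  then show ?thesis using U[of "lprod EN.U (map (\<lambda>g. EN.inc (PG.jelt 1 g)) gs)"] ev_word_jelt[OF gs] by simp
 qed
 then have "fs.span {PG.cmp (length gs) (PG.dprod gs) |gs. set gs <= carrier (grpP S)} <= ?X"
  by (intro fs.span_minimal fs.subspace_span) auto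
 then show ?thesis using PG.kG_eq_span_cmp by blast
qed

lemma ev_PBW_independent:
 "(\<Sum>w\<in>PBW. scale (c w) (ev (wword w))) = 0 ==> \<forall>w\<in>PBW. c w = 0"
 using PG.spanning_family_independent[OF finite_PBW _ ev_PBW_spans] card_PBW by (simp add: Coset.order_def)

lemma PBW_independent:
 assumes "(\<Oplus>\<^sub>EN.U w\<in>PBW. c w \<odot>\<^sub>EN.U wword w) = \<zero>\<^sub>EN.U"
 shows "\<forall>w\<in>PBW. c w = 0"
proof -
 have "(\<Sum>w\<in>PBW. scale (c w) (ev (wword w))) = ev (\<Oplus>\<^sub>EN.U w\<in>PBW. c w \<odot>\<^sub>EN.U wword w)"
  using PBW_words by (subst ev_finsum) auto
 then show ?thesis using assms ev_PBW_independent by (simp add: ev_lin)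
qed

text \<open>The ordered words span and have independent values, so an element with value zero has
  only zero coefficients.\<close>

lemma ev_inj:
 assumes u: "u : carU" and "ev u = 0"
 shows "u = \<zero>\<^sub>EN.U"
proof -
 obtain c where c: "u = (\<Oplus>\<^sub>EN.U w\<in>PBW. c w \<odot>\<^sub>EN.U wword w)"
  using EN.U.spn_family[OF finite_PBW, of wword u] ordered_span_U u PBW_words by blast
 then have "(\<Sum>w\<in>PBW. scale (c w) (ev (wword w))) = 0"
  using assms(2) PBW_words by (subst (asm) c, subst (asm) ev_finsum) auto
 then have "\<forall>w\<in>PBW. c w = 0" by (rule ev_PBW_independent)
 then have "u = (\<Oplus>\<^sub>EN.U w\<in>PBW. \<zero>\<^sub>EN.U)"
  unfolding c using PBW_words by (intro EN.U.finsum_cong') auto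
 then show ?thesis by simp
qed

subsection \<open>Generation in degree one\<close>

lemma jelt_1_span:
 assumes g: "g : carrier (grpP S)"
 shows "PG.jelt 1 g : EN.V.spn (wb S ` deg1)"
proof -
 \<comment> \<open>The projection onto degree 1. It fixes \<open>PG.jelt 1 g\<close> and kills the
   basis vectors of other degrees, so only those indexed by \<open>deg1\<close> occur in an
   expansion.\<close>
 define pr :: "('k, 'p) jen => ('k, 'p) jen" where "pr v = PG.sum.inj 1 (v 1)" for v
 have ap: "v 1 : carrier (extend_scalars (PG.Q 1))" if "v : carJ" for v
  using PG.Jen_apply[OF that, of 1] by simp
 have D: "Jn = direct_sum {1..} (\<lambda>r. extend_scalars (PG.Q r))" by (rule PG.Jen_def)
 have prc: "pr v : carJ" if "v : carJ" for v
  unfolding pr_def D using ap[OF that] by (intro PG.sum.inj_closed) auto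
 have "pr : module_hom class_ring Jn Jn"
 proof (rule module_homI)
  fix u v assume "u : carJ" "v : carJ"
  have "(u \<oplus>\<^sub>Jn v) 1 = u 1 \<oplus>\<^sub>(extend_scalars (PG.Q 1)) v 1" by (simp add: D direct_sum_simps)
  then show "pr (u \<oplus>\<^sub>Jn v) = pr u \<oplus>\<^sub>Jn pr v"
   unfolding pr_def using PG.sum.inj_add[of 1 "u 1" "v 1"] by (simp add: D)
 next
  fix c u
  have "(c \<odot>\<^sub>Jn u) 1 = c \<odot>\<^sub>(extend_scalars (PG.Q 1)) u 1" by (simp add: D direct_sum_simps)
  then show "pr (c \<odot>\<^sub>Jn u) = c \<odot>\<^sub>Jn pr u"
   unfolding pr_def using PG.sum.inj_smult[of 1 c "u 1"] by (simp add: D)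
 qed (rule prc)
 then interpret pr: k_linear Jn Jn pr by unfold_locales
 have pr_deg: "pr v = (if r = 1 then v else \<zero>\<^sub>Jn)" if v: "v : jennings_component (grpP S) r" and r: "r \<ge> 1" for v r
 proof -
  have vz: "v s = \<zero>\<^sub>(extend_scalars (PG.Q s))" if "s \<ge> 1" "s ~= r" for s
   using v that by (simp add: jennings_component_def PG.Q_def)
  have vc: "v : carJ" using v by (simp add: jennings_component_def)
  have vx: "v s = undefined" if "\<not> s \<ge> 1" for s
   using vc that by (auto simp: D direct_sum_simps PiE_iff extensional_def)
  show ?thesis
  proof (rule ext)
   fix s
   show "pr v s = (if r = 1 then v else \<zero>\<^sub>Jn) s"
    using vz[of s] vz[of 1] vx[of s] r
    by (cases "s \<ge> 1"; cases "s = 1"; cases "r = 1")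
     (simp_all add: pr_def PG.sum.inj_def D direct_sum_simps del: One_nat_def)
  qed
 qed
 have j: "PG.jelt 1 g : carJ" using PG.jelt_closed[of 1 g] g PG.F_1 by simp
 have "PG.jelt 1 g : jennings_component (grpP S) 1"
  using j by (auto simp: jennings_component_def jennings_elt_def Let_def)
 then have prj: "pr (PG.jelt 1 g) = PG.jelt 1 g" using pr_deg[of "PG.jelt 1 g" 1] by simp
 have wbc: "\<And>i. i : rkS ==> wb S i : carJ" by (rule wb_family(1))
 have sub: "EN.V.subsp (EN.V.spn (wb S ` deg1))"
  using wbc by (intro EN.V.subsp_spn) (auto simp: deg1_def)
 have pw: "pr (wb S i) : EN.V.spn (wb S ` deg1)" if i: "i : rkS" for i
 proof (cases "degw S i = 1")
  case True
  have "wb S i : EN.V.spn (wb S ` deg1)"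
   using wbc i True by (intro EN.V.spn_superset) (auto simp: deg1_def)
  then show ?thesis using pr_deg[of "wb S i" "degw S i"] wb_homogeneous[OF i] True by simp
 next
  case False
  then show ?thesis using pr_deg[of "wb S i" "degw S i"] wb_homogeneous[OF i] EN.V.subspD(2)[OF sub] by simp
 qed
 have "EN.V.spn (wb S ` rkS) <= {v : carJ. pr v : EN.V.spn (wb S ` deg1)}"
  using wbc pw by (intro EN.V.spn_least pr.subsp_vimage[OF sub]) blast
 then show ?thesis using wb_family(2) j prj by auto
qed

text \<open>The values of the degree-one words already fill \<open>kG\<close>. Any \<open>u\<close>
  thus shares its value with a combination of them, and injectivity of \<open>ev\<close> makes the
  two equal.\<close>

lemma deg1_words_span_U: "carU <= EN.U.spn (wword ` {is. set is <= deg1})" (is "_ <= ?D")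
proof
 fix u assume u: "u : carU"
 have d1: "deg1 <= rkS" by (auto simp: deg1_def)
 have sub: "EN.U.subsp ?D" by (rule subsp_words[OF d1])
 have "fs.subspace (ev ` ?D)"
  unfolding fs.subspace_def
 proof (intro conjI ballI allI)
  show "0 : ev ` ?D" using imageI[OF EN.U.subspD(2)[OF sub], of ev] by (simp add: ev_lin)
  show "x + y : ev ` ?D" if xy: "x : ev ` ?D" "y : ev ` ?D" for x y
  proof -
   obtain a b where ab: "a : ?D" "b : ?D" "x = ev a" "y = ev b" using xy by auto
   then have "x + y = ev (a \<oplus>\<^sub>EN.U b)" using EN.U.subspD(1)[OF sub] by (simp add: ev_lin subset_iff)
   then show ?thesis using EN.U.subspD(3)[OF sub ab(1,2)] by simp
  qed
  show "scale c x : ev ` ?D" if x: "x : ev ` ?D" for x c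
  proof -
   obtain a where a: "a : ?D" "x = ev a" using x by auto
   then have "scale c x = ev (c \<odot>\<^sub>EN.U a)" using EN.U.subspD(1)[OF sub] by (simp add: ev_lin subset_iff)
   then show ?thesis using EN.U.subspD(4)[OF sub a(1)] by simp
  qed
 qed
 moreover have "PG.cmp (length gs) (PG.dprod gs) : ev ` ?D" if gs: "set gs <= carrier (grpP S)" for gs
 proof -
  have "lprod EN.U (map EN.inc (map (PG.jelt 1) gs)) : ?D"
   using gs jelt_1_span by (intro lprod_inc_span[OF d1]) auto
  then have "lprod EN.U (map (\<lambda>g. EN.inc (PG.jelt 1 g)) gs) : ?D" by (simp add: comp_def)
  then have "ev (lprod EN.U (map (\<lambda>g. EN.inc (PG.jelt 1 g)) gs)) : ev ` ?D" by (rule imageI)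
  then show ?thesis using ev_word_jelt[OF gs] by simp
 qed
 ultimately have "fs.span {PG.cmp (length gs) (PG.dprod gs) |gs. set gs <= carrier (grpP S)} <= ev ` ?D"
  by (intro fs.span_minimal) auto
 then have "ev u : ev ` ?D" using PG.kG_eq_span_cmp ev_kG[OF u] by blast
 then obtain d where d: "d : ?D" "ev u = ev d" by auto
 have dU: "d : carU" using d EN.U.subspD(1)[OF sub] by auto
 have "ev (u \<oplus>\<^sub>EN.U (- 1) \<odot>\<^sub>EN.U d) = 0" using u dU d(2) by (simp add: ev_lin)
 then have "u \<oplus>\<^sub>EN.U (- 1) \<odot>\<^sub>EN.U d = \<zero>\<^sub>EN.U" using u dU by (intro ev_inj) auto
 then have "u \<ominus>\<^sub>EN.U d = \<zero>\<^sub>EN.U" using dU by (simp add: EN.U.sm_neg a_minus_def)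
 then show "u : ?D" using d EN.U.minus_eq_zero_iff[OF u dU] by simp
qed

section \<open>The smash product\<close>

lemma proj_auto:
 assumes h: "h : carH"
 shows "proj S h : hom (grpP S) (grpP S)" "proj S h : Bij (carrier (grpP S))"
proof -
 have "proj S h : autL S" using hom_in_carrier[OF proj_hom h] by simp
 also have "autL S <= carrier (AutoGroup (grpP S))" using subgroup_L by (rule subgroup.subset)
 finally show "proj S h : hom (grpP S) (grpP S)" "proj S h : Bij (carrier (grpP S))"
  by (auto simp: AutoGroup_def auto_def)
qed

lemma proj_mult:
 assumes "g : carH" "h : carH" "x : carrier (grpP S)"
 shows "proj S (g \<otimes>\<^sub>gH h) x = proj S g (proj S h x)"
 using hom_mult[OF proj_hom assms(1,2)] proj_auto[OF assms(1)] proj_auto[OF assms(2)] assms(3)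
 by (simp add: AutoGroup_def BijGroup_def compose_def)

lemma proj_closed: "h : carH ==> x : carrier (grpP S) ==> proj S h x : carrier (grpP S)"
 using hom_in_carrier[OF proj_auto(1)] .

sublocale H: group "grpH S" by (rule group_H)

text \<open>The map is injective and idempotent on \<open>P\<close>, which leaves only the
  identity.\<close>

lemma proj_one: "x : carrier (grpP S) ==> proj S \<one>\<^sub>gH x = x"
proof -
 assume x: "x : carrier (grpP S)"
 have "inj_on (proj S \<one>\<^sub>gH) (carrier (grpP S))"
  using proj_auto(2)[OF H.one_closed] by (auto simp: Bij_def bij_betw_def)
 moreover have "proj S \<one>\<^sub>gH (proj S \<one>\<^sub>gH x) = proj S \<one>\<^sub>gH x"
  using proj_mult[OF H.one_closed H.one_closed x] by simp
 ultimately show ?thesis using x proj_closed[OF H.one_closed x] by (auto dest: inj_onD)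
qed

lemma proj_inv: "h : carH ==> x : carrier (grpP S) ==> proj S h (proj S (ivH h) x) = x"
 "h : carH ==> x : carrier (grpP S) ==> proj S (ivH h) (proj S h x) = x"
 using proj_mult[of h "ivH h" x] proj_mult[of "ivH h" h x] proj_one by simp_all

abbreviation jact :: "'h => ('k, 'p) jen => ('k, 'p) jen" where "jact h \<equiv> jennings_act (proj S h)"

lemma
 assumes h: "h : carH"
 shows jact_hom: "jact h : module_hom class_ring Jn Jn"
  and jact_jelt: "r \<ge> 1 ==> a : PG.F r ==> jact h (PG.jelt r a) = PG.jelt r (proj S h a)"
  and proj_F: "a : PG.F r ==> proj S h a : PG.F r"
proof -
 note * = proj_auto(1)[OF h] proj_auto(1)[OF H.inv_closed[OF h]]
 show "jact h : module_hom class_ring Jn Jn"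
  by (rule PG.act_hom[OF *]) (auto simp: proj_inv h)
 show "r \<ge> 1 ==> a : PG.F r ==> jact h (PG.jelt r a) = PG.jelt r (proj S h a)"
  by (rule PG.act_jelt[OF *]) (auto simp: proj_inv h)
 show "a : PG.F r ==> proj S h a : PG.F r"
  by (rule PG.F_hom[OF * _ _ *(1)]) (auto simp: proj_inv h)
qed

lemma jact_linear: "h : carH ==> k_linear Jn Jn (jact h)"
 by unfold_locales (rule jact_hom)

text \<open>On elements \<open>1 \<otimes> a\<close> the bracket is the group commutator, which
  automorphisms respect; bilinearity does the rest.\<close>

lemma jact_br:
 assumes h: "h : carH" and x: "x : carJ" and y: "y : carJ"
 shows "jact h (lbr S x y) = lbr S (jact h x) (jact h y)"
proof -
 interpret a: k_linear Jn Jn "jact h" by (rule jact_linear[OF h])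
 show ?thesis
  using x
 proof (induction x rule: PG.jen_induct)
  case zero
  then show ?case using y by simp
 next
  case (elt r b c)
  note rb = elt
  show ?case using y
  proof (induction y rule: PG.jen_induct)
   case zero
   then show ?case using rb PG.jelt_closed by simp
  next
   case (elt s d e)
   have "proj S h (commutator (grpP S) b d) = commutator (grpP S) (proj S h b) (proj S h d)"
   proof -
    interpret ph: group_hom "grpP S" "grpP S" "proj S h"
     using proj_auto(1)[OF h] by (intro group_hom.intro group_hom_axioms.intro PG.is_group)
    show ?thesis using PG.F_closed[OF rb(2)] PG.F_closed[OF elt(2)] by (simp add: commutator_def)
   qed
   then have "jact h (lbr S (PG.jelt r b) (PG.jelt s d)) = lbr S (jact h (PG.jelt r b)) (jact h (PG.jelt s d))"
    using rb elt PG.gr_commutator(1)[of r s b d] proj_F[OF h]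
    by (simp add: bracket_jelt jact_jelt[OF h])
   then show ?case
    using rb elt PG.jelt_closed by (simp add: a.f_sm EN.br_smult_left EN.br_smult_right EN.br_closed)
  next
   case (add u v)
   then show ?case using rb PG.jelt_closed by (simp add: a.f_add EN.br_add_right EN.br_closed)
  qed
 next
  case (add u v)
  then show ?case using y by (simp add: a.f_add EN.br_add_left EN.br_closed)
 qed
qed

text \<open>The \<open>p\<close>-map is not additive, so the case of a sum also compares Jacobson's
  terms, which are built from brackets.\<close>

lemma jact_pm:
 assumes h: "h : carH" and x: "x : carJ"
 shows "jact h (lpm S x) = lpm S (jact h x)"
proof -
 interpret a: k_linear Jn Jn "jact h" by (rule jact_linear[OF h])
 show ?thesis
  using x
 proof (induction x rule: PG.jen_induct)
  case zero
  then show ?case using chr_pos by (simp add: EN.pm_zero)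
 next
  case (elt r b c)
  have "proj S h (b [^]\<^sub>(grpP S) chr S) = proj S h b [^]\<^sub>(grpP S) chr S"
  proof -
   interpret ph: group_hom "grpP S" "grpP S" "proj S h"
    using proj_auto(1)[OF h] by (intro group_hom.intro group_hom_axioms.intro PG.is_group)
   show ?thesis using PG.F_closed[OF elt(2)] by (simp add: ph.hom_nat_pow)
  qed
  then have "jact h (lpm S (PG.jelt r b)) = lpm S (jact h (PG.jelt r b))"
   using elt PG.gr_frobenius(2)[of b r] proj_F[OF h] chr_pos
   by (simp add: pmap_jelt jact_jelt[OF h])
  then show ?case using elt PG.jelt_closed by (simp add: a.f_sm EN.pm_smult EN.pm_closed)
 next
  case (add u v)
  have k: "k_space Jn" by (rule PG.space_Jen)
  have jc: "jact h (jacobson_coeff Jn (lbr S) (chr S) i u v) = jacobson_coeff Jn (lbr S) (chr S) i (jact h u) (jact h v)"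
   "jacobson_coeff Jn (lbr S) (chr S) i u v : carJ" for i
   using EN.jacobson_coeff_hom[OF k jact_hom[OF h], of "lbr S" u v] jact_br[OF h] add by auto
  have "jact h (lpm S (u \<oplus>\<^sub>Jn v)) = jact h (lpm S u) \<oplus>\<^sub>Jn jact h (lpm S v) \<oplus>\<^bsub>Jn\<^esub>
    (\<Oplus>\<^sub>Jn i\<in>{1..<chr S}. jacobson_coeff Jn (lbr S) (chr S) i (jact h u) (jact h v))"
   using add jc by (simp add: EN.pm_add a.f_add EN.pm_closed a.f_finsum EN.finsum_closed Pi_def)
  then show ?case using add by (simp add: EN.pm_add a.f_add)
 qed
qed

abbreviation uact :: "'h => (('k, 'p) jen list \<Rightarrow>\<^sub>0 'k) set => (('k, 'p) jen list \<Rightarrow>\<^sub>0 'k) set" where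
 "uact h \<equiv> enveloping_act (jact h)"

lemma jact_mult:
 assumes "g : carH" "h : carH" "v : carJ"
 shows "jact (g \<otimes>\<^sub>gH h) v = jact g (jact h v)"
proof -
 interpret a: k_linear Jn Jn "jact g" by (rule jact_linear[OF assms(1)])
 interpret b: k_linear Jn Jn "jact h" by (rule jact_linear[OF assms(2)])
 interpret c: k_linear Jn Jn "jact (g \<otimes>\<^sub>gH h)" using assms by (intro jact_linear) auto
 show ?thesis using assms(3)
 proof (induction v rule: PG.jen_induct)
  case (elt r x e)
  then show ?case
   using assms(1,2) PG.jelt_closed proj_F PG.F_closed
   by (simp add: a.f_sm b.f_sm c.f_sm jact_jelt proj_mult)
 qed (simp_all add: a.f_add b.f_add c.f_add)
qed

lemma jact_one: "v : carJ ==> jact \<one>\<^sub>gH v = v"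
proof -
 interpret a: k_linear Jn Jn "jact \<one>\<^sub>gH" by (rule jact_linear[OF H.one_closed])
 show "v : carJ ==> jact \<one>\<^sub>gH v = v"
 proof (induction v rule: PG.jen_induct)
  case (elt r x e)
  then show ?case using PG.jelt_closed PG.F_closed by (simp add: a.f_sm jact_jelt proj_one)
 qed (simp_all add: a.f_add)
qed

lemma
 assumes h: "h : carH"
 shows uact_hom: "uact h : alg_hom EN.U EN.U"
  and uact_inc: "v : carJ ==> uact h (EN.inc v) = EN.inc (jact h v)"
proof -
 have hi: "ivH h : carH" using h by simp
 have inv: "jact h (jact (ivH h) v) = v" if "v : carJ" for v
  using jact_mult[OF h hi that] jact_one[OF that] h by simp
 show "uact h : alg_hom EN.U EN.U"
  by (rule EN.env_act_hom[OF jact_hom[OF h] jact_hom[OF hi]]) (auto simp: inv jact_br jact_pm h)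
 show "v : carJ ==> uact h (EN.inc v) = EN.inc (jact h v)"
  by (rule EN.env_act_inc[OF jact_hom[OF h] jact_hom[OF hi]]) (auto simp: inv jact_br jact_pm h)
qed

lemma alg_hom_U_eq:
 assumes f: "f : alg_hom EN.U EN.U" and g: "g : alg_hom EN.U EN.U"
  and eq: "\<And>v. v : carJ ==> f (EN.inc v) = g (EN.inc v)" and u: "u : carU"
 shows "f u = g u"
proof -
 interpret f: k_alg_hom EN.U EN.U f by unfold_locales (rule f)
 interpret g: k_alg_hom EN.U EN.U g by unfold_locales (rule g)
 have "EN.U.subsp {u : carU. f u = g u}"
  unfolding EN.U.subsp_def by (auto simp: f.f_add g.f_add f.f_sm g.f_sm)
 moreover have "lprod EN.U (map EN.inc ws) : {u : carU. f u = g u}" if "set ws <= carJ" for ws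
 proof -
  have "set (map EN.inc ws) <= carU" using that by auto
  moreover have "map f (map EN.inc ws) = map g (map EN.inc ws)" using that eq by auto
  ultimately have "f (lprod EN.U (map EN.inc ws)) = g (lprod EN.U (map EN.inc ws))"
   using alg_hom_lprod[OF f.k_alg_hom_axioms, of "map EN.inc ws"] alg_hom_lprod[OF g.k_alg_hom_axioms, of "map EN.inc ws"]
   by (simp only:)
  then show ?thesis using \<open>set (map EN.inc ws) <= carU\<close> EN.U.lprod_closed by blast
 qed
 ultimately show ?thesis using EN.U_spanned u by blast
qed

sublocale SM: skew_algebra "env S" "grpH S" uact
proof -
 interpret E: k_algebra "env S" unfolding env_eq by unfold_locales
 show "skew_algebra (env S) (grpH S) uact"
 proof
  show "finite (carH)" by (rule finite_H)
  show "uact g : alg_hom (env S) (env S)" if "g : carH" for g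
   using uact_hom[OF that] by (simp add: env_eq)
  have id: "(\<lambda>u. u) : alg_hom EN.U EN.U" by (rule alg_homI) auto
  show "uact \<one>\<^sub>gH a = a" if "a : carrier (env S)" for a
   using that alg_hom_U_eq[OF uact_hom[OF H.one_closed] id] by (simp add: env_eq uact_inc jact_one)
  fix g h a assume gh: "g : carH" "h : carH" and a: "a : carrier (env S)"
  interpret g: k_alg_hom EN.U EN.U "uact g" by unfold_locales (rule uact_hom[OF gh(1)])
  interpret h: k_alg_hom EN.U EN.U "uact h" by unfold_locales (rule uact_hom[OF gh(2)])
  have "(\<lambda>u. uact g (uact h u)) : alg_hom EN.U EN.U"
   by (rule alg_homI) (auto simp: g.f_mult h.f_mult g.f_add h.f_add g.f_sm h.f_sm)
  moreover have "jact h v : carJ" if "v : carJ" for v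
   using k_linear.f_closed[OF jact_linear[OF gh(2)] that] .
  ultimately show "uact (g \<otimes>\<^sub>gH h) a = uact g (uact h a)"
   using a gh alg_hom_U_eq[OF uact_hom[of "g \<otimes>\<^sub>gH h"]] by (simp add: env_eq uact_inc jact_mult)
 qed
qed

end

section \<open>Characters of finite groups of order prime to the characteristic\<close>

lemma units_class_ring: "carrier (units_of (class_ring :: 'k::field ring)) = UNIV - {0}"
proof -
 have "\<exists>y. x * y = 1 \<and> y * x = 1" if "x ~= 0" for x :: 'k
  using that by (intro exI[of _ "inverse x"]) auto
 then show ?thesis by (auto simp: units_of_def Units_def class_ring_simps)
qed

lemma hom_units_iff:
 "\<theta> : hom G (units_of (class_ring :: 'k::field ring)) \<longleftrightarrow>
  (\<forall>x\<in>carrier G. \<theta> x ~= 0) \<and> (\<forall>x\<in>carrier G. \<forall>y\<in>carrier G. \<theta> (x \<otimes>\<^sub>G y) = \<theta> x * \<theta> y)"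
 unfolding hom_def Pi_iff units_class_ring by (auto simp: units_of_mult class_ring_simps)

locale character = group G for G :: "'g monoid" (structure) +
 fixes \<theta> :: "'g => 'k::field"
 assumes hom: "\<theta> : hom G (units_of class_ring)"
begin

lemma nz [simp]: "x : carrier G ==> \<theta> x ~= 0"
 and mult: "x : carrier G ==> y : carrier G ==> \<theta> (x \<otimes> y) = \<theta> x * \<theta> y"
 using hom by (auto simp: hom_units_iff)

lemma at_one [simp]: "\<theta> \<one> = 1"
 using mult[of \<one> \<one>] nz[of \<one>] by simp

lemma at_inv: "x : carrier G ==> \<theta> (inv x) = inverse (\<theta> x)"
 using mult[of x "inv x"] by (simp add: inverse_unique)

lemma at_pow: "x : carrier G ==> \<theta> (x [^] (n::nat)) = \<theta> x ^ n"
 by (induction n) (auto simp: mult)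

text \<open>Translation by \<open>g\<close> permutes the summands and multiplies the sum by
  \<open>\<theta> g\<close>, which is not 1.\<close>

lemma sum_nontrivial:
 assumes g: "g : carrier G" "\<theta> g ~= 1"
 shows "(\<Sum>x\<in>carrier G. \<theta> x) = 0"
proof -
 have "bij_betw (\<lambda>x. g \<otimes> x) (carrier G) (carrier G)"
  using g by (simp add: bij_betw_def inj_on_cmult surj_const_mult)
 then have "(\<Sum>x\<in>carrier G. \<theta> x) = (\<Sum>x\<in>carrier G. \<theta> (g \<otimes> x))"
  using sum.reindex_bij_betw[of "\<lambda>x. g \<otimes> x" "carrier G" "carrier G" \<theta>] by simp
 also have "\<dots> = \<theta> g * (\<Sum>x\<in>carrier G. \<theta> x)"
  using g by (simp add: mult sum_distrib_left)
 finally show ?thesis using g(2) by simp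
qed

end

text \<open>The polynomial \<open>X ^ m - c\<close> splits into \<open>m\<close> linear factors. A
  repeated root would also be a root of the derivative, a nonzero multiple of
  \<open>X ^ (m - 1)\<close>, hence 0; but 0 is no root since \<open>c\<close> is not 0.\<close>

lemma card_radical_roots:
 fixes c :: "'k::alg_closed_field"
 assumes m: "0 < m" "of_nat m ~= (0::'k)" and c: "c ~= 0"
 shows "card {r. r ^ m = c} = m"
proof -
 define f where "f = monom (1::'k) m - [:c:]"
 have pf: "poly f x = x ^ m - c" for x by (simp add: f_def poly_monom)
 have "Polynomial.coeff f m = 1" using m(1) by (simp add: f_def coeff_eq_0 coeff_pCons split: nat.split)
 moreover have "degree f \<le> m" unfolding f_def by (intro degree_diff_le) (auto simp: degree_monom_eq)
 ultimately have df: "degree f = m" and lf: "lead_coeff f = 1"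
  using le_degree[of f m] by auto
 have f0: "f ~= 0" using lf by auto
 obtain A where A: "size A = degree f" "f = Polynomial.smult (lead_coeff f) (\<Prod>x\<in>#A. [:-x, 1:])"
  using alg_closed_imp_factorization[OF f0] by blast
 have f: "f = (\<Prod>x\<in>#A. [:-x, 1:])" using A(2) lf by simp
 have roots: "set_mset A = {r. r ^ m = c}"
 proof -
  have "poly f r = 0 \<longleftrightarrow> r \<in># A" for r
   unfolding f by (induction A) auto
  then show ?thesis using pf by auto
 qed
 have cnt: "count A a \<le> 1" for a
 proof (rule ccontr)
  assume "\<not> count A a \<le> 1"
  then have "{#a, a#} <=# A" by (intro mset_subset_eqI) auto
  then obtain B where "A = {#a, a#} + B" by (metis subset_mset.add_diff_inverse)
  then have fq: "f = [:-a, 1:] * ([:-a, 1:] * (\<Prod>x\<in>#B. [:-x, 1:]))" using f by simp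
  have z: "poly [:-a, 1:] a = 0" by simp
  have "poly (pderiv f) a = 0" unfolding fq pderiv_mult poly_add poly_mult z by simp
  moreover have "pderiv f = monom (of_nat m) (m - 1)"
   by (simp add: f_def pderiv_diff pderiv_monom pderiv_pCons)
  ultimately have "a ^ (m - 1) = 0" using m(2) by (simp add: poly_monom)
  then have "a = 0" by (cases "m = 1") auto
  moreover have "a ^ m = c" using pf[of a] unfolding fq by simp
  ultimately show False using c m(1) by (simp add: power_0_left)
 qed
 have "mset_set (set_mset A) = A"
 proof (rule multiset_eqI)
  fix x show "count (mset_set (set_mset A)) x = count A x"
   using cnt[of x] by (cases "x \<in># A") (auto simp: not_in_iff, metis One_nat_def count_greater_eq_one_iff le_antisym)
 qed
 then have "card (set_mset A) = size A" by (metis size_mset_set)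
 then show ?thesis using A(1) df roots by simp
qed

definition extensions :: "'g monoid => 'g set => ('g => 'k::field) => ('g => 'k) set" where
 "extensions G K \<chi> = {\<phi> : hom G (units_of class_ring) \<inter> extensional (carrier G). \<forall>z\<in>K. \<phi> z = \<chi> z}"

locale finite_abelian = comm_group G for G :: "'g monoid" (structure) +
 fixes T :: "'k::alg_closed_field itself"
 assumes fin: "finite (carrier G)" and char: "\<not> CHAR('k) dvd card (carrier G)"
begin

lemma group_on: "subgroup K G ==> group (G\<lparr>carrier := K\<rparr>)"
 by (rule subgroup.subgroup_is_group[OF _ is_group])

lemma subgroup_facts:
 assumes K: "subgroup K G"
 shows "finite K" "0 < card K" "card K dvd card (carrier G)" "of_nat (card K) ~= (0::'k)"
proof -
 show f: "finite K" using subgroup.subset[OF K] fin finite_subset by blast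
 show "0 < card K" using f subgroup.one_closed[OF K] by (auto simp: card_gt_0_iff)
 show "card K dvd card (carrier G)"
  using lagrange[OF K] by (metis Coset.order_def dvd_triv_right)
 then show "of_nat (card K) ~= (0::'k)"
  using char by (auto simp: of_nat_eq_0_iff_char_dvd dest: dvd_trans)
qed

lemma pow_in_subgroup: "subgroup K G ==> x : K ==> x [^] (n::nat) : K"
 by (induction n) (auto simp: subgroup.one_closed subgroup.m_closed)

text \<open>The subgroup generated by \<open>K\<close> and \<open>a\<close>, for a subgroup
  \<open>K\<close>. Natural exponents reach the inverses because \<open>a\<close> has finite
  order.\<close>

definition adjoin :: "'g set => 'g => 'g set" where
 "adjoin K a = {x \<otimes> a [^] (n::nat) | x n. x : K}"

lemma adjoin_subgroup:
 assumes K: "subgroup K G" and a: "a : carrier G"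
 shows "subgroup (adjoin K a) G"
proof -
 have "generate G {a} = {a [^] n | n. n : (UNIV::nat set)}"
  using generate_pow_on_finite_carrier[OF fin a] .
 then have "adjoin K a = K <#> generate G {a}"
  by (auto simp: adjoin_def set_mult_def)
 then show ?thesis using mult_subgroups[OF K generate_is_subgroup] a by simp
qed

lemma adjoin_superset:
 assumes K: "subgroup K G" and a: "a : carrier G"
 shows "K <= adjoin K a" "a : adjoin K a"
proof -
 have "x = x \<otimes> a [^] (0::nat)" if "x : K" for x using that K by (simp add: subgroup.mem_carrier)
 then show "K <= adjoin K a" unfolding adjoin_def by blast
 have "a = \<one> \<otimes> a [^] (1::nat)" using a by simp
 then show "a : adjoin K a" unfolding adjoin_def using subgroup.one_closed[OF K] by blast
qed

lemma pow_diff: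
 assumes "a : carrier G" "x : carrier G" "y : carrier G" "x \<otimes> a [^] (i::nat) = y \<otimes> a [^] j" "i \<le> j"
 shows "x = y \<otimes> a [^] (j - i)"
proof -
 have "a [^] j = a [^] (j - i) \<otimes> a [^] i" using assms nat_pow_mult[of a "j - i" i] by simp
 then have "x \<otimes> a [^] i = (y \<otimes> a [^] (j - i)) \<otimes> a [^] i" using assms by (simp add: m_assoc)
 then show ?thesis using assms by simp
qed

context
 fixes K and a
 assumes K: "subgroup K G" and a: "a : carrier G"
begin

text \<open>The order of the image of \<open>a\<close> in the quotient of \<open>G\<close> by
  \<open>K\<close>.\<close>

definition rel_ord :: nat where "rel_ord = (LEAST n. 0 < n \<and> a [^] n : K)"

lemma rel_ord: "0 < rel_ord" "a [^] rel_ord : K" and pow_mem_iff: "a [^] n : K \<longleftrightarrow> rel_ord dvd n"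
proof -
 have "0 < ord a \<and> a [^] ord a : K"
  using a ord_ge_1[OF fin a] pow_ord_eq_1[OF a] subgroup.one_closed[OF K] by auto
 then have *: "0 < rel_ord \<and> a [^] rel_ord : K" unfolding rel_ord_def by (rule LeastI)
 then show r: "0 < rel_ord" "a [^] rel_ord : K" by auto
 have qK: "a [^] (rel_ord * q) : K" for q
  using r(2) a subgroup.subset[OF K] nat_pow_pow[OF a, of rel_ord q]
  by (metis K pow_in_subgroup)
 show "a [^] n : K \<longleftrightarrow> rel_ord dvd n"
 proof
  assume n: "a [^] n : K"
  have "a [^] (n mod rel_ord) \<otimes> a [^] (rel_ord * (n div rel_ord)) = a [^] n"
   using a by (simp add: nat_pow_mult)
  then have "a [^] (n mod rel_ord) = a [^] n \<otimes> inv (a [^] (rel_ord * (n div rel_ord)))"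
   using a by (metis inv_solve_right nat_pow_closed)
  then have "a [^] (n mod rel_ord) : K"
   using n qK K by (simp add: subgroup.m_closed subgroup.m_inv_closed)
  moreover have "n mod rel_ord < rel_ord" using r by simp
  ultimately have "\<not> 0 < n mod rel_ord"
   using not_less_Least[of "n mod rel_ord" "\<lambda>n. 0 < n \<and> a [^] n : K"] unfolding rel_ord_def by auto
  then show "rel_ord dvd n" by (simp add: dvd_eq_mod_eq_0)
 qed (auto simp: qK)
qed

lemma card_adjoin: "card (adjoin K a) = rel_ord * card K"
proof -
 have "bij_betw (\<lambda>(x, n). x \<otimes> a [^] n) (K \<times> {..<rel_ord}) (adjoin K a)"
 proof (rule bij_betw_imageI)
  have "x = y \<and> i = j"
   if "x : K" "y : K" "i \<le> j" "j < rel_ord" "x \<otimes> a [^] i = y \<otimes> a [^] j" for x y and i j :: nat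
  proof -
   have xy: "x : carrier G" "y : carrier G" using that subgroup.mem_carrier[OF K] by auto
   have x: "x = y \<otimes> a [^] (j - i)" using that xy a by (intro pow_diff) auto
   then have "a [^] (j - i) = inv y \<otimes> x" using xy a by (simp add: inv_solve_left)
   then have "rel_ord dvd j - i"
    using that(1,2) K pow_mem_iff by (metis subgroup.m_closed subgroup.m_inv_closed)
   then have "j - i = 0" using that by (metis dvd_imp_le less_imp_diff_less neq0_conv not_less)
   then show ?thesis using x that(3) xy by simp
  qed
  note inj = this
  show "inj_on (\<lambda>(x, n). x \<otimes> a [^] n) (K \<times> {..<rel_ord})"
  proof (rule inj_onI, clarsimp)
   fix x y and i j :: nat
   assume "x : K" "y : K" "i < rel_ord" "j < rel_ord" "x \<otimes> a [^] i = y \<otimes> a [^] j"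
   then show "x = y \<and> i = j" using inj[of x y i j] inj[of y x j i] by (cases "i \<le> j") auto
  qed
  have "\<exists>y n'. y : K \<and> n' < rel_ord \<and> x \<otimes> a [^] n = y \<otimes> a [^] n'" if "x : K" for x and n :: nat
  proof (intro exI conjI)
   have q: "a [^] (rel_ord * (n div rel_ord)) : K" by (simp add: pow_mem_iff)
   show "x \<otimes> a [^] (rel_ord * (n div rel_ord)) : K" using q that K by (simp add: subgroup.m_closed)
   show "n mod rel_ord < rel_ord" using rel_ord by simp
   show "x \<otimes> a [^] n = x \<otimes> a [^] (rel_ord * (n div rel_ord)) \<otimes> a [^] (n mod rel_ord)"
    using that K a by (simp add: m_assoc nat_pow_mult subgroup.mem_carrier)
  qed
  then show "(\<lambda>(x, n). x \<otimes> a [^] n) ` (K \<times> {..<rel_ord}) = adjoin K a"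
   by (fastforce simp: adjoin_def image_iff)
 qed
 from bij_betw_same_card[OF this] show ?thesis by (simp add: card_cartesian_product algebra_simps)
qed

text \<open>The extension takes the value \<open>\<chi> x * r ^ n\<close> at the product of
  \<open>x\<close> and \<open>a [^] n\<close>. Two such presentations differ by a power of
  \<open>a\<close> lying in \<open>K\<close>, whose exponent is a multiple of
  \<open>rel_ord\<close>; on those powers the condition on \<open>r\<close> gives the required
  value.\<close>

lemma extend_to_adjoin:
 fixes \<chi> :: "'g => 'k"
 assumes \<chi>: "\<chi> : hom (G\<lparr>carrier := K\<rparr>) (units_of class_ring)" and r: "r ^ rel_ord = \<chi> (a [^] rel_ord)"
 obtains \<chi>' where "\<chi>' : hom (G\<lparr>carrier := adjoin K a\<rparr>) (units_of class_ring)"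
  "\<And>x. x : K ==> \<chi>' x = \<chi> x" "\<chi>' a = r"
proof -
 interpret \<chi>: character "G\<lparr>carrier := K\<rparr>" \<chi>
  using \<chi> group_on[OF K] by (intro character.intro character_axioms.intro)
 have r0: "r ~= 0" using r \<chi>.nz rel_ord by (auto simp: power_0_left)
 have q: "\<chi> (a [^] n) = r ^ n" if "rel_ord dvd n" for n
 proof -
  obtain q where n: "n = rel_ord * q" using \<open>rel_ord dvd n\<close> by auto
  have "\<chi> ((a [^] rel_ord) [^]\<^sub>(G\<lparr>carrier := K\<rparr>) q) = \<chi> (a [^] rel_ord) ^ q"
   using rel_ord by (intro \<chi>.at_pow) simp
  then show ?thesis using a n r by (simp add: nat_pow_pow power_mult flip: nat_pow_consistent)
 qed
 have wd: "\<chi> x * r ^ i = \<chi> y * r ^ j"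
  if "x : K" "y : K" "x \<otimes> a [^] i = y \<otimes> a [^] j" for x y and i j :: nat
  using that
 proof (induction i j arbitrary: x y rule: linorder_wlog)
  case (le i j)
  have xy: "x : carrier G" "y : carrier G" using le subgroup.mem_carrier[OF K] by auto
  have x: "x = y \<otimes> a [^] (j - i)" using le xy a by (intro pow_diff) auto
  then have "a [^] (j - i) = inv y \<otimes> x" using xy a by (simp add: inv_solve_left)
  then have K': "a [^] (j - i) : K" using le K by (simp add: subgroup.m_closed subgroup.m_inv_closed)
  have "\<chi> x = \<chi> y * r ^ (j - i)" using x le(3) K' \<chi>.mult[of y "a [^] (j - i)"] q pow_mem_iff by simp
  then show ?case using le(1) by (simp flip: power_add)
 next
  case (sym i j)
  then show ?case by metis
 qed
 define \<chi>' where "\<chi>' y = (SOME c. \<exists>x n. x : K \<and> y = x \<otimes> a [^] (n::nat) \<and> c = \<chi> x * r ^ n)" for y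
 have c': "\<chi>' (x \<otimes> a [^] n) = \<chi> x * r ^ n" if "x : K" for x and n :: nat
  unfolding \<chi>'_def
 proof (rule some_equality)
  show "\<exists>y m. y : K \<and> x \<otimes> a [^] n = y \<otimes> a [^] (m::nat) \<and> \<chi> x * r ^ n = \<chi> y * r ^ m" using that by blast
  show "c = \<chi> x * r ^ n" if "\<exists>y m. y : K \<and> x \<otimes> a [^] n = y \<otimes> a [^] (m::nat) \<and> c = \<chi> y * r ^ m" for c
   using that wd[OF \<open>x : K\<close>] by metis
 qed
 show ?thesis
 proof
  show "\<chi>' : hom (G\<lparr>carrier := adjoin K a\<rparr>) (units_of class_ring)"
  proof -
   have "\<chi>' (x \<otimes> a [^] i) ~= 0" if "x : K" for x and i :: nat
    using c'[OF that] \<chi>.nz[of x] that r0 by simp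
   moreover have "\<chi>' ((x \<otimes> a [^] i) \<otimes> (y \<otimes> a [^] j)) = \<chi>' (x \<otimes> a [^] i) * \<chi>' (y \<otimes> a [^] j)"
    if xy: "x : K" "y : K" for x y and i j :: nat
   proof -
    have "x : carrier G" "y : carrier G" using xy subgroup.mem_carrier[OF K] by auto
    then have "(x \<otimes> a [^] i) \<otimes> (y \<otimes> a [^] j) = (x \<otimes> y) \<otimes> a [^] (i + j)"
     using a by (simp add: m_ac flip: nat_pow_mult)
    moreover have "x \<otimes> y : K" using xy K by (simp add: subgroup.m_closed)
    ultimately show ?thesis using c' xy \<chi>.mult[of x y] by (simp add: power_add)
   qed
   ultimately show ?thesis unfolding hom_units_iff by (auto simp: adjoin_def)
  qed
  show "\<chi>' x = \<chi> x" if "x : K" for x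
   using c'[OF that, of 0] that K by (simp add: subgroup.mem_carrier)
  show "\<chi>' a = r" using c'[OF subgroup.one_closed[OF K], of 1] a \<chi>.at_one by simp
 qed
qed

lemma extensions_fibre:
 fixes \<chi> \<chi>' :: "'g => 'k"
 assumes \<chi>': "\<chi>' : hom (G\<lparr>carrier := adjoin K a\<rparr>) (units_of class_ring)"
  "\<And>x. x : K ==> \<chi>' x = \<chi> x"
 shows "{\<phi> : extensions G K \<chi>. \<phi> a = \<chi>' a} = extensions G (adjoin K a) \<chi>'"
proof (rule equalityI; rule subsetI)
 interpret c: character "G\<lparr>carrier := adjoin K a\<rparr>" \<chi>'
  using \<chi>'(1) group_on[OF adjoin_subgroup[OF K a]] by (intro character.intro character_axioms.intro)
 fix \<phi>
 {
  assume "\<phi> : {\<phi> : extensions G K \<chi>. \<phi> a = \<chi>' a}"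
  then have \<phi>: "\<phi> : hom G (units_of class_ring)" "\<phi> : extensional (carrier G)" "\<And>z. z : K ==> \<phi> z = \<chi> z"
   and eq: "\<phi> a = \<chi>' a" by (auto simp: extensions_def)
  interpret f: character G \<phi> using \<phi>(1) is_group by (intro character.intro character_axioms.intro)
  have "\<phi> (x \<otimes> a [^] n) = \<chi>' (x \<otimes> a [^] n)" if x: "x : K" for x and n :: nat
  proof -
   have sub: "K <= adjoin K a" "a : adjoin K a" by (rule adjoin_superset[OF K a])+
   have "a [^] n : adjoin K a" using sub adjoin_subgroup[OF K a] pow_in_subgroup by blast
   then have "\<chi>' (x \<otimes> a [^] n) = \<chi>' x * \<chi>' (a [^] n)" using c.mult[of x "a [^] n"] x sub by auto
   moreover have "\<chi>' (a [^] n) = \<chi>' a ^ n"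
    using c.at_pow[of a n] sub by (simp flip: nat_pow_consistent)
   ultimately show ?thesis using x \<phi>(3) \<chi>'(2) eq a subgroup.mem_carrier[OF K] by (simp add: f.mult f.at_pow)
  qed
  then show "\<phi> : extensions G (adjoin K a) \<chi>'" using \<phi> by (auto simp: extensions_def adjoin_def)
 }
 show "\<phi> : {\<phi> : extensions G K \<chi>. \<phi> a = \<chi>' a}" if "\<phi> : extensions G (adjoin K a) \<chi>'"
  using that adjoin_superset[OF K a] \<chi>'(2) by (auto simp: extensions_def)
qed

end

text \<open>Adjoin an element \<open>a\<close> outside \<open>K\<close>. The value at
  \<open>a\<close> can be any of the \<open>rel_ord\<close> roots of a fixed nonzero scalar, and the
  extensions with a given value are counted by induction. The factor \<open>card K\<close> avoids a
  division.\<close>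

theorem card_extensions:
 fixes \<chi> :: "'g => 'k"
 assumes "subgroup K G" "\<chi> : hom (G\<lparr>carrier := K\<rparr>) (units_of class_ring)"
 shows "finite (extensions G K \<chi>) \<and> card (extensions G K \<chi>) * card K = card (carrier G)"
 using assms
proof (induction "card (carrier G) - card K" arbitrary: K \<chi> rule: less_induct)
 case less
 note K = less.prems(1)
 interpret \<chi>: character "G\<lparr>carrier := K\<rparr>" \<chi>
  using less.prems(2) group_on[OF K] by (intro character.intro character_axioms.intro)
 show ?case
 proof (cases "K = carrier G")
  case True
  have "extensions G K \<chi> = {restrict \<chi> (carrier G)}"
  proof -
   have "restrict \<chi> (carrier G) : hom G (units_of class_ring)"
    using less.prems(2) True by (auto simp: hom_units_iff)
   then show ?thesis using True by (auto simp: extensions_def extensional_def fun_eq_iff)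
  qed
  then show ?thesis using True by simp
 next
  case False
  then obtain a where a: "a : carrier G" "a \<notin> K" using subgroup.subset[OF K] by blast
  let ?m = "rel_ord K a" and ?K = "adjoin K a"
  let ?R = "{r. r ^ ?m = \<chi> (a [^] ?m)}"
  have K': "subgroup ?K G" by (rule adjoin_subgroup[OF K a(1)])
  have less': "card (carrier G) - card ?K < card (carrier G) - card K"
  proof -
   have "card K < card ?K"
    using adjoin_superset[OF K a(1)] a(2) subgroup_facts(1)[OF K'] by (intro psubset_card_mono) auto
   moreover have "card ?K \<le> card (carrier G)" using fin subgroup.subset[OF K'] by (rule card_mono)
   ultimately show ?thesis by linarith
  qed
  have m: "0 < ?m" "of_nat ?m ~= (0::'k)"
   using rel_ord[OF K a(1)] subgroup_facts(4)[OF K'] card_adjoin[OF K a(1)] by auto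
  have R: "card ?R = ?m"
   using rel_ord[OF K a(1)] \<chi>.nz by (intro card_radical_roots[OF m]) simp
  then have finR: "finite ?R" using m(1) by (intro card_ge_0_finite) simp
  have fib: "finite {\<phi> : extensions G K \<chi>. \<phi> a = r}
    \<and> card {\<phi> : extensions G K \<chi>. \<phi> a = r} * card ?K = card (carrier G)" if r: "r : ?R" for r
  proof -
   obtain \<chi>' where \<chi>': "\<chi>' : hom (G\<lparr>carrier := ?K\<rparr>) (units_of class_ring)"
    "\<And>x. x : K ==> \<chi>' x = \<chi> x" "\<chi>' a = r"
    using extend_to_adjoin[OF K a(1) less.prems(2)] r by blast
   have "{\<phi> : extensions G K \<chi>. \<phi> a = r} = extensions G ?K \<chi>'"
    using extensions_fibre[OF K a(1) \<chi>'(1,2)] \<chi>'(3) by simp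
   then show ?thesis using less.hyps[OF less' K' \<chi>'(1)] by simp
  qed
  have un: "extensions G K \<chi> = (\<Union>r\<in>?R. {\<phi> : extensions G K \<chi>. \<phi> a = r})"
  proof -
   have "\<phi> a : ?R" if \<phi>: "\<phi> : extensions G K \<chi>" for \<phi>
   proof -
    interpret f: character G \<phi>
     using \<phi> is_group by (intro character.intro character_axioms.intro) (auto simp: extensions_def)
    show ?thesis using \<phi> rel_ord(2)[OF K a(1)] f.at_pow[OF a(1), of ?m] by (auto simp: extensions_def)
   qed
   then show ?thesis by auto
  qed
  have "card (extensions G K \<chi>) = (\<Sum>r\<in>?R. card {\<phi> : extensions G K \<chi>. \<phi> a = r})"
   using fib finR by (subst un, subst card_UN_disjoint) auto
  then have "card (extensions G K \<chi>) * card ?K = (\<Sum>r\<in>?R. card {\<phi> : extensions G K \<chi>. \<phi> a = r} * card ?K)"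
   by (simp add: sum_distrib_right)
  also have "\<dots> = ?m * card (carrier G)" using fib R by simp
  finally have "?m * (card (extensions G K \<chi>) * card K) = ?m * card (carrier G)"
   by (simp add: card_adjoin[OF K a(1)] algebra_simps)
  moreover have "finite (extensions G K \<chi>)"
   by (subst un) (use fib finR in auto)
  ultimately show ?thesis using m(1) by simp
 qed
qed

text \<open>If all characters trivial on \<open>K\<close> were trivial at \<open>h\<close>, then
  \<open>K\<close> and \<open>adjoin K h\<close> would have the same ones. The counting formula
  would give both subgroups the same order.\<close>

lemma separating_character:
 assumes K: "subgroup K G" and h: "h : carrier G" "h \<notin> K"
 shows "\<exists>\<psi>\<in>extensions G K (\<lambda>_. 1::'k). \<psi> h ~= 1"
proof (rule ccontr)
 assume neg: "\<not> ?thesis"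
 let ?K = "adjoin K h"
 have triv: "(\<lambda>_. 1::'k) : hom (G\<lparr>carrier := K'\<rparr>) (units_of class_ring)" for K'
  by (simp add: hom_units_iff)
 have K': "subgroup ?K G" by (rule adjoin_subgroup[OF K h(1)])
 have "extensions G K (\<lambda>_. 1::'k) = extensions G ?K (\<lambda>_. 1)"
  using extensions_fibre[OF K h(1) triv, of "\<lambda>_. 1"] neg by auto
 then have "card (extensions G K (\<lambda>_. 1::'k)) * card K = card (extensions G K (\<lambda>_. 1::'k)) * card ?K"
  "card (extensions G K (\<lambda>_. 1::'k)) * card K ~= 0"
  using card_extensions[OF K triv] card_extensions[OF K' triv] fin by auto
 then have "card K = card ?K" by simp
 moreover have "card K < card ?K"
  using adjoin_superset[OF K h(1)] h(2) subgroup_facts(1)[OF K'] by (intro psubset_card_mono) auto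
 ultimately show False by simp
qed

text \<open>For \<open>h\<close> outside \<open>K\<close>, twisting by a character that is trivial
  on \<open>K\<close> but not at \<open>h\<close> permutes the extensions and multiplies the sum by
  a scalar other than 1.\<close>

lemma sum_extensions:
 fixes \<chi> :: "'g => 'k"
 assumes K: "subgroup K G" and \<chi>: "\<chi> : hom (G\<lparr>carrier := K\<rparr>) (units_of class_ring)"
  and h: "h : carrier G"
 shows "(\<Sum>\<phi>\<in>extensions G K \<chi>. \<phi> h) = (if h : K then of_nat (card (extensions G K \<chi>)) * \<chi> h else 0)"
proof (cases "h : K")
 case True
 then show ?thesis by (simp add: extensions_def)
next
 case False
 then obtain \<psi> where \<psi>: "\<psi> : extensions G K (\<lambda>_. 1::'k)" "\<psi> h ~= 1"
  using separating_character[OF K h] by blast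
 let ?t = "\<lambda>\<psi> \<phi>. \<lambda>x\<in>carrier G. \<phi> x * \<psi> x :: 'k"
 have tw: "?t \<psi>' \<phi> : extensions G K \<chi>" if "\<phi> : extensions G K \<chi>" "\<psi>' : extensions G K (\<lambda>_. 1::'k)" for \<phi> \<psi>'
  using that subgroup.subset[OF K] by (auto simp: extensions_def hom_units_iff subset_iff)
 have nz: "\<psi> x ~= 0" if "x : carrier G" for x
  using \<psi>(1) that by (auto simp: extensions_def hom_units_iff)
 let ?i = "\<lambda>x\<in>carrier G. inverse (\<psi> x)"
 have inv: "?i : extensions G K (\<lambda>_. 1::'k)"
  using \<psi>(1) subgroup.subset[OF K] by (auto simp: extensions_def hom_units_iff subset_iff)
 have "bij_betw (?t \<psi>) (extensions G K \<chi>) (extensions G K \<chi>)"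
 proof (rule bij_betw_byWitness[where f' = "?t ?i"])
  show "\<forall>\<phi>\<in>extensions G K \<chi>. ?t ?i (?t \<psi> \<phi>) = \<phi>" "\<forall>\<phi>\<in>extensions G K \<chi>. ?t \<psi> (?t ?i \<phi>) = \<phi>"
   using nz by (auto simp: fun_eq_iff extensions_def extensional_def)
  show "?t \<psi> ` extensions G K \<chi> <= extensions G K \<chi>" "?t ?i ` extensions G K \<chi> <= extensions G K \<chi>"
   using tw[OF _ \<psi>(1)] tw[OF _ inv] by blast+
 qed
 then have "(\<Sum>\<phi>\<in>extensions G K \<chi>. \<phi> h) = (\<Sum>\<phi>\<in>extensions G K \<chi>. ?t \<psi> \<phi> h)"
  using sum.reindex_bij_betw[of "?t \<psi>" "extensions G K \<chi>" "extensions G K \<chi>" "\<lambda>\<phi>. \<phi> h"] by simp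
 also have "\<dots> = (\<Sum>\<phi>\<in>extensions G K \<chi>. \<phi> h) * \<psi> h"
  using h by (simp add: sum_distrib_right)
 finally show ?thesis using \<psi>(2) False by simp
qed

end

section \<open>Characters of the central extension\<close>

context jennings_setting
begin

abbreviation ZH :: "'h monoid" where "ZH \<equiv> (grpH S)\<lparr>carrier := cenH\<rparr>"

lemma centerH_iff: "z : cenH \<longleftrightarrow> z : carH \<and> (\<forall>g\<in>carH. z \<otimes>\<^sub>gH g = g \<otimes>\<^sub>gH z)"
 by (simp add: centerH_def group_center_def)

lemma centerH_closed: "z : cenH ==> z : carH"
 by (simp add: centerH_iff)

lemma center_comm: "z : cenH ==> g : carH ==> z \<otimes>\<^sub>gH g = g \<otimes>\<^sub>gH z"
 unfolding centerH_iff by blast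

lemma subgroup_centerH: "subgroup (cenH) (grpH S)"
proof (rule H.subgroupI)
 show "cenH <= carH" using centerH_closed by blast
 have "\<one>\<^sub>gH : cenH" by (simp add: centerH_iff)
 then show "cenH ~= {}" by auto
 show "ivH a : cenH" if a: "a : cenH" for a
  unfolding centerH_iff
 proof (intro conjI ballI)
  show "ivH a : carH" using a by (simp add: centerH_iff)
  fix g assume g: "g : carH"
  have "a \<otimes>\<^sub>gH g = g \<otimes>\<^sub>gH a" "a : carH" using center_comm[OF a g] centerH_closed[OF a] .
  then show "ivH a \<otimes>\<^sub>gH g = g \<otimes>\<^sub>gH ivH a"
   using g by (metis H.inv_closed H.inv_solve_left H.inv_solve_right H.m_assoc H.m_closed)
 qed
 show "a \<otimes>\<^sub>gH b : cenH" if ab: "a : cenH" "b : cenH" for a b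
 proof -
  have c: "a : carH" "b : carH" using ab by (auto simp: centerH_iff)
  have "a \<otimes>\<^sub>gH b \<otimes>\<^sub>gH g = g \<otimes>\<^sub>gH (a \<otimes>\<^sub>gH b)" if g: "g : carH" for g
  proof -
   have "a \<otimes>\<^sub>gH (b \<otimes>\<^sub>gH g) = a \<otimes>\<^sub>gH (g \<otimes>\<^sub>gH b)"
    using center_comm[OF ab(2) g] by (rule arg_cong)
   moreover have "(a \<otimes>\<^sub>gH g) \<otimes>\<^sub>gH b = (g \<otimes>\<^sub>gH a) \<otimes>\<^sub>gH b"
    using center_comm[OF ab(1) g] by (rule arg_cong)
   ultimately show ?thesis using c g by (simp add: H.m_assoc)
  qed
  then show ?thesis using c unfolding centerH_iff by blast
 qed
qed

lemma subgroup_Z: "subgroup (subZ S) (grpH S)"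
 unfolding Z_derived derived_def by (rule H.generate_is_subgroup) (use H.derived_set_in_carrier in blast)

lemma card_H_dvd: "subgroup K (grpH S) ==> card K dvd Coset.order (grpH S)"
 using H.lagrange by (metis dvd_triv_right)

lemma fab: "finite_abelian TYPE('k) ZH"
proof (intro finite_abelian.intro finite_abelian_axioms.intro)
 have g: "group ZH" by (rule subgroup.subgroup_is_group[OF subgroup_centerH H.is_group])
 show "comm_group ZH"
  by (rule group.group_comm_groupI[OF g]) (simp add: center_comm centerH_closed)
 have "cenH <= carH" using centerH_closed by blast
 then show "finite (carrier ZH)" using finite_H by (simp add: finite_subset)
 show "\<not> CHAR('k) dvd card (carrier ZH)"
  using card_H_dvd[OF subgroup_centerH] order_H char_k by (auto dest: dvd_trans)
qed

interpretation ab: finite_abelian ZH "TYPE('k)" by (rule fab)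

lemma subgroup_Z_center: "subgroup (subZ S) ZH"
 by (rule H.subgroup_incl[OF subgroup_Z subgroup_centerH Z_central])

lemma chi_hom': "chi S : hom (ZH\<lparr>carrier := subZ S\<rparr>) (units_of class_ring)"
 using chi_hom by simp

lemma Irr_extensions: "Irr = extensions ZH (subZ S) (chi S)"
 by (simp add: Irr_over_def extensions_def)

lemma finite_Irr: "finite (Irr)"
 using ab.card_extensions[OF subgroup_Z_center chi_hom'] by (simp add: Irr_extensions)

lemma card_Irr_Z: "card (Irr) * card (subZ S) = card (cenH)"
 using ab.card_extensions[OF subgroup_Z_center chi_hom'] by (simp add: Irr_extensions)

lemma card_Irr: "card (Irr) = Coset.order (ZH Mod subZ S)"
proof -
 have "card (rcosets\<^bsub>ZH\<^esub> subZ S) * card (subZ S) = card (cenH)"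
  using ab.lagrange[OF subgroup_Z_center] by (simp add: Coset.order_def)
 moreover have "0 < card (subZ S)" using ab.subgroup_facts(2)[OF subgroup_Z_center] .
 ultimately show ?thesis using card_Irr_Z by (simp add: Coset.order_def FactGroup_def, metis mult_right_cancel neq0_conv)
qed

lemma card_center_nz: "of_nat (card (cenH)) ~= (0::'k)"
 using ab.subgroup_facts(4)[OF ab.subgroup_self] by simp

lemma card_H_nz: "of_nat (card (carH)) ~= (0::'k)"
 using order_H char_k by (simp add: of_nat_eq_0_iff_char_dvd Coset.order_def)

lemma finite_center: "finite (cenH)"
 using ab.fin by simp

lemma Irr_character: "\<phi> : Irr ==> character ZH \<phi>"
 by (intro character.intro character_axioms.intro ab.is_group) (simp add: Irr_over_def)

lemma Irr_sum:
 "h : cenH ==> (\<Sum>\<phi>\<in>Irr. \<phi> h) = (if h : subZ S then of_nat (card (Irr)) * chi S h else 0)"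
 using ab.sum_extensions[OF subgroup_Z_center chi_hom', of h] by (simp add: Irr_extensions)

text \<open>The conditions of \<open>chars_HZ\<close> without extensionality, so that pointwise
  products such as \<open>wchar\<close> qualify without being restricted.\<close>

definition HZchar :: "('h => 'k) => bool" where
 "HZchar \<theta> \<longleftrightarrow> \<theta> : hom (grpH S) (units_of class_ring) \<and> (\<forall>z\<in>subZ S. \<theta> z = 1)"

lemma HZchar_character: "HZchar \<theta> ==> character (grpH S) \<theta>"
 by (intro character.intro character_axioms.intro H.is_group) (simp add: HZchar_def)

lemma HZchar_psi: "i : rkS ==> HZchar (psi S i)"
 using psi_char[of i] by (simp add: HZchar_def chars_HZ_def)

lemma HZchar_one: "HZchar (\<lambda>_. 1)"
 by (simp add: HZchar_def hom_units_iff)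

lemma HZchar_mult: "HZchar \<theta> ==> HZchar \<theta>' ==> HZchar (\<lambda>h. \<theta> h * \<theta>' h)"
 by (auto simp: HZchar_def hom_units_iff)

primrec wchar :: "nat list => 'h => 'k" where
 "wchar [] = (\<lambda>_. 1)"
| "wchar (i # is) = (\<lambda>h. psi S i h * wchar is h)"

lemma wchar_append: "wchar (is @ js) h = wchar is h * wchar js h"
 by (induction "is") auto

lemma HZchar_wchar: "set is <= rkS ==> HZchar (wchar is)"
 by (induction "is") (auto intro: HZchar_one HZchar_mult HZchar_psi simp del: atLeastAtMost_iff One_nat_def)

lemma twist_Irr:
 assumes \<phi>: "\<phi> : Irr" and \<theta>: "HZchar \<theta>"
 shows "tw \<phi> \<theta> : Irr"
proof -
 interpret f: character ZH \<phi> by (rule Irr_character[OF \<phi>])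
 interpret t: character "grpH S" \<theta> by (rule HZchar_character[OF \<theta>])
 have "tw \<phi> \<theta> : hom ZH (units_of class_ring)"
  using f.mult f.nz t.mult t.nz centerH_closed ab.m_closed by (auto simp: hom_units_iff twist_def)
 moreover have "tw \<phi> \<theta> z = chi S z" if "z : subZ S" for z
  using that \<phi> \<theta> Z_central by (auto simp: twist_def Irr_over_def HZchar_def)
 ultimately show ?thesis by (simp add: Irr_over_def twist_def)
qed

lemma twist_twist: "tw (tw \<phi> \<theta>) \<theta>' = tw \<phi> (\<lambda>h. \<theta> h * \<theta>' h)"
 by (auto simp: twist_def fun_eq_iff)

lemma twist_one: "\<phi> : Irr ==> tw \<phi> (\<lambda>_. 1) = \<phi>"
 by (auto simp: twist_def Irr_over_def extensional_def fun_eq_iff)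

lemma twist_cong: "(\<And>h. h : carH ==> \<theta> h = \<theta>' h) ==> tw \<phi> \<theta> = tw \<phi> \<theta>'"
 by (auto simp: twist_def fun_eq_iff centerH_closed)

lemma twist_psi: "\<phi> : Irr ==> i : rkS ==> tw \<phi> (psi S i) : Irr"
 by (intro twist_Irr HZchar_psi)

lemma twist_wchar: "\<phi> : Irr ==> set is <= rkS ==> tw \<phi> (wchar is) : Irr"
 by (intro twist_Irr HZchar_wchar)

subsection \<open>The commutator pairing\<close>

lemma commutator_Z:
 "h : carH ==> g : carH ==> commutator (grpH S) h g : subZ S"
 unfolding Z_derived derived_def commutator_def by (intro generate.incl) blast

lemma commutator_eq_iff:
 assumes "h : carH" "g : carH" "c : carH"
 shows "commutator (grpH S) h g = c \<longleftrightarrow> h \<otimes>\<^sub>gH g = c \<otimes>\<^sub>gH (g \<otimes>\<^sub>gH h)"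
proof -
 have "commutator (grpH S) h g = h \<otimes>\<^sub>gH g \<otimes>\<^sub>gH ivH (g \<otimes>\<^sub>gH h)"
  using assms by (simp add: commutator_def H.m_assoc H.inv_mult_group)
 then show ?thesis using assms H.inv_solve_right'[of c "h \<otimes>\<^sub>gH g" "g \<otimes>\<^sub>gH h"] by simp
qed

text \<open>Commutators lie in \<open>Z\<close> and are therefore central, which makes the
  commutator multiplicative in its second argument.\<close>

lemma commutator_mult:
 assumes h: "h : carH" "g : carH" "g' : carH"
 shows "commutator (grpH S) h (g \<otimes>\<^sub>gH g') = commutator (grpH S) h g \<otimes>\<^sub>gH commutator (grpH S) h g'"
proof -
 let ?d = "commutator (grpH S) h g" and ?c = "commutator (grpH S) h g'"
 have cd: "?d : carH" "?c : carH" and c: "?c : cenH"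
  using commutator_Z[of h g] commutator_Z[of h g'] h Z_central centerH_closed by auto
 have d: "h \<otimes>\<^sub>gH g = ?d \<otimes>\<^sub>gH (g \<otimes>\<^sub>gH h)" "h \<otimes>\<^sub>gH g' = ?c \<otimes>\<^sub>gH (g' \<otimes>\<^sub>gH h)"
  using commutator_eq_iff h cd by auto
 have "h \<otimes>\<^sub>gH (g \<otimes>\<^sub>gH g') = ?d \<otimes>\<^sub>gH g \<otimes>\<^sub>gH (h \<otimes>\<^sub>gH g')"
  using h cd d(1) by (metis H.m_assoc H.m_closed)
 also have "\<dots> = ?d \<otimes>\<^sub>gH (g \<otimes>\<^sub>gH ?c) \<otimes>\<^sub>gH (g' \<otimes>\<^sub>gH h)"
  unfolding d(2) using h cd by (simp add: H.m_assoc)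
 also have "g \<otimes>\<^sub>gH ?c = ?c \<otimes>\<^sub>gH g" using center_comm[OF c h(2)] by simp
 finally have "h \<otimes>\<^sub>gH (g \<otimes>\<^sub>gH g') = ?d \<otimes>\<^sub>gH ?c \<otimes>\<^sub>gH (g \<otimes>\<^sub>gH g' \<otimes>\<^sub>gH h)"
  using h cd by (simp add: H.m_assoc)
 then show ?thesis using commutator_eq_iff[of h "g \<otimes>\<^sub>gH g'" "?d \<otimes>\<^sub>gH ?c"] h cd by simp
qed

interpretation ch: character "(grpH S)\<lparr>carrier := subZ S\<rparr>" "chi S"
 by (intro character.intro character_axioms.intro chi_hom subgroup.subgroup_is_group[OF subgroup_Z H.is_group])

lemma rho_mult:
 "h : carH ==> g : carH ==> g' : carH ==>
  rho S (g \<otimes>\<^sub>gH g') h = rho S g h * rho S g' h"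
 unfolding rho_def using commutator_mult ch.mult[of "commutator (grpH S) h g"] commutator_Z by simp

lemma rho_nz: "h : carH ==> g : carH ==> rho S g h ~= 0"
 unfolding rho_def using commutator_Z ch.nz by simp

lemma rho_one: "h : carH ==> rho S \<one>\<^sub>gH h = 1"
 using rho_mult[of h "\<one>\<^sub>gH" "\<one>\<^sub>gH"] rho_nz[of h "\<one>\<^sub>gH"] by simp

text \<open>Faithfulness of the character on \<open>Z\<close> turns the trivial values into trivial
  commutators.\<close>

lemma rho_kernel:
 assumes g: "g : carH" and r: "\<And>h. h : carH ==> rho S g h = 1"
 shows "g : cenH"
 unfolding centerH_iff
proof (intro conjI ballI)
 fix h assume h: "h : carH"
 have "commutator (grpH S) h g = \<one>\<^sub>gH"
 proof (rule inj_onD[OF chi_faithful])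
  show "chi S (commutator (grpH S) h g) = chi S \<one>\<^sub>gH" using r[OF h] ch.at_one by (simp add: rho_def)
  show "\<one>\<^sub>gH : subZ S" using subgroup_Z by (rule subgroup.one_closed)
 qed (rule commutator_Z[OF h g])
 then show "g \<otimes>\<^sub>gH h = h \<otimes>\<^sub>gH g" using commutator_eq_iff[of h g "\<one>\<^sub>gH"] g h by simp
qed (rule g)

lemma rho_eq_center:
 assumes g: "g : carH" "g' : carH"
  and r: "\<And>h. h : carH ==> rho S g h = rho S g' h"
 shows "ivH g \<otimes>\<^sub>gH g' : cenH"
proof (rule rho_kernel)
 fix h assume h: "h : carH"
 have "rho S g h * rho S (ivH g \<otimes>\<^sub>gH g') h = rho S (g \<otimes>\<^sub>gH (ivH g \<otimes>\<^sub>gH g')) h"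
  using g h by (simp add: rho_mult)
 also have "g \<otimes>\<^sub>gH (ivH g \<otimes>\<^sub>gH g') = g'" using g by (simp flip: H.m_assoc)
 finally show "rho S (ivH g \<otimes>\<^sub>gH g') h = 1" using r[OF h] rho_nz[OF h g(2)] by simp
qed (use g in simp)

text \<open>The group element collected by a composable word. The recursion runs parallel to
  \<open>composable\<close>.\<close>

primrec Gw :: "nat list => ('h => 'k) => 'h" where
 "Gw [] \<phi> = \<one>\<^sub>gH"
| "Gw (i # is) \<phi> = Gw is (tw \<phi> (psi S i)) \<otimes>\<^sub>gH gi S i \<phi>"

lemma gi_closed: "i : rkS ==> \<phi> : Irr ==> gi S i \<phi> : carH"
 unfolding gi_def by (intro gsel_closed psi_char)

lemma Gw_closed: "set is <= rkS ==> \<phi> : Irr ==> Gw is \<phi> : carH"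
 by (induction "is" arbitrary: \<phi>) (auto intro!: H.m_closed gi_closed twist_psi simp del: atLeastAtMost_iff One_nat_def)

text \<open>The quotients of consecutive values of \<open>xi\<close> telescope along the word, so
  only its start, its end and its character remain.\<close>

lemma Gw_rho:
 assumes "set is <= rkS" "\<phi> : Irr" "h : carH"
 shows "rho S (Gw is \<phi>) h = xi S (tw \<phi> (wchar is)) h * inverse (xi S \<phi> h) * inverse (wchar is h)"
 using assms
proof (induction "is" arbitrary: \<phi>)
 case Nil
 have "xi S \<phi> h ~= 0" using xi_char[OF Nil(2)] Nil(3) by (auto simp: chars_HZ_def hom_units_iff)
 then show ?case using Nil by (simp add: rho_one twist_one)
next
 case (Cons i "is")
 have i: "i : rkS" "set is <= rkS" using Cons.prems(1) by auto
 note t = twist_psi[OF Cons.prems(2) i(1)]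
 have nz: "xi S (tw \<phi> (psi S i)) h ~= 0" using xi_char[OF t] Cons.prems(3) by (auto simp: chars_HZ_def hom_units_iff)
 have "rho S (Gw (i # is) \<phi>) h = rho S (Gw is (tw \<phi> (psi S i))) h * rho S (gi S i \<phi>) h"
  using Cons.prems(2,3) i t by (simp add: rho_mult Gw_closed gi_closed del: atLeastAtMost_iff)
 also have "rho S (gi S i \<phi>) h = xi S (tw \<phi> (psi S i)) h * inverse (xi S \<phi> h) * inverse (psi S i h)"
  unfolding gi_def using i Cons.prems by (intro gsel_rho psi_char)
 also have "rho S (Gw is (tw \<phi> (psi S i))) h
   = xi S (tw \<phi> (wchar (i # is))) h * inverse (xi S (tw \<phi> (psi S i)) h) * inverse (wchar is h)"
  using Cons.IH[OF i(2) t Cons.prems(3)] by (simp add: twist_twist)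
 finally show ?case using nz by (simp add: field_simps)
qed

text \<open>By \<open>Gw_rho\<close>, words with the same start and the same character collect group
  elements with the same value of \<open>rho\<close>.\<close>

lemma Gw_center:
 assumes "set is <= rkS" "set js <= rkS" "\<phi> : Irr"
  and eq: "\<And>h. h : carH ==> wchar is h = wchar js h"
 shows "ivH (Gw is \<phi>) \<otimes>\<^sub>gH Gw js \<phi> : cenH"
 using assms twist_cong[of "wchar is" "wchar js" \<phi>]
 by (intro rho_eq_center) (auto simp: Gw_rho Gw_closed)

subsection \<open>Eigenvectors\<close>

definition eigen :: "('h => 'k) => (('k, 'p) jen list \<Rightarrow>\<^sub>0 'k) set => bool" where
 "eigen \<theta> u \<longleftrightarrow> u : carU \<and> (\<forall>h\<in>carH. uact h u = \<theta> h \<odot>\<^sub>EN.U u)"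

lemma uact_alg: "h : carH ==> k_alg_hom EN.U EN.U (uact h)"
 by (unfold_locales) (rule uact_hom)

lemma eigen_one: "eigen (\<lambda>_. 1) \<one>\<^sub>EN.U"
 using k_alg_hom.f_one[OF uact_alg] by (simp add: eigen_def)

lemma eigen_mult:
 assumes u: "eigen \<theta> u" and v: "eigen \<theta>' v"
 shows "eigen (\<lambda>h. \<theta> h * \<theta>' h) (u \<otimes>\<^sub>EN.U v)"
proof -
 have "uact h (u \<otimes>\<^sub>EN.U v) = (\<theta> h * \<theta>' h) \<odot>\<^sub>EN.U (u \<otimes>\<^sub>EN.U v)" if h: "h : carH" for h
 proof -
  interpret a: k_alg_hom EN.U EN.U "uact h" by (rule uact_alg[OF h])
  show ?thesis using u v h by (simp add: eigen_def a.f_mult EN.U.sm_mult_l EN.U.sm_mult_r EN.U.sm_sm ac_simps)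
 qed
 then show ?thesis using u v by (simp add: eigen_def)
qed

lemma eigen_wi: "i : rkS ==> eigen (psi S i) (wi i)"
 using wb_family(1)[of i] EN.inc.f_sm by (simp add: eigen_def uact_inc wb_eigen del: atLeastAtMost_iff)

lemma wword_Cons: "i : rkS ==> set is <= rkS ==> wword (i # is) = wword is \<otimes>\<^sub>EN.U wi i"
 using wword_append[of "[i]" "is"] by simp

lemma eigen_wword: "set is <= rkS ==> eigen (wchar is) (wword is)"
proof (induction "is")
 case (Cons i "is")
 then have "eigen (\<lambda>h. wchar is h * psi S i h) (wword is \<otimes>\<^sub>EN.U wi i)"
  by (intro eigen_mult eigen_wi) auto
 then show ?case using Cons.prems wword_Cons[of i "is"] by (simp add: ac_simps)
qed (simp add: eigen_one)

text \<open>Bracket and \<open>p\<close>-th power of eigenvectors are eigenvectors. In their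
  expansion in the eigenbasis, a nonzero coefficient forces the eigenvalues to agree.\<close>

lemma
 assumes i: "i : rkS" and k: "k : rkS" and h: "h : carH"
 shows cc_char: "j : rkS ==> cc S i j k ~= 0 ==> psi S k h = psi S i h * psi S j h"
  and dd_char: "dd S i k ~= 0 ==> psi S k h = psi S i h ^ chr S"
proof -
 interpret a: k_linear Jn Jn "jact h" by (rule jact_linear[OF h])
 have coeff: "psi S k h = t"
  if v: "v = (\<Oplus>\<^sub>Jn k\<in>rkS. c k \<odot>\<^sub>Jn wb S k)" and t: "jact h v = t \<odot>\<^sub>Jn v" and c: "c k ~= 0" for v t c
 proof -
  have vJ: "v : carJ" unfolding v using wb_family(1) by (intro EN.finsum_closed) auto
  have "(\<Oplus>\<^sub>Jn k\<in>rkS. (c k * (psi S k h - t)) \<odot>\<^sub>Jn wb S k)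
    = (\<Oplus>\<^sub>Jn k\<in>rkS. c k \<odot>\<^sub>Jn jact h (wb S k) \<oplus>\<^sub>Jn (- t) \<odot>\<^sub>Jn (c k \<odot>\<^sub>Jn wb S k))"
   using wb_family(1) wb_eigen[OF _ h]
   by (intro EN.finsum_cong') (auto simp: EN.V.sm_sm simp flip: EN.V.sm_add_l simp: algebra_simps simp del: One_nat_def atLeastAtMost_iff)
  also have "\<dots> = jact h v \<oplus>\<^sub>Jn (- t) \<odot>\<^sub>Jn v"
   unfolding v using wb_family(1)
   by (subst EN.finsum_addf) (auto simp: a.f_lincomb EN.V.sm_finsum simp del: One_nat_def atLeastAtMost_iff)
  also have "\<dots> = \<zero>\<^sub>Jn" using vJ by (simp add: t EN.V.sm_minus EN.r_neg)
  finally have "\<forall>k\<in>rkS. c k * (psi S k h - t) = 0" by (rule wb_family(3))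
  then show ?thesis using k c by auto
 qed
 show "psi S k h = psi S i h * psi S j h" if j: "j : rkS" and c: "cc S i j k ~= 0"
 proof (rule coeff[OF struct_c[OF i j]])
  show "jact h (lbr S (wb S i) (wb S j)) = (psi S i h * psi S j h) \<odot>\<^sub>Jn lbr S (wb S i) (wb S j)"
   using wb_family(1) i j h
   by (simp add: jact_br wb_eigen EN.br_smult_left EN.br_smult_right EN.br_closed EN.V.sm_sm ac_simps del: atLeastAtMost_iff)
 qed (rule c)
 show "psi S k h = psi S i h ^ chr S" if c: "dd S i k ~= 0"
 proof (rule coeff[OF struct_d[OF i]])
  show "jact h (lpm S (wb S i)) = (psi S i h ^ chr S) \<odot>\<^sub>Jn lpm S (wb S i)"
   using wb_family(1) i h by (simp add: jact_pm wb_eigen EN.pm_smult del: atLeastAtMost_iff)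
 qed (rule c)
qed

text \<open>Averaging over \<open>H\<close> isolates the words of a given character.\<close>

lemma wi_span_char:
 assumes k: "k : rkS"
 shows "wi k : EN.U.spn (wword ` {is. set is <= deg1 \<and> (\<forall>h\<in>carH. wchar is h = psi S k h)})" (is "_ : EN.U.spn ?X")
proof -
 interpret pk: character "grpH S" "psi S k" by (rule HZchar_character[OF HZchar_psi[OF k]])
 define avg where "avg u = (\<Oplus>\<^sub>EN.U h\<in>carH. inverse (psi S k h) \<odot>\<^sub>EN.U uact h u)" for u
 have uc: "uact h u : carU" if "h : carH" "u : carU" for h u
  using SM.act_closed[of h u] that by (simp add: env_eq)
 have avc: "avg u : carU" if "u : carU" for u
  unfolding avg_def using uc that by (intro EN.U.finsum_closed) auto
 have "avg : module_hom class_ring EN.U EN.U"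
 proof (rule module_homI)
  fix u v assume uv: "u : carU" "v : carU"
  have "avg (u \<oplus>\<^sub>EN.U v) = (\<Oplus>\<^sub>EN.U h\<in>carH. inverse (psi S k h) \<odot>\<^sub>EN.U uact h u
    \<oplus>\<^sub>EN.U inverse (psi S k h) \<odot>\<^sub>EN.U uact h v)"
   unfolding avg_def using uv uc SM.act_add[of _ u v]
   by (intro EN.U.finsum_cong') (auto simp: env_eq EN.U.sm_add_r)
  also have "\<dots> = avg u \<oplus>\<^sub>EN.U avg v"
   unfolding avg_def using uv uc by (subst EN.U.finsum_addf) auto
  finally show "avg (u \<oplus>\<^sub>EN.U v) = avg u \<oplus>\<^sub>EN.U avg v" .
 next
  fix c u assume u: "u : carU"
  have "avg (c \<odot>\<^sub>EN.U u) = (\<Oplus>\<^sub>EN.U h\<in>carH. c \<odot>\<^sub>EN.U (inverse (psi S k h) \<odot>\<^sub>EN.U uact h u))"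
   unfolding avg_def using u uc SM.act_sm[of _ u c]
   by (intro EN.U.finsum_cong') (auto simp: env_eq EN.U.sm_sm ac_simps)
  also have "\<dots> = c \<odot>\<^sub>EN.U avg u"
   unfolding avg_def using u uc by (subst EN.U.sm_finsum) auto
  finally show "avg (c \<odot>\<^sub>EN.U u) = c \<odot>\<^sub>EN.U avg u" .
 qed (rule avc)
 then interpret avg: k_linear EN.U EN.U avg by unfold_locales
 have av: "avg u = (\<Sum>h\<in>carH. inverse (psi S k h) * \<theta> h) \<odot>\<^sub>EN.U u" if u: "eigen \<theta> u" for \<theta> u
 proof -
  have uU: "u : carU" using u by (simp add: eigen_def)
  have "avg u = (\<Oplus>\<^sub>EN.U h\<in>carH. (inverse (psi S k h) * \<theta> h) \<odot>\<^sub>EN.U u)"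
   unfolding avg_def
  proof (intro EN.U.finsum_cong')
   fix h assume "h : carH"
   then show "inverse (psi S k h) \<odot>\<^sub>EN.U uact h u = (inverse (psi S k h) * \<theta> h) \<odot>\<^sub>EN.U u"
    using u uU EN.U.sm_sm[OF uU] by (simp add: eigen_def)
  qed (use uU in auto)
  then show ?thesis using EN.U.finsum_sm_left[OF uU] by simp
 qed
 have d1: "deg1 <= rkS" by (auto simp: deg1_def)
 have X: "?X <= carU"
 proof -
  have "wword is : carU" if "set is <= deg1" for "is" using d1 that by (intro wword_closed) blast
  then show ?thesis by blast
 qed
 note sub = EN.U.subsp_spn[OF X]
 have word: "avg (wword is) : EN.U.spn ?X" if "is": "set is <= deg1" for "is"
 proof -
  have is1: "set is <= rkS" using "is" d1 by blast
  have av1: "avg (wword is) = (\<Sum>h\<in>carH. inverse (psi S k h) * wchar is h) \<odot>\<^sub>EN.U wword is"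
   by (rule av[OF eigen_wword[OF is1]])
  show ?thesis
  proof (cases "\<forall>h\<in>carH. wchar is h = psi S k h")
   case True
   then have "wword is : EN.U.spn ?X" using "is" by (intro EN.U.spn_superset[OF X]) auto
   then show ?thesis unfolding av1 using EN.U.subspD(4)[OF sub] by blast
  next
   case False
   then obtain h where h: "h : carH" "wchar is h ~= psi S k h" by auto
   interpret w: character "grpH S" "wchar is" by (rule HZchar_character[OF HZchar_wchar[OF is1]])
   interpret q: character "grpH S" "\<lambda>h. inverse (psi S k h) * wchar is h"
    by unfold_locales (auto simp: hom_units_iff pk.mult w.mult)
   have "(\<Sum>h\<in>carH. inverse (psi S k h) * wchar is h) = 0"
    using h pk.nz[OF h(1)] by (intro q.sum_nontrivial[OF h(1)]) (simp add: field_simps)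
   then show ?thesis unfolding av1 using EN.U.subspD(2)[OF sub] wword_closed[OF is1] by simp
  qed
 qed
 have "EN.U.spn (wword ` {is. set is <= deg1}) <= {u : carU. avg u : EN.U.spn ?X}"
 proof (intro EN.U.spn_least avg.subsp_vimage[OF sub])
  have "wword is : carU" if "set is <= deg1" for "is" using d1 that by (intro wword_closed) blast
  then show "wword ` {is. set is <= deg1} <= {u : carU. avg u : EN.U.spn ?X}" using word by blast
 qed
 then have "avg (wi k) : EN.U.spn ?X" using deg1_words_span_U wi_closed[OF k] by blast
 moreover have "avg (wi k) = of_nat (card (carH)) \<odot>\<^sub>EN.U wi k"
 proof -
  have "(\<Sum>h\<in>carH. inverse (psi S k h) * psi S k h) = of_nat (card (carH))"
   by (subst sum.cong[OF refl, where h = "\<lambda>_. 1"]) auto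
  then show ?thesis using av[OF eigen_wi[OF k]] by simp
 qed
 ultimately have "inverse (of_nat (card (carH))) \<odot>\<^sub>EN.U (of_nat (card (carH)) \<odot>\<^sub>EN.U wi k) : EN.U.spn ?X"
  using EN.U.subspD(4)[OF sub] by simp
 then show ?thesis using card_H_nz wi_closed[OF k] by (simp add: EN.U.sm_sm del: atLeastAtMost_iff)
qed

end

section \<open>Idempotents and monomials in the smash product\<close>

context jennings_setting
begin

interpretation ab: finite_abelian ZH "TYPE('k)" by (rule fab)

sublocale Sm: k_algebra "smash S"
 unfolding smash_def by (rule SM.algebra_R)

lemma smash_eq: "smash S = SM.R"
 by (simp add: smash_def)

abbreviation Sm where "Sm \<equiv> smash S"

definition io :: "(('k, 'p) jen list \<Rightarrow>\<^sub>0 'k) set => ('k, 'p, 'h) smash" where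
 "io u = skew_elt (env S) (grpH S) u \<one>\<^sub>gH"

abbreviation gr :: "'h => ('k, 'p, 'h) smash" where "gr \<equiv> smash_grp S"

lemma io_hom: "io : alg_hom EN.U Sm"
proof -
 have "io = (\<lambda>a. SM.elt a \<one>\<^sub>gH)" by (simp add: io_def fun_eq_iff)
 then show ?thesis using SM.elt_hom by (simp add: smash_eq env_eq)
qed

sublocale io: k_alg_hom EN.U Sm io by unfold_locales (rule io_hom)

lemma smash_w_io: "smash_w S i = io (wi i)"
 by (simp add: smash_w_def io_def)

lemma gr_closed [simp]: "gr g : carrier Sm"
 using SM.elt_closed[OF SM.A.one_closed, of g] by (simp add: smash_grp_def smash_eq)

lemma elt_io_gr: "u : carU ==> g : carH ==> SM.elt u g = io u \<otimes>\<^sub>Sm gr g"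
 using SM.elt_mult[of u "\<one>\<^sub>(env S)" "\<one>\<^sub>gH" g] SM.act_unit[of "\<one>\<^sub>gH"]
 by (simp add: smash_eq io_def smash_grp_def env_eq)

lemma gr_mult: "g : carH ==> h : carH ==> gr g \<otimes>\<^sub>Sm gr h = gr (g \<otimes>\<^sub>gH h)"
 using SM.elt_mult[of "\<one>\<^sub>(env S)" "\<one>\<^sub>(env S)" g h] by (simp add: smash_eq smash_grp_def)

lemma gr_one: "gr \<one>\<^sub>gH = \<one>\<^sub>Sm"
 using SM.elt_one by (simp add: smash_grp_def smash_eq)

lemma gr_io:
 assumes "u : carU" "h : carH"
 shows "gr h \<otimes>\<^sub>Sm io u = io (uact h u) \<otimes>\<^sub>Sm gr h"
proof -
 have "uact h u : carU" using SM.act_closed[of h u] assms by (simp add: env_eq)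
 then show ?thesis
  using SM.elt_mult[of "\<one>\<^sub>(env S)" u h "\<one>\<^sub>gH"] elt_io_gr[of "uact h u" h] assms
  by (simp add: smash_eq smash_grp_def io_def env_eq)
qed

lemma eigen_closed: "eigen \<theta> u ==> u : carU"
 by (simp add: eigen_def)

lemma gr_io_eigen:
 assumes "eigen \<theta> u" "h : carH"
 shows "gr h \<otimes>\<^sub>Sm io u = \<theta> h \<odot>\<^sub>Sm (io u \<otimes>\<^sub>Sm gr h)"
 using assms gr_io[of u h] by (simp add: eigen_def io.f_sm Sm.sm_mult_l)

lemma io_gr_eigen:
 assumes "eigen \<theta> u" "HZchar \<theta>" "h : carH"
 shows "io u \<otimes>\<^sub>Sm gr h = inverse (\<theta> h) \<odot>\<^sub>Sm (gr h \<otimes>\<^sub>Sm io u)"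
 using gr_io_eigen[OF assms(1,3)] character.nz[OF HZchar_character[OF assms(2)] assms(3)] eigen_closed[OF assms(1)]
 by (simp add: Sm.sm_sm)

subsection \<open>Character idempotents\<close>

lemma char_idem_closed [simp]: "char_idem S C \<theta> : carrier Sm"
 unfolding char_idem_def by (intro Sm.finsum_closed) auto

lemma char_idem_mult_left:
 assumes "finite C" "a : carrier Sm"
 shows "a \<otimes>\<^sub>Sm char_idem S C \<theta> = (\<Oplus>\<^sub>Sm h\<in>C. (\<theta> (ivH h) / of_nat (card C)) \<odot>\<^sub>Sm (a \<otimes>\<^sub>Sm gr h))"
proof -
 have "a \<otimes>\<^sub>Sm char_idem S C \<theta> = (\<Oplus>\<^sub>Sm h\<in>C. a \<otimes>\<^sub>Sm ((\<theta> (ivH h) / of_nat (card C)) \<odot>\<^sub>Sm gr h))"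
  unfolding char_idem_def using assms by (intro Sm.finsum_rdistr) auto
 then show ?thesis using assms by (simp add: Sm.sm_mult_r)
qed

lemma char_idem_mult_right:
 assumes "finite C" "a : carrier Sm"
 shows "char_idem S C \<theta> \<otimes>\<^sub>Sm a = (\<Oplus>\<^sub>Sm h\<in>C. (\<theta> (ivH h) / of_nat (card C)) \<odot>\<^sub>Sm (gr h \<otimes>\<^sub>Sm a))"
proof -
 have "char_idem S C \<theta> \<otimes>\<^sub>Sm a = (\<Oplus>\<^sub>Sm h\<in>C. ((\<theta> (ivH h) / of_nat (card C)) \<odot>\<^sub>Sm gr h) \<otimes>\<^sub>Sm a)"
  unfolding char_idem_def using assms by (intro Sm.finsum_ldistr) auto
 then show ?thesis using assms by (simp add: Sm.sm_mult_l)
qed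

lemma char_idem_comm:
 assumes C: "C <= cenH" and g: "g : carH"
 shows "gr g \<otimes>\<^sub>Sm char_idem S C \<theta> = char_idem S C \<theta> \<otimes>\<^sub>Sm gr g"
proof -
 have f: "finite C" using finite_subset[OF C finite_center] .
 have "gr g \<otimes>\<^sub>Sm gr h = gr h \<otimes>\<^sub>Sm gr g" if "h : C" for h
  using that C g center_comm[of h g] centerH_closed[of h] by (auto simp: gr_mult)
 then show ?thesis
  unfolding char_idem_mult_left[OF f gr_closed] char_idem_mult_right[OF f gr_closed]
  by (intro Sm.finsum_cong') auto
qed

lemma e_phi_closed [simp]: "ep \<phi> : carrier Sm"
 by (simp add: e_phi_def)

lemma e_phi_comm: "g : carH ==> gr g \<otimes>\<^sub>Sm ep \<phi> = ep \<phi> \<otimes>\<^sub>Sm gr g"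
 unfolding e_phi_def by (rule char_idem_comm) auto

lemma Irr_inv:
 assumes \<phi>: "\<phi> : Irr" and h: "h : cenH"
 shows "\<phi> (ivH h) = inverse (\<phi> h)"
proof -
 interpret f: character ZH \<phi> by (rule Irr_character[OF \<phi>])
 have "ivH h : cenH" using subgroup.m_inv_closed[OF subgroup_centerH h] .
 then have "\<phi> h * \<phi> (ivH h) = 1"
  using f.mult[of h "ivH h"] f.at_one h centerH_closed[OF h] by simp
 then show ?thesis by (simp add: inverse_unique)
qed

text \<open>Substituting the product of \<open>z\<close> and \<open>h\<close> for \<open>h\<close>
  in the defining sum of the idempotent brings out the factor \<open>\<phi> z\<close>.\<close>

lemma gr_e_phi:
 assumes \<phi>: "\<phi> : Irr" and z: "z : cenH"
 shows "gr z \<otimes>\<^sub>Sm ep \<phi> = \<phi> z \<odot>\<^sub>Sm ep \<phi>"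
proof -
 interpret f: character ZH \<phi> by (rule Irr_character[OF \<phi>])
 let ?F = "\<lambda>h. (\<phi> z * (\<phi> (ivH h) / of_nat (card (cenH)))) \<odot>\<^sub>Sm gr h"
 have "(\<Oplus>\<^sub>Sm h\<in>cenH. ?F h) = (\<Oplus>\<^sub>Sm h\<in>cenH. ?F (z \<otimes>\<^sub>gH h))"
  using Sm.finsum_reindex[of ?F "\<lambda>h. z \<otimes>\<^sub>gH h" "cenH"] ab.inj_on_cmult[of z] ab.surj_const_mult[of z] z
  by simp
 also have "\<dots> = (\<Oplus>\<^sub>Sm h\<in>cenH. (\<phi> (ivH h) / of_nat (card (cenH))) \<odot>\<^sub>Sm (gr z \<otimes>\<^sub>Sm gr h))"
 proof (intro Sm.finsum_cong')
  fix h assume h: "h : cenH"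
  have zh: "z \<otimes>\<^sub>gH h : cenH" using subgroup.m_closed[OF subgroup_centerH z h] .
  have "\<phi> (z \<otimes>\<^sub>gH h) = \<phi> z * \<phi> h" "\<phi> z ~= 0" using f.mult[of z h] f.nz[of z] z h by auto
  then have "\<phi> z * \<phi> (ivH (z \<otimes>\<^sub>gH h)) = \<phi> (ivH h)"
   unfolding Irr_inv[OF \<phi> zh] Irr_inv[OF \<phi> h] by simp
  then show "?F (z \<otimes>\<^sub>gH h) = (\<phi> (ivH h) / of_nat (card (cenH))) \<odot>\<^sub>Sm (gr z \<otimes>\<^sub>Sm gr h)"
   using centerH_closed h z by (simp add: gr_mult)
 qed auto
 also have "\<dots> = gr z \<otimes>\<^sub>Sm ep \<phi>"
  unfolding e_phi_def by (rule char_idem_mult_left[OF finite_center gr_closed, symmetric])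
 finally have "gr z \<otimes>\<^sub>Sm ep \<phi> = (\<Oplus>\<^sub>Sm h\<in>cenH. ?F h)" by simp
 also have "\<dots> = (\<Oplus>\<^sub>Sm h\<in>cenH. \<phi> z \<odot>\<^sub>Sm ((\<phi> (ivH h) / of_nat (card (cenH))) \<odot>\<^sub>Sm gr h))"
  by (intro Sm.finsum_cong') (auto simp: Sm.sm_sm)
 also have "\<dots> = \<phi> z \<odot>\<^sub>Sm ep \<phi>"
  unfolding e_phi_def char_idem_def by (subst Sm.sm_finsum) auto
 finally show ?thesis .
qed

text \<open>For different characters choose a central \<open>z\<close> separating them. Pulled to
  either factor it acts on the product by two different scalars, so the product vanishes.\<close>

lemma e_phi_mult:
 assumes \<phi>: "\<phi> : Irr" and \<phi>': "\<phi>' : Irr"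
 shows "ep \<phi>' \<otimes>\<^sub>Sm ep \<phi> = (if \<phi>' = \<phi> then ep \<phi> else \<zero>\<^sub>Sm)"
proof (cases "\<phi>' = \<phi>")
 case True
 interpret f: character ZH \<phi> by (rule Irr_character[OF \<phi>])
 have "ep \<phi> \<otimes>\<^sub>Sm ep \<phi>
   = (\<Oplus>\<^sub>Sm h\<in>cenH. (1 / of_nat (card (cenH))) \<odot>\<^sub>Sm ep \<phi>)"
  unfolding e_phi_def[of S \<phi>] char_idem_mult_right[OF finite_center char_idem_closed]
  unfolding e_phi_def[symmetric] using f.nz
  by (intro Sm.finsum_cong') (auto simp: gr_e_phi \<phi> Irr_inv Sm.sm_sm)
 also have "\<dots> = ep \<phi>"
  using card_center_nz by (simp add: Sm.finsum_sm_left)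
 finally show ?thesis using True by simp
next
 case False
 have "\<exists>z\<in>cenH. \<phi> z ~= \<phi>' z"
 proof (rule ccontr)
  assume "\<not> (\<exists>z\<in>cenH. \<phi> z ~= \<phi>' z)"
  then have "\<phi> = \<phi>'" using \<phi> \<phi>' by (intro extensionalityI[of \<phi> "cenH"]) (auto simp: Irr_over_def)
  then show False using False by simp
 qed
 then obtain z where z: "z : cenH" "\<phi> z ~= \<phi>' z" by auto
 let ?x = "ep \<phi>' \<otimes>\<^sub>Sm ep \<phi>"
 have "\<phi>' z \<odot>\<^sub>Sm ?x = gr z \<otimes>\<^sub>Sm ep \<phi>' \<otimes>\<^sub>Sm ep \<phi>"
  using z by (simp add: gr_e_phi[OF \<phi>'] Sm.sm_mult_l)
 also have "\<dots> = ep \<phi>' \<otimes>\<^sub>Sm (gr z \<otimes>\<^sub>Sm ep \<phi>)"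
  using z by (simp add: e_phi_comm centerH_closed Sm.m_assoc)
 also have "\<dots> = \<phi> z \<odot>\<^sub>Sm ?x"
  using z by (simp add: gr_e_phi[OF \<phi>] Sm.sm_mult_r)
 finally have "(\<phi> z - \<phi>' z) \<odot>\<^sub>Sm ?x = \<zero>\<^sub>Sm"
  using Sm.sm_add_l[of ?x "\<phi> z" "- \<phi>' z"] by (simp add: Sm.sm_minus Sm.r_neg)
 then show ?thesis using False z Sm.sm_eq_zero[of ?x "\<phi> z - \<phi>' z"] by simp
qed

lemma finite_Z: "finite (subZ S)"
 using finite_subset[OF Z_central finite_center] .

text \<open>After exchanging sums, the coefficient of \<open>h\<close> is a sum of character values,
  which \<open>Irr_sum\<close> makes zero outside \<open>Z\<close>. On \<open>Z\<close> the identity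
  \<open>card_Irr_Z\<close> changes the denominator from the order of the center to that of
  \<open>Z\<close>.\<close>

lemma sum_e_phi: "(\<Oplus>\<^sub>Sm \<phi>\<in>Irr. ep \<phi>) = e_chi S"
proof -
 let ?c = "\<lambda>\<phi> h. \<phi> (ivH h) / of_nat (card (cenH)) :: 'k"
 have "(\<Oplus>\<^sub>Sm \<phi>\<in>Irr. ep \<phi>) = (\<Oplus>\<^sub>Sm h\<in>cenH. \<Oplus>\<^sub>Sm \<phi>\<in>Irr. ?c \<phi> h \<odot>\<^sub>Sm gr h)"
  unfolding e_phi_def char_idem_def by (rule Sm.finsum_swap) (auto simp: finite_Irr finite_center)
 also have "\<dots> = (\<Oplus>\<^sub>Sm h\<in>cenH. (\<Sum>\<phi>\<in>Irr. ?c \<phi> h) \<odot>\<^sub>Sm gr h)"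
  by (simp add: Sm.finsum_sm_left)
 also have "\<dots> = (\<Oplus>\<^sub>Sm h\<in>cenH. (if h : subZ S then chi S (ivH h) / of_nat (card (subZ S)) else 0) \<odot>\<^sub>Sm gr h)"
 proof (intro Sm.finsum_cong')
  fix h assume h: "h : cenH"
  have hi: "ivH h : cenH" using subgroup.m_inv_closed[OF subgroup_centerH h] .
  have Z: "ivH h : subZ S \<longleftrightarrow> h : subZ S"
   using subgroup.m_inv_closed[OF subgroup_Z] centerH_closed[OF h] by (metis H.inv_inv)
  have c: "of_nat (card (cenH)) = (of_nat (card (Irr)) * of_nat (card (subZ S)) :: 'k)"
   using card_Irr_Z by (metis of_nat_mult)
  have "(\<Sum>\<phi>\<in>Irr. ?c \<phi> h) = (\<Sum>\<phi>\<in>Irr. \<phi> (ivH h)) / of_nat (card (cenH))"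
   by (simp add: sum_divide_distrib)
  also have "\<dots> = (if h : subZ S then chi S (ivH h) / of_nat (card (subZ S)) else 0)"
   using Irr_sum[OF hi] card_center_nz unfolding Z c by simp
  finally show "(\<Sum>\<phi>\<in>Irr. ?c \<phi> h) \<odot>\<^sub>Sm gr h
    = (if h : subZ S then chi S (ivH h) / of_nat (card (subZ S)) else 0) \<odot>\<^sub>Sm gr h" by simp
 qed auto
 also have "\<dots> = (\<Oplus>\<^sub>Sm h\<in>subZ S \<union> (cenH - subZ S).
   (if h : subZ S then chi S (ivH h) / of_nat (card (subZ S)) else 0) \<odot>\<^sub>Sm gr h)"
  using Z_central by (intro arg_cong[where f = "finsum Sm _"]) auto
 also have "\<dots> = (\<Oplus>\<^sub>Sm h\<in>subZ S. (if h : subZ S then chi S (ivH h) / of_nat (card (subZ S)) else 0) \<odot>\<^sub>Sm gr h)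
   \<oplus>\<^sub>Sm (\<Oplus>\<^sub>Sm h\<in>cenH - subZ S. (if h : subZ S then chi S (ivH h) / of_nat (card (subZ S)) else 0) \<odot>\<^sub>Sm gr h)"
  using finite_Z finite_center by (intro Sm.finsum_Un_disjoint) auto
 also have "(\<Oplus>\<^sub>Sm h\<in>cenH - subZ S. (if h : subZ S then chi S (ivH h) / of_nat (card (subZ S)) else 0) \<odot>\<^sub>Sm gr h)
   = (\<Oplus>\<^sub>Sm h\<in>cenH - subZ S. \<zero>\<^sub>Sm)"
  by (intro Sm.finsum_cong') auto
 also have "(\<Oplus>\<^sub>Sm h\<in>subZ S. (if h : subZ S then chi S (ivH h) / of_nat (card (subZ S)) else 0) \<odot>\<^sub>Sm gr h) = e_chi S"
  unfolding e_chi_def char_idem_def by (intro Sm.finsum_cong') auto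
 finally show ?thesis by (simp add: e_chi_def)
qed

lemma e_chi_closed [simp]: "e_chi S : carrier Sm"
 by (simp add: e_chi_def)

text \<open>Moving \<open>h\<close> past an eigenvector costs the factor \<open>\<theta> h\<close>,
  and this factor shifts the character of the idempotent. It explains why the arrow labelled
  \<open>i\<close> ends at the twist by \<open>\<psi>_i\<close>.\<close>

lemma e_phi_io:
 assumes u: "eigen \<theta> u" and \<theta>: "HZchar \<theta>"
 shows "ep (tw \<phi> \<theta>) \<otimes>\<^sub>Sm io u = io u \<otimes>\<^sub>Sm ep \<phi>"
proof -
 interpret t: character "grpH S" \<theta> by (rule HZchar_character[OF \<theta>])
 have uU: "io u : carrier Sm" using eigen_closed[OF u] by simp
 show ?thesis
  unfolding e_phi_def char_idem_mult_left[OF finite_center uU] char_idem_mult_right[OF finite_center uU]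
 proof (intro Sm.finsum_cong')
  fix h assume h: "h : cenH"
  have hi: "ivH h : cenH" using subgroup.m_inv_closed[OF subgroup_centerH h] .
  show "(tw \<phi> \<theta> (ivH h) / of_nat (card (cenH))) \<odot>\<^sub>Sm (gr h \<otimes>\<^sub>Sm io u)
    = (\<phi> (ivH h) / of_nat (card (cenH))) \<odot>\<^sub>Sm (io u \<otimes>\<^sub>Sm gr h)"
  proof -
   have "tw \<phi> \<theta> (ivH h) * \<theta> h = \<phi> (ivH h)"
    using hi centerH_closed[OF h] by (simp add: twist_def t.at_inv field_simps)
   then show ?thesis using uU centerH_closed[OF h] by (simp add: gr_io_eigen[OF u] Sm.sm_sm)
  qed
 qed (use uU in auto)
qed

text \<open>The words span \<open>U\<close>, and their characters are trivial on
  \<open>Z\<close>.\<close>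

lemma uact_Z:
 assumes z: "z : subZ S" and u: "u : carU"
 shows "uact z u = u"
proof -
 have zH: "z : carH" using z Z_central centerH_closed by blast
 interpret a: k_alg_hom EN.U EN.U "uact z" by (rule uact_alg[OF zH])
 have "EN.U.subsp {u : carU. uact z u = u}"
  unfolding EN.U.subsp_def by (auto simp: a.f_add a.f_sm)
 moreover have "wword is : {u : carU. uact z u = u}" if "set is <= rkS" for "is"
  using eigen_wword[OF that] HZchar_wchar[OF that] z zH by (simp add: eigen_def HZchar_def)
 ultimately show ?thesis using words_span_U u by blast
qed

text \<open>\<open>Z\<close> is central in \<open>H\<close> and acts trivially on \<open>U\<close>.
  An arbitrary element is then written as the sum of its terms supported at single group
  elements.\<close>

lemma e_chi_central:
 assumes f: "f : carrier Sm"
 shows "f \<otimes>\<^sub>Sm e_chi S = e_chi S \<otimes>\<^sub>Sm f"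
proof -
 have io: "io u \<otimes>\<^sub>Sm e_chi S = e_chi S \<otimes>\<^sub>Sm io u" if u: "u : carU" for u
  unfolding e_chi_def char_idem_mult_left[OF finite_Z io.f_closed[OF u]] char_idem_mult_right[OF finite_Z io.f_closed[OF u]]
 proof (intro Sm.finsum_cong')
  fix z assume z: "z : subZ S"
  then have "z : carH" using Z_central centerH_closed by blast
  then show "(chi S (ivH z) / of_nat (card (subZ S))) \<odot>\<^sub>Sm (io u \<otimes>\<^sub>Sm gr z)
    = (chi S (ivH z) / of_nat (card (subZ S))) \<odot>\<^sub>Sm (gr z \<otimes>\<^sub>Sm io u)"
   using gr_io[OF u] uact_Z[OF z u] by simp
 qed (use u in auto)
 have elt: "SM.elt u g \<otimes>\<^sub>Sm e_chi S = e_chi S \<otimes>\<^sub>Sm SM.elt u g"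
  if u: "u : carU" and g: "g : carH" for u g
 proof -
  have "io u \<otimes>\<^sub>Sm gr g \<otimes>\<^sub>Sm e_chi S = io u \<otimes>\<^sub>Sm (e_chi S \<otimes>\<^sub>Sm gr g)"
   using u char_idem_comm[OF Z_central g, of "chi S"] by (simp add: Sm.m_assoc e_chi_def)
  also have "\<dots> = e_chi S \<otimes>\<^sub>Sm (io u \<otimes>\<^sub>Sm gr g)"
   using u io[OF u] by (simp flip: Sm.m_assoc)
  finally show ?thesis using elt_io_gr[OF u g] by simp
 qed
 have fx: "f x : carU" if "x : carH" for x
  using f that SM.apply_closed[of f x] by (simp add: smash_eq env_eq)
 have ec: "SM.elt (f x) x : carrier Sm" if "x : carH" for x
  using SM.elt_closed[of "f x" x] fx[OF that] by (simp add: smash_eq env_eq)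
 have "f = (\<Oplus>\<^sub>Sm x\<in>carH. SM.elt (f x) x)"
 proof -
  have "(\<Oplus>\<^sub>SM.R x\<in>carH. SM.elt (f x) x) y = f y" if y: "y : carH" for y
  proof -
   have "(\<Oplus>\<^sub>SM.R x\<in>carH. SM.elt (f x) x) y = (\<Oplus>\<^sub>(env S) x\<in>carH. SM.elt (f x) x y)"
    using ec y by (intro SM.finsum_apply) (auto simp: smash_eq)
   also have "\<dots> = SM.elt (f y) y y"
    using y finite_H fx by (intro SM.A.finsum_single) (auto simp: skew_elt_def env_eq)
   finally show ?thesis using y by (simp add: skew_elt_def)
  qed
  moreover have "(\<Oplus>\<^sub>Sm x\<in>carH. SM.elt (f x) x) : carrier Sm"
   using ec by (intro Sm.finsum_closed) auto
  ultimately show ?thesis using f by (intro SM.R_eqI) (auto simp: smash_eq)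
 qed
 then obtain F where F: "f = (\<Oplus>\<^sub>Sm x\<in>carH. F x)"
  "\<And>x. x : carH ==> F x : carrier Sm \<and> F x \<otimes>\<^sub>Sm e_chi S = e_chi S \<otimes>\<^sub>Sm F x"
  using ec elt[OF fx] by blast
 have "f \<otimes>\<^sub>Sm e_chi S = (\<Oplus>\<^sub>Sm x\<in>carH. F x \<otimes>\<^sub>Sm e_chi S)"
  unfolding F(1) using F(2) finite_H by (intro Sm.finsum_ldistr) auto
 also have "\<dots> = (\<Oplus>\<^sub>Sm x\<in>carH. e_chi S \<otimes>\<^sub>Sm F x)"
  using F(2) by (intro Sm.finsum_cong') auto
 also have "\<dots> = e_chi S \<otimes>\<^sub>Sm f"
  unfolding F(1) using F(2) finite_H by (intro Sm.finsum_rdistr[symmetric]) auto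
 finally show ?thesis .
qed

lemma e_chi_e_phi: "\<phi> : Irr ==> ep \<phi> \<otimes>\<^sub>Sm e_chi S = ep \<phi>"
proof -
 assume \<phi>: "\<phi> : Irr"
 have "ep \<phi> \<otimes>\<^sub>Sm e_chi S = (\<Oplus>\<^sub>Sm \<phi>'\<in>Irr. ep \<phi> \<otimes>\<^sub>Sm ep \<phi>')"
  unfolding sum_e_phi[symmetric] using finite_Irr by (intro Sm.finsum_rdistr) auto
 also have "\<dots> = ep \<phi> \<otimes>\<^sub>Sm ep \<phi>"
  using finite_Irr \<phi> by (intro Sm.finsum_single) (auto simp: e_phi_mult)
 finally show ?thesis using \<phi> by (simp add: e_phi_mult)
qed

lemma e_chi_idem: "e_chi S \<otimes>\<^sub>Sm e_chi S = e_chi S"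
proof -
 have "e_chi S \<otimes>\<^sub>Sm e_chi S = (\<Oplus>\<^sub>Sm \<phi>\<in>Irr. ep \<phi> \<otimes>\<^sub>Sm e_chi S)"
  unfolding sum_e_phi[symmetric] using finite_Irr
  by (intro Sm.finsum_ldistr) (auto intro!: Sm.finsum_closed)
 also have "\<dots> = (\<Oplus>\<^sub>Sm \<phi>\<in>Irr. ep \<phi>)"
  by (intro Sm.finsum_cong') (auto simp: e_chi_e_phi)
 finally show ?thesis by (simp add: sum_e_phi)
qed

subsection \<open>Monomials\<close>

text \<open>The common normal form of all products considered below; relations compare two of them
  with group elements differing by a central factor.\<close>

definition mon :: "'h => (('k, 'p) jen list \<Rightarrow>\<^sub>0 'k) set => ('h => 'k) => ('k, 'p, 'h) smash" where
 "mon g u \<phi> = gr g \<otimes>\<^sub>Sm io u \<otimes>\<^sub>Sm ep \<phi>"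

lemma mon_closed [simp]: "u : carU ==> mon g u \<phi> : carrier Sm"
 by (simp add: mon_def)

lemma mon_linear: "k_linear EN.U Sm (\<lambda>u. mon g u \<phi>)"
proof unfold_locales
 show "(\<lambda>u. mon g u \<phi>) : module_hom class_ring EN.U Sm"
  by (rule module_homI)
   (auto simp: mon_def io.f_add io.f_sm Sm.r_distr Sm.l_distr Sm.sm_mult_l Sm.sm_mult_r)
qed

lemma mon_left:
 assumes u: "eigen \<theta> u" and \<theta>: "HZchar \<theta>" and g: "g : carH"
 shows "mon g u \<phi> = ep (tw \<phi> \<theta>) \<otimes>\<^sub>Sm gr g \<otimes>\<^sub>Sm io u"
proof -
 have uU: "u : carU" by (rule eigen_closed[OF u])
 have "mon g u \<phi> = gr g \<otimes>\<^sub>Sm ep (tw \<phi> \<theta>) \<otimes>\<^sub>Sm io u"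
  using uU by (simp add: mon_def Sm.m_assoc e_phi_io[OF u \<theta>])
 then show ?thesis by (simp add: e_phi_comm[OF g])
qed

lemma mon_right_idem:
 "u : carU ==> \<phi> : Irr ==> \<phi>' : Irr ==>
  mon g u \<phi> \<otimes>\<^sub>Sm ep \<phi>' = (if \<phi> = \<phi>' then mon g u \<phi> else \<zero>\<^sub>Sm)"
 by (auto simp: mon_def Sm.m_assoc e_phi_mult)

lemma mon_left_idem:
 assumes u: "eigen \<theta> u" and \<theta>: "HZchar \<theta>" and g: "g : carH"
  and \<phi>: "\<phi> : Irr"
 shows "ep (tw \<phi> \<theta>) \<otimes>\<^sub>Sm mon g u \<phi> = mon g u \<phi>"
 using eigen_closed[OF u] twist_Irr[OF \<phi> \<theta>]
 by (simp add: mon_left[OF u \<theta> g] e_phi_mult flip: Sm.m_assoc)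

text \<open>The inner idempotent is absorbed since it matches the target of the right factor. The
  scalar arises from moving \<open>v\<close> to the right past \<open>g\<close>.\<close>

lemma mon_mult:
 assumes u: "eigen \<theta> u" and \<theta>: "HZchar \<theta>" and g: "g : carH" and \<phi>: "\<phi> : Irr"
  and v: "eigen \<theta>' v" and \<theta>': "HZchar \<theta>'" and h: "h : carH"
 shows "mon h v (tw \<phi> \<theta>) \<otimes>\<^sub>Sm mon g u \<phi> = inverse (\<theta>' g) \<odot>\<^sub>Sm mon (h \<otimes>\<^sub>gH g) (v \<otimes>\<^sub>EN.U u) \<phi>"
proof -
 have c: "u : carU" "v : carU" using eigen_closed u v by auto
 have "mon h v (tw \<phi> \<theta>) \<otimes>\<^sub>Sm mon g u \<phi> = gr h \<otimes>\<^sub>Sm io v \<otimes>\<^sub>Sm (ep (tw \<phi> \<theta>) \<otimes>\<^sub>Sm mon g u \<phi>)"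
  using c by (simp add: mon_def[of h] Sm.m_assoc)
 also have "\<dots> = gr h \<otimes>\<^sub>Sm (io v \<otimes>\<^sub>Sm gr g) \<otimes>\<^sub>Sm (io u \<otimes>\<^sub>Sm ep \<phi>)"
  unfolding mon_left_idem[OF u \<theta> g \<phi>] using c by (simp add: mon_def Sm.m_assoc)
 also have "\<dots> = inverse (\<theta>' g) \<odot>\<^sub>Sm (gr h \<otimes>\<^sub>Sm (gr g \<otimes>\<^sub>Sm io v) \<otimes>\<^sub>Sm (io u \<otimes>\<^sub>Sm ep \<phi>))"
  unfolding io_gr_eigen[OF v \<theta>' g] using c by (simp add: Sm.sm_mult_l Sm.sm_mult_r)
 also have "gr h \<otimes>\<^sub>Sm (gr g \<otimes>\<^sub>Sm io v) \<otimes>\<^sub>Sm (io u \<otimes>\<^sub>Sm ep \<phi>) = mon (h \<otimes>\<^sub>gH g) (v \<otimes>\<^sub>EN.U u) \<phi>"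
  using c g h by (simp add: mon_def Sm.m_assoc io.f_mult flip: gr_mult)
 finally show ?thesis .
qed

text \<open>The central \<open>z\<close> is moved past \<open>u\<close>, which costs
  \<open>\<theta> z\<close>, and then acts on the idempotent by \<open>\<phi> z\<close>.\<close>

lemma mon_center:
 assumes u: "eigen \<theta> u" and \<theta>: "HZchar \<theta>" and g: "g : carH" and \<phi>: "\<phi> : Irr"
  and z: "z : cenH"
 shows "mon (g \<otimes>\<^sub>gH z) u \<phi> = (\<theta> z * \<phi> z) \<odot>\<^sub>Sm mon g u \<phi>"
proof -
 have c: "u : carU" using eigen_closed u by auto
 have zH: "z : carH" by (rule centerH_closed[OF z])
 have "mon (g \<otimes>\<^sub>gH z) u \<phi> = gr g \<otimes>\<^sub>Sm (gr z \<otimes>\<^sub>Sm io u) \<otimes>\<^sub>Sm ep \<phi>"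
  using c g zH by (simp add: mon_def Sm.m_assoc flip: gr_mult)
 also have "\<dots> = \<theta> z \<odot>\<^sub>Sm (gr g \<otimes>\<^sub>Sm io u \<otimes>\<^sub>Sm (gr z \<otimes>\<^sub>Sm ep \<phi>))"
  unfolding gr_io_eigen[OF u zH] using c by (simp add: Sm.sm_mult_l Sm.sm_mult_r Sm.m_assoc)
 also have "\<dots> = (\<theta> z * \<phi> z) \<odot>\<^sub>Sm mon g u \<phi>"
  unfolding gr_e_phi[OF \<phi> z] using c by (simp add: Sm.sm_mult_r Sm.sm_sm mon_def)
 finally show ?thesis .
qed

text \<open>Expanding the idempotent shows that the element is supported on the coset of
  \<open>g\<close> modulo the center. The factor \<open>\<theta> g\<close> comes from writing
  \<open>u\<close> to the left of \<open>g\<close>.\<close>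

lemma mon_coord:
 assumes u: "eigen \<theta> u" and \<theta>: "HZchar \<theta>" and g: "g : carH" and x: "x : carH"
 shows "mon g u \<phi> x = (if ivH g \<otimes>\<^sub>gH x : cenH
  then (\<phi> (ivH (ivH g \<otimes>\<^sub>gH x)) / of_nat (card (cenH)) * \<theta> g) \<odot>\<^sub>EN.U u else \<zero>\<^sub>EN.U)"
proof -
 have c: "u : carU" using eigen_closed u by auto
 have ce: "u : carrier (env S)" using c by (simp add: env_eq)
 let ?c = "\<lambda>z. \<phi> (ivH z) / of_nat (card (cenH)) * \<theta> g :: 'k"
 have "mon g u \<phi> = (\<Oplus>\<^sub>Sm z\<in>cenH. (\<phi> (ivH z) / of_nat (card (cenH))) \<odot>\<^sub>Sm (gr g \<otimes>\<^sub>Sm io u \<otimes>\<^sub>Sm gr z))"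
  unfolding mon_def e_phi_def using c by (intro char_idem_mult_left finite_center) auto
 also have "\<dots> = (\<Oplus>\<^sub>Sm z\<in>cenH. SM.elt (?c z \<odot>\<^sub>EN.U u) (g \<otimes>\<^sub>gH z))"
 proof (intro Sm.finsum_cong' Pi_I)
  fix z assume "z : cenH"
  then have z: "z : carH" by (rule centerH_closed)
  have e: "SM.elt (?c z \<odot>\<^sub>EN.U u) (g \<otimes>\<^sub>gH z) = ?c z \<odot>\<^sub>Sm (io u \<otimes>\<^sub>Sm (gr g \<otimes>\<^sub>Sm gr z))"
   using c g z by (simp add: elt_io_gr gr_mult io.f_sm Sm.sm_mult_l)
  show "(\<phi> (ivH z) / of_nat (card (cenH))) \<odot>\<^sub>Sm (gr g \<otimes>\<^sub>Sm io u \<otimes>\<^sub>Sm gr z)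
    = SM.elt (?c z \<odot>\<^sub>EN.U u) (g \<otimes>\<^sub>gH z)"
   unfolding e gr_io_eigen[OF u g] using c by (simp add: Sm.sm_mult_l Sm.sm_sm Sm.m_assoc)
  show "SM.elt (?c z \<odot>\<^sub>EN.U u) (g \<otimes>\<^sub>gH z) : carrier Sm" unfolding e using c by simp
 qed simp
 finally have "mon g u \<phi> x = (\<Oplus>\<^sub>SM.R z\<in>cenH. SM.elt (?c z \<odot>\<^sub>EN.U u) (g \<otimes>\<^sub>gH z)) x"
  by (simp add: smash_eq)
 also have "\<dots> = (\<Oplus>\<^sub>(env S) z\<in>cenH. SM.elt (?c z \<odot>\<^sub>EN.U u) (g \<otimes>\<^sub>gH z) x)"
  using c x by (intro SM.finsum_apply SM.elt_closed) (auto simp: env_eq)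
 also have "\<dots> = (\<Oplus>\<^sub>EN.U z\<in>cenH. if z = ivH g \<otimes>\<^sub>gH x then ?c z \<odot>\<^sub>EN.U u else \<zero>\<^sub>EN.U)"
  unfolding env_eq
 proof (intro EN.U.finsum_cong')
  fix z assume "z : cenH"
  then have z: "z : carH" by (rule centerH_closed)
  have "x = g \<otimes>\<^sub>gH z \<longleftrightarrow> z = ivH g \<otimes>\<^sub>gH x"
   using H.inv_solve_left[of z g x] z g x by auto
  then show "skew_elt EN.U (grpH S) (?c z \<odot>\<^sub>EN.U u) (g \<otimes>\<^sub>gH z) x
    = (if z = ivH g \<otimes>\<^sub>gH x then ?c z \<odot>\<^sub>EN.U u else \<zero>\<^sub>EN.U)"
   using x by (simp add: skew_elt_def)
 qed (use c in auto)
 also have "\<dots> = (if ivH g \<otimes>\<^sub>gH x : cenH then ?c (ivH g \<otimes>\<^sub>gH x) \<odot>\<^sub>EN.U u else \<zero>\<^sub>EN.U)"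
 proof (cases "ivH g \<otimes>\<^sub>gH x : cenH")
  case True
  then show ?thesis
   using c finite_center by (subst EN.U.finsum_single[of _ "ivH g \<otimes>\<^sub>gH x"]) auto
 next
  case False
  then have "(\<Oplus>\<^sub>EN.U z\<in>cenH. if z = ivH g \<otimes>\<^sub>gH x then ?c z \<odot>\<^sub>EN.U u else \<zero>\<^sub>EN.U) = (\<Oplus>\<^sub>EN.U z\<in>cenH. \<zero>\<^sub>EN.U)"
   by (intro EN.U.finsum_cong') auto
  then show ?thesis using False by simp
 qed
 finally show ?thesis .
qed

lemma mon_independent:
 assumes \<phi>: "\<phi> : Irr"
  and eq: "(\<Oplus>\<^sub>Sm w\<in>PBW. a w \<odot>\<^sub>Sm mon (Gw w \<phi>) (wword w) \<phi>) = \<zero>\<^sub>Sm" and v: "v : PBW"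
 shows "a v = 0"
proof -
 interpret f: character ZH \<phi> by (rule Irr_character[OF \<phi>])
 \<comment> \<open>At this group element the monomial of \<open>v\<close> itself has a nonzero
   coefficient \<open>d v\<close>; other ordered words may contribute too, but with their own words
   of \<open>U\<close>.\<close>
 define x where "x = Gw v \<phi>"
 have x: "x : carH" unfolding x_def by (rule Gw_closed[OF PBW_subset[OF v] \<phi>])
 define d where "d w = (if ivH (Gw w \<phi>) \<otimes>\<^sub>gH x : cenH
  then \<phi> (ivH (ivH (Gw w \<phi>) \<otimes>\<^sub>gH x)) / of_nat (card (cenH)) * wchar w (Gw w \<phi>) else 0)" for w
 have wc: "wword w : carU" if "w : PBW" for w using wword_closed[OF PBW_subset[OF that]] .
 have md: "mon (Gw w \<phi>) (wword w) \<phi> x = d w \<odot>\<^sub>EN.U wword w" if w: "w : PBW" for w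
  using mon_coord[OF eigen_wword[OF PBW_subset[OF w]] HZchar_wchar[OF PBW_subset[OF w]] Gw_closed[OF PBW_subset[OF w] \<phi>] x] wc[OF w]
  by (simp add: d_def)
 have "(\<Oplus>\<^sub>EN.U w\<in>PBW. (a w * d w) \<odot>\<^sub>EN.U wword w) = (\<Oplus>\<^sub>(env S) w\<in>PBW. (a w \<odot>\<^sub>SM.R mon (Gw w \<phi>) (wword w) \<phi>) x)"
  unfolding env_eq
 proof (intro EN.U.finsum_cong' Pi_I)
  fix w assume w: "w : PBW"
  have "(a w \<odot>\<^sub>SM.R mon (Gw w \<phi>) (wword w) \<phi>) x = a w \<odot>\<^sub>EN.U mon (Gw w \<phi>) (wword w) \<phi> x"
   using x SM.skew_simps(6) by (simp add: env_eq)
  then show "(a w * d w) \<odot>\<^sub>EN.U wword w = (a w \<odot>\<^sub>(skew_group_algebra EN.U (grpH S) uact) mon (Gw w \<phi>) (wword w) \<phi>) x"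
   using md[OF w] wc[OF w] by (simp add: EN.U.sm_sm env_eq)
  then show "(a w \<odot>\<^sub>(skew_group_algebra EN.U (grpH S) uact) mon (Gw w \<phi>) (wword w) \<phi>) x : carU"
   using wc[OF w] by (metis EN.U.sm_closed)
 qed simp
 also have "\<dots> = (\<Oplus>\<^sub>SM.R w\<in>PBW. a w \<odot>\<^sub>SM.R mon (Gw w \<phi>) (wword w) \<phi>) x"
  using wc x mon_closed by (intro SM.finsum_apply[symmetric] SM.R.sm_closed) (auto simp: smash_eq)
 also have "\<dots> = \<zero>\<^sub>EN.U"
  using eq x SM.skew_simps(4) by (simp add: smash_eq env_eq)
 finally have "\<forall>w\<in>PBW. a w * d w = 0" by (rule PBW_independent)
 moreover have "d v ~= 0"
 proof -
  interpret w: character "grpH S" "wchar v" by (rule HZchar_character[OF HZchar_wchar[OF PBW_subset[OF v]]])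
  have "ivH x \<otimes>\<^sub>gH x = \<one>\<^sub>gH" "\<one>\<^sub>gH : cenH"
   using x subgroup.one_closed[OF subgroup_centerH] by simp_all
  then show ?thesis using card_center_nz w.nz[OF x] f.at_one by (simp add: d_def flip: x_def)
 qed
 ultimately show ?thesis using v by auto
qed

end

lemma (in k_space) finsum_nonzero_coeffs:
 assumes "finite I" "\<And>i. i : I ==> x i : carrier V"
 shows "(\<Oplus>i\<in>I. c i \<odot> x i) = (\<Oplus>i\<in>{i\<in>I. c i ~= 0}. c i \<odot> x i)"
proof -
 have "(\<Oplus>i\<in>I. c i \<odot> x i) = (\<Oplus>i\<in>{i\<in>I. c i ~= 0} \<union> {i : I. c i = 0}. c i \<odot> x i)"
  by (intro arg_cong[where f = "finsum V _"]) auto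
 also have "\<dots> = (\<Oplus>i\<in>{i\<in>I. c i ~= 0}. c i \<odot> x i) \<oplus> (\<Oplus>i\<in>{i\<in>I. c i = 0}. c i \<odot> x i)"
  using assms by (intro finsum_Un_disjoint) auto
 also have "(\<Oplus>i\<in>{i\<in>I. c i = 0}. c i \<odot> x i) = (\<Oplus>i\<in>{i\<in>I. c i = 0}. \<zero>)"
  using assms by (intro finsum_cong') auto
 finally show ?thesis using assms by (simp add: finsum_closed Pi_def)
qed

section \<open>The relations in the smash product\<close>

context jennings_setting
begin

lemma w_elt_mon: "we i \<phi> = mon (gi S i \<phi>) (wi i) \<phi>"
 by (simp add: w_elt_def mon_def smash_w_io)

lemma w_elt_closed [simp]: "i : rkS ==> we i \<phi> : carrier Sm"
 unfolding w_elt_mon by (intro mon_closed wi_closed)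

abbreviation Wd :: "nat list => ('h => 'k) => ('k, 'p, 'h) smash" where
 "Wd \<equiv> composable S Sm (ep) (we)"

lemma Wd_closed: "set is <= rkS ==> Wd is \<phi> : carrier Sm"
 by (induction "is" arbitrary: \<phi>) (auto simp del: atLeastAtMost_iff One_nat_def)

lemma w_mult_mon:
 assumes "set is <= rkS" "i : rkS" "\<phi> : Irr" "h : carH"
 shows "mon h (wword is) (tw \<phi> (psi S i)) \<otimes>\<^sub>Sm we i \<phi>
  = inverse (wchar is (gi S i \<phi>)) \<odot>\<^sub>Sm mon (h \<otimes>\<^sub>gH gi S i \<phi>) (wword (i # is)) \<phi>"
 unfolding w_elt_mon wword_Cons[OF assms(2,1)]
 using assms by (intro mon_mult eigen_wi HZchar_psi gi_closed eigen_wword HZchar_wchar)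

lemma mon_one: "mon \<one>\<^sub>gH \<one>\<^sub>EN.U \<phi> = ep \<phi>"
 by (simp add: mon_def gr_one)

text \<open>That the scalar is nonzero is needed to carry independence from the normal forms to the
  composable products.\<close>

lemma Wd_mon:
 assumes "set is <= rkS" "\<phi> : Irr"
 shows "\<exists>s. s ~= 0 \<and> Wd is \<phi> = s \<odot>\<^sub>Sm mon (Gw is \<phi>) (wword is) \<phi>"
 using assms
proof (induction "is" arbitrary: \<phi>)
 case Nil
 then show ?case by (intro exI[of _ 1]) (simp add: mon_one)
next
 case (Cons i "is")
 have i: "i : rkS" "set is <= rkS" using Cons.prems(1) by auto
 note t = twist_psi[OF Cons.prems(2) i(1)]
 obtain s where s: "s ~= 0"
  "Wd is (tw \<phi> (psi S i)) = s \<odot>\<^sub>Sm mon (Gw is (tw \<phi> (psi S i))) (wword is) (tw \<phi> (psi S i))"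
  using Cons.IH[OF i(2) t] by auto
 have "Wd (i # is) \<phi> = (s * inverse (wchar is (gi S i \<phi>))) \<odot>\<^sub>Sm mon (Gw (i # is) \<phi>) (wword (i # is)) \<phi>"
  using i t Cons.prems(2) w_mult_mon[OF i(2,1) Cons.prems(2) Gw_closed[OF i(2) t]] wword_closed[OF Cons.prems(1)]
  by (simp add: s(2) Sm.sm_mult_l Sm.sm_sm del: atLeastAtMost_iff One_nat_def)
 moreover have "wchar is (gi S i \<phi>) ~= 0"
  using character.nz[OF HZchar_character[OF HZchar_wchar[OF i(2)]] gi_closed[OF i(1) Cons.prems(2)]] .
 ultimately show ?case using s(1) by (intro exI[of _ "s * inverse (wchar is (gi S i \<phi>))"]) simp
qed

lemma mon_word:
 assumes "is": "set is <= rkS" and \<phi>: "\<phi> : Irr" and g: "g : carH"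
  and z: "ivH (Gw is \<phi>) \<otimes>\<^sub>gH g : cenH"
 shows "\<exists>s. mon g (wword is) \<phi> = s \<odot>\<^sub>Sm Wd is \<phi>"
proof -
 obtain s where s: "s ~= 0" "Wd is \<phi> = s \<odot>\<^sub>Sm mon (Gw is \<phi>) (wword is) \<phi>"
  using Wd_mon[OF "is" \<phi>] by auto
 have G: "Gw is \<phi> : carH" by (rule Gw_closed[OF "is" \<phi>])
 let ?z = "ivH (Gw is \<phi>) \<otimes>\<^sub>gH g"
 have "g = Gw is \<phi> \<otimes>\<^sub>gH ?z" using g G by (simp flip: H.m_assoc)
 then have "mon g (wword is) \<phi> = (wchar is ?z * \<phi> ?z) \<odot>\<^sub>Sm mon (Gw is \<phi>) (wword is) \<phi>"
  using mon_center[OF eigen_wword[OF "is"] HZchar_wchar[OF "is"] G \<phi> z] by simp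
 also have "mon (Gw is \<phi>) (wword is) \<phi> = inverse s \<odot>\<^sub>Sm Wd is \<phi>"
  unfolding s(2) using s(1) wword_closed[OF "is"] by (simp add: Sm.sm_sm)
 finally show ?thesis using Wd_closed[OF "is"] by (auto simp: Sm.sm_sm)
qed

text \<open>Each summand changes its group element from \<open>A\<close> to
  \<open>gi S k \<phi>\<close> at the cost of a central factor. The resulting scalars are the last
  two factors of \<open>q2\<close> and \<open>q3\<close>.\<close>

lemma mon_lincomb:
 assumes i: "\<And>k. k : rkS ==> c k ~= 0 ==> ivH (gi S k \<phi>) \<otimes>\<^sub>gH A : cenH"
  and A: "A : carH" and \<phi>: "\<phi> : Irr"
 shows "mon A (\<Oplus>\<^sub>EN.U k\<in>rkS. c k \<odot>\<^sub>EN.U wi k) \<phi>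
  = (\<Oplus>\<^sub>Sm k\<in>{k\<in>rkS. c k ~= 0}. (c k * (psi S k (ivH (gi S k \<phi>) \<otimes>\<^sub>gH A)
     * \<phi> (ivH (gi S k \<phi>) \<otimes>\<^sub>gH A))) \<odot>\<^sub>Sm we k \<phi>)"
proof -
 interpret m: k_linear EN.U Sm "\<lambda>u. mon A u \<phi>" by (rule mon_linear)
 have "mon A (\<Oplus>\<^sub>EN.U k\<in>rkS. c k \<odot>\<^sub>EN.U wi k) \<phi> = (\<Oplus>\<^sub>Sm k\<in>rkS. c k \<odot>\<^sub>Sm mon A (wi k) \<phi>)"
  by (rule m.f_lincomb) (rule wi_closed)
 also have "\<dots> = (\<Oplus>\<^sub>Sm k\<in>{k\<in>rkS. c k ~= 0}. c k \<odot>\<^sub>Sm mon A (wi k) \<phi>)"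
  by (intro Sm.finsum_nonzero_coeffs mon_closed wi_closed) simp_all
 also have "\<dots> = (\<Oplus>\<^sub>Sm k\<in>{k\<in>rkS. c k ~= 0}. (c k * (psi S k (ivH (gi S k \<phi>) \<otimes>\<^sub>gH A)
     * \<phi> (ivH (gi S k \<phi>) \<otimes>\<^sub>gH A))) \<odot>\<^sub>Sm we k \<phi>)"
 proof (intro Sm.finsum_cong' Pi_I)
  fix k assume "k : {k : rkS. c k ~= 0}"
  then have k: "k : rkS" "c k ~= 0" by auto
  note g = gi_closed[OF k(1) \<phi>]
  let ?z = "ivH (gi S k \<phi>) \<otimes>\<^sub>gH A"
  have "A = gi S k \<phi> \<otimes>\<^sub>gH ?z" using g A by (simp flip: H.m_assoc)
  then have "mon A (wi k) \<phi> = (psi S k ?z * \<phi> ?z) \<odot>\<^sub>Sm we k \<phi>"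
   using mon_center[OF eigen_wi[OF k(1)] HZchar_psi[OF k(1)] g \<phi> i[OF k]] by (simp add: w_elt_mon)
  then show "c k \<odot>\<^sub>Sm mon A (wi k) \<phi> = (c k * (psi S k ?z * \<phi> ?z)) \<odot>\<^sub>Sm we k \<phi>"
   using w_elt_closed[OF k(1)] by (simp add: Sm.sm_sm)
  show "(c k * (psi S k ?z * \<phi> ?z)) \<odot>\<^sub>Sm we k \<phi> : carrier Sm"
   using w_elt_closed[OF k(1)] by blast
 qed simp
 finally show ?thesis .
qed

lemma Gw_single: "i : rkS ==> \<phi> : Irr ==> Gw [i] \<phi> = gi S i \<phi>"
 using gi_closed by simp

lemma Gw_pair: "i : rkS ==> j : rkS ==> \<phi> : Irr ==>
  Gw [i, j] \<phi> = gi S j (tw \<phi> (psi S i)) \<otimes>\<^sub>gH gi S i \<phi>"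
 using gi_closed[of j "tw \<phi> (psi S i)"] twist_psi[of \<phi> i] by simp

lemma w_mult:
 assumes i: "i : rkS" and j: "j : rkS" and \<phi>: "\<phi> : Irr"
 shows "we j (tw \<phi> (psi S i)) \<otimes>\<^sub>Sm we i \<phi>
  = inverse (psi S j (gi S i \<phi>)) \<odot>\<^sub>Sm mon (Gw [i, j] \<phi>) (wi j \<otimes>\<^sub>EN.U wi i) \<phi>"
 unfolding Gw_pair[OF i j \<phi>] w_elt_mon
 using i j \<phi> by (intro mon_mult eigen_wi HZchar_psi gi_closed twist_psi)

text \<open>Both products are brought to the group element \<open>A\<close> and share the scalar
  \<open>inverse (psi S j (gi S i \<phi>))\<close>. What remains is \<open>w_j w_i\<close> compared
  with \<open>w_i w_j\<close>, a commutator in the order opposite to \<open>cc S i j\<close>, hence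
  the minus sign.\<close>

lemma smash_relation1:
 assumes i: "i : rkS" and j: "j : rkS" and \<phi>: "\<phi> : Irr"
 shows "we j (tw \<phi> (psi S i)) \<otimes>\<^sub>Sm we i \<phi>
  = q1 S i j \<phi> \<odot>\<^sub>Sm (we i (tw \<phi> (psi S j)) \<otimes>\<^sub>Sm we j \<phi>)
   \<oplus>\<^sub>Sm (\<Oplus>\<^sub>Sm k\<in>{k\<in>rkS. cc S i j k ~= 0}. (- cc S i j k * q2 S i j k \<phi>) \<odot>\<^sub>Sm we k \<phi>)"
proof -
 define A where "A = Gw [i, j] \<phi>"
 define B where "B = Gw [j, i] \<phi>"
 let ?z = "z1 S i j \<phi>" and ?u = "wi i \<otimes>\<^sub>EN.U wi j" and ?v = "wi j \<otimes>\<^sub>EN.U wi i"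
 let ?c = "inverse (psi S j (gi S i \<phi>))"
 note g = gi_closed[OF i \<phi>] gi_closed[OF j \<phi>]
 have AB: "A : carH" "B : carH"
  unfolding A_def B_def using i j \<phi> by (auto intro!: Gw_closed simp del: atLeastAtMost_iff Gw.simps)
 have z1: "?z = ivH B \<otimes>\<^sub>gH A"
  unfolding z1_def A_def B_def Gw_pair[OF i j \<phi>] Gw_pair[OF j i \<phi>] ..
 have z: "?z : cenH"
  unfolding z1 A_def B_def using i j \<phi> by (intro Gw_center) auto
 have ABz: "A = B \<otimes>\<^sub>gH ?z" unfolding z1 using AB by (simp flip: H.m_assoc)
 have uv: "?u : carU" "?v : carU" using wi_closed[OF i] wi_closed[OF j] by simp_all
 interpret m: k_linear EN.U Sm "\<lambda>u. mon A u \<phi>" by (rule mon_linear)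
 interpret pi: character "grpH S" "psi S i" by (rule HZchar_character[OF HZchar_psi[OF i]])
 interpret pj: character "grpH S" "psi S j" by (rule HZchar_character[OF HZchar_psi[OF j]])
 have 1: "q1 S i j \<phi> \<odot>\<^sub>Sm (we i (tw \<phi> (psi S j)) \<otimes>\<^sub>Sm we j \<phi>) = ?c \<odot>\<^sub>Sm mon A ?u \<phi>"
 proof -
  have "mon A ?u \<phi> = (psi S i ?z * psi S j ?z * \<phi> ?z) \<odot>\<^sub>Sm mon B ?u \<phi>"
   using mon_center[OF eigen_mult[OF eigen_wi[OF i] eigen_wi[OF j]] HZchar_mult[OF HZchar_psi[OF i] HZchar_psi[OF j]] AB(2) \<phi> z]
   by (simp flip: ABz)
  \<comment> \<open>The factor \<open>psi S i (gi S j \<phi>)\<close> in \<open>q1\<close> cancels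
    the scalar that \<open>w_mult\<close> gives for the opposite order; the remaining values at
    \<open>z1\<close> account for replacing \<open>B\<close> by \<open>A\<close>.\<close>
  moreover have "q1 S i j \<phi> * inverse (psi S i (gi S j \<phi>)) = ?c * (psi S i ?z * psi S j ?z * \<phi> ?z)"
   using g centerH_closed[OF z] by (simp add: q1_def pi.mult pj.mult pj.at_inv)
  ultimately show ?thesis
   using uv by (simp add: w_mult[OF j i \<phi>] Sm.sm_sm del: Gw.simps flip: B_def)
 qed
 have 2: "?c \<odot>\<^sub>Sm mon A (?u \<ominus>\<^sub>EN.U ?v) \<phi>
   = (\<Oplus>\<^sub>Sm k\<in>{k\<in>rkS. cc S i j k ~= 0}. (cc S i j k * q2 S i j k \<phi>) \<odot>\<^sub>Sm we k \<phi>)"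
 proof -
  have zk: "ivH (gi S k \<phi>) \<otimes>\<^sub>gH A : cenH" if k: "k : rkS" "cc S i j k ~= 0" for k
   unfolding Gw_single[OF k(1) \<phi>, symmetric] A_def using i j k \<phi> cc_char[OF i k(1) _ j k(2)] by (intro Gw_center) auto
  have "mon A (?u \<ominus>\<^sub>EN.U ?v) \<phi> = (\<Oplus>\<^sub>Sm k\<in>{k\<in>rkS. cc S i j k ~= 0}.
    (cc S i j k * (psi S k (z2 S i j k \<phi>) * \<phi> (z2 S i j k \<phi>))) \<odot>\<^sub>Sm we k \<phi>)"
   unfolding wi_commutator[OF i j] z2_def Gw_pair[OF i j \<phi>, symmetric] A_def[symmetric]
   by (rule mon_lincomb[OF zk AB(1) \<phi>])
  then have "?c \<odot>\<^sub>Sm mon A (?u \<ominus>\<^sub>EN.U ?v) \<phi> = (\<Oplus>\<^sub>Sm k\<in>{k\<in>rkS. cc S i j k ~= 0}.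
    ?c \<odot>\<^sub>Sm ((cc S i j k * (psi S k (z2 S i j k \<phi>) * \<phi> (z2 S i j k \<phi>))) \<odot>\<^sub>Sm we k \<phi>))"
   using w_elt_closed by (simp only:) (rule Sm.sm_finsum, blast)
  also have "\<dots> = (\<Oplus>\<^sub>Sm k\<in>{k\<in>rkS. cc S i j k ~= 0}. (cc S i j k * q2 S i j k \<phi>) \<odot>\<^sub>Sm we k \<phi>)"
  proof (intro Sm.finsum_cong' Pi_I)
   fix k assume "k : {k : rkS. cc S i j k ~= 0}"
   then have k: "we k \<phi> : carrier Sm" using w_elt_closed by blast
   then show "(cc S i j k * q2 S i j k \<phi>) \<odot>\<^sub>Sm we k \<phi> : carrier Sm" by blast
   have "?c * (cc S i j k * (psi S k (z2 S i j k \<phi>) * \<phi> (z2 S i j k \<phi>))) = cc S i j k * q2 S i j k \<phi>"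
    unfolding q2_def by (simp only: ac_simps)
   then show "?c \<odot>\<^sub>Sm ((cc S i j k * (psi S k (z2 S i j k \<phi>) * \<phi> (z2 S i j k \<phi>))) \<odot>\<^sub>Sm we k \<phi>)
     = (cc S i j k * q2 S i j k \<phi>) \<odot>\<^sub>Sm we k \<phi>"
    by (simp only: Sm.sm_sm[OF k])
  qed simp
  finally show ?thesis .
 qed
 have 3: "(\<Oplus>\<^sub>Sm k\<in>{k\<in>rkS. cc S i j k ~= 0}. (- cc S i j k * q2 S i j k \<phi>) \<odot>\<^sub>Sm we k \<phi>)
   = (- 1) \<odot>\<^sub>Sm (?c \<odot>\<^sub>Sm mon A (?u \<ominus>\<^sub>EN.U ?v) \<phi>)"
 proof -
  have "(\<Oplus>\<^sub>Sm k\<in>{k\<in>rkS. cc S i j k ~= 0}. (- cc S i j k * q2 S i j k \<phi>) \<odot>\<^sub>Sm we k \<phi>)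
   = (\<Oplus>\<^sub>Sm k\<in>{k\<in>rkS. cc S i j k ~= 0}. (- 1) \<odot>\<^sub>Sm ((cc S i j k * q2 S i j k \<phi>) \<odot>\<^sub>Sm we k \<phi>))"
  proof (intro Sm.finsum_cong' Pi_I)
   fix k assume "k : {k : rkS. cc S i j k ~= 0}"
   then have k: "we k \<phi> : carrier Sm" using w_elt_closed by blast
   then show "(- cc S i j k * q2 S i j k \<phi>) \<odot>\<^sub>Sm we k \<phi> = (- 1) \<odot>\<^sub>Sm ((cc S i j k * q2 S i j k \<phi>) \<odot>\<^sub>Sm we k \<phi>)"
    "(- 1) \<odot>\<^sub>Sm ((cc S i j k * q2 S i j k \<phi>) \<odot>\<^sub>Sm we k \<phi>) : carrier Sm"
    by (simp_all add: Sm.sm_sm)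
  qed simp
  also have "\<dots> = (- 1) \<odot>\<^sub>Sm (\<Oplus>\<^sub>Sm k\<in>{k\<in>rkS. cc S i j k ~= 0}. (cc S i j k * q2 S i j k \<phi>) \<odot>\<^sub>Sm we k \<phi>)"
   by (rule Sm.sm_finsum[symmetric]) (use w_elt_closed in blast)
  finally show ?thesis unfolding 2 .
 qed
 have mc: "mon A ?u \<phi> : carrier Sm" "mon A ?v \<phi> : carrier Sm" using uv by simp_all
 have "(- 1) \<odot>\<^sub>Sm (?c \<odot>\<^sub>Sm mon A (?u \<ominus>\<^sub>EN.U ?v) \<phi>)
   = (- 1) \<odot>\<^sub>Sm (?c \<odot>\<^sub>Sm mon A ?u \<phi>) \<oplus>\<^sub>Sm ?c \<odot>\<^sub>Sm mon A ?v \<phi>"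
  unfolding m.f_minus[OF uv] using mc by (simp add: a_minus_def Sm.sm_add_r Sm.sm_sm flip: Sm.sm_neg)
 moreover have "we j (tw \<phi> (psi S i)) \<otimes>\<^sub>Sm we i \<phi> = ?c \<odot>\<^sub>Sm mon A ?v \<phi>"
  unfolding A_def by (rule w_mult[OF i j \<phi>])
 moreover have "?c \<odot>\<^sub>Sm mon A ?v \<phi>
   = ?c \<odot>\<^sub>Sm mon A ?u \<phi> \<oplus>\<^sub>Sm ((- 1) \<odot>\<^sub>Sm (?c \<odot>\<^sub>Sm mon A ?u \<phi>) \<oplus>\<^sub>Sm ?c \<odot>\<^sub>Sm mon A ?v \<phi>)"
  using mc by (simp add: Sm.sm_neg Sm.r_neg flip: Sm.a_assoc)
 ultimately show ?thesis unfolding 1 3 by simp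
qed

text \<open>\<open>g_power\<close> recurses on the leftmost factor and \<open>Gw\<close> on the
  rightmost one; the auxiliary fact \<open>sh\<close> changes the side.\<close>

lemma g_power_Gw:
 assumes i: "i : rkS" and \<phi>: "\<phi> : Irr"
 shows "g_power S i m \<phi> = Gw (replicate m i) \<phi>" "g_power S i m \<phi> : carH"
  "twists S i m \<phi> : Irr"
proof -
 have tw: "twists S i a \<psi> : Irr" if "\<psi> : Irr" for a \<psi>
  using that by (induction a) (auto simp: twists_def intro: twist_psi[OF _ i])
 have cl: "g_power S i a \<psi> : carH" if "\<psi> : Irr" for a \<psi>
  using that by (induction a) (auto intro!: H.m_closed gi_closed[OF i] tw)
 have sh: "g_power S i (Suc a) \<psi> = g_power S i a (tw \<psi> (psi S i)) \<otimes>\<^sub>gH gi S i \<psi>" if \<psi>: "\<psi> : Irr" for a \<psi>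
 proof (induction a)
  case 0
  then show ?case using gi_closed[OF i \<psi>] by (simp add: twists_def)
 next
  case (Suc a)
  have "twists S i (Suc a) \<psi> = twists S i a (tw \<psi> (psi S i))" by (simp add: twists_def funpow_Suc_right del: funpow.simps)
  then show ?case
   using Suc gi_closed[OF i \<psi>] gi_closed[OF i tw[OF twist_psi[OF \<psi> i]]] cl[OF twist_psi[OF \<psi> i]]
   by (simp add: H.m_assoc)
 qed
 have eq: "g_power S i m \<psi> = Gw (replicate m i) \<psi>" if "\<psi> : Irr" for \<psi>
  using that
 proof (induction m arbitrary: \<psi>)
  case (Suc m)
  then show ?case using sh[of \<psi> m] twist_psi[OF _ i] by simp
 qed simp
 show "g_power S i m \<phi> = Gw (replicate m i) \<phi>" "g_power S i m \<phi> : carH" "twists S i m \<phi> : Irr"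
  by (rule eq[OF \<phi>], rule cl[OF \<phi>], rule tw[OF \<phi>])
qed

lemma wchar_replicate: "wchar (replicate m i) h = psi S i h ^ m"
 by (induction m) auto

text \<open>The group element contributed by factor number \<open>a\<close> must be passed by the
  \<open>m - 1 - a\<close> copies of \<open>w_i\<close> standing to its left.\<close>

lemma Wd_replicate:
 assumes i: "i : rkS" and \<phi>: "\<phi> : Irr"
 shows "Wd (replicate m i) \<phi> = (\<Prod>a<m. inverse (psi S i (gi S i (twists S i a \<phi>)) ^ (m - 1 - a)))
  \<odot>\<^sub>Sm mon (Gw (replicate m i) \<phi>) (wword (replicate m i)) \<phi>"
 using \<phi>
proof (induction m arbitrary: \<phi>)
 case 0
 then show ?case by (simp add: mon_one)
next
 case (Suc m)
 have r: "set (replicate n i) <= rkS" for n using i by (auto simp: set_replicate_conv_if)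
 note t = twist_psi[OF Suc.prems i]
 have tw: "twists S i (Suc a) \<phi> = twists S i a (tw \<phi> (psi S i))" for a
  by (simp add: twists_def funpow_Suc_right del: funpow.simps)
 have "Wd (replicate (Suc m) i) \<phi> = (\<Prod>a<m. inverse (psi S i (gi S i (twists S i (Suc a) \<phi>)) ^ (m - 1 - a)))
   \<odot>\<^sub>Sm (mon (Gw (replicate m i) (tw \<phi> (psi S i))) (wword (replicate m i)) (tw \<phi> (psi S i)) \<otimes>\<^sub>Sm we i \<phi>)"
  using wword_closed[OF r] w_elt_closed[OF i] by (simp add: Suc.IH[OF t] tw Sm.sm_mult_l)
 also have "\<dots> = ((\<Prod>a<m. inverse (psi S i (gi S i (twists S i (Suc a) \<phi>)) ^ (m - 1 - a))) * inverse (psi S i (gi S i \<phi>) ^ m))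
   \<odot>\<^sub>Sm mon (Gw (replicate (Suc m) i) \<phi>) (wword (replicate (Suc m) i)) \<phi>"
  using w_mult_mon[OF r[of m] i Suc.prems Gw_closed[OF r t]] wword_closed[OF r[of "Suc m"]]
  by (simp add: Sm.sm_sm wchar_replicate)
 also have "(\<Prod>a<m. inverse (psi S i (gi S i (twists S i (Suc a) \<phi>)) ^ (m - 1 - a))) * inverse (psi S i (gi S i \<phi>) ^ m)
   = (\<Prod>a<Suc m. inverse (psi S i (gi S i (twists S i a \<phi>)) ^ (Suc m - 1 - a)))"
 proof -
  have "m - 1 - a = Suc m - 1 - Suc a" for a by simp
  then show ?thesis unfolding prod.lessThan_Suc_shift by (simp add: twists_def ac_simps)
 qed
 finally show ?case .
qed

lemma wword_replicate: "i : rkS ==> wword (replicate m i) = wi i [^]\<^sub>EN.U m"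
 unfolding wword_def rev_replicate map_replicate by (rule EN.U.lprod_replicate) (rule wi_closed)

lemma smash_relation2:
 assumes i: "i : rkS" and \<phi>: "\<phi> : Irr"
 shows "Wd (replicate (chr S) i) \<phi>
  = (\<Oplus>\<^sub>Sm k\<in>{k\<in>rkS. dd S i k ~= 0}. (dd S i k * q3 S i k \<phi>) \<odot>\<^sub>Sm we k \<phi>)"
proof -
 define A where "A = g_power S i (chr S) \<phi>"
 let ?c = "\<Prod>a<chr S - 1. inverse (psi S i (gi S i (twists S i a \<phi>)) ^ (chr S - 1 - a))"
 have r: "set (replicate n i) <= rkS" for n using i by (auto simp: set_replicate_conv_if)
 have A: "A : carH" "A = Gw (replicate (chr S) i) \<phi>"
  unfolding A_def using g_power_Gw[OF i \<phi>] by auto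
 \<comment> \<open>The leftmost factor has exponent 0, so the product may stop before
   \<open>chr S - 1\<close>, as it does in \<open>q3\<close>.\<close>
 have c: "(\<Prod>a<chr S. inverse (psi S i (gi S i (twists S i a \<phi>)) ^ (chr S - 1 - a))) = ?c"
 proof -
  have "chr S = Suc (chr S - 1)" using chr_pos by simp
  then have "{..<chr S} = insert (chr S - 1) {..<chr S - 1}" by auto
  then show ?thesis by simp
 qed
 have zk: "ivH (gi S k \<phi>) \<otimes>\<^sub>gH A : cenH" if k: "k : rkS" "dd S i k ~= 0" for k
  unfolding Gw_single[OF k(1) \<phi>, symmetric] A(2) using k \<phi> dd_char[OF i k(1) _ k(2)] r
  by (intro Gw_center) (auto simp: wchar_replicate)
 have "Wd (replicate (chr S) i) \<phi> = ?c \<odot>\<^sub>Sm mon A (\<Oplus>\<^sub>EN.U k\<in>rkS. dd S i k \<odot>\<^sub>EN.U wi k) \<phi>"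
  unfolding Wd_replicate[OF i \<phi>] c A(2)[symmetric] wword_replicate[OF i] wi_power[OF i] ..
 also have "\<dots> = ?c \<odot>\<^sub>Sm (\<Oplus>\<^sub>Sm k\<in>{k\<in>rkS. dd S i k ~= 0}.
   (dd S i k * (psi S k (z3 S i k \<phi>) * \<phi> (z3 S i k \<phi>))) \<odot>\<^sub>Sm we k \<phi>)"
 proof -
  have "mon A (\<Oplus>\<^sub>EN.U k\<in>rkS. dd S i k \<odot>\<^sub>EN.U wi k) \<phi> = (\<Oplus>\<^sub>Sm k\<in>{k\<in>rkS. dd S i k ~= 0}.
   (dd S i k * (psi S k (z3 S i k \<phi>) * \<phi> (z3 S i k \<phi>))) \<odot>\<^sub>Sm we k \<phi>)"
   unfolding z3_def A_def[symmetric] by (rule mon_lincomb[OF zk A(1) \<phi>])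
  then show ?thesis by (simp only:)
 qed
 also have "\<dots> = (\<Oplus>\<^sub>Sm k\<in>{k\<in>rkS. dd S i k ~= 0}. ?c \<odot>\<^sub>Sm 
   ((dd S i k * (psi S k (z3 S i k \<phi>) * \<phi> (z3 S i k \<phi>))) \<odot>\<^sub>Sm we k \<phi>))"
  by (rule Sm.sm_finsum) (use w_elt_closed in blast)
 also have "\<dots> = (\<Oplus>\<^sub>Sm k\<in>{k\<in>rkS. dd S i k ~= 0}. (dd S i k * q3 S i k \<phi>) \<odot>\<^sub>Sm we k \<phi>)"
 proof (intro Sm.finsum_cong' Pi_I)
  fix k assume "k : {k : rkS. dd S i k ~= 0}"
  then have k: "we k \<phi> : carrier Sm" using w_elt_closed by blast
  then show "(dd S i k * q3 S i k \<phi>) \<odot>\<^sub>Sm we k \<phi> : carrier Sm" by blast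
  have "?c * (dd S i k * (psi S k (z3 S i k \<phi>) * \<phi> (z3 S i k \<phi>))) = dd S i k * q3 S i k \<phi>"
   unfolding q3_def by (simp only: ac_simps)
  then show "?c \<odot>\<^sub>Sm ((dd S i k * (psi S k (z3 S i k \<phi>) * \<phi> (z3 S i k \<phi>))) \<odot>\<^sub>Sm we k \<phi>)
    = (dd S i k * q3 S i k \<phi>) \<odot>\<^sub>Sm we k \<phi>"
   by (simp only: Sm.sm_sm[OF k])
 qed simp
 finally show ?thesis .
qed

end

text \<open>\<open>finsum\<close> depends on the whole record including its carrier, so sums in the
  corner and in the generated subalgebra must be compared with sums in the smash product.\<close>

lemma finsum_same_add:
 assumes A: "k_space A" and B: "k_space B" and ops: "add B = add A" "zero B = zero A"
  and f: "\<And>i. i : I ==> f i : carrier A" "\<And>i. i : I ==> f i : carrier B"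
 shows "finsum B f I = finsum A f I"
proof -
 interpret A: k_space A by fact
 interpret B: k_space B by fact
 show ?thesis using f
 proof (induction I rule: infinite_finite_induct)
  case (insert i I)
  then show ?case by (simp add: ops Pi_def)
 qed (simp_all add: ops)
qed

context k_algebra
begin

lemma corner_algebra:
 assumes e: "e : carrier A" "e \<otimes> e = e" and c: "\<And>a. a : carrier A ==> a \<otimes> e = e \<otimes> a"
 shows "k_algebra (corner A e)" "carrier (corner A e) = {a : carrier A. a \<otimes> e = a}"
proof -
 show car: "carrier (corner A e) = {a : carrier A. a \<otimes> e = a}"
 proof -
  have "a \<otimes> e \<otimes> e = a \<otimes> e" if "a : carrier A" for a using that e by (simp add: m_assoc)
  then show ?thesis using e by (auto simp: corner_def) metis
 qed
 have ops: "x \<oplus>\<^sub>(corner A e) y = x \<oplus> y" "x \<otimes>\<^sub>(corner A e) y = x \<otimes> y" "\<zero>\<^sub>(corner A e) = \<zero>" "\<one>\<^sub>(corner A e) = e"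
  "c' \<odot>\<^sub>(corner A e) x = c' \<odot> x" for x y c'
  by (simp_all add: corner_def)
 have sp: "k_space (corner A e)"
  by (rule k_spaceI) (use e in \<open>auto simp: car ops a_ac l_distr sm_mult_l sm_sm sm_add_l sm_add_r\<close>)
 have el: "e \<otimes> x = x" if "x : carrier A" "x \<otimes> e = x" for x using c[OF that(1)] that(2) by simp
 show "k_algebra (corner A e)"
  by (rule k_algebraI[OF sp]) (use e el in \<open>auto simp: car ops m_assoc l_distr r_distr sm_mult_l sm_mult_r\<close>)
qed

lemma subalgebra_generated_eq:
 assumes T: "T <= carrier A" "\<one> : T" "\<And>x y. x : T ==> y : T ==> x \<oplus> y : T"
   "\<And>x y. x : T ==> y : T ==> x \<otimes> y : T" "\<And>c x. x : T ==> c \<odot> x : T"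
  and S: "S <= T"
  and least: "\<And>B. subring B A ==> (\<And>c b. b : B ==> c \<odot> b : B) ==> S <= B ==> T <= B"
 shows "carrier (subalgebra_generated A S) = T" "k_algebra (subalgebra_generated A S)"
proof -
 have neg: "\<ominus> x : T" if "x : T" for x using T(5)[OF that, of "- 1"] T(1) that by (auto simp: sm_neg)
 have "subring T A" by (rule subringI) (use T neg in auto)
 then have "T : {B. subring B A \<and> (\<forall>c. \<forall>b\<in>B. c \<odot> b : B) \<and> S <= B}" using T S by auto
 moreover have "T <= B" if "B : {B. subring B A \<and> (\<forall>c. \<forall>b\<in>B. c \<odot> b : B) \<and> S <= B}" for B
  using that by (intro least) auto
 ultimately have "\<Inter>{B. subring B A \<and> (\<forall>c. \<forall>b\<in>B. c \<odot> b : B) \<and> S <= B} = T" by blast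
 then show car: "carrier (subalgebra_generated A S) = T" by (simp add: subalgebra_generated_def)
 let ?S = "subalgebra_generated A S"
 have ops: "x \<oplus>\<^sub>?S y = x \<oplus> y" "x \<otimes>\<^sub>?S y = x \<otimes> y" "\<zero>\<^sub>?S = \<zero>" "\<one>\<^sub>?S = \<one>"
  "c' \<odot>\<^sub>?S x = c' \<odot> x" for x y c'
  by (simp_all add: subalgebra_generated_def)
 have T': "x : T ==> x : carrier A" for x using T(1) by blast
 have zero: "\<zero> : T" using T(5)[OF T(2), of 0] by simp
 have sp: "k_space ?S"
  by (rule k_spaceI) (use T T' zero in \<open>auto simp: car ops a_ac sm_sm sm_add_l sm_add_r\<close>)
 show "k_algebra ?S"
  by (rule k_algebraI[OF sp]) (use T T' in \<open>auto simp: car ops m_assoc l_distr r_distr sm_mult_l sm_mult_r\<close>)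
qed

end

section \<open>The path algebra\<close>

context jennings_setting
begin

abbreviation Q where "Q \<equiv> quiver S"

text \<open>At each vertex an index of degree one determines its arrow. Walks therefore correspond
  to a start and an arbitrary list of such indices, and this is the form used for all path
  computations.\<close>

primrec arr :: "nat list => ('h => 'k) => (nat \<times> ('h => 'k)) list" where
 "arr [] \<phi> = []"
| "arr (i # is) \<phi> = (i, \<phi>) # arr is (tw \<phi> (psi S i))"

definition pth :: "nat list => ('h => 'k) => ('h => 'k) \<times> (nat \<times> ('h => 'k)) list" where
 "pth is \<phi> = (\<phi>, arr is \<phi>)"

lemma quiver_simps: "verts Q = Irr" "tail Q a = snd a" "head Q a = tw (snd a) (psi S (fst a))"
 "a : arcs Q \<longleftrightarrow> fst a : deg1 \<and> snd a : Irr"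
 by (auto simp: quiver_def deg1_def split: prod.split)

lemma deg1_rk: "i : deg1 ==> i : rkS" "set is <= deg1 ==> set is <= rkS"
 by (auto simp: deg1_def)

lemma map_fst_arr [simp]: "map fst (arr is \<phi>) = is"
 by (induction "is" arbitrary: \<phi>) auto

lemma twist_Cons: "tw (tw \<phi> (psi S i)) (wchar is) = tw \<phi> (wchar (i # is))"
 by (simp add: twist_twist)

lemma arr_append: "\<phi> : Irr ==> set is <= rkS ==>
  arr (is @ js) \<phi> = arr is \<phi> @ arr js (tw \<phi> (wchar is))"
proof (induction "is" arbitrary: \<phi>)
 case (Cons i "is")
 have i: "i : rkS" "set is <= rkS" using Cons.prems(2) by auto
 show ?case using Cons.IH[OF twist_psi[OF Cons.prems(1) i(1)] i(2)] twist_Cons by simp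
qed (simp add: twist_one)

lemma cas_arr: "\<phi> : Irr ==> pre_digraph.cas Q \<phi> p v ==> set p <= arcs Q ==>
  \<exists>is. set is <= deg1 \<and> p = arr is \<phi> \<and> v = tw \<phi> (wchar is)"
proof (induction p arbitrary: \<phi>)
 case Nil
 then show ?case by (intro exI[of _ "[]"]) (simp add: pre_digraph.cas.simps twist_one)
next
 case (Cons a p)
 then have a: "fst a : deg1" "snd a = \<phi>" "pre_digraph.cas Q (tw \<phi> (psi S (fst a))) p v"
  by (auto simp: pre_digraph.cas.simps quiver_simps)
 obtain "is" where "is": "set is <= deg1" "p = arr is (tw \<phi> (psi S (fst a)))" "v = tw (tw \<phi> (psi S (fst a))) (wchar is)"
  using Cons.IH[OF twist_psi[OF Cons.prems(1) deg1_rk(1)[OF a(1)]] a(3)] Cons.prems(3) by auto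
 have "a # p = arr (fst a # is) \<phi>" using a(2) "is"(2) by (cases a) simp
 then show ?case using "is" a(1) twist_Cons by (intro exI[of _ "fst a # is"]) simp
qed

lemma arr_cas: "\<phi> : Irr ==> set is <= deg1 ==>
  pre_digraph.cas Q \<phi> (arr is \<phi>) (tw \<phi> (wchar is)) \<and> set (arr is \<phi>) <= arcs Q
  \<and> last (pre_digraph.awalk_verts Q \<phi> (arr is \<phi>)) = tw \<phi> (wchar is)"
proof (induction "is" arbitrary: \<phi>)
 case Nil
 then show ?case by (simp add: pre_digraph.cas.simps pre_digraph.awalk_verts.simps twist_one)
next
 case (Cons i "is")
 have i: "i : deg1" "set is <= deg1" using Cons.prems(2) by auto
 have "tw \<phi> (psi S i) : Irr" using twist_psi[OF Cons.prems(1) deg1_rk(1)[OF i(1)]] .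
 from Cons.IH[OF this i(2)] show ?case
  using Cons.prems(1) i pre_digraph.awalk_verts_non_Nil[of Q]
  by (simp add: pre_digraph.cas.simps pre_digraph.awalk_verts.simps quiver_simps twist_Cons[simplified])
qed

lemma quiver_paths_iff:
 "\<phi> : Irr ==> x : quiver_paths Q \<phi> v \<longleftrightarrow> (\<exists>is. set is <= deg1 \<and> x = pth is \<phi> \<and> v = tw \<phi> (wchar is))"
 unfolding quiver_paths_def pth_def pre_digraph.awalk_def quiver_simps(1)
 using cas_arr[of \<phi>] arr_cas[of \<phi>] by (auto simp: quiver_simps(1))

definition PB :: "(('h => 'k) \<times> (nat \<times> ('h => 'k)) list) set" where
 "PB = {pth is \<phi> | is \<phi>. set is <= deg1 \<and> \<phi> : Irr}"

lemma PB_eq: "(\<Union>u\<in>verts Q. \<Union>v\<in>verts Q. quiver_paths Q u v) = PB"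
proof -
 have "(\<exists>u\<in>Irr. \<exists>v\<in>Irr. x : quiver_paths Q u v) \<longleftrightarrow> x : PB" for x
  using twist_wchar[OF _ deg1_rk(2)] by (auto simp: PB_def quiver_paths_iff) 
 then show ?thesis by (auto simp: quiver_simps(1))
qed

lemma quiver_paths_PB: "\<phi> : Irr ==> quiver_paths Q \<phi> v <= PB"
proof
 fix x assume \<phi>: "\<phi> : Irr" and "x : quiver_paths Q \<phi> v"
 then obtain "is" where "x = pth is \<phi>" "set is <= deg1" unfolding quiver_paths_iff[OF \<phi>] by blast
 then show "x : PB" using \<phi> unfolding PB_def by blast
qed

lemma path_mult_pth:
 assumes "\<phi> : Irr" "set is <= deg1"
 shows "path_mult Q (pth js \<theta>) (pth is \<phi>) =
  (if tw \<phi> (wchar is) = \<theta> then single (pth (is @ js) \<phi>) 1 else 0 :: _ \<Rightarrow>\<^sub>0 'k)"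
 using arr_cas[OF assms] arr_append[OF assms(1) deg1_rk(2)[OF assms(2)]]
 by (auto simp: path_mult_def pth_def)

lemma pth_Nil: "path_vertex \<phi> = (single (pth [] \<phi>) 1 :: _ \<Rightarrow>\<^sub>0 'k)"
 by (simp add: path_vertex_def pth_def)

lemma pth_single: "path_arrow Q (i, \<phi>) = (single (pth [i] \<phi>) 1 :: _ \<Rightarrow>\<^sub>0 'k)"
 by (simp add: path_arrow_def pth_def quiver_simps)

lemma pth_PB: "\<phi> : Irr ==> set is <= deg1 ==> pth is \<phi> : PB"
 by (auto simp: PB_def)

lemma paths_basis: "algebra_basis PB (path_mult Q) (\<Sum>\<phi>\<in>Irr. path_vertex \<phi> :: _ \<Rightarrow>\<^sub>0 'k)"
proof
 fix x assume x: "x : PB"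
 obtain "is" \<phi> where x': "x = pth is \<phi>" "set is <= deg1" "\<phi> : Irr" using x by (auto simp: PB_def)
 let ?\<phi>' = "tw \<phi> (wchar is)"
 have t: "?\<phi>' : Irr" using twist_wchar[OF x'(3) deg1_rk(2)[OF x'(2)]] .
 have "bmul (path_mult Q) (\<Sum>\<phi>\<in>Irr. path_vertex \<phi>) (single x (1::'k))
   = (\<Sum>\<theta>\<in>Irr. if ?\<phi>' = \<theta> then single x 1 else 0)"
  unfolding bmul_sum_left pth_Nil x'(1) bmul_single by (intro sum.cong) (simp_all add: path_mult_pth x')
 then show "bmul (path_mult Q) (\<Sum>\<phi>\<in>Irr. path_vertex \<phi>) (single x (1::'k)) = single x 1"
  using t finite_Irr by simp
 have "bmul (path_mult Q) (single x (1::'k)) (\<Sum>\<phi>\<in>Irr. path_vertex \<phi>)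
   = (\<Sum>\<theta>\<in>Irr. if \<theta> = \<phi> then single x 1 else 0)"
  unfolding bmul_sum_right pth_Nil x'(1) bmul_single by (intro sum.cong) (simp_all add: path_mult_pth twist_one)
 then show "bmul (path_mult Q) (single x (1::'k)) (\<Sum>\<phi>\<in>Irr. path_vertex \<phi>) = single x 1"
  using x' finite_Irr by simp
 fix y assume y: "y : PB"
 obtain js \<theta> where y': "y = pth js \<theta>" "set js <= deg1" "\<theta> : Irr" using y by (auto simp: PB_def)
 show "keys (path_mult Q x y :: _ \<Rightarrow>\<^sub>0 'k) <= PB"
  unfolding x'(1) y'(1) using x' y' pth_PB[of \<theta> "js @ is"] by (simp add: path_mult_pth)
 fix z assume z: "z : PB"
 obtain ks \<eta> where z': "z = pth ks \<eta>" "set ks <= deg1" "\<eta> : Irr" using z by (auto simp: PB_def)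
 have a: "tw \<eta> (wchar (ks @ js)) = tw (tw \<eta> (wchar ks)) (wchar js)"
  by (simp add: twist_twist wchar_append[abs_def])
 have s: "set (ks @ js) <= deg1" using y' z' by simp
 show "bmul (path_mult Q) (path_mult Q x y) (single z (1::'k))
   = bmul (path_mult Q) (single x 1) (path_mult Q y z)"
  unfolding x'(1) y'(1) z'(1) path_mult_pth[OF y'(3,2)] path_mult_pth[OF z'(3,2)]
  using path_mult_pth[OF z'(3) s] path_mult_pth[OF z'(3,2)] a by (auto simp: bmul_single)
next
 show "keys (\<Sum>\<phi>\<in>Irr. path_vertex \<phi> :: _ \<Rightarrow>\<^sub>0 'k) <= PB"
  using pth_PB[of _ "[]"] by (intro keys_sum_subset) (auto simp: pth_Nil)
qed

sublocale paths: algebra_basis PB "path_mult Q" "\<Sum>\<phi>\<in>Irr. path_vertex \<phi> :: _ \<Rightarrow>\<^sub>0 'k"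
 by (rule paths_basis)

abbreviation kQ :: "('k, ('k, 'h) kQ) module" where "kQ \<equiv> path_algebra Q"

lemma kQ_eq: "kQ = basis_algebra PB (path_mult Q) (\<Sum>\<phi>\<in>Irr. path_vertex \<phi>)"
 unfolding path_algebra_def PB_eq unfolding quiver_simps(1) ..

sublocale kQ: k_algebra kQ
 unfolding kQ_eq by (rule paths.k_algebra)

lemma kQ_simps: "x : carrier kQ \<longleftrightarrow> keys x <= PB" "x \<otimes>\<^sub>kQ y = bmul (path_mult Q) x y"
 "x \<oplus>\<^sub>kQ y = x + y" "\<zero>\<^sub>kQ = 0" "c \<odot>\<^sub>kQ x = scale c x" "\<one>\<^sub>kQ = (\<Sum>\<phi>\<in>Irr. path_vertex \<phi>)"
 by (simp_all add: kQ_eq)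

lemma kQ_minus: "x : carrier kQ ==> y : carrier kQ ==> x \<ominus>\<^sub>kQ y = x - y"
 using kQ.sm_neg[of y] by (simp add: a_minus_def kQ_simps)

lemma kQ_closed: "\<phi> : Irr ==> set is <= deg1 ==> single (pth is \<phi>) c : carrier kQ"
 "\<phi> : Irr ==> path_vertex \<phi> : carrier kQ"
 using pth_PB[of \<phi> "is"] pth_PB[of \<phi> "[]"] by (auto simp: kQ_simps pth_Nil)

lemma vertex_mult:
 assumes \<phi>: "\<phi> : Irr" and x: "keys x <= quiver_paths Q \<phi> v"
 shows "x \<otimes>\<^sub>kQ path_vertex \<phi> = x" "path_vertex v \<otimes>\<^sub>kQ x = x"
proof -
 show "x \<otimes>\<^sub>kQ path_vertex \<phi> = x"
  using x
 proof (induction x rule: poly_mapping_induct_on)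
  case (single y c)
  then obtain "is" where "y = pth is \<phi>" using \<phi> by (auto simp: quiver_paths_iff)
  then show ?case using \<phi> by (simp add: kQ_simps pth_Nil bmul_single path_mult_pth twist_one scale_single)
 qed (simp_all add: kQ_simps bmul_add_left)
 show "path_vertex v \<otimes>\<^sub>kQ x = x"
  using x
 proof (induction x rule: poly_mapping_induct_on)
  case (single y c)
  then obtain "is" where "y = pth is \<phi>" "set is <= deg1" "v = tw \<phi> (wchar is)" using \<phi> by (auto simp: quiver_paths_iff)
  then show ?case using \<phi> by (simp add: kQ_simps pth_Nil bmul_single path_mult_pth scale_single)
 qed (simp_all add: kQ_simps bmul_add_right)
qed

section \<open>The map from the path algebra\<close>

lemma Wd_right_idem:
 assumes "set is <= rkS" "\<phi> : Irr" "\<phi>' : Irr"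
 shows "Wd is \<phi> \<otimes>\<^sub>Sm ep \<phi>' = (if \<phi> = \<phi>' then Wd is \<phi> else \<zero>\<^sub>Sm)"
proof -
 obtain s where "Wd is \<phi> = s \<odot>\<^sub>Sm mon (Gw is \<phi>) (wword is) \<phi>" using Wd_mon[OF assms(1,2)] by auto
 then show ?thesis
  using mon_right_idem[OF wword_closed[OF assms(1)] assms(2,3), of "Gw is \<phi>"] wword_closed[OF assms(1)]
  by (cases "\<phi> = \<phi>'") (simp_all add: Sm.sm_mult_l)
qed

lemma Wd_left_idem:
 assumes "set is <= rkS" "\<phi> : Irr"
 shows "ep (tw \<phi> (wchar is)) \<otimes>\<^sub>Sm Wd is \<phi> = Wd is \<phi>"
proof -
 obtain s where "Wd is \<phi> = s \<odot>\<^sub>Sm mon (Gw is \<phi>) (wword is) \<phi>" using Wd_mon[OF assms] by auto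
 then show ?thesis
  using mon_left_idem[OF eigen_wword[OF assms(1)] HZchar_wchar[OF assms(1)] Gw_closed[OF assms] assms(2)] wword_closed[OF assms(1)]
  by (simp add: Sm.sm_mult_r)
qed

lemma Wd_append:
 assumes "set is <= rkS" "set js <= rkS" "\<phi> : Irr"
 shows "Wd (is @ js) \<phi> = Wd js (tw \<phi> (wchar is)) \<otimes>\<^sub>Sm Wd is \<phi>"
 using assms
proof (induction "is" arbitrary: \<phi>)
 case Nil
 then show ?case by (simp add: twist_one Wd_right_idem del: One_nat_def)
next
 case (Cons i "is")
 have i: "i : rkS" "set is <= rkS" using Cons.prems(1) by auto
 note t = twist_psi[OF Cons.prems(3) i(1)]
 have "Wd ((i # is) @ js) \<phi> = Wd js (tw \<phi> (wchar (i # is))) \<otimes>\<^sub>Sm Wd is (tw \<phi> (psi S i)) \<otimes>\<^sub>Sm we i \<phi>"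
  using Cons.IH[OF i(2) Cons.prems(2) t] twist_Cons by simp
 then show ?case
  using Wd_closed[OF Cons.prems(2)] Wd_closed[OF i(2)] w_elt_closed[OF i(1)] by (simp add: Sm.m_assoc)
qed

lemma Wd_mult_zero:
 assumes "set is <= rkS" "set js <= rkS" "\<phi> : Irr" "\<theta> : Irr"
  and ne: "tw \<phi> (wchar is) ~= \<theta>"
 shows "Wd js \<theta> \<otimes>\<^sub>Sm Wd is \<phi> = \<zero>\<^sub>Sm"
proof -
 have "Wd js \<theta> \<otimes>\<^sub>Sm Wd is \<phi> = Wd js \<theta> \<otimes>\<^sub>Sm (ep (tw \<phi> (wchar is)) \<otimes>\<^sub>Sm Wd is \<phi>)"
  by (simp only: Wd_left_idem[OF assms(1,3)])
 also have "\<dots> = Wd js \<theta> \<otimes>\<^sub>Sm ep (tw \<phi> (wchar is)) \<otimes>\<^sub>Sm Wd is \<phi>"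
  using Wd_closed[OF assms(1)] Wd_closed[OF assms(2)] by (simp add: Sm.m_assoc)
 finally show ?thesis
  using Wd_right_idem[OF assms(2,4) twist_wchar[OF assms(3,1)]] ne Wd_closed[OF assms(1)] by simp
qed

abbreviation Cn where "Cn \<equiv> corner Sm (e_chi S)"

sublocale Cn: k_algebra Cn
 by (rule Sm.corner_algebra(1)[OF e_chi_closed e_chi_idem e_chi_central])

lemma Cn_carrier: "x : carrier Cn \<longleftrightarrow> x : carrier Sm \<and> x \<otimes>\<^sub>Sm e_chi S = x"
 using Sm.corner_algebra(2)[OF e_chi_closed e_chi_idem e_chi_central] by auto

lemma Cn_ops: "mult Cn = mult Sm" "add Cn = add Sm" "zero Cn = zero Sm" "smult Cn = smult Sm" "one Cn = e_chi S"
 by (simp_all add: corner_def)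

lemma Wd_Cn:
 assumes "set is <= rkS" "\<phi> : Irr"
 shows "Wd is \<phi> : carrier Cn"
proof -
 have "Wd is \<phi> \<otimes>\<^sub>Sm e_chi S = Wd is \<phi> \<otimes>\<^sub>Sm (ep \<phi> \<otimes>\<^sub>Sm e_chi S)"
  using Wd_right_idem[OF assms assms(2)] Wd_closed[OF assms(1)] by (simp flip: Sm.m_assoc)
 also have "\<dots> = Wd is \<phi>" using Wd_right_idem[OF assms assms(2)] by (simp add: e_chi_e_phi[OF assms(2)])
 finally show ?thesis using Wd_closed[OF assms(1)] by (simp add: Cn_carrier)
qed

definition path_elt :: "('h => 'k) \<times> (nat \<times> ('h => 'k)) list => ('k, 'p, 'h) smash" where
 "path_elt x = Wd (map fst (snd x)) (fst x)"

lemma path_elt_pth: "path_elt (pth is \<phi>) = Wd is \<phi>"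
 by (simp add: path_elt_def pth_def)

lemma path_elt_Cn: "x : PB ==> path_elt x : carrier Cn"
 using Wd_Cn[OF deg1_rk(2)] by (auto simp: PB_def path_elt_pth)

text \<open>The map from the path algebra that realizes each path as the composable product of its
  arrows; it takes values in the corner cut out by \<open>e_chi S\<close>.\<close>

definition Phi :: "('k, 'h) kQ => ('k, 'p, 'h) smash" where "Phi = Cn.lext path_elt"

lemma Phi_single: "\<phi> : Irr ==> set is <= deg1 ==> Phi (single (pth is \<phi>) c) = c \<odot>\<^sub>Cn Wd is \<phi>"
 unfolding Phi_def using path_elt_Cn[OF pth_PB[of \<phi> "is"]] by (subst Cn.lext_single) (auto simp: path_elt_pth)

lemma Phi_hom: "Phi : alg_hom kQ Cn"
 unfolding Phi_def kQ_eq
proof (rule paths.lext_alg_hom[OF Cn.k_algebra_axioms path_elt_Cn])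
 fix x y assume "x : PB" "y : PB"
 then obtain js \<theta> "is" \<phi> where xy: "x = pth js \<theta>" "set js <= deg1" "\<theta> : Irr"
  "y = pth is \<phi>" "set is <= deg1" "\<phi> : Irr" by (auto simp: PB_def)
 note r = deg1_rk(2)[OF xy(2)] deg1_rk(2)[OF xy(5)]
 show "Cn.lext path_elt (path_mult Q x y) = path_elt x \<otimes>\<^sub>Cn path_elt y"
 proof (cases "tw \<phi> (wchar is) = \<theta>")
  case True
  have "Cn.lext path_elt (path_mult Q x y) = Phi (single (pth (is @ js) \<phi>) 1)"
   using True by (simp add: xy(1,4) path_mult_pth[OF xy(6,5)] Phi_def)
  also have "\<dots> = Wd (is @ js) \<phi>" using xy Wd_Cn[of "is @ js" \<phi>] r by (subst Phi_single) auto
  finally show ?thesis using Wd_append[OF r(2,1) xy(6)] True by (simp add: xy(1,4) path_elt_pth Cn_ops)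
 next
  case False
  then show ?thesis
   using Wd_mult_zero[OF r(2,1) xy(6,3)] by (simp add: xy(1,4) path_mult_pth[OF xy(6,5)] path_elt_pth Cn_ops)
 qed
next
 have v: "Phi (\<Sum>\<phi>\<in>J. path_vertex \<phi>) = (\<Oplus>\<^sub>Cn \<phi>\<in>J. ep \<phi>)" if "J <= Irr" for J
  using finite_subset[OF that finite_Irr] that
 proof (induction J rule: finite_induct)
  case empty
  then show ?case by (simp add: Phi_def)
 next
  case (insert \<phi> J)
  have c: "path_vertex \<phi>' : carrier kQ" if "\<phi>' : insert \<phi> J" for \<phi>' using that insert.prems kQ_closed(2) by auto
  have "Phi (path_vertex \<phi> + (\<Sum>\<phi>\<in>J. path_vertex \<phi>)) = Phi (path_vertex \<phi>) \<oplus>\<^sub>Cn Phi (\<Sum>\<phi>\<in>J. path_vertex \<phi>)"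
   unfolding Phi_def using c by (intro Cn.lext_add[where B = PB] path_elt_Cn keys_sum_subset) (auto simp: kQ_simps)
  moreover have "Phi (path_vertex \<phi>) = ep \<phi>" "ep \<phi>' : carrier Cn" if "\<phi>' : Irr" for \<phi>'
   using Phi_single[of \<phi> "[]" 1] insert.prems Wd_Cn[of "[]" \<phi>] Wd_Cn[of "[]" \<phi>'] that by (simp_all add: pth_Nil)
  ultimately show ?case using insert by (auto simp: Pi_def subset_iff)
 qed
 have "(\<Oplus>\<^sub>Cn \<phi>\<in>Irr. ep \<phi>) = (\<Oplus>\<^sub>Sm \<phi>\<in>Irr. ep \<phi>)"
  using Wd_Cn[of "[]"] by (intro finsum_same_add Sm.k_space_axioms Cn.k_space_axioms) (auto simp: Cn_ops)
 then show "Cn.lext path_elt (\<Sum>\<phi>\<in>Irr. path_vertex \<phi>) = \<one>\<^sub>Cn"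
  using v[OF subset_refl] by (simp add: sum_e_phi Cn_ops Phi_def)
qed

sublocale Phi: k_alg_hom kQ Cn Phi by unfold_locales (rule Phi_hom)

end

section \<open>The algebra and its presentation\<close>

context jennings_setting
begin

lemma keys_kQ: "\<phi> : Irr ==> keys x <= quiver_paths Q \<phi> v ==> x : carrier kQ"
 using quiver_paths_PB[of \<phi> v] by (auto simp: kQ_simps)

text \<open>By \<open>wi_span_char\<close>, \<open>w_k\<close> is a combination of degree-one words
  with character \<open>psi S k\<close>. Such words are paths with the required end points, and
  \<open>Gw_center\<close> makes their group elements agree with \<open>gi S k \<zeta>\<close> up to
  the center.\<close>

lemma expression_exists:
 assumes k: "k : rkS" and \<zeta>: "\<zeta> : Irr"
 shows "\<exists>x. is_expression S Phi k \<zeta> x"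
proof -
 let ?g = "gi S k \<zeta>" and ?P = "quiver_paths Q \<zeta> (tw \<zeta> (psi S k))"
 let ?V = "{u : carU. \<exists>x. keys x <= ?P \<and> Phi x = mon ?g u \<zeta>}"
 let ?X = "wword ` {is. set is <= deg1 \<and> (\<forall>h\<in>carH. wchar is h = psi S k h)}"
 interpret m: k_linear EN.U Sm "\<lambda>u. mon ?g u \<zeta>" by (rule mon_linear)
 have "EN.U.subsp ?V"
  unfolding EN.U.subsp_def
 proof (intro conjI ballI allI)
  have "Phi 0 = mon ?g \<zero>\<^sub>EN.U \<zeta>" using Phi.f_zero by (simp add: kQ_simps Cn_ops)
  then show "\<zero>\<^sub>EN.U : ?V" by (auto intro!: exI[of _ 0])
  fix u assume u: "u : ?V"
  then obtain x where x: "keys x <= ?P" "Phi x = mon ?g u \<zeta>" and uU: "u : carU" by auto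
  note xc = keys_kQ[OF \<zeta> x(1)]
  show "c \<odot>\<^sub>EN.U u : ?V" for c
   using Phi.f_sm[OF xc, of c] x uU keys_scale_subset[OF x(1), of c]
   by (auto simp: kQ_simps Cn_ops m.f_sm intro!: exI[of _ "scale c x"])
  fix v assume v: "v : ?V"
  then obtain y where y: "keys y <= ?P" "Phi y = mon ?g v \<zeta>" and vU: "v : carU" by auto
  show "u \<oplus>\<^sub>EN.U v : ?V"
   using Phi.f_add[OF xc keys_kQ[OF \<zeta> y(1)]] x y uU vU keys_add_subset[OF x(1) y(1)]
   by (auto simp: kQ_simps Cn_ops m.f_add intro!: exI[of _ "x + y"])
 qed auto
 moreover have "?X <= ?V"
 proof
  fix u assume "u : ?X"
  then obtain "is" where u: "u = wword is" and "is": "set is <= deg1"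
   and ch: "\<And>h. h : carH ==> wchar is h = psi S k h" by auto
  note r = deg1_rk(2)[OF "is"]
  have k1: "set [k] <= rkS" using k by simp
  have "ivH (Gw is \<zeta>) \<otimes>\<^sub>gH Gw [k] \<zeta> : cenH"
   using ch by (intro Gw_center[OF r k1 \<zeta>]) simp
  then obtain s where s: "mon ?g (wword is) \<zeta> = s \<odot>\<^sub>Sm Wd is \<zeta>"
   using mon_word[OF r \<zeta> gi_closed[OF k \<zeta>]] unfolding Gw_single[OF k \<zeta>] by auto
  have "pth is \<zeta> : ?P" using "is" \<zeta> twist_cong[of "wchar is" "psi S k" \<zeta>] ch by (auto simp: quiver_paths_iff)
  then have A: "keys (single (pth is \<zeta>) s) <= ?P" by auto
  have B: "Phi (single (pth is \<zeta>) s) = mon ?g u \<zeta>"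
   unfolding Phi_single[OF \<zeta> "is"] u s by (simp add: Cn_ops)
  show "u : ?V" using A B wword_closed[OF r] u by blast
 qed
 ultimately have "wi k : ?V" using wi_span_char[OF k] EN.U.spn_least by blast
 then show ?thesis by (auto simp: is_expression_def w_elt_mon)
qed

lemma Phi_vertex: "\<phi> : Irr ==> Phi (path_vertex \<phi>) = ep \<phi>"
 using Phi_single[of \<phi> "[]" 1] Wd_Cn[of "[]" \<phi>] by (simp add: pth_Nil)

lemma w_elt_Cn:
 assumes i: "i : rkS" and \<phi>: "\<phi> : Irr"
 shows "we i \<phi> : carrier Cn" "Wd [i] \<phi> = we i \<phi>"
proof -
 show "Wd [i] \<phi> = we i \<phi>"
  using mon_left_idem[OF eigen_wi[OF i] HZchar_psi[OF i] gi_closed[OF i \<phi>] \<phi>] by (simp add: w_elt_mon)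
 then show "we i \<phi> : carrier Cn" using Wd_Cn[of "[i]" \<phi>] i \<phi> by simp
qed

lemma Phi_arrow: "\<phi> : Irr ==> i : deg1 ==> Phi (path_arrow Q (i, \<phi>)) = we i \<phi>"
 using Phi_single[of \<phi> "[i]" 1] w_elt_Cn[OF deg1_rk(1)[of i], of \<phi>]
 by (simp add: pth_single del: composable.simps)

text \<open>The image of \<open>Phi\<close> contains all generators by
  \<open>expression_exists\<close>. Conversely, a subalgebra with these generators contains all
  composable products, hence the image.\<close>

lemma
 shows alg_A_carrier: "carrier (alg_A S) = Phi ` carrier kQ" and alg_A_algebra: "k_algebra (alg_A S)"
proof -
 let ?G = "ep ` Irr \<union> {we i \<phi> | i \<phi>. i : rkS \<and> \<phi> : Irr}"
 have G: "?G <= Phi ` carrier kQ"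
 proof -
  have "ep \<phi> : Phi ` carrier kQ" if "\<phi> : Irr" for \<phi>
   using Phi_vertex[OF that] kQ_closed(2)[OF that] by (metis imageI)
  moreover have "we i \<phi> : Phi ` carrier kQ" if i: "i : rkS" "\<phi> : Irr" for i \<phi>
  proof -
   obtain x where "is_expression S Phi i \<phi> x" using expression_exists[OF i] by auto
   then show ?thesis using keys_kQ[OF i(2)] unfolding is_expression_def by (metis imageI)
  qed
  ultimately show ?thesis by auto
 qed
 have least: "Phi ` carrier kQ <= B"
  if B: "subring B Cn" "\<And>c b. b : B ==> c \<odot>\<^sub>Cn b : B" "?G <= B" for B
 proof -
  have W: "Wd is \<phi> : B" if "set is <= rkS" "\<phi> : Irr" for "is" \<phi>
   using that
  proof (induction "is" arbitrary: \<phi>)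
   case Nil
   then show ?case using B(3) by auto
  next
   case (Cons i "is")
   have i: "i : rkS" "set is <= rkS" using Cons.prems(1) by auto
   have "we i \<phi> : B" using B(3) i(1) Cons.prems(2) by blast
   then have "Wd is (tw \<phi> (psi S i)) \<otimes>\<^sub>Cn we i \<phi> : B"
    using i Cons.prems(2) by (intro subringE(6)[OF B(1)] Cons.IH twist_psi)
   then show ?case by (simp add: Cn_ops)
  qed
  have "Phi x : B" if "keys x <= PB" for x
   using that
  proof (induction x rule: poly_mapping_induct_on)
   case zero
   then show ?case using Phi.f_zero subringE(2)[OF B(1)] by (simp add: kQ_simps)
  next
   case (single y c)
   then obtain "is" \<phi> where "y = pth is \<phi>" "set is <= deg1" "\<phi> : Irr" by (auto simp: PB_def)
   then show ?case using W deg1_rk(2) B(2) by (simp add: Phi_single)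
  next
   case (add x y)
   then show ?case using Phi.f_add[of x y] subringE(7)[OF B(1)] by (simp add: kQ_simps)
  qed
  then show ?thesis by (auto simp: kQ_simps)
 qed
 have "\<one>\<^sub>Cn : Phi ` carrier kQ" using Phi.f_one kQ.one_closed by (metis imageI)
 moreover have "x \<oplus>\<^sub>Cn y : Phi ` carrier kQ" "x \<otimes>\<^sub>Cn y : Phi ` carrier kQ" "c \<odot>\<^sub>Cn x : Phi ` carrier kQ"
  if xy: "x : Phi ` carrier kQ" "y : Phi ` carrier kQ" for x y c
 proof -
  obtain a b where ab: "x = Phi a" "y = Phi b" "a : carrier kQ" "b : carrier kQ" using xy by auto
  have "Phi (a \<oplus>\<^sub>kQ b) = x \<oplus>\<^sub>Cn y" "Phi (a \<otimes>\<^sub>kQ b) = x \<otimes>\<^sub>Cn y" "Phi (c \<odot>\<^sub>kQ a) = c \<odot>\<^sub>Cn x"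
   using ab by (simp_all add: Phi.f_add Phi.f_mult Phi.f_sm)
  then show "x \<oplus>\<^sub>Cn y : Phi ` carrier kQ" "x \<otimes>\<^sub>Cn y : Phi ` carrier kQ" "c \<odot>\<^sub>Cn x : Phi ` carrier kQ"
   using ab kQ.add.m_closed kQ.m_closed kQ.sm_closed by (metis imageI)+
 qed
 moreover have "Phi ` carrier kQ <= carrier Cn" by auto
 ultimately show "carrier (alg_A S) = Phi ` carrier kQ" "k_algebra (alg_A S)"
  unfolding alg_A_def using Cn.subalgebra_generated_eq[of "Phi ` carrier kQ" ?G] G least by simp_all
qed

sublocale AA: k_algebra "alg_A S" by (rule alg_A_algebra)

lemma AA_ops: "mult (alg_A S) = mult Sm" "add (alg_A S) = add Sm" "zero (alg_A S) = zero Sm"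
 "smult (alg_A S) = smult Sm" "one (alg_A S) = e_chi S"
 by (simp_all add: alg_A_def subalgebra_generated_def corner_def)

lemma AA_Sm: "x : carrier (alg_A S) ==> x : carrier Sm"
 unfolding alg_A_carrier using Cn_carrier Phi.f_closed by blast

lemma Phi_AA: "Phi : alg_hom kQ (alg_A S)"
proof (rule alg_homI)
 show "Phi x : carrier (alg_A S)" if "x : carrier kQ" for x using that by (simp add: alg_A_carrier)
 show "Phi \<one>\<^sub>kQ = \<one>\<^sub>(alg_A S)" using Phi.f_one by (simp add: AA_ops Cn_ops)
 show "Phi (x \<otimes>\<^sub>kQ y) = Phi x \<otimes>\<^sub>(alg_A S) Phi y" if "x : carrier kQ" "y : carrier kQ" for x y
  using Phi.f_mult[OF that] by (simp add: AA_ops Cn_ops)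
 show "Phi (x \<oplus>\<^sub>kQ y) = Phi x \<oplus>\<^sub>(alg_A S) Phi y" if "x : carrier kQ" "y : carrier kQ" for x y
  using Phi.f_add[OF that] by (simp add: AA_ops Cn_ops)
 show "Phi (c \<odot>\<^sub>kQ x) = c \<odot>\<^sub>(alg_A S) Phi x" if "x : carrier kQ" for c x
  using Phi.f_sm[OF that] by (simp add: AA_ops Cn_ops)
qed

sublocale PhiA: k_alg_hom kQ "alg_A S" Phi by unfold_locales (rule Phi_AA)

lemma PBW_monomial_Wd: "PBW_monomial S (is, \<phi>) = Wd is \<phi>"
proof -
 have "composable S (alg_A S) (ep) (we) is \<phi> = Wd is \<phi>"
  by (induction "is" arbitrary: \<phi>) (simp_all add: AA_ops)
 then show ?thesis by (simp add: PBW_monomial_def)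
qed

lemma PBW_index_eq: "PBWi = PBW \<times> Irr"
 by (auto simp: PBW_index_def PBW_def ordered_words_def)

lemma finite_PBW_index: "finite (PBWi)"
 by (simp add: PBW_index_eq finite_PBW finite_Irr)

lemma card_PBW_index: "card (PBWi) = Coset.order (ZH Mod subZ S) * Coset.order (grpP S)"
 by (simp add: PBW_index_eq card_cartesian_product card_PBW card_Irr ac_simps)

text \<open>Multiplication on the right by the idempotent of \<open>\<phi>\<close> keeps only the
  monomials starting at \<open>\<phi>\<close>. For these, \<open>mon_independent\<close> applies
  after rescaling by the nonzero scalars of \<open>Wd_mon\<close>.\<close>

lemma Wd_independent:
 assumes eq: "(\<Oplus>\<^sub>Sm p\<in>PBWi. a p \<odot>\<^sub>Sm PBW_monomial S p) = \<zero>\<^sub>Sm" and p: "p : PBWi"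
 shows "a p = 0"
proof -
 obtain v \<phi> where p': "p = (v, \<phi>)" "v : PBW" "\<phi> : Irr" using p by (auto simp: PBW_index_eq)
 have mc: "PBW_monomial S q : carrier Sm" if "q : PBWi" for q
  using that Wd_closed[OF PBW_subset] by (auto simp: PBW_index_eq PBW_monomial_Wd)
 have J: "PBWi = (\<lambda>w. (w, \<phi>)) ` PBW \<union> {q : PBWi. snd q ~= \<phi>}"
  using p'(3) by (auto simp: PBW_index_eq)
 let ?f = "\<lambda>q. a q \<odot>\<^sub>Sm (PBW_monomial S q \<otimes>\<^sub>Sm ep \<phi>)"
 have "\<zero>\<^sub>Sm = (\<Oplus>\<^sub>Sm p\<in>PBWi. a p \<odot>\<^sub>Sm PBW_monomial S p) \<otimes>\<^sub>Sm ep \<phi>"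
  by (simp add: eq)
 also have "\<dots> = (\<Oplus>\<^sub>Sm q\<in>PBWi. (a q \<odot>\<^sub>Sm PBW_monomial S q) \<otimes>\<^sub>Sm ep \<phi>)"
  using mc by (intro Sm.finsum_ldistr finite_PBW_index) auto
 also have "\<dots> = (\<Oplus>\<^sub>Sm q\<in>PBWi. ?f q)"
  using mc by (intro Sm.finsum_cong') (auto simp: Sm.sm_mult_l)
 also have "\<dots> = (\<Oplus>\<^sub>Sm q\<in>(\<lambda>w. (w, \<phi>)) ` PBW \<union> {q : PBWi. snd q ~= \<phi>}. ?f q)"
  using J by (rule arg_cong)
 also have "\<dots> = (\<Oplus>\<^sub>Sm q\<in>(\<lambda>w. (w, \<phi>)) ` PBW. ?f q) \<oplus>\<^sub>Sm (\<Oplus>\<^sub>Sm q\<in>{q\<in>PBWi. snd q ~= \<phi>}. ?f q)"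
  using mc p'(3) by (intro Sm.finsum_Un_disjoint finite_imageI finite_PBW) (auto simp: PBW_index_eq finite_PBW finite_Irr)
 also have "(\<Oplus>\<^sub>Sm q\<in>{q\<in>PBWi. snd q ~= \<phi>}. ?f q) = (\<Oplus>\<^sub>Sm q\<in>{q\<in>PBWi. snd q ~= \<phi>}. \<zero>\<^sub>Sm)"
  using p'(3) by (intro Sm.finsum_cong') (auto simp: PBW_index_eq PBW_monomial_Wd Wd_right_idem[OF PBW_subset])
 also have "(\<Oplus>\<^sub>Sm q\<in>(\<lambda>w. (w, \<phi>)) ` PBW. ?f q) = (\<Oplus>\<^sub>Sm w\<in>PBW. ?f (w, \<phi>))"
  using mc p'(3) by (intro Sm.finsum_reindex) (auto simp: PBW_index_eq inj_on_def)
 finally have z: "(\<Oplus>\<^sub>Sm w\<in>PBW. ?f (w, \<phi>)) = \<zero>\<^sub>Sm"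
  using mc p'(3) by (subst (asm) Sm.finsum_zero) (auto simp: PBW_index_eq Pi_def Sm.finsum_closed)
 have "\<forall>w\<in>PBW. \<exists>s. s ~= 0 \<and> Wd w \<phi> = s \<odot>\<^sub>Sm mon (Gw w \<phi>) (wword w) \<phi>"
  using Wd_mon[OF PBW_subset _] p'(3) by blast
 then obtain s where s: "\<And>w. w : PBW ==> s w ~= 0 \<and> Wd w \<phi> = s w \<odot>\<^sub>Sm mon (Gw w \<phi>) (wword w) \<phi>"
  by metis
 have "(\<Oplus>\<^sub>Sm w\<in>PBW. ?f (w, \<phi>)) = (\<Oplus>\<^sub>Sm w\<in>PBW. (a (w, \<phi>) * s w) \<odot>\<^sub>Sm mon (Gw w \<phi>) (wword w) \<phi>)"
 proof (intro Sm.finsum_cong' Pi_I)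
  fix w assume w: "w : PBW"
  have m: "mon (Gw w \<phi>) (wword w) \<phi> : carrier Sm" using wword_closed[OF PBW_subset[OF w]] by simp
  then show "(a (w, \<phi>) * s w) \<odot>\<^sub>Sm mon (Gw w \<phi>) (wword w) \<phi> : carrier Sm" by simp
  have "?f (w, \<phi>) = a (w, \<phi>) \<odot>\<^sub>Sm Wd w \<phi>"
   using p'(3) w by (simp add: PBW_monomial_Wd Wd_right_idem[OF PBW_subset])
  then show "?f (w, \<phi>) = (a (w, \<phi>) * s w) \<odot>\<^sub>Sm mon (Gw w \<phi>) (wword w) \<phi>"
   using s[OF w] Sm.sm_sm[OF m] by simp
 qed simp
 then have "a (v, \<phi>) * s v = 0" using z by (intro mon_independent[OF p'(3) _ p'(2)]) simp
 then show ?thesis using s[OF p'(2)] p'(1) by simp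
qed

subsection \<open>The relations\<close>

lemma kQ_finsum: "(\<And>i. i : K ==> f i : carrier kQ) ==> finsum kQ f K = sum f K"
 by (induction K rule: infinite_finite_induct) (simp_all add: kQ_simps Pi_def)

text \<open>Solves a relation for its leading term: if everything else in it lies in the subspace,
  so does \<open>a\<close>.\<close>

lemma subsp_kQ_relation:
 assumes V: "kQ.subsp V" and r: "a - scale q b - (\<Sum>k\<in>K. scale (c k) (z k)) : V" and b: "b : V"
  and z: "\<And>k. k : K ==> z k : V"
 shows "a : V"
proof -
 have "(\<Sum>k\<in>K. scale (c k) (z k)) : V"
 proof -
  have "c k \<odot>\<^sub>kQ z k : V" if "k : K" for k using kQ.subspD(4)[OF V z[OF that]] .
  then have "(\<Oplus>\<^sub>kQ k\<in>K. c k \<odot>\<^sub>kQ z k) : V" by (rule kQ.subsp_finsum[OF V])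
  moreover have "c k \<odot>\<^sub>kQ z k : carrier kQ" if "k : K" for k using kQ.subspD(1)[OF V] z[OF that] by auto
  ultimately show ?thesis using kQ_finsum[of K "\<lambda>k. c k \<odot>\<^sub>kQ z k"] by (simp add: kQ_simps)
 qed
 moreover have "scale q b : V" using kQ.subspD(4)[OF V b, of q] by (simp add: kQ_simps)
 ultimately have "scale q b + (\<Sum>k\<in>K. scale (c k) (z k)) : V"
  using kQ.subspD(3)[OF V] by (simp add: kQ_simps)
 from kQ.subspD(3)[OF V r this]
 have "a - scale q b - (\<Sum>k\<in>K. scale (c k) (z k)) + (scale q b + (\<Sum>k\<in>K. scale (c k) (z k))) : V"
  by (simp only: kQ_simps(3))
 also have "a - scale q b - (\<Sum>k\<in>K. scale (c k) (z k)) + (scale q b + (\<Sum>k\<in>K. scale (c k) (z k))) = a"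
  by simp
 finally show ?thesis .
qed

context
 fixes X :: "nat => ('h => 'k) => ('k, 'h) kQ"
 assumes X: "\<And>k \<zeta>. k : rkS ==> \<zeta> : Irr ==> 2 \<le> degw S k ==> is_expression S Phi k \<zeta> (X k \<zeta>)"
begin

abbreviation W :: "nat => ('h => 'k) => ('k, 'h) kQ" where "W \<equiv> w_sub S X"

lemma W_expression:
 assumes i: "i : rkS" and \<phi>: "\<phi> : Irr"
 shows "is_expression S Phi i \<phi> (W i \<phi>)"
proof (cases "degw S i = 1")
 case True
 then have d: "i : deg1" using i by (simp add: deg1_def)
 have "pth [i] \<phi> : quiver_paths Q \<phi> (tw \<phi> (psi S i))"
  using d \<phi> by (auto simp: quiver_paths_iff intro!: exI[of _ "[i]"])
 then show ?thesis
  using True Phi_arrow[OF \<phi> d] by (simp add: is_expression_def w_sub_def pth_single)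
next
 case False
 then show ?thesis using X[OF i \<phi>] wb_homogeneous[OF i] by (simp add: w_sub_def)
qed

lemma W_facts:
 assumes "i : rkS" "\<phi> : Irr"
 shows "W i \<phi> : carrier kQ" "Phi (W i \<phi>) = we i \<phi>"
  "W i \<phi> \<otimes>\<^sub>kQ path_vertex \<phi> = W i \<phi>" "path_vertex (tw \<phi> (psi S i)) \<otimes>\<^sub>kQ W i \<phi> = W i \<phi>"
 using W_expression[OF assms] keys_kQ[OF assms(2)] vertex_mult[OF assms(2)] by (auto simp: is_expression_def)

abbreviation cw :: "nat list => ('h => 'k) => ('k, 'h) kQ" where "cw \<equiv> composable S kQ path_vertex W"

lemma cw_facts:
 assumes "set is <= rkS" "\<phi> : Irr"
 shows "cw is \<phi> : carrier kQ \<and> Phi (cw is \<phi>) = Wd is \<phi> \<and> cw is \<phi> \<otimes>\<^sub>kQ path_vertex \<phi> = cw is \<phi>"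
 using assms
proof (induction "is" arbitrary: \<phi>)
 case Nil
 have "keys (path_vertex \<phi> :: ('k, 'h) kQ) <= quiver_paths Q \<phi> \<phi>"
  using Nil twist_one[of \<phi>] by (auto simp: pth_Nil quiver_paths_iff intro!: exI[of _ "[]"])
 then show ?case using Nil kQ_closed(2)[of \<phi>] Phi_vertex[of \<phi>] vertex_mult(1)[of \<phi> "path_vertex \<phi>" \<phi>] by simp
next
 case (Cons i "is")
 have i: "i : rkS" "set is <= rkS" using Cons.prems(1) by auto
 note IH = Cons.IH[OF i(2) twist_psi[OF Cons.prems(2) i(1)]] and f = W_facts[OF i(1) Cons.prems(2)]
 show ?case using IH f kQ_closed(2)[OF Cons.prems(2)] by (simp add: kQ.m_assoc Phi.f_mult Cn_ops)
qed

lemma cw_append: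
 assumes "set is <= rkS" "set js <= rkS" "\<phi> : Irr"
 shows "cw (is @ js) \<phi> = cw js (tw \<phi> (wchar is)) \<otimes>\<^sub>kQ cw is \<phi>"
 using assms
proof (induction "is" arbitrary: \<phi>)
 case Nil
 then show ?case using cw_facts[of js \<phi>] by (simp add: twist_one)
next
 case (Cons i "is")
 have i: "i : rkS" "set is <= rkS" using Cons.prems(1) by auto
 note t = twist_psi[OF Cons.prems(3) i(1)]
 have "cw ((i # is) @ js) \<phi> = cw js (tw \<phi> (wchar (i # is))) \<otimes>\<^sub>kQ cw is (tw \<phi> (psi S i)) \<otimes>\<^sub>kQ W i \<phi>"
  using Cons.IH[OF i(2) Cons.prems(2) t] twist_Cons by simp
 then show ?case
  using cw_facts[OF Cons.prems(2) twist_wchar[OF Cons.prems(3,1)]] cw_facts[OF i(2) t] W_facts[OF i(1) Cons.prems(3)]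
  by (simp add: kQ.m_assoc)
qed

lemma cw_single: "i : rkS ==> \<phi> : Irr ==> cw [i] \<phi> = W i \<phi>"
 using W_facts[of i \<phi>] by simp

lemma cw_pair: "i : rkS ==> j : rkS ==> \<phi> : Irr ==>
  cw [i, j] \<phi> = W j (tw \<phi> (psi S i)) \<otimes>\<^sub>kQ W i \<phi>"
 using W_facts[of j "tw \<phi> (psi S i)"] twist_psi[of \<phi> i] by simp

lemma cw_deg1:
 assumes "set is <= deg1" "\<phi> : Irr"
 shows "cw is \<phi> = single (pth is \<phi>) 1"
 using assms
proof (induction "is" arbitrary: \<phi>)
 case Nil
 then show ?case by (simp add: pth_Nil)
next
 case (Cons i "is")
 have i: "i : deg1" "set is <= deg1" using Cons.prems(1) by auto
 have "W i \<phi> = single (pth [i] \<phi>) 1" using i by (simp add: w_sub_def deg1_def pth_single)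
 moreover have "path_mult Q (pth is (tw \<phi> (psi S i))) (pth [i] \<phi>) = (single (pth (i # is) \<phi>) 1 :: ('k, 'h) kQ)"
  using path_mult_pth[of \<phi> "[i]" "is" "tw \<phi> (psi S i)"] Cons.prems(2) i(1) by simp
 ultimately show ?case
  using Cons.IH[OF i(2) twist_psi[OF Cons.prems(2) deg1_rk(1)[OF i(1)]]] by (simp add: kQ_simps bmul_single)
qed

abbreviation I where "I \<equiv> relation_ideal S X"

lemma relation1_eq:
 assumes "i : rkS" "j : rkS" "\<phi> : Irr"
 shows "relation1 S X i j \<phi> = cw [i, j] \<phi> - scale (q1 S i j \<phi>) (cw [j, i] \<phi>)
  - (\<Sum>k\<in>{k\<in>rkS. cc S i j k ~= 0}. scale (- cc S i j k * q2 S i j k \<phi>) (W k \<phi>))"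
 unfolding cw_pair[OF assms] cw_pair[OF assms(2,1,3)] by (simp add: relation1_def Let_def)

text \<open>The vacuous \<open>scale 0 0\<close> gives the second relation the shape of the first,
  so that \<open>relation_kernel\<close> and \<open>subsp_kQ_relation\<close> serve both.\<close>

lemma relation2_eq:
 "relation2 S X i \<phi> = cw (replicate (chr S) i) \<phi> - scale 0 0
  - (\<Sum>k\<in>{k\<in>rkS. dd S i k ~= 0}. scale (dd S i k * q3 S i k \<phi>) (W k \<phi>))"
 by (simp add: relation2_def Let_def)

text \<open>Converts an identity in the smash product into membership of the corresponding path
  combination in the kernel of \<open>Phi\<close>.\<close>

lemma relation_kernel:
 assumes a: "a : carrier kQ" and b: "b : carrier kQ" and K: "K <= rkS" and \<phi>: "\<phi> : Irr"
  and eq: "Phi a = q \<odot>\<^sub>Sm Phi b \<oplus>\<^sub>Sm (\<Oplus>\<^sub>Sm k\<in>K. c k \<odot>\<^sub>Sm we k \<phi>)"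
 shows "a - scale q b - (\<Sum>k\<in>K. scale (c k) (W k \<phi>)) : {x : carrier kQ. Phi x = \<zero>\<^sub>Cn}"
proof -
 have Wk: "W k \<phi> : carrier kQ" "Phi (W k \<phi>) = we k \<phi>" "we k \<phi> : carrier Cn" if "k : K" for k
  using W_facts[of k \<phi>] w_elt_Cn(1)[of k \<phi>] K \<phi> that by blast+
 let ?s = "\<Oplus>\<^sub>kQ k\<in>K. c k \<odot>\<^sub>kQ W k \<phi>"
 have s: "?s : carrier kQ" using Wk by (intro kQ.finsum_closed) auto
 have sb: "q \<odot>\<^sub>kQ b : carrier kQ" using b by simp
 have seq: "?s = (\<Sum>k\<in>K. c k \<odot>\<^sub>kQ W k \<phi>)" using Wk by (intro kQ_finsum) auto
 have ab: "a \<ominus>\<^sub>kQ q \<odot>\<^sub>kQ b = a - scale q b" using kQ_minus[OF a sb] by (simp only: kQ_simps(5))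
 have abc: "a \<ominus>\<^sub>kQ q \<odot>\<^sub>kQ b : carrier kQ" using a sb by (rule kQ.minus_closed)
 have "a \<ominus>\<^sub>kQ q \<odot>\<^sub>kQ b \<ominus>\<^sub>kQ ?s = a - scale q b - (\<Sum>k\<in>K. c k \<odot>\<^sub>kQ W k \<phi>)"
  using kQ_minus[OF abc s] unfolding ab seq .
 then have e: "a - scale q b - (\<Sum>k\<in>K. scale (c k) (W k \<phi>)) = a \<ominus>\<^sub>kQ q \<odot>\<^sub>kQ b \<ominus>\<^sub>kQ ?s"
  by (simp only: kQ_simps(5))
 have "Phi ?s = (\<Oplus>\<^sub>Cn k\<in>K. c k \<odot>\<^sub>Cn Phi (W k \<phi>))" using Wk by (intro Phi.f_lincomb)
 also have "\<dots> = (\<Oplus>\<^sub>Cn k\<in>K. c k \<odot>\<^sub>Cn we k \<phi>)"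
  using Wk by (intro Cn.finsum_cong') auto
 also have "\<dots> = (\<Oplus>\<^sub>Sm k\<in>K. c k \<odot>\<^sub>Cn we k \<phi>)"
 proof (rule finsum_same_add[OF Sm.k_space_axioms Cn.k_space_axioms Cn_ops(2,3)])
  show "c k \<odot>\<^sub>Cn we k \<phi> : carrier Cn" if "k : K" for k using Wk(3)[OF that] by (rule Cn.sm_closed)
  then show "c k \<odot>\<^sub>Cn we k \<phi> : carrier Sm" if "k : K" for k using that Cn_carrier by blast
 qed
 finally have Ps: "Phi ?s = (\<Oplus>\<^sub>Sm k\<in>K. c k \<odot>\<^sub>Sm we k \<phi>)" by (simp add: Cn_ops)
 have "Phi a = q \<odot>\<^sub>Cn Phi b \<oplus>\<^sub>Cn Phi ?s" using eq Ps by (simp add: Cn_ops)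
 also have "\<dots> = Phi (q \<odot>\<^sub>kQ b) \<oplus>\<^sub>Cn Phi ?s" using b by (simp add: Phi.f_sm)
 finally have "Phi a \<ominus>\<^sub>Cn Phi (q \<odot>\<^sub>kQ b) = Phi ?s"
  using Phi.f_closed[OF s] Phi.f_closed[OF sb] Cn.a_comm[of "Phi (q \<odot>\<^sub>kQ b)" "Phi ?s"]
  by (simp add: a_minus_def Cn.a_assoc Cn.r_neg)
 then have "Phi (a \<ominus>\<^sub>kQ q \<odot>\<^sub>kQ b \<ominus>\<^sub>kQ ?s) = \<zero>\<^sub>Cn"
  using a sb s by (simp add: Phi.f_minus Cn.minus_eq_zero_iff)
 then show ?thesis unfolding e using a sb s by simp
qed

lemma
 shows ideal_I: "ideal I kQ" and I_kernel: "x : I ==> Phi x = \<zero>\<^sub>Cn"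
  and relation1_I: "i : rkS ==> j : rkS ==> \<phi> : Irr ==> relation1 S X i j \<phi> : I"
  and relation2_I: "i : rkS ==> \<phi> : Irr ==> relation2 S X i \<phi> : I"
proof -
 let ?G = "{relation1 S X i j \<phi> | i j \<phi>. i : rkS \<and> j : rkS \<and> \<phi> : Irr}
  \<union> {relation2 S X i \<phi> | i \<phi>. i : rkS \<and> \<phi> : Irr}"
 let ?K = "{x : carrier kQ. Phi x = \<zero>\<^sub>Cn}"
 have 1: "relation1 S X i j \<phi> : ?K" if i: "i : rkS" and j: "j : rkS" and \<phi>: "\<phi> : Irr" for i j \<phi>
  unfolding relation1_eq[OF i j \<phi>]
 proof (rule relation_kernel)
  have w: "set [i, j] <= rkS" "set [j, i] <= rkS" using i j by auto
  show "cw [i, j] \<phi> : carrier kQ" "cw [j, i] \<phi> : carrier kQ" using cw_facts[OF w(1) \<phi>] cw_facts[OF w(2) \<phi>] by auto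
  have wp: "Wd [i, j] \<phi> = we j (tw \<phi> (psi S i)) \<otimes>\<^sub>Sm we i \<phi>"
   if "i : rkS" "j : rkS" for i j
   using w_elt_Cn(2)[OF that(2) twist_psi[OF \<phi> that(1)]] by simp
  show "Phi (cw [i, j] \<phi>) = q1 S i j \<phi> \<odot>\<^sub>Sm Phi (cw [j, i] \<phi>)
    \<oplus>\<^sub>Sm (\<Oplus>\<^sub>Sm k\<in>{k\<in>rkS. cc S i j k ~= 0}. (- cc S i j k * q2 S i j k \<phi>) \<odot>\<^sub>Sm we k \<phi>)"
   using cw_facts[OF w(1) \<phi>] cw_facts[OF w(2) \<phi>] smash_relation1[OF i j \<phi>] unfolding wp[OF i j] wp[OF j i] by simp
 qed (use \<phi> in auto)
 have 2: "relation2 S X i \<phi> : ?K" if i: "i : rkS" and \<phi>: "\<phi> : Irr" for i \<phi>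
  unfolding relation2_eq
 proof (rule relation_kernel)
  have w: "set (replicate (chr S) i) <= rkS" using i by (auto simp: set_replicate_conv_if)
  show "cw (replicate (chr S) i) \<phi> : carrier kQ" using cw_facts[OF w \<phi>] by auto
  show "0 : carrier kQ" by (simp add: kQ_simps)
  have "(\<Oplus>\<^sub>Sm k\<in>{k\<in>rkS. dd S i k ~= 0}. (dd S i k * q3 S i k \<phi>) \<odot>\<^sub>Sm we k \<phi>) : carrier Sm"
   using w_elt_closed by (intro Sm.finsum_closed) blast
  moreover have "Phi 0 = \<zero>\<^sub>Sm" using Phi.f_zero by (simp add: kQ_simps Cn_ops)
  ultimately show "Phi (cw (replicate (chr S) i) \<phi>) = 0 \<odot>\<^sub>Sm Phi 0
    \<oplus>\<^sub>Sm (\<Oplus>\<^sub>Sm k\<in>{k\<in>rkS. dd S i k ~= 0}. (dd S i k * q3 S i k \<phi>) \<odot>\<^sub>Sm we k \<phi>)"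
   using cw_facts[OF w \<phi>] smash_relation2[OF i \<phi>] by simp
 qed (use \<phi> in auto)
 have G: "?G <= ?K" using 1 2 by blast
 then have Gc: "?G <= carrier kQ" by blast
 have I: "I = Idl\<^bsub>kQ\<^esub> ?G" by (simp add: relation_ideal_def)
 show "ideal I kQ" unfolding I by (rule kQ.genideal_ideal[OF Gc])
 have "I <= ?K" unfolding I by (rule kQ.genideal_minimal[OF Phi.ideal_kernel G])
 then show "x : I ==> Phi x = \<zero>\<^sub>Cn" by blast
 have "?G <= I" unfolding I by (rule kQ.genideal_self[OF Gc])
 then show "i : rkS ==> j : rkS ==> \<phi> : Irr ==> relation1 S X i j \<phi> : I"
  "i : rkS ==> \<phi> : Irr ==> relation2 S X i \<phi> : I" by blast+
qed

text \<open>The straightening process repeated in the path algebra modulo the relations. The new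
  condition is that middle factors must be parallel, that is, must share both end points.\<close>

lemma cw_span:
 assumes V: "kQ.subsp V" "I <= V" and PBW: "\<And>w \<phi>. w : PBW ==> \<phi> : Irr ==> cw w \<phi> : V"
 shows "carrier kQ <= V"
proof -
 interpret I: ideal I kQ by (rule ideal_I)
 have cwc: "cw is \<phi> : carrier kQ" if "set is <= rkS" "\<phi> : Irr" for "is" \<phi>
  using cw_facts[OF that] by simp
 \<comment> \<open>The middle factors that may stand between fixed outer words without leaving
   \<open>V\<close>; this is a subspace containing the ideal, so relations can be used inside a
   path.\<close>
 define V2 where "V2 u v \<phi> \<theta> = {x : carrier kQ. cw v \<theta> \<otimes>\<^sub>kQ x : {y : carrier kQ. y \<otimes>\<^sub>kQ cw u \<phi> : V}}" for u v \<phi> \<theta>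
 have V2: "kQ.subsp (V2 u v \<phi> \<theta>)" "I <= V2 u v \<phi> \<theta>"
  if "set u <= rkS" "set v <= rkS" "\<phi> : Irr" "\<theta> : Irr" for u v \<phi> \<theta>
 proof -
  show "kQ.subsp (V2 u v \<phi> \<theta>)"
   unfolding V2_def by (intro kQ.subsp_mult_left kQ.subsp_mult_right V(1) cwc that)
  show "I <= V2 u v \<phi> \<theta>"
   unfolding V2_def using V(2) I.I_l_closed I.I_r_closed I.Icarr cwc[OF that(1,3)] cwc[OF that(2,4)] by (auto simp: subset_iff)
 qed
 have V2_iff: "cw ws (tw \<phi> (wchar u)) : V2 u v \<phi> \<theta> \<longleftrightarrow> cw (u @ ws @ v) \<phi> : V"
  if w: "set u <= rkS" "set ws <= rkS" "set v <= rkS" and \<phi>: "\<phi> : Irr"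
   and \<theta>: "\<theta> = tw (tw \<phi> (wchar u)) (wchar ws)" for u ws v \<phi> \<theta>
 proof -
  note t = twist_wchar[OF \<phi> w(1)]
  note t' = twist_wchar[OF t w(2)]
  have wv: "set (ws @ v) <= rkS" using w by simp
  have "cw (u @ ws @ v) \<phi> = cw v \<theta> \<otimes>\<^sub>kQ cw ws (tw \<phi> (wchar u)) \<otimes>\<^sub>kQ cw u \<phi>"
   unfolding cw_append[OF w(1) wv \<phi>] cw_append[OF w(2,3) t] \<theta> ..
  then show ?thesis using cwc[OF w(2) t] cwc[OF w(3) t'] \<theta> by (simp add: V2_def)
 qed
 have all: "\<forall>\<phi>\<in>Irr. cw is \<phi> : V" if "set is <= rkS" for "is"
  using that chr_pos(3)
 proof (rule ordered_word_induct[where P = "\<lambda>is. \<forall>\<phi>\<in>Irr. cw is \<phi> : V"])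
  fix w assume "set w <= rkS" "sorted (rev w)" "\<forall>i. count_list w i \<le> chr S - 1"
  then have "w : PBW" by (simp add: PBW_def ordered_words_def)
  then show "\<forall>\<phi>\<in>Irr. cw w \<phi> : V" using PBW by blast
 next
  fix u i j v
  assume 2: "set (u @ i # j # v) <= rkS" "i < j" "\<forall>\<phi>\<in>Irr. cw (u @ j # i # v) \<phi> : V"
   "\<And>k. k : rkS ==> \<forall>\<phi>\<in>Irr. cw (u @ k # v) \<phi> : V"
  show "\<forall>\<phi>\<in>Irr. cw (u @ i # j # v) \<phi> : V"
  proof
   fix \<phi> assume \<phi>: "\<phi> : Irr"
   have w: "set u <= rkS" "set v <= rkS" "i : rkS" "j : rkS" using 2(1) by auto
   have ij: "set [i, j] <= rkS" "set [j, i] <= rkS" using w by auto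
   define \<phi>1 where "\<phi>1 = tw \<phi> (wchar u)"
   define \<theta> where "\<theta> = tw \<phi>1 (wchar [i, j])"
   have t: "\<phi>1 : Irr" "\<theta> : Irr"
    unfolding \<theta>_def \<phi>1_def by (intro twist_wchar \<phi> w ij)+
   \<comment> \<open>The two orders of the indices have the same character, so the swapped pair ends
     at the same vertex.\<close>
   have \<theta>': "\<theta> = tw \<phi>1 (wchar [j, i])" unfolding \<theta>_def by (rule twist_cong) (simp add: ac_simps)
   note v2 = V2[OF w(1,2) \<phi> t(2)]
   have "relation1 S X i j \<phi>1 : V2 u v \<phi> \<theta>" using relation1_I[OF w(3,4) t(1)] v2(2) by blast
   then have "cw [i, j] \<phi>1 : V2 u v \<phi> \<theta>"
    unfolding relation1_eq[OF w(3,4) t(1)]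
   proof (rule subsp_kQ_relation[OF v2(1)])
    show "cw [j, i] \<phi>1 : V2 u v \<phi> \<theta>"
     using V2_iff[OF w(1) ij(2) w(2) \<phi>] \<theta>' 2(3) \<phi> unfolding \<phi>1_def by simp
    fix k assume "k : {k : rkS. cc S i j k ~= 0}"
    then have k: "k : rkS" "cc S i j k ~= 0" by auto
    have k1: "set [k] <= rkS" using k by simp
    \<comment> \<open>A nonzero structure constant forces the character of \<open>k\<close> to be
      the product of those of \<open>i\<close> and \<open>j\<close>, so the single letter is
      parallel to the pair.\<close>
    have "\<theta> = tw \<phi>1 (wchar [k])"
     unfolding \<theta>_def by (rule twist_cong) (simp add: cc_char[OF w(3) k(1) _ w(4) k(2)])
    then show "W k \<phi>1 : V2 u v \<phi> \<theta>"
     using V2_iff[OF w(1) k1 w(2) \<phi>] 2(4)[OF k(1)] \<phi> cw_single[OF k(1) t(1)] unfolding \<phi>1_def by simp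
   qed
   then show "cw (u @ i # j # v) \<phi> : V"
    using V2_iff[OF w(1) ij(1) w(2) \<phi>] \<theta>_def unfolding \<phi>1_def by simp
  qed
 next
  fix u i v
  assume 3: "set (u @ i # v) <= rkS" "\<And>k. k : rkS ==> \<forall>\<phi>\<in>Irr. cw (u @ k # v) \<phi> : V"
  show "\<forall>\<phi>\<in>Irr. cw (u @ replicate (chr S) i @ v) \<phi> : V"
  proof
   fix \<phi> assume \<phi>: "\<phi> : Irr"
   have w: "set u <= rkS" "set v <= rkS" "i : rkS" using 3(1) by auto
   have r: "set (replicate (chr S) i) <= rkS" using w by (auto simp: set_replicate_conv_if)
   define \<phi>1 where "\<phi>1 = tw \<phi> (wchar u)"
   define \<theta> where "\<theta> = tw \<phi>1 (wchar (replicate (chr S) i))"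
   have t: "\<phi>1 : Irr" "\<theta> : Irr"
    unfolding \<theta>_def \<phi>1_def by (intro twist_wchar \<phi> w r)+
   note v2 = V2[OF w(1,2) \<phi> t(2)]
   have "relation2 S X i \<phi>1 : V2 u v \<phi> \<theta>" using relation2_I[OF w(3) t(1)] v2(2) by blast
   then have "cw (replicate (chr S) i) \<phi>1 : V2 u v \<phi> \<theta>"
    unfolding relation2_eq
   proof (rule subsp_kQ_relation[OF v2(1)])
    show "0 : V2 u v \<phi> \<theta>" using kQ.subspD(2)[OF v2(1)] by (simp add: kQ_simps)
    fix k assume "k : {k : rkS. dd S i k ~= 0}"
    then have k: "k : rkS" "dd S i k ~= 0" by auto
    have k1: "set [k] <= rkS" using k by simp
    have "\<theta> = tw \<phi>1 (wchar [k])"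
     unfolding \<theta>_def by (rule twist_cong) (simp add: dd_char[OF w(3) k(1) _ k(2)] wchar_replicate)
    then show "W k \<phi>1 : V2 u v \<phi> \<theta>"
     using V2_iff[OF w(1) k1 w(2) \<phi>] 3(2)[OF k(1)] \<phi> cw_single[OF k(1) t(1)] unfolding \<phi>1_def by simp
   qed
   then show "cw (u @ replicate (chr S) i @ v) \<phi> : V"
    using V2_iff[OF w(1) r w(2) \<phi>] \<theta>_def unfolding \<phi>1_def by simp
  qed
 qed
 have "x : V" if "keys x <= PB" for x
  using that
 proof (induction x rule: poly_mapping_induct_on)
  case zero
  then show ?case using kQ.subspD(2)[OF V(1)] by (simp add: kQ_simps)
 next
  case (single y c)
  then obtain "is" \<phi> where y: "y = pth is \<phi>" "set is <= deg1" "\<phi> : Irr" by (auto simp: PB_def)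
  have "c \<odot>\<^sub>kQ cw is \<phi> : V" using all[OF deg1_rk(2)[OF y(2)]] y(3) kQ.subspD(4)[OF V(1)] by blast
  then show ?case by (simp add: y(1) cw_deg1[OF y(2,3)] kQ_simps scale_single)
 next
  case (add x y)
  then show ?case using kQ.subspD(3)[OF V(1), of x y] by (simp add: kQ_simps)
 qed
 then show ?thesis by (auto simp: kQ_simps)
qed

end

end

section \<open>The PBW basis of the algebra and the isomorphism with the quotient\<close>

context jennings_setting
begin

context
 fixes X :: "nat => ('h => 'k) => ('k, 'h) kQ"
 assumes X: "\<And>k \<zeta>. k : rkS ==> \<zeta> : Irr ==> 2 \<le> degw S k ==> is_expression S Phi k \<zeta> (X k \<zeta>)"
begin

abbreviation cwp :: "nat list \<times> ('h => 'k) => ('k, 'h) kQ" where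
 "cwp \<equiv> \<lambda>(is, \<phi>). composable S kQ path_vertex (w_sub S X) is \<phi>"

lemma cwp_facts: "p : PBWi ==> cwp p : carrier kQ" "p : PBWi ==> Phi (cwp p) = PBW_monomial S p"
 using cw_facts[OF X PBW_subset] by (auto simp: PBW_index_eq PBW_monomial_Wd)

lemma cwp_span:
 assumes V: "kQ.subsp V" "relation_ideal S X <= V" and PBW: "\<And>p. p : PBWi ==> cwp p : V"
 shows "carrier kQ <= V"
 using PBW by (intro cw_span[OF X V]) (auto simp: PBW_index_eq)

text \<open>\<open>Phi\<close> kills the relation ideal, so the preimage of the span is a subspace
  of the kind to which \<open>cwp_span\<close> applies.\<close>

lemma alg_A_spanned: "carrier (alg_A S) <= AA.spn (PBW_monomial S ` PBWi)"
proof -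
 have mc: "PBW_monomial S ` PBWi <= carrier (alg_A S)"
  using cwp_facts by (force simp: alg_A_carrier)
 note sub = AA.subsp_spn[OF mc]
 have "carrier kQ <= {x : carrier kQ. Phi x : AA.spn (PBW_monomial S ` PBWi)}"
 proof (rule cwp_span[OF PhiA.subsp_vimage[OF sub]])
  show "relation_ideal S X <= {x : carrier kQ. Phi x : AA.spn (PBW_monomial S ` PBWi)}"
   using I_kernel[OF X] ideal.Icarr[OF ideal_I[OF X]] AA.subspD(2)[OF sub] by (auto simp: Cn_ops AA_ops)
  show "cwp p : {x : carrier kQ. Phi x : AA.spn (PBW_monomial S ` PBWi)}" if "p : PBWi" for p
   using cwp_facts[OF that] AA.spn_superset[OF mc, of "PBW_monomial S p"] that by simp
 qed
 then show ?thesis by (auto simp: alg_A_carrier)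
qed

lemma alg_A_independent:
 assumes "(\<Oplus>\<^sub>(alg_A S) p\<in>PBWi. a p \<odot>\<^sub>(alg_A S) PBW_monomial S p) = \<zero>\<^sub>(alg_A S)"
 shows "\<forall>p\<in>PBWi. a p = 0"
proof -
 have mc: "PBW_monomial S p : carrier (alg_A S)" if "p : PBWi" for p
  using cwp_facts[OF that] by (force simp: alg_A_carrier)
 have "(\<Oplus>\<^sub>(alg_A S) p\<in>PBWi. a p \<odot>\<^sub>(alg_A S) PBW_monomial S p)
   = (\<Oplus>\<^sub>Sm p\<in>PBWi. a p \<odot>\<^sub>(alg_A S) PBW_monomial S p)"
 proof (rule finsum_same_add[OF Sm.k_space_axioms AA.k_space_axioms AA_ops(2,3)])
  show "a p \<odot>\<^sub>(alg_A S) PBW_monomial S p : carrier (alg_A S)" if "p : PBWi" for p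
   using mc[OF that] by (rule AA.sm_closed)
  then show "a p \<odot>\<^sub>(alg_A S) PBW_monomial S p : carrier Sm" if "p : PBWi" for p
   using that AA_Sm by blast
 qed
 then have "(\<Oplus>\<^sub>Sm p\<in>PBWi. a p \<odot>\<^sub>Sm PBW_monomial S p) = \<zero>\<^sub>Sm"
  using assms by (simp add: AA_ops)
 then show ?thesis using Wd_independent by blast
qed

lemma
 shows alg_A_inj: "inj_on (PBW_monomial S) (PBWi)"
  and alg_A_basis: "AA.basis (PBW_monomial S ` PBWi)"
  and alg_A_dim: "AA.dim = card (PBWi)"
proof -
 have mc: "PBW_monomial S p : carrier (alg_A S)" if "p : PBWi" for p
  using cwp_facts[OF that] by (force simp: alg_A_carrier)
 note * = AA.indep_family_basis[OF finite_PBW_index mc alg_A_spanned alg_A_independent]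
 show "inj_on (PBW_monomial S) (PBWi)" "AA.basis (PBW_monomial S ` PBWi)" "AA.dim = card (PBWi)"
  by (rule *; assumption)+
qed

text \<open>The ordered words span the quotient and are carried to independent elements of the
  algebra. They therefore form bases on both sides, which gives injectivity and the dimension
  together.\<close>

lemma presentation:
 "\<exists>\<Theta>\<in>alg_iso (quot_alg kQ (relation_ideal S X)) (alg_A S).
   \<forall>x\<in>carrier kQ. \<Theta> (relation_ideal S X +>\<^sub>kQ x) = Phi x"
 "vectorspace.dim class_ring (quot_alg kQ (relation_ideal S X)) = card (PBWi)"
proof -
 let ?I = "relation_ideal S X" and ?B = "quot_alg kQ (relation_ideal S X)"
 define \<pi> where "\<pi> x = ?I +>\<^sub>kQ x" for x
 have I: "ideal ?I kQ" by (rule ideal_I[OF X])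
 note sI = kQ.ideal_subsp[OF I]
 interpret B: k_algebra ?B by (rule kQ.quot_algebra[OF I])
 interpret p: k_alg_hom kQ ?B \<pi>
  by unfold_locales (use kQ.quot_alg_hom[OF I] in \<open>simp add: \<pi>_def[abs_def]\<close>)
 have eq_iff: "\<pi> x = \<pi> y \<longleftrightarrow> x \<ominus>\<^sub>kQ y : ?I" if "x : carrier kQ" "y : carrier kQ" for x y
  unfolding \<pi>_def using kQ.quot_eq_iff[OF sI that] .
 have zero_iff: "\<pi> x = \<zero>\<^sub>?B \<longleftrightarrow> x : ?I" if x: "x : carrier kQ" for x
  using eq_iff[OF x kQ.zero_closed] p.f_zero x by (simp add: a_minus_def)
 have carB: "carrier ?B = \<pi> ` carrier kQ" by (simp add: quot_alg_simps(1) \<pi>_def[abs_def])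
 let ?b = "\<lambda>p. \<pi> (cwp p)"
 have bc: "?b p : carrier ?B" if "p : PBWi" for p using cwp_facts(1)[OF that] by blast
 then have bS: "?b ` PBWi <= carrier ?B" by blast
 note sub = B.subsp_spn[OF bS]
 have spB: "carrier ?B <= B.spn (?b ` PBWi)"
 proof -
  have "carrier kQ <= {x : carrier kQ. \<pi> x : B.spn (?b ` PBWi)}"
  proof (rule cwp_span[OF p.subsp_vimage[OF sub]])
   show "?I <= {x : carrier kQ. \<pi> x : B.spn (?b ` PBWi)}"
   proof
    fix x assume x: "x : ?I"
    then have c: "x : carrier kQ" by (rule ideal.Icarr[OF I])
    show "x : {x : carrier kQ. \<pi> x : B.spn (?b ` PBWi)}"
     using c x iffD2[OF zero_iff[OF c] x] B.subspD(2)[OF sub] by simp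
   qed
   show "cwp p : {x : carrier kQ. \<pi> x : B.spn (?b ` PBWi)}" if "p : PBWi" for p
    using cwp_facts(1)[OF that] B.spn_superset[OF bS, of "?b p"] that by blast
  qed
  then show ?thesis by (auto simp: carB)
 qed
 have lin: "Phi (\<Oplus>\<^sub>kQ p\<in>PBWi. a p \<odot>\<^sub>kQ cwp p) = (\<Oplus>\<^sub>(alg_A S) p\<in>PBWi. a p \<odot>\<^sub>(alg_A S) PBW_monomial S p)"
  "\<pi> (\<Oplus>\<^sub>kQ p\<in>PBWi. a p \<odot>\<^sub>kQ cwp p) = (\<Oplus>\<^sub>?B p\<in>PBWi. a p \<odot>\<^sub>?B ?b p)"
  "(\<Oplus>\<^sub>kQ p\<in>PBWi. a p \<odot>\<^sub>kQ cwp p) : carrier kQ" for a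
 proof -
  have "Phi (\<Oplus>\<^sub>kQ p\<in>PBWi. a p \<odot>\<^sub>kQ cwp p) = (\<Oplus>\<^sub>(alg_A S) p\<in>PBWi. a p \<odot>\<^sub>(alg_A S) Phi (cwp p))"
   by (rule PhiA.f_lincomb) (rule cwp_facts(1))
  also have "\<dots> = (\<Oplus>\<^sub>(alg_A S) p\<in>PBWi. a p \<odot>\<^sub>(alg_A S) PBW_monomial S p)"
  proof (intro AA.finsum_cong' Pi_I)
   fix p assume p: "p : PBWi"
   show "a p \<odot>\<^sub>(alg_A S) Phi (cwp p) = a p \<odot>\<^sub>(alg_A S) PBW_monomial S p" unfolding cwp_facts(2)[OF p] ..
   show "a p \<odot>\<^sub>(alg_A S) PBW_monomial S p : carrier (alg_A S)"
    unfolding cwp_facts(2)[OF p, symmetric] using cwp_facts(1)[OF p] by blast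
  qed simp
  finally show "Phi (\<Oplus>\<^sub>kQ p\<in>PBWi. a p \<odot>\<^sub>kQ cwp p) = (\<Oplus>\<^sub>(alg_A S) p\<in>PBWi. a p \<odot>\<^sub>(alg_A S) PBW_monomial S p)" .
  show "\<pi> (\<Oplus>\<^sub>kQ p\<in>PBWi. a p \<odot>\<^sub>kQ cwp p) = (\<Oplus>\<^sub>?B p\<in>PBWi. a p \<odot>\<^sub>?B ?b p)"
   by (rule p.f_lincomb) (rule cwp_facts(1))
  show "(\<Oplus>\<^sub>kQ p\<in>PBWi. a p \<odot>\<^sub>kQ cwp p) : carrier kQ"
   using cwp_facts(1) by (intro kQ.finsum_closed Pi_I kQ.sm_closed)
 qed
 have Phi0: "Phi x = \<zero>\<^sub>(alg_A S)" if "x : ?I" for x using I_kernel[OF X that] by (simp add: Cn_ops AA_ops)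
 have indB: "\<forall>p\<in>PBWi. a p = 0" if "(\<Oplus>\<^sub>?B p\<in>PBWi. a p \<odot>\<^sub>?B ?b p) = \<zero>\<^sub>?B" for a
 proof (rule alg_A_independent)
  have "(\<Oplus>\<^sub>kQ p\<in>PBWi. a p \<odot>\<^sub>kQ cwp p) : ?I" using that zero_iff[OF lin(3)] unfolding lin(2) by blast
  from Phi0[OF this] show "(\<Oplus>\<^sub>(alg_A S) p\<in>PBWi. a p \<odot>\<^sub>(alg_A S) PBW_monomial S p) = \<zero>\<^sub>(alg_A S)"
   unfolding lin(1) .
 qed
 show "vectorspace.dim class_ring ?B = card (PBWi)"
  by (rule B.indep_family_basis(3)[OF finite_PBW_index bc spB indB])
 \<comment> \<open>Modulo the ideal, \<open>x\<close> is a combination of ordered words. Applying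
   \<open>Phi\<close> gives a relation between independent monomials, so all coefficients vanish and
   \<open>x\<close> lies in the ideal.\<close>
 have kernel: "x : ?I" if x: "x : carrier kQ" "Phi x = \<zero>\<^sub>(alg_A S)" for x
 proof -
  have "\<pi> x : B.spn (?b ` PBWi)" using spB x(1) by blast
  then obtain a where a: "\<pi> x = (\<Oplus>\<^sub>?B p\<in>PBWi. a p \<odot>\<^sub>?B ?b p)"
   using B.spn_family[OF finite_PBW_index, of ?b "\<pi> x"] bc by blast
  let ?y = "\<Oplus>\<^sub>kQ p\<in>PBWi. a p \<odot>\<^sub>kQ cwp p"
  have "x \<ominus>\<^sub>kQ ?y : ?I" using a eq_iff[OF x(1) lin(3)] unfolding lin(2) by blast
  from Phi0[OF this] have "Phi x \<ominus>\<^sub>(alg_A S) Phi ?y = \<zero>\<^sub>(alg_A S)" unfolding PhiA.f_minus[OF x(1) lin(3)] .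
  then have "Phi ?y = \<zero>\<^sub>(alg_A S)"
   using x(2) AA.minus_eq_zero_iff[OF PhiA.f_closed[OF x(1)] PhiA.f_closed[OF lin(3)]] by simp
  then have "\<forall>p\<in>PBWi. a p = 0" unfolding lin(1) by (rule alg_A_independent)
  then have "\<pi> x = (\<Oplus>\<^sub>?B p\<in>PBWi. \<zero>\<^sub>?B)"
   unfolding a using bc by (intro B.finsum_cong') auto
  then show ?thesis using zero_iff[OF x(1)] by simp
 qed
 have Phi_eq: "Phi x = Phi y \<longleftrightarrow> \<pi> x = \<pi> y" if xy: "x : carrier kQ" "y : carrier kQ" for x y
 proof -
  have "Phi x = Phi y \<longleftrightarrow> Phi (x \<ominus>\<^sub>kQ y) = \<zero>\<^sub>(alg_A S)"
   unfolding PhiA.f_minus[OF xy] using AA.minus_eq_zero_iff[OF PhiA.f_closed[OF xy(1)] PhiA.f_closed[OF xy(2)]] by simp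
  also have "\<dots> \<longleftrightarrow> x \<ominus>\<^sub>kQ y : ?I" using kernel[OF kQ.minus_closed[OF xy]] Phi0 by blast
  finally show ?thesis using eq_iff[OF xy] by simp
 qed
 define \<Theta> where "\<Theta> Y = Phi (SOME x. x : carrier kQ \<and> \<pi> x = Y)" for Y
 have \<Theta>: "\<Theta> (\<pi> x) = Phi x" if x: "x : carrier kQ" for x
 proof -
  have "\<exists>y. y : carrier kQ \<and> \<pi> y = \<pi> x" using x by blast
  then have "(SOME y. y : carrier kQ \<and> \<pi> y = \<pi> x) : carrier kQ \<and> \<pi> (SOME y. y : carrier kQ \<and> \<pi> y = \<pi> x) = \<pi> x"
   by (rule someI_ex)
  then show ?thesis unfolding \<Theta>_def using Phi_eq x by blast
 qed
 have "\<Theta> : alg_hom ?B (alg_A S)"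
 proof (rule alg_homI)
  fix u v c assume u: "u : carrier ?B"
  then obtain x where x: "u = \<pi> x" "x : carrier kQ" by (auto simp: carB)
  show "\<Theta> u : carrier (alg_A S)" using x \<Theta> by simp
  show "\<Theta> (c \<odot>\<^sub>?B u) = c \<odot>\<^sub>(alg_A S) \<Theta> u"
   using x \<Theta>[of x] \<Theta>[of "c \<odot>\<^sub>kQ x"] p.f_sm[of x c] PhiA.f_sm[of x c] by simp
  assume v: "v : carrier ?B"
  then obtain y where y: "v = \<pi> y" "y : carrier kQ" by (auto simp: carB)
  show "\<Theta> (u \<otimes>\<^sub>?B v) = \<Theta> u \<otimes>\<^sub>(alg_A S) \<Theta> v"
   using x y \<Theta>[of x] \<Theta>[of y] \<Theta>[of "x \<otimes>\<^sub>kQ y"] p.f_mult[of x y] PhiA.f_mult[of x y] by simp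
  show "\<Theta> (u \<oplus>\<^sub>?B v) = \<Theta> u \<oplus>\<^sub>(alg_A S) \<Theta> v"
   using x y \<Theta>[of x] \<Theta>[of y] \<Theta>[of "x \<oplus>\<^sub>kQ y"] p.f_add[of x y] PhiA.f_add[of x y] by simp
 next
  show "\<Theta> \<one>\<^sub>?B = \<one>\<^sub>(alg_A S)" using \<Theta>[OF kQ.one_closed] p.f_one PhiA.f_one by simp
 qed
 moreover have "bij_betw \<Theta> (carrier ?B) (carrier (alg_A S))"
 proof (rule bij_betw_imageI)
  show "inj_on \<Theta> (carrier ?B)" unfolding carB using \<Theta> Phi_eq by (auto intro!: inj_onI)
  show "\<Theta> ` carrier ?B = carrier (alg_A S)"
   unfolding carB alg_A_carrier image_image using \<Theta> by (intro image_cong) auto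
 qed
 ultimately have "\<Theta> : alg_iso ?B (alg_A S)"
  by (simp add: alg_iso_def alg_hom_def ring_iso_def)
 then show "\<exists>\<Theta>\<in>alg_iso ?B (alg_A S). \<forall>x\<in>carrier kQ. \<Theta> (?I +>\<^sub>kQ x) = Phi x"
  using \<Theta> unfolding \<pi>_def by blast
qed

end

lemma w_elt_forms:
 assumes i: "i : rkS" and \<phi>: "\<phi> : Irr"
 shows "we i \<phi> = ep (tw \<phi> (psi S i)) \<otimes>\<^sub>Sm smash_grp S (gi S i \<phi>) \<otimes>\<^sub>Sm smash_w S i"
  and "we i \<phi> = ep (tw \<phi> (psi S i)) \<otimes>\<^sub>Sm smash_grp S (gi S i \<phi>) \<otimes>\<^sub>Sm smash_w S i \<otimes>\<^sub>Sm ep \<phi>"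
proof -
 show 1: "we i \<phi> = ep (tw \<phi> (psi S i)) \<otimes>\<^sub>Sm smash_grp S (gi S i \<phi>) \<otimes>\<^sub>Sm smash_w S i"
  unfolding w_elt_mon smash_w_io by (rule mon_left[OF eigen_wi[OF i] HZchar_psi[OF i] gi_closed[OF i \<phi>]])
 show "we i \<phi> = ep (tw \<phi> (psi S i)) \<otimes>\<^sub>Sm smash_grp S (gi S i \<phi>) \<otimes>\<^sub>Sm smash_w S i \<otimes>\<^sub>Sm ep \<phi>"
  unfolding 1[symmetric] w_elt_mon using mon_right_idem[OF wi_closed[OF i] \<phi> \<phi>] by simp
qed

end

theorem theorem3p11:
  fixes S :: "('k::alg_closed_field, 'p, 'h) jennings_data"
  assumes "jennings_setting S"
  shows "(card (verts (quiver S)) = Coset.order ((grpH S)\<lparr>carrier := centerH S\<rparr> Mod subZ S)) \<and>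
    (\<forall>i\<in>{1..rk S}. \<forall>\<phi>\<in>Irr_over S. twist S \<phi> (psi S i) \<in> Irr_over S \<and>
      w_elt S i \<phi> = e_phi S (twist S \<phi> (psi S i)) \<otimes>\<^bsub>smash S\<^esub> smash_grp S (gi S i \<phi>)
                      \<otimes>\<^bsub>smash S\<^esub> smash_w S i \<and>
      w_elt S i \<phi> = e_phi S (twist S \<phi> (psi S i)) \<otimes>\<^bsub>smash S\<^esub> smash_grp S (gi S i \<phi>)
                      \<otimes>\<^bsub>smash S\<^esub> smash_w S i \<otimes>\<^bsub>smash S\<^esub> e_phi S \<phi>) \<and>
    (\<exists>\<Phi> \<in> alg_hom (path_algebra (quiver S)) (alg_A S).
      (\<forall>\<phi>\<in>Irr_over S. \<Phi> (path_vertex \<phi>) = e_phi S \<phi>) \<and>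
      (\<forall>(i, \<phi>)\<in>arcs (quiver S). \<Phi> (path_arrow (quiver S) (i, \<phi>)) = w_elt S i \<phi>) \<and>
      (\<forall>k\<in>{1..rk S}. \<forall>\<zeta>\<in>Irr_over S. 2 \<le> degw S k \<longrightarrow> (\<exists>x. is_expression S \<Phi> k \<zeta> x)) \<and>
      (\<forall>X. (\<forall>k\<in>{1..rk S}. \<forall>\<zeta>\<in>Irr_over S. 2 \<le> degw S k \<longrightarrow> is_expression S \<Phi> k \<zeta> (X k \<zeta>)) \<longrightarrow>
        (\<exists>\<Theta> \<in> alg_iso (quot_alg (path_algebra (quiver S)) (relation_ideal S X)) (alg_A S).
           \<forall>x\<in>carrier (path_algebra (quiver S)).
             \<Theta> (relation_ideal S X +>\<^bsub>path_algebra (quiver S)\<^esub> x) = \<Phi> x) \<and>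
        vectorspace.dim class_ring (quot_alg (path_algebra (quiver S)) (relation_ideal S X)) =
          Coset.order ((grpH S)\<lparr>carrier := centerH S\<rparr> Mod subZ S) * Coset.order (grpP S))) \<and>
    inj_on (PBW_monomial S) (PBW_index S) \<and>
    vectorspace.basis class_ring (alg_A S) (PBW_monomial S ` PBW_index S) \<and>
    vectorspace.dim class_ring (alg_A S) =
      Coset.order ((grpH S)\<lparr>carrier := centerH S\<rparr> Mod subZ S) * Coset.order (grpP S)"
proof -
 interpret jennings_setting S by (rule assms)
 \<comment> \<open>The claims about the algebra itself mention no expressions, but they are derived
   through a presentation; this choice supplies one.\<close>
 have X: "is_expression S Phi k \<zeta> (SOME x. is_expression S Phi k \<zeta> x)" if "k : rkS" "\<zeta> : Irr" for k \<zeta>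
  using expression_exists[OF that] by (rule someI_ex)
 have arc: "Phi (path_arrow Q (i, \<phi>)) = we i \<phi>" if "(i, \<phi>) : arcs Q" for i \<phi>
  using Phi_arrow that by (simp add: quiver_simps)
 show ?thesis
 proof (intro conjI)
  show "card (verts Q) = Coset.order (ZH Mod subZ S)" by (simp add: quiver_simps card_Irr)
  show "\<forall>i\<in>rkS. \<forall>\<phi>\<in>Irr. tw \<phi> (psi S i) : Irr \<and>
   we i \<phi> = ep (tw \<phi> (psi S i)) \<otimes>\<^sub>Sm smash_grp S (gi S i \<phi>) \<otimes>\<^sub>Sm smash_w S i \<and>
   we i \<phi> = ep (tw \<phi> (psi S i)) \<otimes>\<^sub>Sm smash_grp S (gi S i \<phi>) \<otimes>\<^sub>Sm smash_w S i \<otimes>\<^sub>Sm ep \<phi>"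
   using twist_psi w_elt_forms by blast
  show "inj_on (PBW_monomial S) (PBWi)" by (rule alg_A_inj[OF X])
  show "AA.basis (PBW_monomial S ` PBWi)" by (rule alg_A_basis[OF X])
  show "AA.dim = Coset.order (ZH Mod subZ S) * Coset.order (grpP S)"
   using alg_A_dim[OF X] by (simp add: card_PBW_index)
  show "\<exists>\<Phi>\<in>alg_hom kQ (alg_A S).
   (\<forall>\<phi>\<in>Irr. \<Phi> (path_vertex \<phi>) = ep \<phi>) \<and>
   (\<forall>(i, \<phi>)\<in>arcs Q. \<Phi> (path_arrow Q (i, \<phi>)) = we i \<phi>) \<and>
   (\<forall>k\<in>rkS. \<forall>\<zeta>\<in>Irr. 2 \<le> degw S k \<longrightarrow> (\<exists>x. is_expression S \<Phi> k \<zeta> x)) \<and>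
   (\<forall>X. (\<forall>k\<in>rkS. \<forall>\<zeta>\<in>Irr. 2 \<le> degw S k \<longrightarrow> is_expression S \<Phi> k \<zeta> (X k \<zeta>)) \<longrightarrow>
    (\<exists>\<Theta>\<in>alg_iso (quot_alg kQ (relation_ideal S X)) (alg_A S).
      \<forall>x\<in>carrier kQ. \<Theta> (relation_ideal S X +>\<^sub>kQ x) = \<Phi> x) \<and>
    vectorspace.dim class_ring (quot_alg kQ (relation_ideal S X)) =
     Coset.order (ZH Mod subZ S) * Coset.order (grpP S))"
  proof (rule bexI[OF _ Phi_AA], intro conjI allI impI)
   show "\<forall>\<phi>\<in>Irr. Phi (path_vertex \<phi>) = ep \<phi>" using Phi_vertex by blast
   show "\<forall>(i, \<phi>)\<in>arcs Q. Phi (path_arrow Q (i, \<phi>)) = we i \<phi>" using arc by blast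
   show "\<forall>k\<in>rkS. \<forall>\<zeta>\<in>Irr. 2 \<le> degw S k \<longrightarrow> (\<exists>x. is_expression S Phi k \<zeta> x)"
    using expression_exists by blast
   fix X assume X: "\<forall>k\<in>rkS. \<forall>\<zeta>\<in>Irr. 2 \<le> degw S k \<longrightarrow> is_expression S Phi k \<zeta> (X k \<zeta>)"
   then have X': "is_expression S Phi k \<zeta> (X k \<zeta>)" if "k : rkS" "\<zeta> : Irr" "2 \<le> degw S k" for k \<zeta>
    using that by blast
   show "\<exists>\<Theta>\<in>alg_iso (quot_alg kQ (relation_ideal S X)) (alg_A S).
      \<forall>x\<in>carrier kQ. \<Theta> (relation_ideal S X +>\<^sub>kQ x) = Phi x"
    by (rule presentation(1)[OF X'])
   show "vectorspace.dim class_ring (quot_alg kQ (relation_ideal S X)) = Coset.order (ZH Mod subZ S) * Coset.order (grpP S)"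
    using presentation(2)[OF X'] by (simp add: card_PBW_index)
  qed
 qed
qed

end
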